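(* Let $\Gamma$ be a finite shifted simplicial complex on $[n]$ and let $I=I_\Gamma S\subset S$. (1) $\Delta_{\mathrm{lex}}(I)=I$ if and only if $I$ is a universal squarefree lexsegment ideal (USLI). Moreover, if $I$ is not a USLI, then all the ideals in the sequence $\{\Delta_{\mathrm{lex}}^i(I)\}_{i=0}^\infty$ are distinct (equivalently, the complexes $\Delta^i_{\mathrm{lex}}(\Gamma)$ whose Stanley–Reisner ideals they are, are distinct). (2) The limit $\overline{\Delta}_{\mathrm{lex}}(I)=\lim_{i\to\infty}\Delta^i_{\mathrm{lex}}(I)$ is well defined and is a USLI (so the limit complex is a, usually infinite, USLI complex). Moreover, it is the unique USLI whose $B$-sequence equals the $B$-sequence of $I_\Gamma$.
   Context: $\mathbf k$ is a field of characteristic zero; $S_{[n]}=\mathbf k[x_1,\ldots,x_n]$ and $S=\mathbf k[x_i:i\in\mathbb N]=\bigcup_n S_{[n]}$. A simplicial complex on $[n]$ is a family of subsets of $[n]$ closed under subsets; it is shifted if $F\in\Gamma$, $i\in F$, $i<j\le n$ imply $(F\setminus\{i\})\cup\{j\}\in\Gamma$. Its Stanley–Reisner ideal is $I_\Gamma=\langle \prod_{i\in F}x_i : F\subseteq[n], F\notin\Gamma\rangle\subset S_{[n]}$. All term orders are graded with lower-degree monomials larger than higher-degree ones; the lex order $>_{\mathrm{lex}}$ compares monomials of equal degree lexicographically with $x_1>x_2>\cdots$. For a homogeneous ideal $J\subset S_{[n]}$, $\mathrm{Gin}_{\mathrm{lex}}(J)$ is the initial ideal $\mathrm{in}_{\mathrm{lex}}(gJ)$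 for a generic (upper triangular) linear change of coordinates $g$. For a monomial ideal $I\subset S$ finitely generated in each degree, $\mathrm{Gin}_{\mathrm{lex}}(I):=\lim_{n\to\infty}(\mathrm{Gin}_{\mathrm{lex}}(I\cap S_{[n]}))S$ (the degree-$d$ components stabilize for $n$ large). The squarefree operation is $\Phi(x_{i_1}x_{i_2}\cdots x_{i_k})=x_{i_1}x_{i_2+1}\cdots x_{i_k+k-1}$ for $i_1\le\cdots\le i_k$; for a monomial ideal $J$ with minimal generating set $G(J)$, $\Phi(J)=\langle\Phi(m):m\in G(J)\rangle$. Lex shifting: $\Delta_{\mathrm{lex}}(I)=\Phi(\mathrm{Gin}_{\mathrm{lex}}(I))$, and $\Delta^i_{\mathrm{lex}}$ is its $i$-fold iterate; $\Delta_{\mathrm{lex}}(\Gamma)$ denotes the complex whose Stanley–Reisner ideal is $\Delta_{\mathrm{lex}}(I_\Gamma S)$. A sequence of ideals $J_k$ has limit $J$ if for every $d$ the degree-$d$ components of $J_k$ are eventually equal to $J_d$. A squarefree monomial ideal $I\subset S$ is a squarefree lexsegment ideal of $S$ if for every monomial $m\in I$ and every squarefree monomial $m'\in S$ with $\deg m'=\deg m$ and $m'>_{\mathrm{lex}}m$, $m'\in I$. A USLI is an ideal of $S$ (or of $S_{[n]}$) $L$ finitely generated in each degree such that $LS$ is a squarefree lexsegment ideal of $S$. Betti numbers: for a monomial ideal $J\subset S_{[n]}$, $\beta_{i,j}(J)$ are the graded Betti numbers of its minimal free resolution over $S_{[n]}$; for $I\subset S$ finitely generated in each degree, $\beta_{i,j}(I):=\lim_n\beta_{i,j}(I\cap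 S_{[n]})$ (eventually constant). The $B$-sequence is $B(I)=\{B_j(I)\}_{j\ge1}$ with $B_j(I)=\sum_{i=0}^j(-1)^i\beta_{i,j}(I)$.
   Formalization: Uniqueness in (2) is stated among USLIs that contain 1 exactly when I does, because the B-sequence starts at j = 1 and so cannot distinguish the zero ideal from the unit ideal S (both are USLIs with zero B-sequence). *)

theory Defs
  imports Complex_Main "HOL-Library.Poly_Mapping"
begin

section \<open>Polynomials in the variables x1, x2, ...\<close>

text \<open>
  Variables are indexed from 0: index \<open>i\<close> stands for the variable usually written with
  index \<open>i + 1\<close>. Thus \<open>[n]\<close> is \<open>{..<n}\<close>, the ring in all variables is the whole type,
  and the ring in the first \<open>n\<close> variables is \<open>poly_ring {..<n}\<close>.
\<close>

type_synonym monom = "nat \<Rightarrow>\<^sub>0 nat"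
type_synonym 'k spoly = "monom \<Rightarrow>\<^sub>0 'k"

definition mon :: "monom \<Rightarrow> 'k::field_char_0 spoly" where
  "mon m = Poly_Mapping.single m 1"

definition X :: "nat \<Rightarrow> 'k::field_char_0 spoly" where
  "X i = mon (Poly_Mapping.single i 1)"

definition scalar :: "'k::field_char_0 \<Rightarrow> 'k spoly" where
  "scalar c = Poly_Mapping.single 0 c"

definition mdeg :: "monom \<Rightarrow> nat" where
  "mdeg m = (\<Sum>i\<in>Poly_Mapping.keys m. Poly_Mapping.lookup m i)"

definition homogeneous :: "nat \<Rightarrow> 'k::field_char_0 spoly \<Rightarrow> bool" where
  "homogeneous d f \<longleftrightarrow> (\<forall>m\<in>Poly_Mapping.keys f. mdeg m = d)"

definition poly_ring :: "nat set \<Rightarrow> 'k::field_char_0 spoly set" where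
  "poly_ring V = {f. \<forall>m\<in>Poly_Mapping.keys f. Poly_Mapping.keys m \<subseteq> V}"

text \<open>The value of \<open>f\<close> under \<open>h\<close> on coefficients and \<open>\<sigma>\<close> on variables.\<close>

definition eval_mpoly ::
    "('k::zero \<Rightarrow> 'r::comm_ring_1) \<Rightarrow> ('v \<Rightarrow> 'r) \<Rightarrow> (('v \<Rightarrow>\<^sub>0 nat) \<Rightarrow>\<^sub>0 'k) \<Rightarrow> 'r" where
  "eval_mpoly h \<sigma> f = (\<Sum>m\<in>Poly_Mapping.keys f.
     h (Poly_Mapping.lookup f m) * (\<Prod>v\<in>Poly_Mapping.keys m. \<sigma> v ^ Poly_Mapping.lookup m v))"


section \<open>Ideals\<close>

text \<open>The ideal of the subring \<open>R\<close> generated by \<open>G \<subseteq> R\<close>.\<close>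

definition ideal_gen :: "'a::comm_ring_1 set \<Rightarrow> 'a set \<Rightarrow> 'a set" where
  "ideal_gen R G = {\<Sum>g\<in>A. c g * g | A c. finite A \<and> A \<subseteq> G \<and> c ` A \<subseteq> R}"

definition degree_comp :: "nat \<Rightarrow> 'k::field_char_0 spoly set \<Rightarrow> 'k spoly set" where
  "degree_comp d J = {f \<in> J. homogeneous d f}"

definition homogeneous_ideal :: "'k::field_char_0 spoly set \<Rightarrow> bool" where
  "homogeneous_ideal J \<longleftrightarrow> J = ideal_gen UNIV (\<Union>d. degree_comp d J)"

text \<open>The limit is required to be a homogeneous ideal: only then is it determined by its
  graded components.\<close>

definition ideal_tendsto ::
    "(nat \<Rightarrow> 'k::field_char_0 spoly set) \<Rightarrow> 'k spoly set \<Rightarrow> bool" where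
  "ideal_tendsto J L \<longleftrightarrow> homogeneous_ideal L \<and>
     (\<forall>d. \<forall>\<^sub>F k in sequentially. degree_comp d (J k) = degree_comp d L)"

definition ideal_lim :: "(nat \<Rightarrow> 'k::field_char_0 spoly set) \<Rightarrow> 'k spoly set" where
  "ideal_lim J = (THE L. ideal_tendsto J L)"

definition min_gens :: "'k::field_char_0 spoly set \<Rightarrow> monom set" where
  "min_gens J = {m. mon m \<in> J \<and>
     (\<forall>m'. mon m' \<in> J \<and> (\<forall>i. Poly_Mapping.lookup m' i \<le> Poly_Mapping.lookup m i) \<longrightarrow> m' = m)}"

definition fin_gen_each_degree :: "'k::field_char_0 spoly set \<Rightarrow> bool" where
  "fin_gen_each_degree J \<longleftrightarrow> (\<forall>d. finite {m \<in> min_gens J. mdeg m = d})"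


section \<open>Term order and generic initial ideals\<close>

definition lex_greater :: "monom \<Rightarrow> monom \<Rightarrow> bool" where
  "lex_greater m m' \<longleftrightarrow> (\<exists>i. Poly_Mapping.lookup m i > Poly_Mapping.lookup m' i \<and>
     (\<forall>j<i. Poly_Mapping.lookup m j = Poly_Mapping.lookup m' j))"

definition term_greater :: "monom \<Rightarrow> monom \<Rightarrow> bool" where
  "term_greater m m' \<longleftrightarrow> mdeg m < mdeg m' \<or> (mdeg m = mdeg m' \<and> lex_greater m m')"

definition in_mon :: "'k::field_char_0 spoly \<Rightarrow> monom" where
  "in_mon f = (THE m. m \<in> Poly_Mapping.keys f \<and>
     (\<forall>m'\<in>Poly_Mapping.keys f. m' \<noteq> m \<longrightarrow> term_greater m m'))"

definition in_ideal :: "nat \<Rightarrow> 'k::field_char_0 spoly set \<Rightarrow> 'k spoly set" where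
  "in_ideal n J = ideal_gen (poly_ring {..<n}) {mon (in_mon f) | f. f \<in> J \<and> f \<noteq> 0}"

definition upper_triangular :: "nat \<Rightarrow> (nat \<Rightarrow> nat \<Rightarrow> 'k::field_char_0) \<Rightarrow> bool" where
  "upper_triangular n g \<longleftrightarrow> (\<forall>i<n. g i i \<noteq> 0) \<and> (\<forall>i<n. \<forall>j<i. g i j = 0)"

text \<open>The matrix \<open>g\<close> sends the \<open>j\<close>-th variable to the combination of variables given by its
  \<open>j\<close>-th column.\<close>

definition coord_change ::
    "nat \<Rightarrow> (nat \<Rightarrow> nat \<Rightarrow> 'k::field_char_0) \<Rightarrow> 'k spoly \<Rightarrow> 'k spoly" where
  "coord_change n g = eval_mpoly scalar (\<lambda>j. \<Sum>i<n. scalar (g i j) * X i)"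

text \<open>\<open>Q\<close> holds on a nonempty Zariski open set of invertible upper triangular matrices: it holds
  wherever some nonzero polynomial in the matrix entries does not vanish.\<close>

definition generic_upper :: "nat \<Rightarrow> ((nat \<Rightarrow> nat \<Rightarrow> 'k::field_char_0) \<Rightarrow> bool) \<Rightarrow> bool" where
  "generic_upper n Q \<longleftrightarrow> (\<exists>P :: ((nat \<times> nat) \<Rightarrow>\<^sub>0 nat) \<Rightarrow>\<^sub>0 'k. P \<noteq> 0 \<and>
     (\<forall>m\<in>Poly_Mapping.keys P. Poly_Mapping.keys m \<subseteq> {(i, j). i \<le> j \<and> j < n}) \<and>
     (\<forall>g. upper_triangular n g \<and> eval_mpoly id (\<lambda>(i, j). g i j) P \<noteq> 0 \<longrightarrow> Q g))"

definition gin_fin :: "nat \<Rightarrow> 'k::field_char_0 spoly set \<Rightarrow> 'k spoly set" where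
  "gin_fin n J = (THE M. generic_upper n (\<lambda>g. in_ideal n (coord_change n g ` J) = M))"

definition gin :: "'k::field_char_0 spoly set \<Rightarrow> 'k spoly set" where
  "gin I = ideal_lim (\<lambda>n. ideal_gen UNIV (gin_fin n (I \<inter> poly_ring {..<n})))"


section \<open>Lex shifting\<close>

text \<open>The variables of \<open>m\<close> in weakly increasing order, repeated according to their exponents.\<close>

definition var_list :: "monom \<Rightarrow> nat list" where
  "var_list m = concat (map (\<lambda>i. replicate (Poly_Mapping.lookup m i) i)
     (sorted_list_of_set (Poly_Mapping.keys m)))"

definition sqfree_op :: "monom \<Rightarrow> monom" where
  "sqfree_op m = (\<Sum>p<length (var_list m). Poly_Mapping.single (var_list m ! p + p) 1)"

definition lex_shift :: "'k::field_char_0 spoly set \<Rightarrow> 'k spoly set" where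
  "lex_shift I = ideal_gen UNIV (mon ` sqfree_op ` min_gens (gin I))"


section \<open>Simplicial complexes and squarefree lexsegment ideals\<close>

text \<open>For infinite \<open>V\<close>, a complex on \<open>V\<close> may be infinite but its faces are finite. The void
  complex \<open>{}\<close> is allowed.\<close>

definition simplicial_complex :: "nat set \<Rightarrow> nat set set \<Rightarrow> bool" where
  "simplicial_complex V \<Gamma> \<longleftrightarrow> (\<forall>F\<in>\<Gamma>. finite F \<and> F \<subseteq> V \<and> (\<forall>G\<subseteq>F. G \<in> \<Gamma>))"

definition shifted :: "nat \<Rightarrow> nat set set \<Rightarrow> bool" where
  "shifted n \<Gamma> \<longleftrightarrow> (\<forall>F\<in>\<Gamma>. \<forall>i\<in>F. \<forall>j. i < j \<and> j < n \<longrightarrow> insert j (F - {i}) \<in> \<Gamma>)"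

definition sr_ideal :: "nat set \<Rightarrow> nat set set \<Rightarrow> 'k::field_char_0 spoly set" where
  "sr_ideal V \<Gamma> = ideal_gen (poly_ring V) {\<Prod>i\<in>F. X i | F. finite F \<and> F \<subseteq> V \<and> F \<notin> \<Gamma>}"

definition sr_complex :: "'k::field_char_0 spoly set \<Rightarrow> nat set set" where
  "sr_complex I = (THE \<Gamma>. simplicial_complex UNIV \<Gamma> \<and> sr_ideal UNIV \<Gamma> = I)"

definition sqfree_mon :: "monom \<Rightarrow> bool" where
  "sqfree_mon m \<longleftrightarrow> (\<forall>i. Poly_Mapping.lookup m i \<le> 1)"

definition sqfree_mon_ideal :: "'k::field_char_0 spoly set \<Rightarrow> bool" where
  "sqfree_mon_ideal I \<longleftrightarrow> (\<exists>A. (\<forall>m\<in>A. sqfree_mon m) \<and> I = ideal_gen UNIV (mon ` A))"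

definition sqfree_lexsegment :: "'k::field_char_0 spoly set \<Rightarrow> bool" where
  "sqfree_lexsegment I \<longleftrightarrow> sqfree_mon_ideal I \<and>
     (\<forall>m m'. mon m \<in> I \<and> sqfree_mon m' \<and> mdeg m' = mdeg m \<and> lex_greater m' m \<longrightarrow> mon m' \<in> I)"

definition usli :: "'k::field_char_0 spoly set \<Rightarrow> bool" where
  "usli L \<longleftrightarrow> fin_gen_each_degree L \<and> sqfree_lexsegment L"


section \<open>Graded Betti numbers\<close>

text \<open>Elements of the free \<open>R\<close>-module of rank \<open>r\<close>.\<close>

definition free_mod :: "'a::comm_ring_1 set \<Rightarrow> nat \<Rightarrow> (nat \<Rightarrow> 'a) set" where
  "free_mod R r = {v. (\<forall>p<r. v p \<in> R) \<and> (\<forall>p\<ge>r. v p = 0)}"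

definition mat_app ::
    "nat \<Rightarrow> nat \<Rightarrow> (nat \<Rightarrow> nat \<Rightarrow> 'a::comm_ring_1) \<Rightarrow> (nat \<Rightarrow> 'a) \<Rightarrow> nat \<Rightarrow> 'a" where
  "mat_app r s D v = (\<lambda>p. if p < r then \<Sum>q<s. D p q * v q else 0)"

text \<open>
  A minimal graded free resolution of \<open>J\<close> over \<open>R\<close>, the polynomial ring in \<open>n\<close> variables:
  \<open>\<dots> \<rightarrow> F 2 \<rightarrow> F 1 \<rightarrow> F 0 \<rightarrow> J \<rightarrow> 0\<close>. The free module \<open>F i\<close> has rank \<open>r i\<close> and a basis whose
  \<open>q\<close>-th element has degree \<open>a i q\<close>; this basis element of \<open>F 0\<close> is sent to \<open>e q\<close>; the
  matrix of \<open>F (i + 1) \<rightarrow> F i\<close> is \<open>D i\<close>. Minimality says that the entries of every \<open>D i\<close> lie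
  in the ideal generated by the variables.
\<close>

definition min_free_res ::
    "nat \<Rightarrow> 'k::field_char_0 spoly set \<Rightarrow> (nat \<Rightarrow> nat) \<Rightarrow> (nat \<Rightarrow> nat \<Rightarrow> nat) \<Rightarrow>
     (nat \<Rightarrow> 'k spoly) \<Rightarrow> (nat \<Rightarrow> nat \<Rightarrow> nat \<Rightarrow> 'k spoly) \<Rightarrow> bool" where
  "min_free_res n J r a e D \<longleftrightarrow> (let R = poly_ring {..<n} in
     (\<forall>q<r 0. e q \<in> R \<and> homogeneous (a 0 q) (e q)) \<and>
     (\<forall>i. \<forall>p<r i. \<forall>q<r (Suc i). D i p q \<in> R \<and>
        (\<forall>m\<in>Poly_Mapping.keys (D i p q). a (Suc i) q = a i p + mdeg m)) \<and>
     (\<lambda>v. \<Sum>q<r 0. e q * v q) ` free_mod R (r 0) = J \<and>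
     {v \<in> free_mod R (r 0). (\<Sum>q<r 0. e q * v q) = 0}
       = mat_app (r 0) (r 1) (D 0) ` free_mod R (r 1) \<and>
     (\<forall>i. {v \<in> free_mod R (r (Suc i)). mat_app (r i) (r (Suc i)) (D i) v = (\<lambda>_. 0)}
       = mat_app (r (Suc i)) (r (Suc (Suc i))) (D (Suc i)) ` free_mod R (r (Suc (Suc i)))) \<and>
     (\<forall>i. \<forall>p<r i. \<forall>q<r (Suc i). Poly_Mapping.lookup (D i p q) 0 = 0))"

text \<open>The second index of a Betti number is the internal degree, i.e. the twist of the summand.\<close>

definition betti_fin :: "nat \<Rightarrow> 'k::field_char_0 spoly set \<Rightarrow> nat \<Rightarrow> nat \<Rightarrow> nat" where
  "betti_fin n J i j =
     (THE b. \<exists>r a e D. min_free_res n J r a e D \<and> b = card {q. q < r i \<and> a i q = j})"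

definition betti :: "'k::field_char_0 spoly set \<Rightarrow> nat \<Rightarrow> nat \<Rightarrow> nat" where
  "betti I i j = lim (\<lambda>n. betti_fin n (I \<inter> poly_ring {..<n}) i j)"

text \<open>The \<open>B\<close>-sequence of a table of graded Betti numbers; only the terms with \<open>j \<ge> 1\<close> belong
  to it. Generators of degree 0 are therefore not recorded, and the zero ideal and the unit
  ideal have the same \<open>B\<close>-sequence.\<close>

definition B_seq :: "(nat \<Rightarrow> nat \<Rightarrow> nat) \<Rightarrow> nat \<Rightarrow> int" where
  "B_seq \<beta> j = (\<Sum>i=0..j. (-1) ^ i * int (\<beta> i j))"

end

(* Proof idea. Lex shifting acts on shifted families of finite sets: generic initial ideals are strongly stable,
   and the squarefree operation preserves the numbers of squarefree monomials of each degree in all large sets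
   of variables. A finitely generated USLI is encoded by a word w with one letter per variable. If the ideal of
   w is contained in a shifted ideal I and u is a squarefree monomial of I, of large degree and not in the ideal
   of w, then in suitable special (singular) coordinates all monomials of that degree up to the largest one not
   yet generated become leading monomials; independence being an open condition, they are initial monomials in
   generic coordinates. So each lex shift appends letters to w, and the shifts converge degree by degree to
   the USLI of the union of these words. A shifted family is determined by its counting function if this is the
   counting function of a word; hence an ideal that is not a USLI never becomes one, and as a repetition would
   make the sequence periodic and its members equal to the limit, all shifts are distinct. Finally, the
   B-sequence and the Hilbert function determine each other through the Euler characteristic of the minimal
   resolution, and two squarefree lexsegment ideals with the same Hilbert function are equal. *)
theory Submission
  imports Defs "HOL-Computational_Algebra.Polynomial" "HOL-Library.Product_Lexorder"
    "HOL-Library.Nat_Bijection" "HOL-Library.Multiset"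
begin

section \<open>Monomials and polynomials\<close>

text \<open>Generic leading monomials are never computed, only bounded. The number of them above a
  threshold is the rank of a matrix of coefficients, and a rank found at one substitution, even a
  singular one, is a lower bound at generic ones; maximality and the fixed Hilbert function turn
  such bounds into equalities. The obstacle in the special coordinates is a letter
  \<open>True\<close> whose variable does not divide \<open>u\<close>: all elements of the ideal of
  the remaining word have a factor that \<open>u\<close> lacks. There the later linear forms depend
  on a parameter, which has to avoid the roots of a polynomial. The convergence is a matter of
  counting: the members of the least size outside the ideal of the word are finitely many, and each
  step adds a set of this size to the word, while the number of members of this size in large sets
  of variables is constant. The void complex gives the unit ideal, which is treated apart; as
  B-sequences start at index 1, membership of 1 separates it from the zero ideal. For resolutions,
  vectors are encoded as polynomials in one more variable, so that division and Dickson's lemma for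
  monomials apply to modules as well.\<close>

abbreviation lookup where "lookup \<equiv> Poly_Mapping.lookup"
abbreviation keys where "keys \<equiv> Poly_Mapping.keys"
abbreviation sgl where "sgl \<equiv> Poly_Mapping.single"

definition Mon :: "nat set=>monom set" where "Mon V = {m. keys m <= V}"

definition Deg :: "nat=>monom set" where "Deg d = {m. mdeg m = d}"

text \<open>The linear span of a set of monomials, an ideal only if \<open>U\<close> is closed under
  multiplication. Monomial ideals, their graded components and the subrings are all spans of this
  kind, which turns equations between them into equations between sets of monomials.\<close>

definition mideal :: "monom set=>'k::field_char_0 spoly set" where "mideal U = {f. keys f <= U}"

text \<open>The library orders finitely supported functions by their first difference, which is the
  lex order with the first variable largest. \<open>Max\<close>, \<open>Min\<close> and the laws of
  ordered monoids are thereby available for monomials.\<close>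

lemma lex_greater_iff: "lex_greater m m' \<longleftrightarrow> m' < m"
unfolding lex_greater_def less_poly_mapping.rep_eq less_fun_def by auto

lemma mdeg_eq: "finite V ==> keys m <= V ==> mdeg m = (SUM i:V. lookup m i)"
unfolding mdeg_def by (rule sum.mono_neutral_left) (auto simp: in_keys_iff)

lemma mdeg_zero [simp]: "mdeg 0 = 0" by (simp add: mdeg_def)

lemma mdeg_add [simp]: "mdeg (a + b) = mdeg a + mdeg b"
proof -
let ?V = "keys a Un keys b"
have "keys (a + b) <= ?V" by (rule Poly_Mapping.keys_add)
hence "mdeg (a + b) = (SUM i:?V. lookup (a + b) i)" by (intro mdeg_eq) auto
also have "... = (SUM i:?V. lookup a i) + (SUM i:?V. lookup b i)" by (simp add: lookup_add sum.distrib)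
also have "... = mdeg a + mdeg b" using mdeg_eq[of ?V a] mdeg_eq[of ?V b] by simp
finally show ?thesis .
qed

lemma mdeg_single [simp]: "mdeg (sgl i c) = c" by (cases "c = 0") (simp_all add: mdeg_def)

lemma mdeg_sum: "mdeg (SUM x:A. f x) = (SUM x:A. mdeg (f x))" by (induction A rule: infinite_finite_induct) auto

lemma lookup_le_mdeg: "lookup m i <= mdeg m"
proof (cases "i:keys m")
case True
thus ?thesis unfolding mdeg_def by (intro member_le_sum) auto
qed (simp add: in_keys_iff)

lemma mdeg_eq_0_iff [simp]: "mdeg m = 0 \<longleftrightarrow> m = 0"
proof
assume "mdeg m = 0"
hence "lookup m i = 0" for i using lookup_le_mdeg[of m i] by simp
thus "m = 0" by (intro poly_mapping_eqI) simp
qed simp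

lemma keys_add_nat: "keys (a + b) = keys a Un keys (b :: 'v \<Rightarrow>\<^sub>0 nat)" by (auto simp: in_keys_iff lookup_add)

lemma keys_sum_nat: "finite A ==> keys (SUM x:A. f x) = (UN x:A. keys (f x :: 'v \<Rightarrow>\<^sub>0 nat))"
by (induction A rule: finite_induct) (auto simp: keys_add_nat)

lemma Mon_add [simp]: "a + b:Mon V \<longleftrightarrow> a:Mon V & b:Mon V" by (auto simp: Mon_def keys_add_nat)

abbreviation Mn :: "nat=>monom set" where "Mn n \<equiv> Mon {..<n::nat}"
abbreviation PR :: "nat=>'k::field_char_0 spoly set" where "PR n \<equiv> poly_ring {..<n::nat}"

lemma Mon_zero [simp]: "0:Mon V" by (simp add: Mon_def)

lemma Mon_UNIV [simp]: "Mon UNIV = UNIV" by (simp add: Mon_def)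

lemma Mon_mono: "V <= V' ==> Mon V <= Mon V'" by (auto simp: Mon_def)

lemma Deg_iff [simp]: "m:Deg d \<longleftrightarrow> mdeg m = d" by (simp add: Deg_def)

lemma finite_Mon_bounded: "finite V ==> finite {m:Mon V. mdeg m <= d}"
proof -
assume fin: "finite V"
let ?F = "{f. ALL x. (x:V --> f x:{..d}) & (x ~: V --> f x = (0::nat))}"
have "finite ?F" by (rule finite_set_of_finite_funs) (use fin in auto)
moreover have "lookup ` {m:Mon V. mdeg m <= d} <= ?F"
proof clarify
 fix m x assume m: "m:Mon V" "mdeg m <= d"
 have "lookup m x <= d" using lookup_le_mdeg[of m x] m by simp
 moreover have "x ~: V ==> lookup m x = 0" using m by (auto simp: Mon_def in_keys_iff)
 ultimately show "(x:V --> lookup m x:{..d}) & (x ~: V --> lookup m x = 0)" by auto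
qed
ultimately have "finite (lookup ` {m:Mon V. mdeg m <= d})" by (rule rev_finite_subset)
thus ?thesis by (rule finite_imageD) (auto intro!: inj_onI poly_mapping_eqI)
qed

lemma finite_Mon_Deg [simp]: "finite V ==> finite (Mon V Int Deg d)" by (rule finite_subset[OF _ finite_Mon_bounded[of V d]]) auto

lemma mdvd_iff: "(ALL i. lookup a i <= lookup m i) \<longleftrightarrow> (EX c. m = a + (c :: 'v \<Rightarrow>\<^sub>0 nat))"
proof
assume "ALL i. lookup a i <= lookup m i"
hence "m = a + (m - a)" by (intro poly_mapping_eqI) (simp add: lookup_add lookup_minus)
thus "EX c. m = a + c" by blast
qed (auto simp: lookup_add)

lemma monom_minus_add: "i:keys m ==> m - sgl i 1 + sgl i 1 = (m :: 'v \<Rightarrow>\<^sub>0 nat)"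
by (intro poly_mapping_eqI) (auto simp: lookup_add lookup_minus lookup_single when_def in_keys_iff)

lemma mdeg_minus_single: "i:keys m ==> Suc (mdeg (m - sgl i 1)) = mdeg m"
by (metis monom_minus_add mdeg_add mdeg_single Suc_eq_plus1)

lemma monom_induct [case_names zero add]:
 assumes "P 0" "!!m i. P m ==> P (m + sgl i 1)"
 shows "P (m :: monom)"
proof (induction "mdeg m" arbitrary: m)
case 0
thus ?case using assms(1) by simp
next
case (Suc d)
hence "m ~= 0" by auto
then obtain i where i: "i:keys m" by (metis keys_eq_empty ex_in_conv)
hence "d = mdeg (m - sgl i 1)" using Suc(2) mdeg_minus_single[OF i] by simp
from Suc(1)[OF this] show ?case using assms(2) monom_minus_add[OF i] by metis
qed

lemma mon_zero [simp]: "mon 0 = 1" by (simp add: mon_def)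

lemma mon_add: "mon (a + b) = mon a * mon b" by (simp add: mon_def mult_single)

lemma keys_mon [simp]: "keys (mon m :: 'k::field_char_0 spoly) = {m}" by (simp add: mon_def)

lemma lookup_mon: "lookup (mon m) m' = (if m = m' then 1 else 0)" by (simp add: mon_def lookup_single when_def)

lemma lookup_mon_same [simp]: "lookup (mon m) m = 1" by (simp add: lookup_mon)

lemma mon_nonzero [simp]: "(mon m :: 'k::field_char_0 spoly) ~= 0" by (metis keys_mon keys_zero insert_not_empty)

lemma X_power: "X i ^ c = mon (sgl i c)" by (induction c) (simp_all add: X_def mon_add[symmetric] single_add[symmetric])

lemma scalar_zero [simp]: "scalar 0 = 0" and scalar_one [simp]: "scalar 1 = 1" by (simp_all add: scalar_def)

lemma scalar_add: "scalar (a + b) = scalar a + scalar b"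
 and scalar_mult: "scalar (a * b) = scalar a * scalar b"
 and scalar_uminus: "scalar (- a) = - scalar a"
by (simp_all add: scalar_def single_add mult_single single_uminus)

lemma scalar_sum: "scalar (SUM x:A. f x) = (SUM x:A. scalar (f x))"
by (induction A rule: infinite_finite_induct) (auto simp: scalar_add)

lemma lookup_scalar_mult [simp]: "lookup (scalar c * f) m = c * lookup f m"
by (simp add: scalar_def mult_map_scale_conv_mult[symmetric] map.rep_eq when_def)

lemma keys_scalar_mult: "keys (scalar c * f) = (if c = 0 then {} else keys f)" by (auto simp: in_keys_iff)

lemma poly_expand:
 assumes "finite S" "keys f <= S"
 shows "f = (SUM m:S. scalar (lookup f m) * mon m)"
proof (rule poly_mapping_eqI)
fix k
have "lookup (SUM m:S. scalar (lookup f m) * mon m) k = (SUM m:S. if m = k then lookup f m else 0)"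
 by (simp add: lookup_sum lookup_mon if_distrib cong: if_cong)
also have "... = lookup f k" using assms by (auto simp: sum.delta in_keys_iff)
finally show "lookup f k = lookup (SUM m:S. scalar (lookup f m) * mon m) k" by simp
qed

lemma lookup_mon_mult: "lookup (mon a * f) (a + m) = lookup f m"
proof -
have "mon a * f = (SUM m:keys f. scalar (lookup f m) * mon (a + m))" by (subst poly_expand[of "keys f" f])
  (simp_all add: sum_distrib_left mon_add mult_ac)
hence "lookup (mon a * f) (a + m) = (SUM k:keys f. if k = m then lookup f k else 0)"
 by (simp add: lookup_sum lookup_mon if_distrib cong: if_cong)
also have "... = lookup f m" by (auto simp: sum.delta in_keys_iff)
finally show ?thesis .
qed

lemma keys_mon_mult: "keys (mon a * f) = (+) a ` keys f"
proof
show "keys (mon a * f) <= (+) a ` keys f" using keys_mult[of "mon a" f] by auto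
show "(+) a ` keys f <= keys (mon a * f)" by (auto simp: in_keys_iff lookup_mon_mult)
qed

lemma keys_sum_subset: "(!!x. x:A ==> keys (f x) <= S) ==> keys (SUM x:A. f x) <= S" using keys_sum[of f A] by blast

lemma mideal_zero [simp]: "0:mideal U" by (simp add: mideal_def)

lemma mideal_add: "f:mideal U ==> g:mideal U ==> f + g:mideal U" using Poly_Mapping.keys_add[of f g] by (auto simp: mideal_def)

lemma mideal_scalar: "f:mideal U ==> scalar c * f:mideal U" by (auto simp: mideal_def keys_scalar_mult)

lemma mideal_sum: "(!!x. x:A ==> f x:mideal U) ==> (SUM x:A. f x):mideal U"
by (induction A rule: infinite_finite_induct) (auto intro: mideal_add)

lemma mon_in_mideal [simp]: "(mon m :: 'k::field_char_0 spoly):mideal U \<longleftrightarrow> m:U" by (simp add: mideal_def)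

lemma mideal_inj: "(mideal U :: 'k::field_char_0 spoly set) = mideal U' \<longleftrightarrow> U = U'"
by (metis mon_in_mideal subsetI subset_antisym)

lemma mideal_subset_iff: "(mideal U :: 'k::field_char_0 spoly set) <= mideal U' \<longleftrightarrow> U <= U'"
proof
assume *: "(mideal U :: 'k spoly set) <= mideal U'"
show "U <= U'"
proof
 fix m assume "m:U"
 hence "(mon m :: 'k spoly):mideal U'" by (intro subsetD[OF *]) simp
 thus "m:U'" by simp
qed
qed (auto simp: mideal_def)

lemma poly_ring_eq: "poly_ring V = mideal (Mon V)" by (auto simp: poly_ring_def mideal_def Mon_def)

lemma mideal_Int: "mideal U Int mideal U' = mideal (U Int U')" by (auto simp: mideal_def)

lemma mideal_Deg: "homogeneous d f \<longleftrightarrow> f:mideal (Deg d)" by (auto simp: homogeneous_def mideal_def)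

lemma degree_comp_eq: "degree_comp d J = J Int mideal (Deg d)" by (auto simp: degree_comp_def mideal_Deg)

lemma mideal_UNIV [simp]: "mideal UNIV = UNIV" by (simp add: mideal_def)

lemma mideal_mult:
 assumes "f:mideal A" "g:mideal B" "!!a b. a:A ==> b:B ==> a + b:C"
 shows "f * g:mideal C" using keys_mult[of f g] assms by (fastforce simp: mideal_def)

lemma poly_ring_zero [simp]: "0:poly_ring V" by (simp add: poly_ring_eq)

lemma poly_ring_mult: "f:poly_ring V ==> g:poly_ring V ==> f * g:poly_ring V" unfolding poly_ring_eq by (rule mideal_mult) auto

lemma poly_ring_add: "f:poly_ring V ==> g:poly_ring V ==> f + g:poly_ring V" unfolding poly_ring_eq by (rule mideal_add)

lemma poly_ring_scalar [simp]: "scalar c:poly_ring V" by (auto simp: poly_ring_def scalar_def)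

lemma poly_ring_one [simp]: "1:poly_ring V" using poly_ring_scalar[of 1 V] by simp

lemma poly_ring_mon [simp]: "(mon m :: 'k::field_char_0 spoly):poly_ring V \<longleftrightarrow> m:Mon V"
by (simp add: poly_ring_eq)

lemma poly_ring_UNIV [simp]: "poly_ring UNIV = UNIV" by (simp add: poly_ring_def)

lemma poly_ring_sum: "(!!x. x:A ==> f x:poly_ring V) ==> (SUM x:A. f x):poly_ring V" unfolding poly_ring_eq by (rule mideal_sum)

lemma poly_ring_prod: "(!!x. x:A ==> f x:poly_ring V) ==> (PROD x:A. f x):poly_ring V"
by (induction A rule: infinite_finite_induct) (auto intro: poly_ring_mult)

lemma poly_ring_uminus: "f:poly_ring V ==> - f:poly_ring V" by (simp add: poly_ring_def)

lemma poly_ring_diff: "f:poly_ring V ==> g:poly_ring V ==> f - g:poly_ring V"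
using poly_ring_add[of f V "- g"] by (simp add: poly_ring_uminus)

lemma poly_ring_mono: "V <= V' ==> poly_ring V <= poly_ring V'" by (auto simp: poly_ring_def)

section \<open>Monomial ideals\<close>

definition mup :: "nat set=>monom set=>monom set" where "mup V A = {a + c | a c. a:A & c:Mon V}"

definition upclosed :: "nat set=>monom set=>bool" where
 "upclosed V U \<longleftrightarrow> U <= Mon V & (ALL a:U. ALL c:Mon V. a + c:U)"

lemma upclosedD: "upclosed V U ==> a:U ==> c:Mon V ==> a + c:U" by (simp add: upclosed_def)

lemma upclosed_mup: "A <= Mon V ==> upclosed V (mup V A)" unfolding upclosed_def mup_def by (auto simp: add.assoc) (metis Mon_add)

lemma subset_mup: "A <= mup V A"
proof
fix a assume "a:A"
hence "a + 0:mup V A" unfolding mup_def using Mon_zero by blast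
thus "a:mup V A" by simp
qed

lemma mup_upclosed: "upclosed V U ==> mup V U = U" using subset_mup[of U V] unfolding upclosed_def mup_def by auto

lemma mup_least: "upclosed V U ==> A <= U ==> mup V A <= U" by (auto simp: mup_def upclosed_def)

lemma ideal_gen_zero: "0:ideal_gen R G" unfolding ideal_gen_def by (auto intro!: exI[of _ "{}"])

lemma ideal_gen_add:
 assumes "!!x y. x:R ==> y:R ==> x + y:R" "(0::'a::comm_ring_1):R"
 and "f:ideal_gen R G" "g:ideal_gen R G"
 shows "f + g:ideal_gen R G"
proof -
from assms(3) obtain A c where A: "finite A" "A <= G" "c ` A <= R" and f: "f = (SUM g:A. c g * g)" by (auto simp: ideal_gen_def)
from assms(4) obtain B b where B: "finite B" "B <= G" "b ` B <= R" and g: "g = (SUM g:B. b g * g)" by (auto simp: ideal_gen_def)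
let ?c = "%x. (if x:A then c x else 0) + (if x:B then b x else 0)"
have "(SUM x:A Un B. ?c x * x) = (SUM x:A Un B. (if x:A then c x * x else 0))
  + (SUM x:A Un B. (if x:B then b x * x else 0))" unfolding sum.distrib[symmetric] by (intro sum.cong) (auto simp: distrib_right)
also have "(SUM x:A Un B. (if x:A then c x * x else 0)) = f"
 unfolding f using A B by (simp add: sum.inter_restrict[symmetric] Int_absorb2 Int_commute)
also have "(SUM x:A Un B. (if x:B then b x * x else 0)) = g"
 unfolding g using A B by (simp add: sum.inter_restrict[symmetric] Int_absorb2 Int_commute)
finally have "f + g = (SUM x:A Un B. ?c x * x)" by simp
moreover have "?c ` (A Un B) <= R" using assms(1,2) A(3) B(3) by (auto simp: image_subset_iff)
ultimately show ?thesis using A B unfolding ideal_gen_def by (intro CollectI exI[of _ "A Un B"] exI[of _ ?c]) auto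
qed

lemma ideal_gen_mult_in: "g:G ==> c:R ==> c * g:ideal_gen R G"
unfolding ideal_gen_def by (intro CollectI exI[of _ "{g}"] exI[of _ "%_. c"]) auto

lemma ideal_gen_mono: "G <= H ==> ideal_gen R G <= ideal_gen R H"
proof
fix f assume GH: "G <= H" and "f:ideal_gen R G"
then obtain A c where A: "finite A" "A <= G" "c ` A <= R" and f: "f = (SUM g:A. c g * g)" by (auto simp: ideal_gen_def)
show "f:ideal_gen R H" unfolding ideal_gen_def using A f GH by (intro CollectI exI[of _ A] exI[of _ c]) auto
qed

lemma ideal_gen_sum:
 assumes "!!x y. x:R ==> y:R ==> x + y:R" "(0::'a::comm_ring_1):R"
 and "!!x. x:A ==> f x:ideal_gen R G"
 shows "(SUM x:A. f x):ideal_gen R G" using assms(3) by (induction A rule: infinite_finite_induct)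
 (auto intro: ideal_gen_zero ideal_gen_add[OF assms(1,2)])

lemma ideal_gen_least:
 assumes "G <= J" "0:J" "!!x y. x:J ==> y:J ==> x + y:J" "!!c x. c:R ==> x:J ==> c * x:J"
 shows "ideal_gen R G <= J"
proof
fix f assume "f:ideal_gen R G"
then obtain A c where A: "finite A" "A <= G" "c ` A <= R" and f: "f = (SUM g:A. c g * g)" by (auto simp: ideal_gen_def)
have "(SUM g:A. c g * g):J" using A by (induction A rule: finite_induct) (use assms in auto)
thus "f:J" using f by simp
qed

lemma ideal_gen_mon:
 assumes "A <= Mon V"
 shows "ideal_gen (poly_ring V) (mon ` A) = (mideal (mup V A) :: 'k::field_char_0 spoly set)"
proof
show "ideal_gen (poly_ring V) (mon ` A) <= (mideal (mup V A) :: 'k spoly set)"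
proof (rule ideal_gen_least)
 show "mon ` A <= (mideal (mup V A) :: 'k spoly set)" using subset_mup[of A V] by auto
 show "c * x:mideal (mup V A)" if "c:poly_ring V" "x:mideal (mup V A)" for c x :: "'k spoly" using that unfolding poly_ring_eq
  by (rule mideal_mult) (metis add.commute upclosedD upclosed_mup[OF assms])
qed (auto intro: mideal_add)
show "(mideal (mup V A) :: 'k spoly set) <= ideal_gen (poly_ring V) (mon ` A)"
proof
 fix f :: "'k spoly" assume f: "f:mideal (mup V A)"
 have "scalar (lookup f m) * mon m:ideal_gen (poly_ring V) (mon ` A)" if "m:keys f" for m
 proof -
  from that f obtain a c where m: "m = a + c" "a:A" "c:Mon V" by (auto simp: mideal_def mup_def)
  have "(scalar (lookup f m) * mon c) * mon a:ideal_gen (poly_ring V) (mon ` A)"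
   by (rule ideal_gen_mult_in) (use m in "auto intro: poly_ring_mult")
  thus ?thesis by (simp add: m mon_add mult_ac)
 qed
 hence "(SUM m:keys f. scalar (lookup f m) * mon m):ideal_gen (poly_ring V) (mon ` A)"
  by (intro ideal_gen_sum) (auto intro: poly_ring_add)
 thus "f:ideal_gen (poly_ring V) (mon ` A)" using poly_expand[of "keys f" f] by simp
qed
qed

lemma ideal_gen_mon_UNIV: "ideal_gen UNIV (mon ` A) = (mideal (mup UNIV A) :: 'k::field_char_0 spoly set)"
using ideal_gen_mon[of A UNIV] by simp

lemma ideal_gen_mideal:
 assumes "U <= Mon V"
 shows "ideal_gen (poly_ring V) (mideal U) = (mideal (mup V U) :: 'k::field_char_0 spoly set)"
proof
show "ideal_gen (poly_ring V) (mideal U) <= (mideal (mup V U) :: 'k spoly set)"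
proof (rule ideal_gen_least)
 show "mideal U <= (mideal (mup V U) :: 'k spoly set)" by (simp add: mideal_subset_iff subset_mup)
 show "c * x:mideal (mup V U)" if "c:poly_ring V" "x:mideal (mup V U)" for c x :: "'k spoly" using that unfolding poly_ring_eq
  by (rule mideal_mult) (metis add.commute upclosedD upclosed_mup[OF assms])
qed (auto intro: mideal_add)
have "mon ` U <= (mideal U :: 'k spoly set)" by auto
hence "ideal_gen (poly_ring V) (mon ` U) <= ideal_gen (poly_ring V) (mideal U :: 'k spoly set)" by (rule ideal_gen_mono)
thus "(mideal (mup V U) :: 'k spoly set) <= ideal_gen (poly_ring V) (mideal U)" by (simp add: ideal_gen_mon[OF assms])
qed

lemma ideal_gen_mideal_UNIV: "ideal_gen UNIV (mideal U) = (mideal (mup UNIV U) :: 'k::field_char_0 spoly set)"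
using ideal_gen_mideal[of U UNIV] by simp

lemma min_gens_mideal: "min_gens (mideal U :: 'k::field_char_0 spoly set)
 = {m:U. ALL a:U. ALL c. m = a + c --> a = m}" unfolding min_gens_def mdvd_iff by auto

section \<open>Evaluation and coordinate changes\<close>

definition evm :: "('v=>'r::comm_ring_1)=>('v \<Rightarrow>\<^sub>0 nat)=>'r" where
 "evm \<sigma> m = (PROD v:keys m. \<sigma> v ^ lookup m v)"

lemma evm_eq: "finite V ==> keys m <= V ==> evm \<sigma> m = (PROD v:V. \<sigma> v ^ lookup m v)"
unfolding evm_def by (rule prod.mono_neutral_left) (auto simp: in_keys_iff)

lemma evm_zero [simp]: "evm \<sigma> 0 = 1" by (simp add: evm_def)

lemma evm_single [simp]: "evm \<sigma> (sgl i c) = \<sigma> i ^ c" by (cases "c = 0") (auto simp: evm_def)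

lemma evm_add: "evm \<sigma> (a + b) = evm \<sigma> a * evm \<sigma> b"
proof -
let ?V = "keys a Un keys b"
have "evm \<sigma> (a + b) = (PROD v:?V. \<sigma> v ^ lookup (a + b) v)" by (rule evm_eq) (auto simp: keys_add_nat)
also have "... = (PROD v:?V. \<sigma> v ^ lookup a v) * (PROD v:?V. \<sigma> v ^ lookup b v)"
 by (simp add: lookup_add power_add prod.distrib)
also have "... = evm \<sigma> a * evm \<sigma> b" using evm_eq[of ?V a \<sigma>] evm_eq[of ?V b \<sigma>] by simp
finally show ?thesis .
qed

lemma evm_cong: "(!!v. v:keys m ==> \<sigma> v = \<tau> v) ==> evm \<sigma> m = evm \<tau> m" by (simp add: evm_def)

text \<open>Two instances are used: the identity, to evaluate a polynomial at the entries of a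
  matrix, and \<open>scalar\<close>, to substitute polynomials for variables.\<close>

locale coeff_hom =
 fixes h :: "'k::comm_ring_1=>'r::comm_ring_1"
 assumes h0: "h 0 = 0" and h1: "h 1 = 1"
 and hadd: "h (a + b) = h a + h b" and hmult: "h (a * b) = h a * h b"
begin

lemma eval_eq: "finite S ==> keys f <= S ==> eval_mpoly h \<sigma> f = (SUM m:S. h (lookup f m) * evm \<sigma> m)"
unfolding eval_mpoly_def evm_def[symmetric] by (rule sum.mono_neutral_left) (auto simp: in_keys_iff h0)

lemma eval_zero [simp]: "eval_mpoly h \<sigma> 0 = 0" by (simp add: eval_mpoly_def)

lemma eval_add: "eval_mpoly h \<sigma> (f + g) = eval_mpoly h \<sigma> f + eval_mpoly h \<sigma> g"
using eval_eq[of "keys f Un keys g" "f + g" \<sigma>] eval_eq[of "keys f Un keys g" f \<sigma>]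
 eval_eq[of "keys f Un keys g" g \<sigma>] Poly_Mapping.keys_add[of f g] by (simp add: lookup_add hadd distrib_right sum.distrib)

lemma eval_single: "eval_mpoly h \<sigma> (sgl m c) = h c * evm \<sigma> m" using eval_eq[of "{m}" "sgl m c" \<sigma>] by simp

lemma eval_sum: "eval_mpoly h \<sigma> (SUM x:A. f x) = (SUM x:A. eval_mpoly h \<sigma> (f x))"
by (induction A rule: infinite_finite_induct) (auto simp: eval_add)

lemma sum_singles: "f = (SUM m:keys f. sgl m (lookup f m))"
proof (rule poly_mapping_eqI)
fix k
have "lookup (SUM m:keys f. sgl m (lookup f m)) k = (SUM m:keys f. if m = k then lookup f m else 0)"
 by (simp add: lookup_sum lookup_single when_def)
also have "... = lookup f k" by (auto simp: sum.delta in_keys_iff)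
finally show "lookup f k = lookup (SUM m:keys f. sgl m (lookup f m)) k" by simp
qed

lemma eval_mult: "eval_mpoly h \<sigma> (f * g) = eval_mpoly h \<sigma> f * eval_mpoly h \<sigma> g"
proof -
have "f * g = (SUM a:keys f. SUM b:keys g. sgl (a + b) (lookup f a * lookup g b))"
 by (subst sum_singles[of f], subst sum_singles[of g]) (simp only: sum_product mult_single)
hence "eval_mpoly h \<sigma> (f * g) = (SUM a:keys f. SUM b:keys g. (h (lookup f a) * evm \<sigma> a) * (h (lookup g b) * evm \<sigma> b))"
 by (simp add: eval_sum eval_single hmult evm_add mult_ac)
also have "... = eval_mpoly h \<sigma> f * eval_mpoly h \<sigma> g" by (simp add: sum_product eval_mpoly_def evm_def)
finally show ?thesis .
qed

end

interpretation id_hom: coeff_hom "id :: 'k::field_char_0=>'k" by unfold_locales auto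

interpretation scalar_hom: coeff_hom "scalar :: 'k::field_char_0=>'k spoly" by unfold_locales (auto simp: scalar_add scalar_mult)

definition lin :: "nat=>(nat=>nat=>'k::field_char_0)=>nat=>'k spoly" where "lin n g j = (\<Sum>i<n. scalar (g i j) * X i)"

definition subst :: "(nat=>'k::field_char_0 spoly)=>'k spoly=>'k spoly" where "subst l = eval_mpoly scalar l"

lemma coord_change_eq: "coord_change n g = subst (lin n g)" by (simp add: coord_change_def subst_def lin_def[abs_def])

lemma subst_zero [simp]: "subst l 0 = 0" by (simp add: subst_def)

lemma subst_add: "subst l (f + h) = subst l f + subst l h" by (simp add: subst_def scalar_hom.eval_add)

lemma subst_mult: "subst l (f * h) = subst l f * subst l h" by (simp add: subst_def scalar_hom.eval_mult)

lemma subst_sum: "subst l (SUM x:A. f x) = (SUM x:A. subst l (f x))" by (simp add: subst_def scalar_hom.eval_sum)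

lemma subst_scalar [simp]: "subst l (scalar c) = scalar c" by (simp add: subst_def scalar_def scalar_hom.eval_single)

lemma subst_mon: "subst l (mon m) = evm l m" by (simp add: subst_def mon_def scalar_hom.eval_single)

lemma subst_X [simp]: "subst l (X i) = l i" by (simp add: X_def subst_mon)

lemma subst_one [simp]: "subst l 1 = 1" using subst_scalar[of l 1] by simp

lemma subst_power: "subst l (f ^ k) = subst l f ^ k" by (induction k) (auto simp: subst_mult)

lemma subst_prod: "subst l (PROD x:A. f x) = (PROD x:A. subst l (f x))"
by (induction A rule: infinite_finite_induct) (auto simp: subst_mult)

lemma subst_diff: "subst l (f - h) = subst l f - subst l h" using subst_add[of l "f - h" h] by simp

lemma subst_expand: "finite S ==> keys f <= S ==> subst l f = (SUM m:S. scalar (lookup f m) * evm l m)"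
by (simp add: subst_def scalar_hom.eval_eq)

lemma subst_cong:
 assumes "f:poly_ring V" "!!v. v:V ==> l v = l' v"
 shows "subst l f = subst l' f"
proof -
have "evm l m = evm l' m" if "m:keys f" for m by (rule evm_cong) (use assms that in "auto simp: poly_ring_def")
thus ?thesis by (simp add: subst_expand[of "keys f"])
qed

lemma subst_subst: "subst l (subst l' f) = subst (%j. subst l (l' j)) f"
proof -
have "subst l (evm l' m) = evm (%j. subst l (l' j)) m" for m by (simp add: evm_def subst_prod subst_power)
thus ?thesis by (simp add: subst_expand[of "keys f" f] subst_sum subst_mult)
qed

lemma subst_X_id [simp]: "subst X (f :: 'k::field_char_0 spoly) = f"
proof -
have "evm X m = (mon m :: 'k spoly)" for m by (induction m rule: monom_induct) (simp_all add: evm_add mon_add X_def)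
hence "subst X f = (SUM m:keys f. scalar (lookup f m) * mon m)" by (simp add: subst_expand[of "keys f"])
thus ?thesis using poly_expand[of "keys f" f] by simp
qed

lemma homogeneous_zero [simp]: "homogeneous d 0" by (simp add: homogeneous_def)

lemma homogeneous_add: "homogeneous d f ==> homogeneous d g ==> homogeneous d (f + g)" by (simp add: mideal_Deg mideal_add)

lemma homogeneous_mult: "homogeneous d f ==> homogeneous e g ==> homogeneous (d + e) (f * g)"
unfolding mideal_Deg by (rule mideal_mult) auto

lemma homogeneous_scalar [simp]: "homogeneous 0 (scalar c)" by (simp add: homogeneous_def scalar_def)

lemma homogeneous_scalar_mult: "homogeneous d f ==> homogeneous d (scalar c * f)"
using homogeneous_mult[OF homogeneous_scalar] by simp

lemma homogeneous_sum: "(!!x. x:A ==> homogeneous d (f x)) ==> homogeneous d (SUM x:A. f x)" by (simp add: mideal_Deg mideal_sum)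

lemma homogeneous_mon [simp]: "homogeneous d (mon m :: 'k::field_char_0 spoly) \<longleftrightarrow> mdeg m = d"
by (simp add: homogeneous_def)

lemma homogeneous_X [simp]: "homogeneous (Suc 0) (X i)" by (simp add: X_def)

lemma homogeneous_power: "homogeneous d f ==> homogeneous (k * d) (f ^ k)"
proof (induction k)
case (Suc k)
thus ?case using homogeneous_mult[OF Suc(2) Suc(1)[OF Suc(2)]] by simp
qed (simp add: homogeneous_def)

lemma homogeneous_prod: "finite A ==> (!!x. x:A ==> homogeneous (d x) (f x)) ==>
 homogeneous (SUM x:A. d x) (PROD x:A. f x)"
proof (induction A rule: finite_induct)
case (insert x F)
hence "homogeneous (d x + (SUM x:F. d x)) (f x * (PROD x:F. f x))" by (intro homogeneous_mult) auto
thus ?case using insert by simp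
qed (simp add: homogeneous_def)

lemma homogeneous_evm:
 assumes "!!j. j:keys m ==> homogeneous (Suc 0) (l j)"
 shows "homogeneous (mdeg m) (evm l m)"
proof -
have "homogeneous (SUM v:keys m. lookup m v) (PROD v:keys m. l v ^ lookup m v)"
 by (rule homogeneous_prod) (use homogeneous_power[OF assms] in auto)
thus ?thesis by (simp add: evm_def mdeg_def)
qed

lemma homogeneous_subst:
 assumes "homogeneous d f" "!!j. homogeneous (Suc 0) (l j)"
 shows "homogeneous d (subst l f)" unfolding subst_expand[of "keys f" f l, simplified]
by (rule homogeneous_sum, rule homogeneous_scalar_mult) (metis assms homogeneous_evm homogeneous_def)

lemma homogeneous_lin [simp]: "homogeneous (Suc 0) (lin n g j)"
unfolding lin_def by (intro homogeneous_sum homogeneous_scalar_mult) simp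

lemma X_in_poly_ring: "(X i :: 'k::field_char_0 spoly):poly_ring V \<longleftrightarrow> i:V" by (simp add: X_def Mon_def)

lemma lin_in_poly_ring: "lin n g j:PR n" unfolding lin_def by (intro poly_ring_sum poly_ring_mult) (auto simp: X_in_poly_ring)

lemma evm_in_poly_ring: "(!!j. j:keys m ==> l j:poly_ring V) ==> evm l m:poly_ring V"
proof -
assume *: "!!j. j:keys m ==> l j:poly_ring V"
have "l j ^ c:poly_ring V" if "j:keys m" for j c by (induction c) (use * that in "auto intro: poly_ring_mult")
thus ?thesis unfolding evm_def by (intro poly_ring_prod)
qed

lemma subst_in_poly_ring: "(!!j. l j:poly_ring V) ==> subst l f:poly_ring V" unfolding subst_expand[of "keys f" f l, simplified]
by (intro poly_ring_sum poly_ring_mult evm_in_poly_ring) auto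

section \<open>Leading monomials\<close>

interpretation vs: vector_space "%(c::'k::field_char_0) (f::'k spoly). scalar c * f"
by unfold_locales (auto simp: scalar_add scalar_mult distrib_left distrib_right mult.assoc)

text \<open>Largest monomial for lex alone; \<open>in_mon\<close> compares degrees first, and the
  two agree on nonzero homogeneous polynomials. \<open>lead 0\<close> is the maximum of an empty
  set, so \<open>leads\<close> discards 0.\<close>

definition lead :: "'k::field_char_0 spoly=>monom" where "lead f = Max (keys f)"

definition leads :: "'k::field_char_0 spoly set=>monom set" where "leads W = lead ` (W - {0})"

lemma lead_in_keys: "f ~= 0 ==> lead f:keys f" unfolding lead_def by (rule Max_in) auto

lemma lead_ge: "k:keys f ==> k <= lead f" unfolding lead_def by simp

lemma lead_eqI: "k:keys f ==> (!!k'. k':keys f ==> k' <= k) ==> lead f = k" unfolding lead_def by (rule Max_eqI) auto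

lemma lookup_gt_lead: "lead f < k ==> lookup f k = 0" using lead_ge[of k f] by (meson in_keys_iff leD)

lemma lookup_lead_nonzero: "f ~= 0 ==> lookup f (lead f) ~= 0" using lead_in_keys[of f] by (simp add: in_keys_iff)

lemma lead_mon_mult: "f ~= 0 ==> lead (mon a * f) = a + lead f" by (rule lead_eqI) (auto simp: keys_mon_mult lead_in_keys lead_ge)

lemma lead_mon [simp]: "lead (mon a :: 'k::field_char_0 spoly) = a" by (simp add: lead_def)

text \<open>In a vanishing combination the largest leading monomial that carries a nonzero
  coefficient occurs in one summand only, so it cannot cancel.\<close>

lemma independent_leads:
 fixes A :: "'k::field_char_0 spoly set"
 assumes "0 ~: A" "inj_on lead A"
 shows "vs.independent A" unfolding vs.independent_explicit_finite_subsets
proof (intro allI impI ballI)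
fix S and u :: "'k spoly=>'k" and v
assume S: "S <= A" "finite S" and 0: "(SUM v:S. scalar (u v) * v) = 0" and v: "v:S"
show "u v = 0"
proof (rule ccontr)
 assume uv: "u v ~= 0"
 define S' where "S' = {v:S. u v ~= 0}"
 have fin: "finite (lead ` S')" and ne: "lead ` S' ~= {}" using S v uv by (auto simp: S'_def)
 obtain w where w: "w:S'" "lead w = Max (lead ` S')" using Max_in[OF fin ne] by auto
 have z: "u x * lookup x (lead w) = 0" if x: "x:S" "x ~= w" for x
 proof (cases "u x = 0")
  case False
  hence "lead x <= lead w" using x w fin by (auto simp: S'_def)
  moreover have "lead x ~= lead w" using inj_onD[OF assms(2), of x w] x w(1) S by (auto simp: S'_def)
  ultimately show ?thesis by (simp add: lookup_gt_lead)
 qed simp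
 have "(SUM x:S. u x * lookup x (lead w)) = u w * lookup w (lead w)"
  using w S z by (subst sum.mono_neutral_right[of S "{w}"]) (auto simp: S'_def)
 moreover have "(SUM x:S. u x * lookup x (lead w)) = lookup (SUM v:S. scalar (u v) * v) (lead w)" by (simp add: lookup_sum)
 ultimately have "u w * lookup w (lead w) = 0" using 0 by simp
 moreover have "w ~= 0" using w assms(1) S by (auto simp: S'_def)
 ultimately show False using w lookup_lead_nonzero[of w] by (auto simp: S'_def)
qed
qed

text \<open>Division algorithm: subtracting a multiple of the element of \<open>B\<close> with the
  same leading monomial lowers the leading monomial, and all monomials stay in the finite set
  \<open>D\<close>.\<close>

lemma span_leads:
 fixes W B :: "'k::field_char_0 spoly set"
 assumes W: "vs.subspace W" "finite D" "!!f. f:W ==> keys f <= D"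
 and B: "B <= W" "0 ~: B" "leads W <= lead ` B"
 shows "W <= vs.span B"
proof
fix f assume "f:W"
thus "f:vs.span B"
proof (induction "card {k:D. k <= lead f}" arbitrary: f rule: less_induct)
 case less
 show ?case
 proof (cases "f = 0")
  case False
  hence "lead f:leads W" using less by (auto simp: leads_def)
  then obtain b where b: "b:B" "lead b = lead f" using B by auto
  have b0: "b ~= 0" using b B by auto
  define c where "c = lookup f (lead f) / lookup b (lead f)"
  define h where "h = f - scalar c * b"
  have hW: "h:W" unfolding h_def by (rule vs.subspace_diff[OF W(1)]) (use less b B W(1) in "auto intro: vs.subspace_scale")
  have lh: "lookup h (lead f) = 0" using lookup_lead_nonzero[OF b0] b by (simp add: h_def lookup_minus c_def)
  have "h:vs.span B"
  proof (cases "h = 0")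
   case False
   have "lead h <= lead f"
   proof (rule ccontr)
    assume "~ ?thesis"
    hence "lookup h (lead h) = 0" using lookup_gt_lead[of f "lead h"] lookup_gt_lead[of b "lead h"] b
     by (simp add: h_def lookup_minus)
    thus False using lookup_lead_nonzero[OF False] by simp
   qed
   moreover have "lead h ~= lead f" using lh lookup_lead_nonzero[OF False] by auto
   ultimately have lt: "lead h < lead f" by simp
   have "lead f:D" using W(3)[OF less(2)] lead_in_keys[OF \<open>f ~= 0\<close>] by auto
   hence "lead f:{k:D. k <= lead f} - {k:D. k <= lead h}" using lt by auto
   hence "{k:D. k <= lead h} \<subset> {k:D. k <= lead f}" using lt by fastforce
   hence "card {k:D. k <= lead h} < card {k:D. k <= lead f}" by (rule psubset_card_mono[rotated]) (use W in auto)
   thus ?thesis using less(1) hW by blast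
  qed (simp add: vs.span_zero)
  moreover have "f = h + scalar c * b" by (simp add: h_def)
  ultimately show ?thesis using b by (metis vs.span_add vs.span_scale vs.span_base)
 qed (simp add: vs.span_zero)
qed
qed

lemma leads_subset: "(!!f. f:W ==> keys f <= D) ==> leads W <= D" unfolding leads_def using lead_in_keys by blast

lemma leads_mono: "W <= W' ==> leads W <= leads W'" by (auto simp: leads_def)

lemma leads_basis:
 obtains B where "B <= W" "0 ~: B" "inj_on lead B" "lead ` B = leads W"
proof -
have "EX f. ALL t:leads W. f t:W & f t ~= 0 & lead (f t) = t" by (rule bchoice) (auto simp: leads_def)
then obtain f where f: "!!t. t:leads W ==> f t:W & f t ~= 0 & lead (f t) = t" by blast
show ?thesis by (rule that[of "f ` leads W"]) (use f in "auto simp: inj_on_def image_iff")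
qed

text \<open>With the reverse inequality below, a finite-dimensional space has as many leading
  monomials as its dimension. Both bounds use a set of elements of \<open>W\<close>, one for each
  leading monomial.\<close>

lemma card_leads_le:
 fixes W B :: "'k::field_char_0 spoly set"
 assumes "W <= vs.span B" "finite B"
 shows "card (leads W) <= card B"
proof -
obtain C where C: "C <= W" "0 ~: C" "inj_on lead C" "lead ` C = leads W" by (rule leads_basis)
have "card C <= card B" using vs.independent_span_bound[OF assms(2) independent_leads[OF C(2,3)]] C(1) assms(1) by blast
thus ?thesis using card_image[OF C(3)] C(4) by simp
qed

lemma card_leads_ge:
 fixes W B :: "'k::field_char_0 spoly set"
 assumes W: "vs.subspace W" "finite D" "!!f. f:W ==> keys f <= D"
 and B: "B <= W" "vs.independent B"
 shows "card B <= card (leads W)"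
proof -
obtain C where C: "C <= W" "0 ~: C" "inj_on lead C" "lead ` C = leads W" by (rule leads_basis)
have fin: "finite (leads W)" using finite_subset[OF leads_subset[OF W(3)] W(2)] by blast
hence "finite C" using C by (metis finite_imageD)
moreover have "B <= vs.span C" using span_leads[OF W C(1,2)] C(4) B by auto
ultimately have "card B <= card C" using vs.independent_span_bound[of C B] B by blast
thus ?thesis using card_image[OF C(3)] C(4) by simp
qed

lemma independent_family:
 fixes p :: "'i=>'k::field_char_0 spoly"
 assumes "finite A" "!!c. (SUM v:A. scalar (c v) * p v) = 0 ==> ALL v:A. c v = 0"
 shows "inj_on p A" "vs.independent (p ` A)"
proof -
show inj: "inj_on p A"
proof (rule inj_onI, rule ccontr)
 fix x y assume xy: "x:A" "y:A" "p x = p y" "x ~= y"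
 let ?c = "%v. if v = x then 1 else if v = y then - 1 else (0::'k)"
 have "(SUM v:A. scalar (?c v) * p v) = (SUM v:{x,y}. scalar (?c v) * p v)"
  by (rule sum.mono_neutral_right) (use xy assms in auto)
 also have "... = 0" using xy by (simp add: scalar_uminus)
 finally have "ALL v:A. ?c v = 0" by (rule assms(2))
 thus False using xy(1) by auto
qed
show "vs.independent (p ` A)"
proof (rule vs.independent_if_scalars_zero)
 fix f x assume 0: "(SUM x:p ` A. scalar (f x) * x) = 0" and x: "x:p ` A"
 have "(SUM v:A. scalar (f (p v)) * p v) = 0" using 0 by (simp add: sum.reindex[OF inj])
 hence "ALL v:A. f (p v) = 0" by (rule assms(2))
 thus "f x = 0" using x by auto
qed (use assms in auto)
qed

definition pr :: "monom set=>'k::field_char_0 spoly=>'k spoly" where "pr C f = (SUM m:keys f Int C. scalar (lookup f m) * mon m)"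

lemma lookup_pr: "lookup (pr C f) m = (if m:C then lookup f m else 0)"
proof -
have "lookup (pr C f) m = (SUM k:keys f Int C. if k = m then lookup f k else 0)"
 by (simp add: pr_def lookup_sum lookup_mon if_distrib cong: if_cong)
also have "... = (if m:C then lookup f m else 0)" by (auto simp: sum.delta in_keys_iff)
finally show ?thesis .
qed

lemma keys_pr: "keys (pr C f) = keys f Int C" by (auto simp: in_keys_iff lookup_pr split: if_splits)

lemma pr_add: "pr C (f + g) = pr C f + pr C g"
 and pr_scalar: "pr C (scalar c * f) = scalar c * pr C f"
 and pr_zero [simp]: "pr C 0 = 0" by (rule poly_mapping_eqI, simp add: lookup_pr lookup_add)+

lemma pr_id: "keys f <= C ==> pr C f = f" by (rule poly_mapping_eqI) (auto simp: lookup_pr in_keys_iff)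

text \<open>Deleting all monomials below \<open>t\<close> keeps exactly the leading monomials that
  are at least \<open>t\<close>. Their number is thus the dimension of a truncated space, that is,
  the rank of a matrix of coefficients, and ranks can be compared under specialization.\<close>

lemma leads_pr: "leads (pr {t..} ` W) = leads W Int {t..}"
proof -
have *: "pr {t..} f ~= 0 ==> f ~= 0 & lead (pr {t..} f) = lead f & t <= lead f" for f :: "'a spoly"
proof -
 assume ne: "pr {t..} f ~= 0"
 hence "lead (pr {t..} f):keys f Int {t..}" using lead_in_keys keys_pr by metis
 hence k: "lead (pr {t..} f):keys f" "t <= lead (pr {t..} f)" by auto
 have f: "f ~= 0" using ne by auto
 have "t <= lead f" using k lead_ge by (metis order_trans)
 moreover have "lead (pr {t..} f) = lead f"
  by (rule lead_eqI) (use \<open>t <= lead f\<close> f in "auto simp: keys_pr lead_in_keys lead_ge")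
 ultimately show "f ~= 0 & lead (pr {t..} f) = lead f & t <= lead f" using f by simp
qed
have **: "f ~= 0 ==> t <= lead f ==> pr {t..} f ~= 0" for f :: "'a spoly"
proof -
 assume "f ~= 0" "t <= lead f"
 hence "lead f:keys (pr {t..} f)" by (simp add: keys_pr lead_in_keys)
 thus "pr {t..} f ~= 0" by auto
qed
show ?thesis
proof (intro subset_antisym subsetI)
 fix m assume "m:leads (pr {t..} ` W)"
 then obtain f where "f:W" "pr {t..} f ~= 0" "m = lead (pr {t..} f)" by (auto simp: leads_def)
 thus "m:leads W Int {t..}" using *[of f] by (auto simp: leads_def)
next
 fix m assume "m:leads W Int {t..}"
 then obtain f where f: "f:W" "f ~= 0" "m = lead f" "t <= lead f" by (auto simp: leads_def)
 hence "pr {t..} f ~= 0" "lead (pr {t..} f) = m" using *[of f] **[of f] by auto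
 thus "m:leads (pr {t..} ` W)" using f unfolding leads_def by (metis Diff_iff image_eqI singletonD)
qed
qed

lemma subspace_pr: "vs.subspace W ==> vs.subspace (pr C ` W)" unfolding vs.subspace_def
proof (intro conjI ballI allI)
assume *: "0:W & (ALL x:W. ALL y:W. x + y:W) & (ALL c. ALL x:W. scalar c * x:W)"
thus "0:pr C ` W" by (metis image_eqI pr_zero)
show "x + y:pr C ` W" if "x:pr C ` W" "y:pr C ` W" for x y using that * by (auto simp: pr_add[symmetric])
show "scalar c * x:pr C ` W" if "x:pr C ` W" for c x using that * by (auto simp: pr_scalar[symmetric])
qed

text \<open>Linear independence of the rows \<open>A\<close> of a matrix after restriction to the
  columns \<open>C\<close>. The matrix form is chosen because the entries will be polynomial
  functions of parameters.\<close>

definition indep_at :: "('i=>monom=>'k::field_char_0)=>'i set=>monom set=>bool" where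
 "indep_at e A C \<longleftrightarrow> (ALL c. (ALL m:C. (SUM i:A. c i * e i m) = 0) --> (ALL i:A. c i = 0))"

lemma family_leads_ge:
 fixes p :: "'i=>'k::field_char_0 spoly"
 assumes W: "vs.subspace W" "finite D" "!!f. f:W ==> keys f <= D"
 and A: "finite A" "!!v. v:A ==> p v:W" and C: "C <= {t..}"
 and ind: "indep_at (%v m. lookup (p v) m) A C"
 shows "card A <= card (leads W Int {t..})"
proof -
let ?q = "%v. pr {t..} (p v)"
have *: "ALL v:A. c v = 0" if "(SUM v:A. scalar (c v) * ?q v) = 0" for c
proof -
 have "(SUM i:A. c i * lookup (p i) m) = 0" if m: "m:C" for m
 proof -
  have "(SUM i:A. c i * lookup (p i) m) = lookup (SUM v:A. scalar (c v) * ?q v) m"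
   using m C by (auto simp: lookup_sum lookup_pr intro!: sum.cong)
  thus ?thesis using that by (simp add: \<open>(SUM v:A. scalar (c v) * ?q v) = 0\<close>)
 qed
 thus ?thesis using ind by (auto simp: indep_at_def)
qed
note fam = independent_family[OF A(1), of ?q, OF *]
have "card (?q ` A) <= card (leads (pr {t..} ` W))"
proof (rule card_leads_ge[OF subspace_pr[OF W(1)] W(2)])
 show "keys f <= D" if "f:pr {t..} ` W" for f using that W(3) by (fastforce simp: keys_pr)
qed (use A fam in auto)
thus ?thesis using card_image[OF fam(1)] by (simp add: leads_pr)
qed

section \<open>Generic coordinates\<close>

text \<open>The elimination argument is applied over two parameter spaces: upper triangular
  matrices, and a single scalar that degenerates a torus action.\<close>

locale function_algebra =
 fixes PF :: "('g=>'k::field_char_0) set"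
 assumes PF_const: "(%_. c):PF"
 and PF_add: "\<phi>:PF ==> \<psi>:PF ==> (%g. \<phi> g + \<psi> g):PF"
 and PF_mult: "\<phi>:PF ==> \<psi>:PF ==> (%g. \<phi> g * \<psi> g):PF"
begin

lemma PF_diff: "\<phi>:PF ==> \<psi>:PF ==> (%g. \<phi> g - \<psi> g):PF"
using PF_add[OF _ PF_mult[OF PF_const[of "-1"]], of \<phi> \<psi>] by simp

lemma PF_sum: "(!!x. x:A ==> \<phi> x:PF) ==> (%g. SUM x:A. \<phi> x g):PF"
by (induction A rule: infinite_finite_induct) (auto intro: PF_add PF_const)

text \<open>Independence is an open condition: one Gaussian elimination step divides by the pivot
  \<open>e a m\<^sub>0\<close>, whose nonvanishing is recorded as a factor of the polynomial \<open>P\<close>.\<close>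

lemma open_indep:
 assumes "finite A" "!!i m. i:A ==> m:C ==> e i m:PF" "indep_at (%i m. e i m g0) A C"
 shows "EX P:PF. P g0 ~= 0 & (ALL g. P g ~= 0 --> indep_at (%i m. e i m g) A C)" using assms
proof (induction A arbitrary: e rule: finite_induct)
case empty
show ?case by (rule bexI[OF _ PF_const[of 1]]) (auto simp: indep_at_def)
next
case (insert a A)
have "EX m0:C. e a m0 g0 ~= 0"
proof (rule ccontr)
 assume no: "~ ?thesis"
 let ?c = "%i. if i = a then 1 else (0::'k)"
 have "ALL m:C. (SUM i:insert a A. ?c i * e i m g0) = 0" using no insert.hyps by (auto intro!: sum.neutral)
 hence "ALL i:insert a A. ?c i = 0" using insert.prems(2)[unfolded indep_at_def, THEN spec[of _ ?c]] by blast
 thus False by simp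
qed
then obtain m0 where m0: "m0:C" "e a m0 g0 ~= 0" by blast
\<comment> \<open>Fraction-free elimination of the column \<open>m0\<close>: the new rows vanish in
  this column.\<close>
define e' where "e' i m = (%g. e a m0 g * e i m g - e i m0 g * e a m g)" for i m
have e'PF: "e' i m:PF" if "i:A" "m:C" for i m unfolding e'_def using that m0 insert.prems(1) by (intro PF_diff PF_mult) auto
have key: "(SUM i:A. c i * e' i m g) = e a m0 g * (SUM i:A. c i * e i m g) - (SUM i:A. c i * e i m0 g) * e a m g"
 for c m g by (simp add: e'_def sum_distrib_left sum_distrib_right algebra_simps sum_subtractf)
have "indep_at (%i m. e' i m g0) A C" unfolding indep_at_def
proof (intro allI impI ballI)
 fix c i assume c: "ALL m:C. (SUM i:A. c i * e' i m g0) = 0" and i: "i:A"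
 \<comment> \<open>A relation among the eliminated rows lifts to the original rows; the coefficient
   at \<open>a\<close> is the one that clears the column \<open>m0\<close>.\<close>
 define c' where "c' j = (if j = a then - (SUM i:A. c i * e i m0 g0) else c j * e a m0 g0)" for j
 have "(SUM i:insert a A. c' i * e i m g0) = 0" if m: "m:C" for m
 proof -
  have "(SUM i:A. c' i * e i m g0) = e a m0 g0 * (SUM i:A. c i * e i m g0)" unfolding sum_distrib_left using insert.hyps
   by (intro sum.cong) (auto simp: c'_def)
  thus ?thesis using c[rule_format, OF m] insert.hyps key[of c m g0] by (simp add: c'_def)
 qed
 hence "c' i = 0" using insert.prems(2) i unfolding indep_at_def by blast
 moreover have "i ~= a" using i insert.hyps by auto
 ultimately show "c i = 0" using m0 by (simp add: c'_def)
qed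
from insert.IH[OF e'PF this] obtain P where P: "P:PF" "P g0 ~= 0" "!!g. P g ~= 0 ==> indep_at (%i m. e' i m g) A C" by blast
show ?case
proof (rule bexI[of _ "%g. P g * e a m0 g"], intro conjI allI impI)
 show "P g0 * e a m0 g0 ~= 0" using P m0 by simp
 show "(%g. P g * e a m0 g):PF" using P m0 insert.prems(1) by (intro PF_mult) auto
 fix g assume g: "P g * e a m0 g ~= 0"
 show "indep_at (%i m. e i m g) (insert a A) C" unfolding indep_at_def
 proof (intro allI impI)
  fix c assume c: "ALL m:C. (SUM i:insert a A. c i * e i m g) = 0"
  have c1: "c a * e a m g + (SUM i:A. c i * e i m g) = 0" if "m:C" for m using c that insert.hyps by auto
  have "(SUM i:A. c i * e' i m g) = 0" if m: "m:C" for m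
  proof -
   have "(SUM i:A. c i * e i m g) = - c a * e a m g" "(SUM i:A. c i * e i m0 g) = - c a * e a m0 g"
    using c1[OF m] c1[OF m0(1)] by (simp_all add: eq_neg_iff_add_eq_0 add.commute)
   thus ?thesis unfolding key by simp
  qed
  hence A0: "ALL i:A. c i = 0" using P(3)[of g] g by (auto simp: indep_at_def)
  hence "c a * e a m0 g = 0" using c1[OF m0(1)] by simp
  thus "ALL i:insert a A. c i = 0" using A0 g by auto
 qed
qed
qed

end

interpretation poly_fun: function_algebra "{%x. poly p x | p. True} :: ('k::field_char_0=>'k) set"
proof unfold_locales
fix c :: 'k and \<phi> \<psi> :: "'k=>'k"
show "(%_. c):{%x. poly p x |p. True}" by (auto intro!: exI[of _ "[:c:]"])
assume "\<phi>:{%x. poly p x |p. True}" "\<psi>:{%x. poly p x |p. True}"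
then obtain p q where pq: "\<phi> = (%x. poly p x)" "\<psi> = (%x. poly q x)" by auto
hence "(%g. \<phi> g + \<psi> g) = (%x. poly (p + q) x)" "(%g. \<phi> g * \<psi> g) = (%x. poly (p * q) x)" by auto
thus "(%g. \<phi> g + \<psi> g):{%x. poly p x |p. True}" "(%g. \<phi> g * \<psi> g):{%x. poly p x |p. True}" by blast+
qed

section \<open>Polynomial functions on upper triangular matrices and generic properties\<close>

definition tri_vars :: "nat=>(nat \<times> nat) set" where "tri_vars n = {(i, j). i <= j & j < n}"

definition PFm :: "nat=>((nat=>nat=>'k::field_char_0)=>'k) set" where
 "PFm n = {%g. eval_mpoly id (%(i, j). g i j) P | P. ALL m:keys P. keys m <= tri_vars n}"

interpretation mat_fun: function_algebra "PFm n"
proof unfold_locales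
fix c :: 'a and \<phi> \<psi> :: "(nat=>nat=>'a)=>'a"
show "(%_. c):PFm n" unfolding PFm_def by (intro CollectI exI[of _ "sgl 0 c"]) (auto simp: id_hom.eval_single)
assume "\<phi>:PFm n" "\<psi>:PFm n"
then obtain P Q where P: "\<phi> = (%g. eval_mpoly id (%(i, j). g i j) P)" "ALL m:keys P. keys m <= tri_vars n"
 and Q: "\<psi> = (%g. eval_mpoly id (%(i, j). g i j) Q)" "ALL m:keys Q. keys m <= tri_vars n" unfolding PFm_def by blast
have "ALL m:keys (P + Q). keys m <= tri_vars n" using Poly_Mapping.keys_add[of P Q] P Q by blast
thus "(%g. \<phi> g + \<psi> g):PFm n" unfolding PFm_def P Q by (intro CollectI exI[of _ "P + Q"]) (auto simp: id_hom.eval_add)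
have "ALL m:keys (P * Q). keys m <= tri_vars n" using keys_mult[of P Q] P(2) Q(2) by (fastforce simp: keys_add_nat)
thus "(%g. \<phi> g * \<psi> g):PFm n" unfolding PFm_def P Q by (intro CollectI exI[of _ "P * Q"]) (auto simp: id_hom.eval_mult)
qed

lemma PFm_var: "i <= j ==> j < n ==> (%g. g i j):PFm n" unfolding PFm_def
by (intro CollectI exI[of _ "sgl (sgl (i, j) 1) 1"]) (auto simp: id_hom.eval_single tri_vars_def)

lemma digits_unique:
 fixes a b :: "nat=>nat"
 assumes "!!i. i < N ==> a i < E" "!!i. i < N ==> b i < E" "(\<Sum>i<N. a i * E ^ i) = (\<Sum>i<N. b i * E ^ i)" "i < N"
 shows "a i = b i"
proof -
have bound: "(\<Sum>i<N. a i * E ^ i) < E ^ N" if "!!i. i < N ==> a i < E" for N and a :: "nat=>nat" using that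
proof (induction N)
 case (Suc N)
 hence "(\<Sum>i<N. a i * E ^ i) + a N * E ^ N < E ^ N + a N * E ^ N" by simp
 also have "... = Suc (a N) * E ^ N" by simp
 also have "... <= E * E ^ N" using Suc.prems[of N] by (intro mult_right_mono) auto
 finally show ?case by simp
qed simp
show ?thesis using assms
proof (induction N arbitrary: i)
 case (Suc N)
 let ?A = "\<Sum>i<N. a i * E ^ i" and ?B = "\<Sum>i<N. b i * E ^ i"
 have A: "?A < E ^ N" and B: "?B < E ^ N" using bound Suc.prems by auto
 have eq: "?A + a N * E ^ N = ?B + b N * E ^ N" using Suc.prems(3) by simp
 have "0 < E ^ N" using A by linarith
 hence "E ^ N ~= 0" by simp
 hence "a N = (?A + a N * E ^ N) div E ^ N" "b N = (?B + b N * E ^ N) div E ^ N" using A B by simp_all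
 hence N: "a N = b N" using eq by simp
 hence "?A = ?B" using eq by simp
 thus ?case using Suc.IH[of i] Suc.prems N by (cases "i = N") auto
qed simp
qed

text \<open>Kronecker substitution: along the curve \<open>g i j = x ^ (E ^ code (i, j))\<close> distinct monomials
  become distinct powers of \<open>x\<close>.\<close>

lemma nonzero_point:
 fixes P :: "((nat \<times> nat) \<Rightarrow>\<^sub>0 nat) \<Rightarrow>\<^sub>0 'k::field_char_0"
 assumes "P ~= 0" and vars: "ALL m:keys P. keys m <= tri_vars n"
 shows "EX g. upper_triangular n g & eval_mpoly id (%(i, j). g i j) P ~= 0"
proof -
\<comment> \<open>\<open>E\<close> exceeds every exponent in \<open>P\<close>, and \<open>N\<close>
  below exceeds the code of every variable, so \<open>w\<close> reads the exponents of a monomial as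
  digits in base \<open>E\<close>.\<close>
define E where "E = Suc (Max (insert 0 (UN m:keys P. lookup m ` keys m)))"
have E: "lookup m v < E" if "m:keys P" for m v
proof (cases "v:keys m")
 case True
 thus ?thesis unfolding E_def less_Suc_eq_le using that by (intro Max_ge) auto
qed (simp add: in_keys_iff E_def)
define N where "N = Suc (Max (insert 0 (UN m:keys P. prod_encode ` keys m)))"
have N: "prod_encode v < N" if "m:keys P" "v:keys m" for m v unfolding N_def less_Suc_eq_le using that by (intro Max_ge) auto
define w where "w m = (SUM v:keys m. lookup m v * E ^ prod_encode v)" for m :: "(nat \<times> nat) \<Rightarrow>\<^sub>0 nat"
have w: "w m = (\<Sum>k<N. lookup m (prod_decode k) * E ^ k)" if m: "m:keys P" for m
proof -
 have "w m = (SUM k:prod_encode ` keys m. lookup m (prod_decode k) * E ^ k)"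
  unfolding w_def by (subst sum.reindex) (simp_all add: inj_prod_encode)
 also have "... = (\<Sum>k<N. lookup m (prod_decode k) * E ^ k)"
 proof (rule sum.mono_neutral_left)
  show "ALL i:{..<N} - prod_encode ` keys m. lookup m (prod_decode i) * E ^ i = 0"
  proof
   fix i assume "i:{..<N} - prod_encode ` keys m"
   hence "prod_decode i ~: keys m" by (metis DiffD2 image_eqI prod_decode_inverse)
   thus "lookup m (prod_decode i) * E ^ i = 0" by (simp add: in_keys_iff)
  qed
 qed (use N m in auto)
 finally show ?thesis .
qed
have winj: "inj_on w (keys P)"
proof (rule inj_onI)
 fix m m' assume m: "m:keys P" "m':keys P" "w m = w m'"
 have *: "lookup m (prod_decode k) = lookup m' (prod_decode k)" if "k < N" for k
  using digits_unique[of N "%k. lookup m (prod_decode k)" E "%k. lookup m' (prod_decode k)" k]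
   E m w that by auto
 show "m = m'"
 proof (rule poly_mapping_eqI)
  fix v
  show "lookup m v = lookup m' v"
  proof (cases "v:keys m Un keys m'")
   case True
   hence "prod_encode v < N" using N m(1,2) by blast
   from *[OF this] show ?thesis by simp
  qed (simp add: in_keys_iff)
 qed
qed
define q where "q = (SUM m:keys P. monom (lookup P m) (w m))"
obtain m0 where m0: "m0:keys P" using assms(1) by (metis keys_eq_empty ex_in_conv)
have "coeff q (w m0) = (SUM m:keys P. if m = m0 then lookup P m else 0)"
 unfolding q_def coeff_sum by (intro sum.cong) (use winj m0 in "auto simp: inj_on_def")
also have "... = lookup P m0" using m0 by (simp add: sum.delta)
finally have "coeff q (w m0) ~= 0" using m0 by (simp add: in_keys_iff)
hence "q ~= 0" by auto
hence "finite (insert 0 {x. poly q x = 0})" using poly_roots_finite by auto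
\<comment> \<open>A nonzero \<open>x\<close> makes the diagonal entries of the matrix
  \<open>g\<close> below nonzero.\<close>
then obtain x where x: "x ~= 0" "poly q x ~= 0"
 using ex_new_if_finite[OF infinite_UNIV_char_0, of "insert 0 {x. poly q x = 0}"] by auto
define g where "g i j = (if i <= j then x ^ (E ^ prod_encode (i, j)) else 0)" for i j :: nat
have "upper_triangular n g" using x by (auto simp: upper_triangular_def g_def)
moreover have "eval_mpoly id (%(i, j). g i j) P = poly q x"
proof -
 have "evm (%(i, j). g i j) m = x ^ w m" if m: "m:keys P" for m
 proof -
  have "evm (%(i, j). g i j) m = (PROD v:keys m. x ^ (lookup m v * E ^ prod_encode v))" unfolding evm_def
  proof (rule prod.cong)
   fix v assume v: "v:keys m"
   then obtain i j where ij: "v = (i, j)" "i <= j" using vars m unfolding tri_vars_def by blast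
   thus "(case v of (i, j)=>g i j) ^ lookup m v = x ^ (lookup m v * E ^ prod_encode v)"
    by (simp add: g_def power_mult[symmetric] mult.commute)
  qed simp
  thus ?thesis by (simp add: w_def power_sum)
 qed
 thus ?thesis by (simp add: id_hom.eval_eq[of "keys P"] q_def poly_sum poly_monom)
qed
ultimately show ?thesis using x by auto
qed

lemma generic_upper_alt: "generic_upper n Q \<longleftrightarrow> (EX P. P ~= 0 & (ALL m:keys P. keys m <= tri_vars n) &
  (ALL g. upper_triangular n g & eval_mpoly id (%(i, j). g i j) P ~= 0 --> Q g))" by (simp add: generic_upper_def tri_vars_def)

lemma generic_upper_ex: "generic_upper n Q ==> EX g. upper_triangular n g & Q g"
unfolding generic_upper_alt using nonzero_point by blast

lemma generic_upper_mono: "generic_upper n Q ==> (!!g. upper_triangular n g ==> Q g ==> Q' g) ==> generic_upper n Q'"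
unfolding generic_upper_alt by blast

lemma generic_upper_all: "(!!g. upper_triangular n g ==> Q g) ==> generic_upper n (Q :: _=>bool)"
unfolding generic_upper_alt by (intro exI[of _ 1]) auto

text \<open>The product of the two witnesses is a witness, since the polynomial ring in the entries
  is a domain. With \<open>generic_upper_ex\<close>, finitely many generic properties hold at a
  common matrix.\<close>

lemma generic_upper_conj:
 assumes "generic_upper n Q" "generic_upper n Q'"
 shows "generic_upper n (%g. Q g & Q' g)"
proof -
from assms obtain P P' where P: "P ~= 0" "ALL m:keys P. keys m <= tri_vars n"
  "!!g. upper_triangular n g ==> eval_mpoly id (%(i, j). g i j) P ~= 0 ==> Q g"
 and P': "P' ~= 0" "ALL m:keys P'. keys m <= tri_vars n"
  "!!g. upper_triangular n g ==> eval_mpoly id (%(i, j). g i j) P' ~= 0 ==> Q' g" unfolding generic_upper_alt by metis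
show ?thesis unfolding generic_upper_alt
proof (intro exI[of _ "P * P'"] conjI allI impI ballI)
 show "P * P' ~= 0" using P P' by simp
 show "keys m <= tri_vars n" if "m:keys (P * P')" for m using keys_mult[of P P'] that P(2) P'(2) by (fastforce simp: keys_add_nat)
 fix g assume "upper_triangular n g & eval_mpoly id (%(i, j). g i j) (P * P') ~= 0"
 thus "Q g" "Q' g" using P(3) P'(3) by (auto simp: id_hom.eval_mult)
qed
qed

lemma generic_upper_finite: "finite S ==> (!!s. s:S ==> generic_upper n (Q s)) ==> generic_upper n (%g. ALL s:S. Q s g)"
by (induction S rule: finite_induct) (auto intro: generic_upper_all generic_upper_conj)

lemma generic_PFm: "\<phi>:PFm n ==> \<phi> g0 ~= 0 ==> generic_upper n (%g. \<phi> g ~= 0)"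
proof -
assume "\<phi>:PFm n" "\<phi> g0 ~= 0"
then obtain P where "\<phi> = (%g. eval_mpoly id (%(i, j). g i j) P)" "ALL m:keys P. keys m <= tri_vars n" "P ~= 0"
 unfolding PFm_def by force
thus ?thesis unfolding generic_upper_alt by blast
qed

section \<open>Generic initial monomials\<close>

text \<open>Matrices are total functions, but only the entries on and above the diagonal are
  variables of the witnessing polynomials; \<open>ut\<close> discards the rest. The next predicate,
  \<open>lowz\<close>, leaves the diagonal free and so admits singular matrices.\<close>

definition ut :: "(nat=>nat=>'k::field_char_0)=>nat=>nat=>'k" where "ut g i j = (if i <= j then g i j else 0)"

definition lowz :: "nat=>(nat=>nat=>'k::field_char_0)=>bool" where "lowz n g \<longleftrightarrow> (ALL i<n. ALL j<i. g i j = 0)"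

lemma upper_triangular_lowz: "upper_triangular n g ==> lowz n g" by (simp add: upper_triangular_def lowz_def)

lemma lin_ut: "lowz n g ==> j < n ==> lin n (ut g) j = lin n g j"
unfolding lin_def by (intro sum.cong) (auto simp: ut_def lowz_def)

lemma subst_ut: "lowz n g ==> f:PR n ==> subst (lin n (ut g)) f = subst (lin n g) f" by (rule subst_cong) (auto simp: lin_ut)

definition PFp :: "nat=>((nat=>nat=>'k::field_char_0)=>'k spoly)=>bool" where
 "PFp n F \<longleftrightarrow> (ALL m. (%g. lookup (F g) m):PFm n)"

lemma PFp_sum: "(!!x. x:A ==> PFp n (F x)) ==> PFp n (%g. SUM x:A. F x g)"
unfolding PFp_def lookup_sum by (intro allI mat_fun.PF_sum) auto

lemma lookup_mon_mult_if: "lookup (mon a * f) k = (if EX c. k = a + c then lookup f (k - a) else 0)"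
proof (cases "EX c. k = a + c")
case True
thus ?thesis using lookup_mon_mult[of a f "k - a"] by auto
next
case False
hence "k ~: keys (mon a * f)" by (auto simp: keys_mon_mult)
thus ?thesis using False by (simp add: in_keys_iff)
qed

lemma PFp_term: "\<phi>:PFm n ==> PFp n G ==> PFp n (%g. scalar (\<phi> g) * (mon a * G g))" unfolding PFp_def lookup_scalar_mult
proof
fix m assume \<phi>: "\<phi>:PFm n" and G: "ALL m. (%g. lookup (G g) m):PFm n"
have "(%g. lookup (mon a * G g) m):PFm n"
 unfolding lookup_mon_mult_if using G by (cases "EX c. m = a + c") (simp_all add: mat_fun.PF_const)
with \<phi> show "(%g. \<phi> g * lookup (mon a * G g) m):PFm n" by (rule mat_fun.PF_mult)
qed

lemma PFp_one: "PFp n (%_. 1)" unfolding PFp_def by (auto intro: mat_fun.PF_const)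

lemma ut_PFm: "j < n ==> (%g. ut g i j):PFm n" by (cases "i <= j") (auto simp: ut_def intro: PFm_var mat_fun.PF_const)

lemma PFp_evm: "m:Mn n ==> PFp n (%g :: nat=>nat=>'k::field_char_0. evm (lin n (ut g)) m)"
proof (induction m rule: monom_induct)
case (add m j)
hence m: "m:Mn n" and j: "j < n" by (auto simp: Mon_def keys_add_nat)
have "PFp n (%g :: nat=>nat=>'k. \<Sum>i<n. scalar (ut g i j) * (mon (sgl i 1) * evm (lin n (ut g)) m))"
 using add.IH[OF m] by (intro PFp_sum PFp_term ut_PFm j)
moreover have "(%g :: nat=>nat=>'k. \<Sum>i<n. scalar (ut g i j) * (mon (sgl i 1) * evm (lin n (ut g)) m))
  = (%g. evm (lin n (ut g)) (m + sgl j 1))"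
 by (rule ext) (simp add: evm_add lin_def sum_distrib_left sum_distrib_right X_def mult_ac)
ultimately show ?case by simp
qed (simp add: PFp_one)

lemma PFp_subst: "f:PR n ==> PFp n (%g. subst (lin n (ut g)) f)"
proof -
assume f: "f:PR n"
have "PFp n (%g. SUM m:keys f. scalar (lookup f m) * (mon 0 * evm (lin n (ut g)) m))"
 using f by (intro PFp_sum PFp_term mat_fun.PF_const PFp_evm) (auto simp: poly_ring_def Mon_def)
thus ?thesis by (simp add: subst_expand[of "keys f"])
qed

text \<open>One substitution with independent images, even a singular one, forces independent images
  for generic matrices. The special coordinates enter through this statement.\<close>

lemma generic_indep:
 fixes p :: "'i=>'k::field_char_0 spoly"
 assumes g0: "lowz n g0" and A: "finite A" and p: "!!v. v:A ==> p v:PR n"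
 and ind: "indep_at (%v. lookup (subst (lin n g0) (p v))) A C"
 shows "generic_upper n (%g. indep_at (%v. lookup (subst (lin n g) (p v))) A C)"
proof -
let ?e = "%v m g. lookup (subst (lin n (ut g)) (p v)) m"

have conv: "indep_at (%v m. ?e v m g) A C \<longleftrightarrow> indep_at (%v. lookup (subst (lin n g) (p v))) A C"
 if "lowz n g" for g unfolding indep_at_def using subst_ut[OF that p] by simp
have "EX P:PFm n. P g0 ~= 0 & (ALL g. P g ~= 0 --> indep_at (%v m. ?e v m g) A C)"
proof (rule mat_fun.open_indep[OF A])
 show "?e v m:PFm n" if "v:A" for v m using PFp_subst[OF p[OF that]] by (simp add: PFp_def)
 show "indep_at (%v m. ?e v m g0) A C" using ind conv[OF g0] by simp
qed
then obtain P where P: "P:PFm n" "P g0 ~= 0" "!!g. P g ~= 0 ==> indep_at (%v m. ?e v m g) A C" by blast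
show ?thesis by (rule generic_upper_mono[OF generic_PFm[OF P(1,2)]]) (use P(3) conv upper_triangular_lowz in blast)
qed

text \<open>Linear substitutions preserve degrees, so this is the degree \<open>d\<close> component
  of the transform by \<open>g\<close> of the span of \<open>Z\<close>.\<close>

definition Wd :: "nat=>monom set=>nat=>(nat=>nat=>'k::field_char_0)=>'k spoly set" where
 "Wd n Z d g = subst (lin n g) ` mideal (Z Int Deg d)"

lemma subspace_mideal: "vs.subspace (mideal U)" unfolding vs.subspace_def by (auto intro: mideal_add mideal_scalar)

lemma subst_scalar_mult: "subst l (scalar c * f) = scalar c * subst l f" by (simp add: subst_mult)

lemma subspace_subst: "vs.subspace W ==> vs.subspace (subst l ` W)" unfolding vs.subspace_def
proof (intro conjI ballI allI)
assume *: "0:W & (ALL x:W. ALL y:W. x + y:W) & (ALL c. ALL x:W. scalar c * x:W)"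
thus "0:subst l ` W" by (metis image_eqI subst_zero)
show "x + y:subst l ` W" if "x:subst l ` W" "y:subst l ` W" for x y using that * by (auto simp: subst_add[symmetric])
show "scalar c * x:subst l ` W" if "x:subst l ` W" for c x using that * by (auto simp: subst_scalar_mult[symmetric])
qed

lemma subspace_Wd: "vs.subspace (Wd n Z d g)" unfolding Wd_def by (intro subspace_subst subspace_mideal)

lemma Wd_keys: "f:Wd n Z d g ==> keys f <= Mn n Int Deg d"
proof -
assume "f:Wd n Z d g"
then obtain h where h: "h:mideal (Z Int Deg d)" "f = subst (lin n g) h" by (auto simp: Wd_def)
have "homogeneous d h" using h unfolding mideal_Deg by (auto simp: mideal_def)
hence "homogeneous d f" unfolding h by (rule homogeneous_subst) simp
moreover have "f:PR n" unfolding h by (rule subst_in_poly_ring) (rule lin_in_poly_ring)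
ultimately show ?thesis by (auto simp: mideal_Deg mideal_def poly_ring_eq)
qed

lemma leads_Wd_subset: "leads (Wd n Z d g) <= Mn n Int Deg d" by (rule leads_subset) (rule Wd_keys)

lemma finite_MD [simp]: "finite (Mn n Int Deg d)" by simp

lemma finite_leads_Wd [simp]: "finite (leads (Wd n Z d g))" by (rule finite_subset[OF leads_Wd_subset]) simp

lemma family_leads_Wd:
 assumes "finite A" "!!v. v:A ==> p v:Wd n Z d g" "C <= {t..}" "indep_at (%v. lookup (p v)) A C"
 shows "card A <= card (leads (Wd n Z d g) Int {t..})" by (rule family_leads_ge[OF subspace_Wd finite_MD _ assms]) (rule Wd_keys)

lemma generic_leads_ge:
 fixes p :: "'i=>'k::field_char_0 spoly"
 assumes g0: "lowz n g0" and A: "finite A" and p: "!!v. v:A ==> p v:mideal (Z Int Deg d)"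
 and Z: "Z <= Mn n" and C: "C <= {t..}"
 and ind: "indep_at (%v. lookup (subst (lin n g0) (p v))) A C"
 shows "generic_upper n (%g :: nat=>nat=>'k. card A <= card (leads (Wd n Z d g) Int {t..}))"
proof (rule generic_upper_mono[OF generic_indep[OF g0 A _ ind]])
show "p v:PR n" if "v:A" for v using p[OF that] Z by (auto simp: mideal_def poly_ring_eq)
fix g assume "indep_at (%v. lookup (subst (lin n g) (p v))) A C"
thus "card A <= card (leads (Wd n Z d g) Int {t..})" by (intro family_leads_Wd[OF A _ C]) (use p in "auto simp: Wd_def")
qed

lemma indep_at_leads:
 fixes f :: "monom=>'k::field_char_0 spoly"
 assumes "finite A" "A <= C" "!!v. v:A ==> f v ~= 0 & lead (f v) = v"
 shows "indep_at (%v. lookup (f v)) A C" unfolding indep_at_def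
proof (intro allI impI ballI, rule ccontr)
fix c v assume c: "ALL m:C. (SUM i:A. c i * lookup (f i) m) = 0" and v: "v:A" "c v ~= 0"
define w where "w = Max {v:A. c v ~= 0}"
have w: "w:A" "c w ~= 0" using Max_in[of "{v:A. c v ~= 0}"] assms(1) v by (auto simp: w_def)
have "c i * lookup (f i) w = 0" if i: "i:A" "i ~= w" for i
proof (cases "c i = 0")
 case False
 hence "i <= w" unfolding w_def using assms(1) i by (intro Max_ge) auto
 thus ?thesis using i assms(3)[OF i(1)] lookup_gt_lead[of "f i" w] by auto
qed simp
hence "(SUM i:A. c i * lookup (f i) w) = c w * lookup (f w) w" using w assms(1) by (subst sum.mono_neutral_right[of A "{w}"]) auto
moreover have "lookup (f w) w ~= 0" using lookup_lead_nonzero[of "f w"] assms(3)[OF w(1)] by simp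
ultimately show False using c w assms(2) by force
qed

lemma leads_choice:
 obtains f where "!!t. t:leads W ==> f t:W & f t ~= 0 & lead (f t) = t"
proof -
have "EX f. ALL t:leads W. f t:W & f t ~= 0 & lead (f t) = t" by (rule bchoice) (auto simp: leads_def)
thus ?thesis using that by blast
qed

text \<open>Lower semicontinuity: polynomials whose images at \<open>g0\<close> have distinct
  leading monomials from \<open>t\<close> on are independent modulo the monomials below
  \<open>t\<close>, and they stay so generically.\<close>

lemma generic_leads_card:
 fixes g0 :: "nat=>nat=>'k::field_char_0"
 assumes g0: "lowz n g0" and Z: "Z <= Mn n"
 shows "generic_upper n (%g :: nat=>nat=>'k. card (leads (Wd n Z d g0) Int {t..}) <= card (leads (Wd n Z d g) Int {t..}))"
proof -
let ?A = "leads (Wd n Z d g0) Int {t..}"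
obtain f where f: "!!t. t:leads (Wd n Z d g0) ==> f t:Wd n Z d g0 & f t ~= 0 & lead (f t) = t" by (rule leads_choice) blast
have "ALL t:leads (Wd n Z d g0). EX h. h:mideal (Z Int Deg d) & f t = subst (lin n g0) h" using f unfolding Wd_def by blast
then obtain p where p: "!!t. t:leads (Wd n Z d g0) ==> p t:mideal (Z Int Deg d) & f t = subst (lin n g0) (p t)" by metis
have "indep_at (%v. lookup (subst (lin n g0) (p v))) ?A {t..}" by (rule indep_at_leads) (use f p in force)+
thus ?thesis using generic_leads_ge[OF g0, of ?A p Z d "{t..}" t] p Z by auto
qed

lemma card_atLeast_determines:
 fixes S S' :: "'a::linorder set"
 assumes "finite S" "finite S'" "S <= D" "S' <= D" "!!t. t:D ==> card (S Int {t..}) = card (S' Int {t..})"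
 shows "S = S'"
proof (rule ccontr)
assume "S ~= S'"
define E where "E = (S - S') Un (S' - S)"
define t where "t = Max E"
have E: "finite E" "E ~= {}" using assms \<open>S ~= S'\<close> by (auto simp: E_def)
hence t: "t:E" unfolding t_def by (rule Max_in)
have gt: "x:S \<longleftrightarrow> x:S'" if "t < x" for x
proof (rule ccontr)
 assume "~ ?thesis"
 hence "x:E" by (auto simp: E_def)
 hence "x <= t" unfolding t_def using E by simp
 thus False using that by simp
qed
have split: "card (T Int {t..}) = card (T Int {t<..}) + (if t:T then 1 else 0)" if "finite T" for T
proof -
 have "T Int {t..} = (if t:T then insert t (T Int {t<..}) else T Int {t<..})" by (auto simp: order.order_iff_strict)
 thus ?thesis using that by auto
qed
have "S Int {t<..} = S' Int {t<..}" using gt by auto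
moreover have "t:D" using t assms by (auto simp: E_def)
ultimately have "t:S \<longleftrightarrow> t:S'"
 using assms(5)[of t] split[OF assms(1)] split[OF assms(2)] by (auto split: if_splits)
thus False using t by (auto simp: E_def)
qed

text \<open>For each threshold \<open>t\<close> the counts are bounded, so some matrix attains the
  maximum. By semicontinuity generic matrices attain all these finitely many maxima at once, and the
  counts for all thresholds determine the set of leading monomials.\<close>

lemma ex_generic_leads:
 assumes Z: "Z <= Mn n"
 shows "EX L. generic_upper n (%g :: nat=>nat=>'k::field_char_0. leads (Wd n Z d g) = L) &
 (ALL (g :: nat=>nat=>'k) t. upper_triangular n g --> t:Mn n Int Deg d -->
   card (leads (Wd n Z d g) Int {t..}) <= card (L Int {t..}))"
proof -
let ?D = "Mn n Int Deg d"
let ?c = "%(g :: nat=>nat=>'k) t. card (leads (Wd n Z d g) Int {t..})"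
have bound: "?c g t <= card ?D" for g t using leads_Wd_subset[of n Z d g] by (intro card_mono) auto
obtain gi :: "nat=>nat=>'k" where gi: "upper_triangular n gi"
 using generic_upper_ex[OF generic_upper_all, of n "%_. True"] by auto
have "EX g. upper_triangular n g & (ALL g'. upper_triangular n g' --> ?c g' t <= ?c g t)" for t
 using ex_has_greatest_nat[of "upper_triangular n" gi "%g. ?c g t" "Suc (card ?D)"] gi bound by (metis less_Suc_eq_le)
then obtain gt where gt: "!!t. upper_triangular n (gt t)" "!!t g'. upper_triangular n g' ==> ?c g' t <= ?c (gt t) t" by metis
have "generic_upper n (%g. ALL t:?D. ?c (gt t) t <= ?c g t)"
 by (intro generic_upper_finite generic_leads_card Z upper_triangular_lowz gt) simp
hence gen: "generic_upper n (%g. ALL t:?D. ?c g t = ?c (gt t) t)" by (rule generic_upper_mono) (use gt le_antisym in blast)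
then obtain gs where gs: "upper_triangular n gs" "ALL t:?D. ?c gs t = ?c (gt t) t" using generic_upper_ex by blast
show ?thesis
proof (intro exI[of _ "leads (Wd n Z d gs)"] conjI allI impI)
 show "generic_upper n (%g :: nat=>nat=>'k. leads (Wd n Z d g) = leads (Wd n Z d gs))"
 proof (rule generic_upper_mono[OF gen])
  fix g :: "nat=>nat=>'k" assume "ALL t:?D. ?c g t = ?c (gt t) t"
  thus "leads (Wd n Z d g) = leads (Wd n Z d gs)"
   by (intro card_atLeast_determines[OF finite_leads_Wd finite_leads_Wd leads_Wd_subset leads_Wd_subset]) (use gs in simp)
 qed
 show "?c g t <= ?c gs t" if "upper_triangular n g" "t:?D" for g t using gt(2)[OF that(1)] gs that by auto
qed
qed

text \<open>The generic leading monomials in degree \<open>d\<close>; the type token records the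
  field. The maximality clause is kept beside genericity because strong stability is proved by
  confronting it with one particular matrix.\<close>

definition glead :: "'k::field_char_0 itself=>nat=>monom set=>nat=>monom set" where
 "glead k n Z d = (SOME L. generic_upper n (%g :: nat=>nat=>'k. leads (Wd n Z d g) = L) &
 (ALL (g :: nat=>nat=>'k) t. upper_triangular n g --> t:Mn n Int Deg d -->
   card (leads (Wd n Z d g) Int {t..}) <= card (L Int {t..})))"

lemma glead_generic: "Z <= Mn n ==>
 generic_upper n (%g :: nat=>nat=>'k::field_char_0. leads (Wd n Z d g) = glead TYPE('k) n Z d)"
using someI_ex[OF ex_generic_leads[where 'k = 'k, of Z n d]] unfolding glead_def by blast

lemma glead_max: "Z <= Mn n ==> upper_triangular n (g :: nat=>nat=>'k::field_char_0) ==> t:Mn n Int Deg d ==>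
 card (leads (Wd n Z d g) Int {t..}) <= card (glead TYPE('k) n Z d Int {t..})"
using someI_ex[OF ex_generic_leads[where 'k = 'k, of Z n d]] unfolding glead_def by blast

section \<open>Upper triangular substitutions\<close>

text \<open>\<open>F\<close> is \<open>c\<close> times the monomial \<open>a\<close> plus lex larger
  monomials. An upper triangular substitution replaces a variable by a multiple of itself plus
  larger variables, so it acts on monomials in this way.\<close>

definition tri :: "'k::field_char_0 spoly=>monom=>'k=>bool" where
 "tri F a c \<longleftrightarrow> keys F <= {a..} & lookup F a = c"

lemma tri_mult: "tri F a c ==> tri G b d ==> tri (F * G) (a + b) (c * d)"
proof -
assume F: "tri F a c" and G: "tri G b d"
define F' where "F' = F - scalar c * mon a"
have "a ~: keys F'" using F by (simp add: F'_def tri_def in_keys_iff lookup_minus)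
moreover have "keys F' <= keys F Un {a}"
 unfolding F'_def using keys_diff[of F "scalar c * mon a"] by (auto simp: keys_scalar_mult split: if_splits)
ultimately have F': "keys F' <= {a<..}" using F by (auto simp: tri_def subset_iff order.order_iff_strict)
have "keys (F' * G) <= {a + b<..}" using keys_mult[of F' G] F' G by (fastforce simp: tri_def intro: add_less_le_mono)
hence k1: "keys (F' * G) <= {a + b..}" and k2: "lookup (F' * G) (a + b) = 0"
 by (auto simp: subset_iff in_keys_iff dest: order.strict_implies_order)
have k3: "keys (scalar c * (mon a * G)) <= {a + b..}" using G by (auto simp: keys_scalar_mult keys_mon_mult tri_def)
have eq: "F * G = scalar c * (mon a * G) + F' * G" by (simp add: F'_def algebra_simps)
have "keys (F * G) <= {a + b..}" unfolding eq using Poly_Mapping.keys_add[of "scalar c * (mon a * G)" "F' * G"] k1 k3 by blast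
moreover have "lookup (F * G) (a + b) = c * d" unfolding eq using G k2 by (simp add: lookup_add lookup_mon_mult tri_def)
ultimately show ?thesis by (simp add: tri_def)
qed

lemma single_le_single: "i <= j ==> sgl j (1::nat) <= (sgl i 1 :: monom)"
by (cases "i = j") (auto simp: order.order_iff_strict lex_greater_iff[symmetric] lex_greater_def
  lookup_single when_def intro!: exI[of _ i])

lemma tri_lin: "lowz n g ==> j < n ==> tri (lin n g j) (sgl j 1) (g j j)"
proof -
assume g: "lowz n g" and j: "j < n"
have k: "keys (scalar (g i j) * X i) <= {sgl j (1::nat)..}" if "i < n" for i
 using g that single_le_single[of i j] by (cases "i <= j") (auto simp: keys_scalar_mult X_def lowz_def)
have "keys (lin n g j) <= {sgl j 1..}" unfolding lin_def by (rule keys_sum_subset) (use k in auto)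
moreover have "lookup (lin n g j) (sgl j 1) = (\<Sum>i<n. if i = j then g i j else 0)" unfolding lin_def lookup_sum
 by (intro sum.cong) (auto simp: X_def lookup_mon inj_eq[OF inj_single] dest: arg_cong[of _ _ keys])
ultimately show ?thesis using j by (simp add: tri_def)
qed

lemma tri_evm: "lowz n g ==> m:Mn n ==> tri (evm (lin n g) m) m (evm (%j. g j j) m)"
proof (induction m rule: monom_induct)
case zero
thus ?case by (auto simp: tri_def)
next
case (add m j)
hence "j < n" "m:Mn n" by (auto simp: Mon_def keys_add_nat)
hence "tri (evm (lin n g) m * lin n g j) (m + sgl j 1) (evm (%j. g j j) m * g j j)" using add by (intro tri_mult tri_lin) auto
thus ?case by (simp add: evm_add)
qed

text \<open>The lex smallest monomial of \<open>f\<close> receives contributions from itself alone,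
  with a product of diagonal entries as factor.\<close>

lemma subst_nonzero:
 assumes g: "upper_triangular n g" and f: "f:PR n" "f ~= 0"
 shows "subst (lin n g) f ~= 0"
proof -
define m0 where "m0 = Min (keys f)"
have m0: "m0:keys f" unfolding m0_def using f by (intro Min_in) auto
have le: "m0 <= m" if "m:keys f" for m unfolding m0_def using that by simp
have t: "tri (evm (lin n g) m) m (evm (%j. g j j) m)" if "m:keys f" for m
 by (rule tri_evm) (use upper_triangular_lowz[OF g] f that in "auto simp: poly_ring_def Mon_def")
have z: "lookup f m * lookup (evm (lin n g) m) m0 = 0" if "m:keys f" "m ~= m0" for m
 using t[OF that(1)] le[OF that(1)] that(2) by (force simp: tri_def in_keys_iff)
have "lookup (subst (lin n g) f) m0 = (SUM m:keys f. lookup f m * lookup (evm (lin n g) m) m0)"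
 by (simp add: subst_expand[of "keys f"] lookup_sum)
also have "... = lookup f m0 * lookup (evm (lin n g) m0) m0" using m0 z by (subst sum.mono_neutral_right[of "keys f" "{m0}"]) auto
also have "lookup (evm (lin n g) m0) m0 = evm (%j. g j j) m0" using t[OF m0] by (simp add: tri_def)
also have "lookup f m0 * evm (%j. g j j) m0 ~= 0"
proof -
 have "keys m0 <= {..<n}" using f m0 by (auto simp: poly_ring_def)
 hence "evm (%j. g j j) m0 ~= 0" using g by (auto simp: evm_def upper_triangular_def)
 thus ?thesis using m0 by (simp add: in_keys_iff)
qed
finally show ?thesis by auto
qed

lemma card_leads_Wd:
 fixes g :: "nat=>nat=>'k::field_char_0"
 assumes g: "upper_triangular n g" and Z: "Z <= Mn n"
 shows "card (leads (Wd n Z d g)) = card (Z Int Deg d)"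
proof -
have fin: "finite (Z Int Deg d)" by (rule finite_subset[of _ "Mn n Int Deg d"]) (use Z in auto)
let ?p = "%m. subst (lin n g) (mon m)"
have ind: "ALL v:Z Int Deg d. c v = 0" if "(SUM v:Z Int Deg d. scalar (c v) * ?p v) = 0" for c
proof -
 let ?f = "SUM v:Z Int Deg d. scalar (c v) * mon v"
 have "subst (lin n g) ?f = 0" using that by (simp add: subst_sum subst_scalar_mult)
 moreover have "?f:PR n" using Z by (intro poly_ring_sum poly_ring_mult) auto
 ultimately have f0: "?f = 0" using subst_nonzero[OF g] by blast
 have "c v = lookup ?f v" if "v:Z Int Deg d" for v using that fin by (simp add: lookup_sum lookup_mon if_distrib cong: if_cong)
 thus ?thesis using f0 by simp
qed
note fam = independent_family[OF fin, of ?p, OF ind]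
have "Wd n Z d g <= vs.span (?p ` (Z Int Deg d))"
proof
 fix f assume "f:Wd n Z d g"
 then obtain h where h: "keys h <= Z Int Deg d" "f = subst (lin n g) h" by (auto simp: Wd_def mideal_def)
 have "f = (SUM m:keys h. scalar (lookup h m) * ?p m)" unfolding h by (simp add: subst_expand[of "keys h"] subst_mon)
 thus "f:vs.span (?p ` (Z Int Deg d))" using h(1) by (auto intro!: vs.span_sum vs.span_scale intro: vs.span_base)
qed
hence "card (leads (Wd n Z d g)) <= card (?p ` (Z Int Deg d))" by (rule card_leads_le) (use fin in auto)
moreover have "card (?p ` (Z Int Deg d)) <= card (leads (Wd n Z d g))"
 by (rule card_leads_ge[OF subspace_Wd finite_MD Wd_keys _ fam(2)]) (auto simp: Wd_def)
ultimately show ?thesis using card_image[OF fam(1)] by simp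
qed

lemma glead_subset: "Z <= Mn n ==> glead TYPE('k::field_char_0) n Z d <= Mn n Int Deg d"
using generic_upper_ex[OF glead_generic[where 'k = 'k, of Z n d]] leads_Wd_subset by metis

lemma card_glead: "Z <= Mn n ==> card (glead TYPE('k::field_char_0) n Z d) = card (Z Int Deg d)"
using generic_upper_ex[OF glead_generic[where 'k = 'k, of Z n d]] card_leads_Wd by metis

text \<open>Back substitution in the triangular system, one variable after the other; this yields
  preimages without forming the inverse matrix.\<close>

lemma X_in_subst_image:
 assumes g: "upper_triangular n g" and "i < n"
 shows "EX f:PR n. subst (lin n g) f = X i" using \<open>i < n\<close>
proof (induction i rule: less_induct)
case (less i)
hence "EX f. ALL l<i. f l:PR n & subst (lin n g) (f l) = X l" by (metis order.strict_trans)
then obtain f where f: "!!l. l < i ==> f l:PR n & subst (lin n g) (f l) = X l" by blast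
let ?h = "scalar (inverse (g i i)) * (X i - (\<Sum>l<i. scalar (g l i) * f l))"
have gii: "g i i ~= 0" using g less by (simp add: upper_triangular_def)
have "lin n g i = (\<Sum>l<Suc i. scalar (g l i) * X l)" unfolding lin_def using g less(2)
 by (intro sum.mono_neutral_right) (auto simp: upper_triangular_def)
hence l: "lin n g i = (\<Sum>l<i. scalar (g l i) * X l) + scalar (g i i) * X i" by simp
have "subst (lin n g) ?h = scalar (inverse (g i i)) * (scalar (g i i) * X i)"
 using f by (simp add: subst_scalar_mult subst_diff subst_sum l)
also have "... = X i" using gii by (simp add: mult.assoc[symmetric] scalar_mult[symmetric])
finally have "subst (lin n g) ?h = X i" .
moreover have "?h:PR n" using f less(2) by (intro poly_ring_mult poly_ring_diff poly_ring_sum) (auto simp: X_in_poly_ring)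
ultimately show ?case by blast
qed

lemma mon_in_subst_image:
 assumes g: "upper_triangular n g" and "m:Mn n"
 shows "EX f:PR n. subst (lin n g) f = mon m" using assms(2)
proof (induction m rule: monom_induct)
case zero
show ?case by (rule bexI[of _ 1]) auto
next
case (add m i)
hence "i < n" "m:Mn n" by (auto simp: Mon_def keys_add_nat)
then obtain f h where "f:PR n" "subst (lin n g) f = mon m" "h:PR n" "subst (lin n g) h = X i"
 using add X_in_subst_image[OF g] by blast
thus ?case by (intro bexI[of _ "f * h"]) (auto simp: subst_mult mon_add X_def intro: poly_ring_mult)
qed

lemma pr_Deg_subst:
 assumes "!!j. homogeneous (Suc 0) (l j)"
 shows "pr (Deg d) (subst l f) = subst l (pr (Deg d) f)"
proof (rule poly_mapping_eqI)
fix m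
have dec: "lookup (subst l f) m = (SUM k:keys f. lookup f k * lookup (evm l k) m)"
 by (simp add: subst_expand[of "keys f"] lookup_sum)
have dec': "lookup (subst l (pr (Deg d) f)) m = (SUM k:keys f. lookup (pr (Deg d) f) k * lookup (evm l k) m)"
 by (subst subst_expand[of "keys f"]) (auto simp: keys_pr lookup_sum)
have hom: "lookup (evm l k) m = 0" if "mdeg k ~= mdeg m" for k
 using homogeneous_evm[of k l] assms that unfolding homogeneous_def by (metis in_keys_iff)
have "lookup (pr (Deg d) f) k * lookup (evm l k) m = (if mdeg m = d then lookup f k * lookup (evm l k) m else 0)" for k
 using hom[of k] by (auto simp: lookup_pr)
thus "lookup (pr (Deg d) (subst l f)) m = lookup (subst l (pr (Deg d) f)) m" by (simp add: lookup_pr dec dec')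
qed

lemma Wd_mult_mon:
 assumes g: "upper_triangular n g" and Z: "upclosed {..<n} Z"
 and f: "f:Wd n Z d g" and c: "c:Mn n"
 shows "mon c * f:Wd n Z (d + mdeg c) g"
proof -
obtain h where h: "h:mideal (Z Int Deg d)" "f = subst (lin n g) h" using f by (auto simp: Wd_def)
obtain q where q: "q:PR n" "subst (lin n g) q = mon c" using mon_in_subst_image[OF g c] by blast
\<comment> \<open>\<open>Wd\<close> consists of images of homogeneous polynomials, so only the
  component of the right degree is kept.\<close>
define q' where "q' = pr (Deg (mdeg c)) q"
have q': "subst (lin n g) q' = mon c" unfolding q'_def using pr_Deg_subst[of "lin n g" "mdeg c" q] by (simp add: q pr_id)
have "q':mideal (Mn n Int Deg (mdeg c))" using q by (auto simp: q'_def mideal_def keys_pr poly_ring_eq)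
hence "q' * h:mideal (Z Int Deg (d + mdeg c))" using h(1)
proof (rule mideal_mult)
 fix a b assume "a:Mn n Int Deg (mdeg c)" "b:Z Int Deg d"
 thus "a + b:Z Int Deg (d + mdeg c)" using upclosedD[OF Z, of b a] by (simp add: add.commute)
qed
moreover have "subst (lin n g) (q' * h) = mon c * f" by (simp add: subst_mult q' h)
ultimately show ?thesis unfolding Wd_def by (metis image_eqI)
qed

lemma glead_upclosed:
 assumes Z: "upclosed {..<n} Z" and "a:glead TYPE('k::field_char_0) n Z d" "c:Mn n"
 shows "a + c:glead TYPE('k) n Z (d + mdeg c)"
proof -
have ZM: "Z <= Mn n" using Z by (simp add: upclosed_def)
obtain g :: "nat=>nat=>'k" where g: "upper_triangular n g" "leads (Wd n Z d g) = glead TYPE('k) n Z d"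
  "leads (Wd n Z (d + mdeg c) g) = glead TYPE('k) n Z (d + mdeg c)"
 using generic_upper_ex[OF generic_upper_conj[OF glead_generic[OF ZM] glead_generic[OF ZM]]] by blast
then obtain f where f: "f:Wd n Z d g" "f ~= 0" "lead f = a" using assms(2) unfolding g(2)[symmetric] leads_def by auto
have "mon c * f:Wd n Z (d + mdeg c) g" by (rule Wd_mult_mon[OF g(1) Z f(1) assms(3)])
moreover have "mon c * f ~= 0" "lead (mon c * f) = c + a" using f lead_mon_mult by auto
ultimately have "c + a:leads (Wd n Z (d + mdeg c) g)" unfolding leads_def by (metis DiffI image_eqI singletonD)
thus ?thesis using g by (simp add: add.commute)
qed

section \<open>Restriction of monomials and finite generation\<close>

text \<open>Sets the variables outside \<open>V\<close> to 1.\<close>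

definition mres :: "nat set=>monom=>monom" where "mres V m = (SUM i:keys m Int V. sgl i (lookup m i))"

lemma lookup_mres: "lookup (mres V m) i = (if i:V then lookup m i else 0)"
proof -
have "lookup (mres V m) i = (SUM k:keys m Int V. if k = i then lookup m k else 0)"
 by (simp add: mres_def lookup_sum lookup_single when_def)
also have "... = (if i:V then lookup m i else 0)" by (auto simp: sum.delta in_keys_iff)
finally show ?thesis .
qed

lemma keys_mres: "keys (mres V m) = keys m Int V" by (auto simp: in_keys_iff lookup_mres split: if_splits)

lemma mres_id: "m:Mon V ==> mres V m = m" by (rule poly_mapping_eqI) (auto simp: lookup_mres Mon_def in_keys_iff)

lemma mres_add: "mres V (a + b) = mres V a + mres V b" by (rule poly_mapping_eqI) (simp add: lookup_mres lookup_add)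

lemma mres_mres: "mres V (mres V' m) = mres (V Int V') m" by (rule poly_mapping_eqI) (auto simp: lookup_mres)

lemma mres_zero_iff: "mres V m = 0 \<longleftrightarrow> keys m Int V = {}" by (metis keys_mres keys_eq_empty)

lemma mres_split: "mres V m + mres (- V) m = m" by (rule poly_mapping_eqI) (simp add: lookup_mres lookup_add)

lemma mres_in_Mon [simp]: "mres V m:Mon V" by (simp add: Mon_def keys_mres)

text \<open>Dickson's lemma by induction on the number of variables: finitely many representatives
  modulo the last variable serve every monomial with a large last exponent, and each smaller value
  of that exponent is a case with one variable less.\<close>

lemma dickson_finite:
 assumes "A <= Mn n"
 shows "\<exists>B\<subseteq>A. finite B & (ALL a:A. EX b:B. ALL i. lookup b i <= lookup a i)" using assms
proof (induction n arbitrary: A)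
case 0
hence "A <= {0}" by (auto simp: Mon_def)
thus ?case by (intro exI[of _ A]) (auto intro: finite_subset)
next
case (Suc n)
let ?r = "mres {..<n}"
have r: "?r ` S <= Mn n" for S by auto
obtain B where B: "B <= ?r ` A" "finite B" "!!a. a:?r ` A ==> EX b:B. ALL i. lookup b i <= lookup a i"
 using Suc.IH[OF r, of A] by blast
obtain B' where B': "B' <= A" "finite B'" "B = ?r ` B'" using finite_subset_image[OF B(2,1)] by blast
define K where "K = Max (insert 0 ((%b. lookup b n) ` B'))"
have K: "lookup b n <= K" if "b:B'" for b unfolding K_def using that B'(2) by (intro Max_ge) auto
have "\<exists>C\<subseteq>{a:A. lookup a n = k}. finite C & (ALL a:A. lookup a n = k --> (EX b:C. ALL i. lookup (?r b) i <= lookup (?r a) i))" for k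
proof -
 obtain D where D: "D <= ?r ` {a:A. lookup a n = k}" "finite D"
  "!!a. a:?r ` {a:A. lookup a n = k} ==> EX b:D. ALL i. lookup b i <= lookup a i"
  using Suc.IH[OF r, of "{a:A. lookup a n = k}"] by blast
 obtain C where "C <= {a:A. lookup a n = k}" "finite C" "D = ?r ` C" using finite_subset_image[OF D(2,1)] by blast
 thus ?thesis using D(3) by (intro exI[of _ C]) blast
qed
hence "EX C. ALL k. C k <= {a:A. lookup a n = k} & finite (C k) &
  (ALL a:A. lookup a n = k --> (EX b:C k. ALL i. lookup (?r b) i <= lookup (?r a) i))" by (intro choice allI)
then obtain C where CC: "ALL k. C k <= {a:A. lookup a n = k} & finite (C k) &
  (ALL a:A. lookup a n = k --> (EX b:C k. ALL i. lookup (?r b) i <= lookup (?r a) i))" by (rule exE)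
have C: "C k <= {a:A. lookup a n = k}" "finite (C k)"
 "a:A ==> lookup a n = k ==> EX b:C k. ALL i. lookup (?r b) i <= lookup (?r a) i" for a k using CC[rule_format, of k] by simp_all
have CA: "b:A" "lookup b n = k" if "b:C k" for b k using C(1)[of k] that by auto
have le: "ALL i. lookup b i <= lookup a i"
 if ab: "a:A" "b:A" and lt: "ALL i. lookup (?r b) i <= lookup (?r a) i" and n: "lookup b n <= lookup a n" for a b
proof
 fix i
 have "keys b <= {..<Suc n}" using ab Suc.prems by (auto simp: Mon_def)
 hence "i < n \<or> i = n \<or> lookup b i = 0" by (metis in_keys_iff lessThan_iff less_Suc_eq subsetD)
 thus "lookup b i <= lookup a i" using lt[rule_format, of i] n by (auto simp: lookup_mres)
qed
show ?case
proof (intro exI[of _ "B' Un (\<Union>k<K. C k)"] conjI ballI)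
 show "B' Un (\<Union>k<K. C k) <= A" using B'(1) CA(1) by auto
 show "finite (B' Un (\<Union>k<K. C k))" using B' C by auto
 fix a assume a: "a:A"
 show "EX b:B' Un (\<Union>k<K. C k). ALL i. lookup b i <= lookup a i"
 proof (cases "lookup a n < K")
  case True
  obtain b where b: "b:C (lookup a n)" "ALL i. lookup (?r b) i <= lookup (?r a) i" using C(3)[OF a] by blast
  have "ALL i. lookup b i <= lookup a i" by (rule le[OF a CA(1)[OF b(1)] b(2)]) (simp add: CA(2)[OF b(1)])
  thus ?thesis using b(1) True by (intro bexI[of _ b]) auto
 next
  case False
  obtain b where b: "b:B'" "ALL i. lookup (?r b) i <= lookup (?r a) i" using B(3) a B'(3) by blast
  have "b:A" using b(1) B'(1) by auto
  moreover have "lookup b n <= lookup a n" using K[OF b(1)] False by simp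
  ultimately have "ALL i. lookup b i <= lookup a i" by (intro le[OF a _ b(2)])
  thus ?thesis using b(1) by (intro bexI[of _ b]) auto
 qed
qed
qed

lemma upclosed_degree_bound:
 assumes "upclosed {..<n} U"
 obtains D where "!!m. m:U ==> EX a c. m = a + c & a:U & mdeg a <= D & c:Mn n"
proof -
have U: "U <= Mn n" using assms by (simp add: upclosed_def)
obtain B where B: "B <= U" "finite B" "ALL a:U. EX b:B. ALL i. lookup b i <= lookup a i" using dickson_finite[OF U] by blast
show ?thesis
proof (rule that[of "Max (insert 0 (mdeg ` B))"])
 fix m assume m: "m:U"
 then obtain b c where b: "b:B" "m = b + c" using B(3) unfolding mdvd_iff by blast
 moreover have "c:Mn n" using m U b by auto
 moreover have "mdeg b <= Max (insert 0 (mdeg ` B))" using b B(2) by (intro Max_ge) auto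
 ultimately show "EX a c. m = a + c & a:U & mdeg a <= Max (insert 0 (mdeg ` B)) & c:Mn n" using B(1) by blast
qed
qed

section \<open>The generic initial ideal of a monomial ideal\<close>

definition GL :: "'k::field_char_0 itself=>nat=>monom set=>monom set" where "GL k n Z = (\<Union>d. glead k n Z d)"

lemma GL_Deg: "Z <= Mn n ==> GL TYPE('k::field_char_0) n Z Int Deg d = glead TYPE('k) n Z d"
using glead_subset[where 'k = 'k, of Z n] unfolding GL_def by fastforce

lemma GL_iff: "Z <= Mn n ==> a:GL TYPE('k::field_char_0) n Z \<longleftrightarrow> a:glead TYPE('k) n Z (mdeg a)"
by (simp only: GL_Deg[symmetric] Int_iff Deg_iff simp_thms)

lemma GL_subset: "Z <= Mn n ==> GL TYPE('k::field_char_0) n Z <= Mn n"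
using glead_subset[where 'k = 'k, of Z n] unfolding GL_def by fastforce

lemma GL_upclosed:
 assumes "upclosed {..<n} Z" shows "upclosed {..<n} (GL TYPE('k::field_char_0) n Z)" unfolding upclosed_def
proof (intro conjI ballI)
show "GL TYPE('k) n Z <= Mn n" using assms by (intro GL_subset) (simp add: upclosed_def)
show "a + c:GL TYPE('k) n Z" if "a:GL TYPE('k) n Z" "c:Mn n" for a c
 using that glead_upclosed[OF assms, where 'k = 'k] unfolding GL_def by blast
qed

lemma lead_upclosed_Wd:
 assumes "upper_triangular n g" "upclosed {..<n} Z" "a:leads (Wd n Z e g)" "c:Mn n"
 shows "a + c:leads (Wd n Z (e + mdeg c) g)"
proof -
obtain f where f: "f:Wd n Z e g" "f ~= 0" "lead f = a" using assms(3) by (auto simp: leads_def)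
have "mon c * f:Wd n Z (e + mdeg c) g" by (rule Wd_mult_mon[OF assms(1,2) f(1) assms(4)])
moreover have "mon c * f ~= 0" "lead (mon c * f) = a + c" using f lead_mon_mult by (auto simp: add.commute)
ultimately show ?thesis unfolding leads_def by (metis DiffI image_eqI singletonD)
qed

text \<open>Infinitely many generic conditions cannot simply be intersected. Agreement up to the
  degree \<open>D\<close> of the generators of \<open>GL\<close> already gives one inclusion in
  every degree, and equal dimensions give equality.\<close>

lemma generic_all_degrees:
 assumes Z: "upclosed {..<n} Z"
 shows "generic_upper n (%g :: nat=>nat=>'k::field_char_0. ALL d. leads (Wd n Z d g) = glead TYPE('k) n Z d)"
proof -
have ZM: "Z <= Mn n" using Z by (simp add: upclosed_def)
obtain D where D: "!!m. m:GL TYPE('k) n Z ==>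
  EX a c. m = a + c & a:GL TYPE('k) n Z & mdeg a <= D & c:Mn n" using upclosed_degree_bound[OF GL_upclosed[OF Z]] by blast
have "generic_upper n (%g :: nat=>nat=>'k. ALL d:{..D}. leads (Wd n Z d g) = glead TYPE('k) n Z d)"
 by (intro generic_upper_finite glead_generic ZM) simp
thus ?thesis
proof (rule generic_upper_mono, intro allI)
 fix g :: "nat=>nat=>'k" and d
 assume g: "upper_triangular n g" and L: "ALL d:{..D}. leads (Wd n Z d g) = glead TYPE('k) n Z d"
 have "glead TYPE('k) n Z d <= leads (Wd n Z d g)"
 proof
  fix m assume m: "m:glead TYPE('k) n Z d"
  hence md: "mdeg m = d" using glead_subset[OF ZM] by fastforce
  obtain a c where ac: "m = a + c" "a:GL TYPE('k) n Z" "mdeg a <= D" "c:Mn n" using D[of m] m unfolding GL_def by blast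
  have "a:GL TYPE('k) n Z Int Deg (mdeg a)" using ac(2) by simp
  hence "a:glead TYPE('k) n Z (mdeg a)" by (simp only: GL_Deg[OF ZM])
  hence "a:leads (Wd n Z (mdeg a) g)" using L[rule_format, of "mdeg a"] ac(3) by simp
  from lead_upclosed_Wd[OF g Z this ac(4)] show "m:leads (Wd n Z d g)" using ac md by simp
 qed
 moreover have "card (leads (Wd n Z d g)) = card (glead TYPE('k) n Z d)" using card_leads_Wd[OF g ZM] card_glead[OF ZM] by metis
 ultimately show "leads (Wd n Z d g) = glead TYPE('k) n Z d" by (intro card_subset_eq[symmetric]) auto
qed
qed

lemma in_mon_eq:
 assumes f: "f ~= 0" and d: "EX m:keys f. mdeg m = d" "!!m. m:keys f ==> d <= mdeg m"
 shows "in_mon f = lead (pr (Deg d) f)" unfolding in_mon_def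
proof (rule the_equality)
have ne: "pr (Deg d) f ~= 0" using d(1) by (metis keys_pr Deg_iff IntI empty_iff keys_zero)
hence l: "lead (pr (Deg d) f):keys f" "mdeg (lead (pr (Deg d) f)) = d" using lead_in_keys[OF ne] by (auto simp: keys_pr)
have gr: "term_greater (lead (pr (Deg d) f)) m'" if "m':keys f" "m' ~= lead (pr (Deg d) f)" for m'
proof (cases "mdeg m' = d")
 case True
 hence "m' <= lead (pr (Deg d) f)" using that by (intro lead_ge) (simp add: keys_pr)
 thus ?thesis using that l True by (simp add: term_greater_def lex_greater_iff)
next
 case False
 thus ?thesis using d(2)[OF that(1)] l by (simp add: term_greater_def)
qed
thus "lead (pr (Deg d) f):keys f & (ALL m':keys f. m' ~= lead (pr (Deg d) f) --> term_greater (lead (pr (Deg d) f)) m')"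
 using l by blast
fix m assume m: "m:keys f & (ALL m':keys f. m' ~= m --> term_greater m m')"
show "m = lead (pr (Deg d) f)"
proof (rule ccontr)
 assume "m ~= lead (pr (Deg d) f)"
 hence "term_greater m (lead (pr (Deg d) f))" "term_greater (lead (pr (Deg d) f)) m" using m l gr by auto
 thus False by (auto simp: term_greater_def lex_greater_iff)
qed
qed

text \<open>The component of least degree of an element of the transformed ideal lies in that ideal
  again and carries the initial monomial, so homogeneous elements already provide all initial
  monomials.\<close>

lemma initial_monomials:
 assumes g: "!!d. leads (Wd n Z d g) = L d"
 shows "{mon (in_mon f) | f. f:subst (lin n g) ` mideal Z & f ~= 0} = (mon ` (\<Union>d. L d) :: 'k::field_char_0 spoly set)"
proof (intro subset_antisym subsetI)
fix x :: "'k spoly" assume "x:{mon (in_mon f) | f. f:subst (lin n g) ` mideal Z & f ~= 0}"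
then obtain f h where h: "h:mideal Z" "f = subst (lin n g) h" "f ~= 0" "x = mon (in_mon f)" by auto
define d where "d = Min (mdeg ` keys f)"
have fin: "finite (mdeg ` keys f)" "mdeg ` keys f ~= {}" using h by auto
have d1: "EX m:keys f. mdeg m = d" using Min_in[OF fin] by (auto simp: d_def)
have d2: "d <= mdeg m" if "m:keys f" for m unfolding d_def using that by simp
have "pr (Deg d) f = subst (lin n g) (pr (Deg d) h)" unfolding h by (rule pr_Deg_subst) simp
moreover have "pr (Deg d) h:mideal (Z Int Deg d)" using h by (auto simp: mideal_def keys_pr)
ultimately have "pr (Deg d) f:Wd n Z d g" by (auto simp: Wd_def)
moreover have "pr (Deg d) f ~= 0" using d1 by (metis keys_pr Deg_iff IntI empty_iff keys_zero)
ultimately have "lead (pr (Deg d) f):L d" unfolding g[symmetric] leads_def by blast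
thus "x:mon ` (\<Union>d. L d)" using in_mon_eq[OF h(3) d1 d2] h(4) by auto
next
fix x :: "'k spoly" assume "x:mon ` (\<Union>d. L d)"
then obtain d f where f: "f:Wd n Z d g" "f ~= 0" "x = mon (lead f)" unfolding g[symmetric] leads_def by auto
have hd: "keys f <= Deg d" using Wd_keys[OF f(1)] by auto
have "in_mon f = lead (pr (Deg d) f)" by (rule in_mon_eq[OF f(2)]) (use hd lead_in_keys[OF f(2)] in force)+
hence "in_mon f = lead f" using pr_id[OF hd] by simp
moreover have "f:subst (lin n g) ` mideal Z" using f(1) by (auto simp: Wd_def mideal_def)
ultimately show "x:{mon (in_mon f) | f. f:subst (lin n g) ` mideal Z & f ~= 0}" using f(2,3) by (intro CollectI exI[of _ f]) simp
qed

lemma gin_fin_mideal: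
 assumes Z: "upclosed {..<n} Z"
 shows "gin_fin n (mideal Z) = (mideal (GL TYPE('k) n Z) :: 'k::field_char_0 spoly set)"
proof -
let ?Q = "%M (g :: nat=>nat=>'k). in_ideal n (coord_change n g ` mideal Z) = M"
have ZM: "Z <= Mn n" using Z by (simp add: upclosed_def)
have gen: "generic_upper n (?Q (mideal (GL TYPE('k) n Z)))"
proof (rule generic_upper_mono[OF generic_all_degrees[OF Z]])
 fix g :: "nat=>nat=>'k"
 assume "ALL d. leads (Wd n Z d g) = glead TYPE('k) n Z d"
 hence "in_ideal n (coord_change n g ` mideal Z) = ideal_gen (PR n) (mon ` GL TYPE('k) n Z)"
  unfolding in_ideal_def coord_change_eq GL_def by (subst initial_monomials) auto
 thus "?Q (mideal (GL TYPE('k) n Z)) g"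
  using ideal_gen_mon[OF GL_subset[OF ZM, where 'k = 'k], where 'k = 'k] mup_upclosed[OF GL_upclosed[OF Z, where 'k = 'k]] by simp
qed
show ?thesis unfolding gin_fin_def
proof (rule the_equality, rule gen)
 fix M :: "'k spoly set" assume "generic_upper n (?Q M)"
 \<comment> \<open>Two generic conditions hold at a common matrix, where both ideals are the same
   initial ideal.\<close>
 from generic_upper_ex[OF generic_upper_conj[OF gen this]] show "M = mideal (GL TYPE('k) n Z)" by blast
qed
qed

section \<open>Strong stability\<close>

text \<open>A weight that realizes lex among the monomials of degree \<open>d\<close> in
  \<open>n\<close> variables: exponents are at most \<open>d\<close>, so they are digits in base
  \<open>Suc d\<close>.\<close>

definition wt :: "nat=>nat=>monom=>nat" where "wt n d m = (\<Sum>i<n. lookup m i * Suc d ^ (n - Suc i))"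

lemma wt_less:
 assumes "v:Mn n Int Deg d" "w:Mn n Int Deg d" "v < w"
 shows "wt n d v < wt n d w"
proof -
obtain i where i: "lookup v i < lookup w i" "!!j. j < i ==> lookup w j = lookup v j"
 using assms(3) unfolding lex_greater_iff[symmetric] lex_greater_def by blast
have "i < n" using i(1) assms(2) by (cases "i < n") (auto simp: Mon_def in_keys_iff subset_iff)
have dv: "(\<Sum>j<n. lookup v j) = d" using mdeg_eq[of "{..<n}" v] assms(1) by (auto simp: Mon_def)
let ?E = "Suc d"
have split: "{..<n} = {..<i} Un {i} Un {Suc i..<n}" using \<open>i < n\<close> by auto
have sp: "wt n d m = (\<Sum>j<i. lookup m j * ?E ^ (n - Suc j)) + lookup m i * ?E ^ (n - Suc i)
  + (SUM j:{Suc i..<n}. lookup m j * ?E ^ (n - Suc j))" for m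
proof -
 have "{..<i} Int {Suc i..<n} = {}" by auto
 thus ?thesis unfolding wt_def split by (subst sum.union_disjoint; simp)+
qed
have tail: "(SUM j:{Suc i..<n}. lookup v j * ?E ^ (n - Suc j)) < ?E ^ (n - Suc i)"
proof (cases "Suc i < n")
 case True
 have "(SUM j:{Suc i..<n}. lookup v j * ?E ^ (n - Suc j)) <= (SUM j:{Suc i..<n}. lookup v j * ?E ^ (n - Suc (Suc i)))"
  by (intro sum_mono mult_left_mono power_increasing) auto
 also have "... = (SUM j:{Suc i..<n}. lookup v j) * ?E ^ (n - Suc (Suc i))" by (simp add: sum_distrib_right)
 also have "... <= d * ?E ^ (n - Suc (Suc i))" unfolding dv[symmetric] by (intro mult_right_mono sum_mono2) auto
 also have "... < ?E * ?E ^ (n - Suc (Suc i))" by simp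
 also have "... = ?E ^ (n - Suc i)" using True by (simp flip: power_Suc add: Suc_diff_Suc)
 finally show ?thesis .
qed simp
have "wt n d v < (\<Sum>j<i. lookup v j * ?E ^ (n - Suc j)) + lookup v i * ?E ^ (n - Suc i) + ?E ^ (n - Suc i)"
 unfolding sp using tail by linarith
also have "... = (\<Sum>j<i. lookup w j * ?E ^ (n - Suc j)) + Suc (lookup v i) * ?E ^ (n - Suc i)"
 using i(2) by (simp add: algebra_simps)
also have "... <= (\<Sum>j<i. lookup w j * ?E ^ (n - Suc j)) + lookup w i * ?E ^ (n - Suc i)"
 using i(1) by (intro add_left_mono mult_right_mono) auto
also have "... <= wt n d w" unfolding sp by simp
finally show ?thesis .
qed

definition mmul :: "nat=>(nat=>nat=>'k::field_char_0)=>(nat=>nat=>'k)=>nat=>nat=>'k" where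
 "mmul n A B a b = (\<Sum>l<n. A a l * B l b)"

lemma subst_lin_lin: "subst (lin n A) (lin n B b) = lin n (mmul n A B) b"
proof -
have "subst (lin n A) (lin n B b) = (\<Sum>l<n. scalar (B l b) * lin n A l)"
 unfolding lin_def[of n B] by (simp add: subst_sum subst_scalar_mult)
also have "... = (\<Sum>l<n. \<Sum>a<n. scalar (A a l * B l b) * X a)" by (simp add: lin_def sum_distrib_left scalar_mult mult_ac)
also have "... = (\<Sum>a<n. \<Sum>l<n. scalar (A a l * B l b) * X a)" by (rule sum.swap)
also have "... = lin n (mmul n A B) b" by (simp add: lin_def mmul_def scalar_sum sum_distrib_right)
finally show ?thesis .
qed

lemma subst_mmul: "subst (lin n A) (subst (lin n B) f) = subst (lin n (mmul n A B)) f" by (simp add: subst_subst subst_lin_lin)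

lemma upper_triangular_mmul:
 assumes A: "upper_triangular n A" and B: "upper_triangular n B"
 shows "upper_triangular n (mmul n A B)" unfolding upper_triangular_def
proof (intro conjI allI impI)
fix i assume i: "i < n"
have "mmul n A B i i = (SUM l:{i}. A i l * B l i)" unfolding mmul_def by (rule sum.mono_neutral_right)
  (use A B i in "auto simp: upper_triangular_def neq_iff")
thus "mmul n A B i i ~= 0" using A B i by (simp add: upper_triangular_def)
fix j assume j: "j < i"
show "mmul n A B i j = 0" unfolding mmul_def
proof (rule sum.neutral, rule ballI)
 fix l assume l: "l:{..<n}"
 show "A i l * B l j = 0" using A B i j l by (cases "l < i") (auto simp: upper_triangular_def)
qed
qed

definition elem :: "nat=>nat=>nat=>nat=>'k::field_char_0" where "elem i j a b = (if a = b \<or> (a = i & b = j) then 1 else 0)"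

lemma upper_triangular_elem: "i < j ==> upper_triangular n (elem i j)" by (auto simp: upper_triangular_def elem_def)

lemma lin_elem: "i < j ==> j < n ==> b < n ==>
 lin n (elem i j) b = (if b = j then X j + X i else X b :: 'k::field_char_0 spoly)"
proof -
assume ij: "i < j" "j < n" "b < n"
have "lin n (elem i j) b = (\<Sum>a<n. (if a = b then X a else 0) + (if a = i then (if b = j then X a else 0) else 0) :: 'k spoly)"
 unfolding lin_def by (intro sum.cong) (use ij in "auto simp: elem_def")
also have "... = X b + (if b = j then X i else 0)" using ij by (simp add: sum.distrib)
finally show ?thesis by simp
qed

text \<open>Expanding the power of \<open>X j + X i\<close> gives the binomial coefficient of
  \<open>s\<close> over \<open>s - 1\<close>, which is the exponent of \<open>j\<close>. It is a
  nonzero scalar because the characteristic is zero.\<close>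

lemma lookup_evm_elem:
 assumes ij: "i < j" "j < n" and m: "m:Mn n" "j:keys m"
 shows "lookup (evm (lin n (elem i j)) m :: 'k::field_char_0 spoly) (m - sgl j 1 + sgl i 1) = of_nat (lookup m j)"
proof -
define s where "s = lookup m j"
define r where "r = mres (- {j}) m"
have s: "s > 0" using m by (simp add: s_def in_keys_iff)
have mr: "m = r + sgl j s" by (rule poly_mapping_eqI) (auto simp: r_def s_def lookup_add lookup_mres lookup_single when_def)
have m': "m - sgl j 1 + sgl i 1 = r + (sgl j (s - 1) + sgl i 1)"
 by (rule poly_mapping_eqI) (use s ij in "auto simp: r_def s_def lookup_add lookup_minus lookup_mres lookup_single when_def")
have er: "evm (lin n (elem i j)) r = (mon r :: 'k spoly)"
proof -
 have "evm (lin n (elem i j)) r = evm (X :: nat=>'k spoly) r"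
  by (rule evm_cong) (use ij m in "auto simp: lin_elem r_def keys_mres Mon_def")
 thus ?thesis using subst_mon[of "X :: nat=>'k spoly" r] by (simp only: subst_X_id)
qed
have "evm (lin n (elem i j)) m = mon r * (X j + X i :: 'k spoly) ^ s"
 unfolding mr evm_add er evm_single using ij by (simp add: lin_elem)
also have "(X j + X i :: 'k spoly) ^ s = (\<Sum>k\<le>s. scalar (of_nat (s choose k)) * mon (sgl j k + sgl i (s - k)))"
 unfolding binomial_ring by (intro sum.cong) (auto simp: X_power mon_add scalar_def mult.assoc single_of_nat)
finally have "lookup (evm (lin n (elem i j)) m :: 'k spoly) (m - sgl j 1 + sgl i 1)
  = (\<Sum>k\<le>s. of_nat (s choose k) * (if sgl j k + sgl i (s - k) = sgl j (s - 1) + sgl i 1 then 1 else 0))"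
 unfolding m' by (simp add: lookup_mon_mult lookup_sum lookup_mon)
also have "... = (\<Sum>k\<le>s. if k = s - 1 then of_nat (s choose k) else 0)"
proof (intro sum.cong)
 fix k assume "k:{..s}"
 have "sgl j k + sgl i (s - k) = sgl j (s - 1) + sgl i 1 \<longleftrightarrow> k = s - 1"
 proof
  assume "sgl j k + sgl i (s - k) = sgl j (s - 1) + sgl i 1"
  hence "lookup (sgl j k + sgl i (s - k)) j = lookup (sgl j (s - 1) + sgl i 1) j" by simp
  thus "k = s - 1" using ij by (simp add: lookup_add lookup_single when_def)
 qed (use s in auto)
 thus "of_nat (s choose k) * (if sgl j k + sgl i (s - k) = sgl j (s - 1) + sgl i 1 then 1 else 0)
  = (if k = s - 1 then of_nat (s choose k) else (0::'k))" by simp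
qed simp
also have "... = of_nat s"
proof -
 obtain r where r: "s = Suc r" using s by (cases s) auto
 show ?thesis unfolding r by simp
qed
finally show ?thesis by (simp add: s_def)
qed

text \<open>One-parameter torus with the weights \<open>wt\<close>: after rescaling, letting the
  inverse of \<open>s\<close> specialize to 0 degenerates a homogeneous polynomial to its leading
  term.\<close>

definition torus :: "nat=>nat=>'k::field_char_0=>nat=>nat=>'k" where
 "torus n d s a b = (if a = b then s ^ (Suc d ^ (n - Suc a)) else 0)"

lemma upper_triangular_torus: "s ~= 0 ==> upper_triangular n (torus n d s)" by (auto simp: upper_triangular_def torus_def)

lemma evm_torus: "m:Mn n ==> evm (lin n (torus n d s)) m = scalar (s ^ wt n d m) * mon m"
proof (induction m rule: monom_induct)
case zero
show ?case by (simp add: wt_def)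
next
case (add m j)
hence j: "j < n" "m:Mn n" by (auto simp: Mon_def keys_add_nat)
have "lin n (torus n d s) j = (\<Sum>a<n. if a = j then scalar (s ^ (Suc d ^ (n - Suc a))) * X a else 0)"
 unfolding lin_def by (intro sum.cong) (auto simp: torus_def)
hence l: "lin n (torus n d s) j = scalar (s ^ (Suc d ^ (n - Suc j))) * X j" using j by simp
have "wt n d (m + sgl j 1) = wt n d m + wt n d (sgl j 1)" by (simp add: wt_def lookup_add algebra_simps sum.distrib)
also have "wt n d (sgl j 1) = (\<Sum>i<n. if i = j then Suc d ^ (n - Suc i) else 0)"
 unfolding wt_def by (intro sum.cong) (auto simp: lookup_single when_def)
finally have "wt n d (m + sgl j 1) = wt n d m + Suc d ^ (n - Suc j)" using j by simp
thus ?case using add.IH[OF j(2)] by (simp add: evm_add l X_def mon_add power_add scalar_mult mult_ac)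
qed

lemma monomial_move_less:
 assumes "i < j" "j:keys m"
 shows "m < m - sgl j 1 + (sgl i 1 :: monom)"
proof -
have "lex_greater (m - sgl j 1 + sgl i 1) m" unfolding lex_greater_def
 using assms by (intro exI[of _ i]) (auto simp: lookup_add lookup_minus lookup_single when_def)
thus ?thesis by (simp add: lex_greater_iff)
qed

lemma mdeg_move: "j:keys m ==> mdeg (m - sgl j 1 + sgl i 1) = mdeg m" using mdeg_minus_single[of j m] by simp

text \<open>If \<open>m x\<^sub>i / x\<^sub>j\<close> were missing, degenerate a generic transform of the ideal by a torus to its
  initial space and apply \<open>x\<^sub>j \<mapsto> x\<^sub>j + x\<^sub>i\<close>: the images of the initial monomials above
  the threshold together with the image of \<open>m\<close> stay independent above it, contradicting the maximality
  of generic leading monomials.\<close>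

lemma glead_stable:
 assumes Z: "Z <= Mn n" and m: "m:glead TYPE('k::field_char_0) n Z d" "j:keys m" "i < j"
 shows "m - sgl j 1 + sgl i 1:glead TYPE('k) n Z d"
proof (rule ccontr)
define m' where "m' = m - sgl j 1 + sgl i 1"
assume "~ ?thesis"
hence nm': "m' ~: glead TYPE('k) n Z d" by (simp add: m'_def)
let ?D = "Mn n Int Deg d" and ?L = "glead TYPE('k) n Z d"
have LD: "?L <= ?D" by (rule glead_subset[OF Z])
have finL: "finite ?L" by (rule finite_subset[OF LD]) simp
have mD: "m:?D" using m LD by auto
have jn: "j < n" using m mD by (auto simp: Mon_def)
have "keys m' <= insert i (keys m)"
 by (auto simp: m'_def in_keys_iff lookup_add lookup_minus lookup_single when_def split: if_splits)
hence m'D: "m':?D" using mD m(3) jn mdeg_move[OF m(2), of i] by (auto simp: m'_def Mon_def)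
have mm': "m < m'" unfolding m'_def by (rule monomial_move_less[OF m(3,2)])
obtain g :: "nat=>nat=>'k" where g: "upper_triangular n g" "leads (Wd n Z d g) = ?L"
 using generic_upper_ex[OF glead_generic[OF Z]] by blast
obtain f0 where f0: "!!t. t:?L ==> f0 t:Wd n Z d g & f0 t ~= 0 & lead (f0 t) = t"
 using leads_choice[of "Wd n Z d g"] g(2) by metis
define f where "f w = scalar (inverse (lookup (f0 w) w)) * f0 w" for w
have f: "f w:Wd n Z d g" "lookup (f w) w = 1" "!!v. v:keys (f w) ==> v <= w" if w: "w:?L" for w
proof -
 have nz: "lookup (f0 w) w ~= 0" using f0[OF w] lookup_lead_nonzero by metis
 show "f w:Wd n Z d g" unfolding f_def using f0[OF w] subspace_Wd[of n Z d g] by (auto simp: vs.subspace_def)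
 show "lookup (f w) w = 1" using nz by (simp add: f_def)
 show "v <= w" if "v:keys (f w)" for v
  using that f0[OF w] lead_ge[of v "f0 w"] by (auto simp: f_def keys_scalar_mult split: if_splits)
qed
let ?w = "wt n d"
\<comment> \<open>Up to a power of \<epsilon> this is the image of \<open>f w\<close> under the
  torus at the inverse of \<epsilon>. No exponent is truncated, as \<open>w\<close> has the largest
  weight, and at \<epsilon> = 0 only the leading monomial \<open>w\<close> remains.\<close>
define F where "F \<epsilon> w = (SUM v:keys (f w). scalar (lookup (f w) v * \<epsilon> ^ (?w w - ?w v)) * mon v)" for \<epsilon> w
let ?h = "lin n (elem i j) :: nat=>'k spoly"
let ?A = "insert m (?L Int {m'..})" and ?C = "?D Int {m'..}"
have AL: "?A <= ?L" using m by auto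
have finA: "finite ?A" using finL by auto
have fkeys: "v:?D" if "w:?L" "v:keys (f w)" for v w using Wd_keys[OF f(1)[OF that(1)]] that by blast
have e: "lookup (subst ?h (F \<epsilon> w)) v = (SUM u:keys (f w). lookup (f w) u * \<epsilon> ^ (?w w - ?w u) * lookup (evm ?h u) v)" for \<epsilon> w v
 unfolding F_def by (simp add: subst_sum subst_scalar_mult subst_mon lookup_sum)
have F0: "F 0 w = mon w" if w: "w:?L" for w
proof -
 have z: "scalar (lookup (f w) v * 0 ^ (?w w - ?w v)) * mon v = (0 :: 'k spoly)" if v: "v:keys (f w)" "v ~= w" for v
 proof -
  have "v < w" using f(3)[OF w v(1)] v by simp
  hence "?w v < ?w w" by (intro wt_less fkeys[OF w v(1)]) (use w LD in auto)
  thus ?thesis by (simp add: power_0_left)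
 qed
 have "w:keys (f w)" using f(2)[OF w] by (simp add: in_keys_iff)
 thus ?thesis unfolding F_def using z f(2)[OF w] by (subst sum.mono_neutral_right[of "keys (f w)" "{w}"]) auto
qed
have tri: "tri (evm ?h w) w 1" if "w:?D" for w
 using tri_evm[OF upper_triangular_lowz[OF upper_triangular_elem[OF m(3)]], of w n] that by (simp add: elem_def evm_def)
have ind0: "indep_at (%w v. lookup (subst ?h (F 0 w)) v) ?A ?C" unfolding indep_at_def
proof (intro allI impI)
 fix c assume "ALL v:?C. (SUM w:?A. c w * lookup (subst ?h (F 0 w)) v) = 0"
 hence c: "(SUM w:?A. c w * lookup (evm ?h w) v) = 0" if "v:?C" for v
 proof -
  have "(SUM w:?A. c w * lookup (evm ?h w) v) = (SUM w:?A. c w * lookup (subst ?h (F 0 w)) v)"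
   by (intro sum.cong refl) (metis AL F0 subsetD subst_mon)
  thus ?thesis using \<open>ALL v:?C. (SUM w:?A. c w * lookup (subst ?h (F 0 w)) v) = 0\<close> that by simp
 qed
 have low: "lookup (evm ?h w) v = 0" if "w:?D" "v < w" for v w
  using tri[OF that(1)] that(2) unfolding tri_def by (metis atLeast_iff in_keys_iff leD subset_iff)
 \<comment> \<open>At \<open>m'\<close> nothing but the image of \<open>m\<close> contributes:
   \<open>m'\<close> is not in \<open>?L\<close>, so the other members are larger than
   \<open>m'\<close>, and their images contain no smaller monomials.\<close>
 have cm: "c m = 0"
 proof -
  have z: "c w * lookup (evm ?h w) m' = 0" if "w:?A" "w ~= m" for w
  proof -
   have "w ~= m'" using nm' that by auto
   thus ?thesis using low[of w m'] that LD by (auto simp: order.order_iff_strict)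
  qed
  have "(SUM w:?A. c w * lookup (evm ?h w) m') = c m * lookup (evm ?h m) m'"
   using z finA by (subst sum.mono_neutral_right[of ?A "{m}"]) auto
  also have "lookup (evm ?h m) m' = of_nat (lookup m j)" unfolding m'_def by (rule lookup_evm_elem) (use m mD jn in auto)
  finally show ?thesis using c[of m'] m'D m by (auto simp: in_keys_iff)
 qed
 show "ALL w:?A. c w = 0"
 proof (rule ccontr)
  assume "~ ?thesis"
  hence ne: "{w:?A. c w ~= 0} ~= {}" by auto
  \<comment> \<open>The least index is taken, since the images contain no monomials below their
    index.\<close>
  define w0 where "w0 = Min {w:?A. c w ~= 0}"
  have finS: "finite {w:?A. c w ~= 0}" by (rule finite_subset[OF _ finA]) auto
  hence "w0:{w:?A. c w ~= 0}" using ne unfolding w0_def by (rule Min_in)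
  hence w0: "w0:?A" "c w0 ~= 0" by auto
  hence w0': "w0:?C" using cm LD by auto
  have z: "c w * lookup (evm ?h w) w0 = 0" if "w:?A" "w ~= w0" for w
  proof (cases "c w = 0")
   case False
   hence "w0 <= w" unfolding w0_def using that by (intro Min_le[OF finS]) auto
   hence "w0 < w" using that(2) by (simp add: order.order_iff_strict)
   moreover have "w:?D" using that(1) AL LD by blast
   ultimately show ?thesis using low[of w w0] by simp
  qed simp
  have "(SUM w:?A. c w * lookup (evm ?h w) w0) = c w0 * lookup (evm ?h w0) w0"
   using z finA w0 by (subst sum.mono_neutral_right[of ?A "{w0}"]) auto
  thus False using c[OF w0'] w0 tri[of w0] w0' by (auto simp: tri_def)
 qed
qed
have "EX P:{%x. poly p x |p. True}. P 0 ~= 0 & (ALL \<epsilon>. P \<epsilon> ~= 0 --> indep_at (%w v. lookup (subst ?h (F \<epsilon> w)) v) ?A ?C)"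
proof (rule poly_fun.open_indep[of ?A ?C "%w v \<epsilon>. lookup (subst ?h (F \<epsilon> w)) v" 0, OF finA _ ind0])
 fix w v
 have "(%\<epsilon>. \<epsilon> ^ k):{%x :: 'k. poly p x |p. True}" for k
  by (intro CollectI exI[of _ "Polynomial.monom 1 k"]) (auto simp: poly_monom)
 thus "(%\<epsilon>. lookup (subst ?h (F \<epsilon> w)) v):{%x. poly p x |p. True}"
  unfolding e by (intro poly_fun.PF_sum poly_fun.PF_mult poly_fun.PF_const)
qed
then obtain p where p: "poly p 0 ~= 0"
 "!!\<epsilon>. poly p \<epsilon> ~= 0 ==> indep_at (%w v. lookup (subst ?h (F \<epsilon> w)) v) ?A ?C" by blast
have "p ~= 0" using p(1) by auto
hence "finite (insert 0 {x. poly p x = 0})" using poly_roots_finite[of p] by simp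
then obtain \<epsilon> where \<epsilon>: "\<epsilon> ~= 0" "poly p \<epsilon> ~= 0"
 using ex_new_if_finite[OF infinite_UNIV_char_0, of "insert 0 {x. poly p x = 0}"] by auto
let ?t = "torus n d (inverse \<epsilon>)"
\<comment> \<open>A single upper triangular matrix: the generic \<open>g\<close>, followed by the
  torus and the elementary substitution.\<close>
let ?G = "mmul n (elem i j) (mmul n ?t g)"
have G: "upper_triangular n ?G"
 using \<epsilon> by (intro upper_triangular_mmul upper_triangular_elem upper_triangular_torus g m) auto
have "subst ?h (F \<epsilon> w):Wd n Z d ?G" if w: "w:?L" for w
proof -
 obtain h where h: "h:mideal (Z Int Deg d)" "f w = subst (lin n g) h" using f(1)[OF w] by (auto simp: Wd_def)
 have "scalar (\<epsilon> ^ ?w w) * subst (lin n ?t) (f w)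
   = (SUM v:keys (f w). scalar (lookup (f w) v * (\<epsilon> ^ ?w w * inverse \<epsilon> ^ ?w v)) * mon v)"
  unfolding subst_expand[of "keys (f w)" "f w", simplified] sum_distrib_left
 proof (rule sum.cong)
  fix v assume "v:keys (f w)"
  hence v: "v:Mn n" using fkeys[OF w] by blast
  show "scalar (\<epsilon> ^ ?w w) * (scalar (lookup (f w) v) * evm (lin n ?t) v)
   = scalar (lookup (f w) v * (\<epsilon> ^ ?w w * inverse \<epsilon> ^ ?w v)) * mon v"
   unfolding evm_torus[OF v] scalar_mult by (simp only: mult_ac)
 qed simp
 also have "... = F \<epsilon> w" unfolding F_def
 proof (rule sum.cong)
  fix v assume v: "v:keys (f w)"
  have "?w v <= ?w w"
  proof (cases "v = w")
   case False
   hence "v < w" using f(3)[OF w v] by simp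
   moreover have "w:?D" using w LD by blast
   ultimately show ?thesis using wt_less[OF fkeys[OF w v]] by (simp add: order.strict_implies_order)
  qed simp
  hence "\<epsilon> ^ ?w w * inverse \<epsilon> ^ ?w v = \<epsilon> ^ (?w w - ?w v)"
   using \<epsilon>(1) by (simp add: power_diff power_inverse divide_inverse)
  thus "scalar (lookup (f w) v * (\<epsilon> ^ ?w w * inverse \<epsilon> ^ ?w v)) * mon v
   = scalar (lookup (f w) v * \<epsilon> ^ (?w w - ?w v)) * mon v" by simp
 qed simp
 finally have F: "F \<epsilon> w = scalar (\<epsilon> ^ ?w w) * subst (lin n ?t) (f w)" by (rule sym)
 have "subst ?h (F \<epsilon> w) = scalar (\<epsilon> ^ ?w w) * subst (lin n ?G) h"
  unfolding F h(2) subst_scalar_mult subst_mmul ..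
 also have "... = subst (lin n ?G) (scalar (\<epsilon> ^ ?w w) * h)" by (simp add: subst_scalar_mult)
 finally show ?thesis unfolding Wd_def using mideal_scalar[OF h(1)] by blast
qed
hence "card ?A <= card (leads (Wd n Z d ?G) Int {m'..})"
 by (intro family_leads_Wd[OF finA _ _ p(2)[OF \<epsilon>(2)]]) (use AL in auto)
also have "... <= card (?L Int {m'..})" by (rule glead_max[OF Z G m'D])
also have "... < card ?A"
proof -
 have "m ~: ?L Int {m'..}" using mm' by auto
 moreover have "finite (?L Int {m'..})" using finL by blast
 ultimately have "card ?A = Suc (card (?L Int {m'..}))" by (rule card_insert_disjoint[rotated])
 thus ?thesis by simp
qed
finally show False by simp
qed

section \<open>Stabilization in the number of variables\<close>

lemma upper_triangular_le: "n <= n' ==> upper_triangular n' g ==> upper_triangular n g" by (simp add: upper_triangular_def)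

lemma generic_upper_ext:
 assumes "n <= n'" "generic_upper n (Q :: (nat=>nat=>'k::field_char_0)=>bool)"
 shows "generic_upper n' Q"
proof -
have "tri_vars n <= tri_vars n'" using assms(1) by (auto simp: tri_vars_def)
thus ?thesis using assms(2) upper_triangular_le[OF assms(1)] unfolding generic_upper_alt by (meson order_trans)
qed

lemma card_fiber:
 assumes S: "S <= Mn n" and n: "n <= n'"
 shows "card {m:Mn n' Int Deg d. mres {..<n} m:S}
 = (\<Sum>e\<le>d. card (S Int Deg e) * card (Mon {n..<n'} Int Deg (d - e)))"
proof -
let ?P = "Sigma {..d} (%e. (S Int Deg e) \<times> (Mon {n..<n'} Int Deg (d - e)))"
have fin: "finite (S Int Deg e)" for e by (rule finite_subset[of _ "Mn n Int Deg e"]) (use S in auto)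
have r: "mres {..<n} (a + c) = a" "mres {n..<n'} (a + c) = c" if "a:Mn n" "c:Mon {n..<n'}" for a c
proof -
 have "mres {..<n} c = 0" "mres {n..<n'} a = 0" using that by (auto simp: mres_zero_iff Mon_def)
 thus "mres {..<n} (a + c) = a" "mres {n..<n'} (a + c) = c" using that by (simp_all add: mres_add mres_id)
qed
have sub: "Mn n <= Mn n'" "Mon {n..<n'} <= Mn n'" using n by (auto intro!: Mon_mono)
let ?f = "%(e :: nat, a, c). a + c :: monom"
let ?g = "%m. (mdeg (mres {..<n} m), mres {..<n} m, mres {n..<n'} m)"
have "bij_betw ?f ?P {m:Mn n' Int Deg d. mres {..<n} m:S}"
proof (rule bij_betw_byWitness[where f' = ?g])
 show "ALL p:?P. ?g (?f p) = p" using S by (auto simp: r subset_iff)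
 have split: "mres {..<n} m + mres {n..<n'} m = m" if "m:Mn n'" for m
  by (rule poly_mapping_eqI) (use that in "auto simp: lookup_add lookup_mres Mon_def in_keys_iff subset_iff")
 thus "ALL m:{m:Mn n' Int Deg d. mres {..<n} m:S}.
  ?f (?g m) = m" by auto
 show "?f ` ?P <= {m:Mn n' Int Deg d. mres {..<n} m:S}"
 proof
  fix m assume "m:?f ` ?P"
  then obtain e a c where a: "e:{..d}" "a:S Int Deg e" "c:Mon {n..<n'} Int Deg (d - e)" "m = a + c" by auto
  thus "m:{m:Mn n' Int Deg d. mres {..<n} m:S}" using S sub r(1)[of a c] by auto
 qed
 show "?g ` {m:Mn n' Int Deg d. mres {..<n} m:S} <= ?P"
 proof (rule image_subsetI)
  fix m assume m: "m:{m:Mn n' Int Deg d. mres {..<n} m:S}"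
  have "mdeg (mres {..<n} m) + mdeg (mres {n..<n'} m) = d"
   using split[of m] m mdeg_add[of "mres {..<n} m" "mres {n..<n'} m"] by simp
  thus "?g m:?P" using m by auto
 qed
qed
hence "card {m:Mn n' Int Deg d. mres {..<n} m:S} = card ?P" by (simp add: bij_betw_same_card)
also have "... = (\<Sum>e\<le>d. card (S Int Deg e) * card (Mon {n..<n'} Int Deg (d - e)))"
 using fin by (subst card_SigmaI) (auto simp: card_cartesian_product)
finally show ?thesis .
qed

lemma lin_le:
 assumes "n <= n'" "upper_triangular n' g" "j < n"
 shows "lin n' g j = lin n g j"
unfolding lin_def by (rule sum.mono_neutral_right) (use assms in "auto simp: upper_triangular_def")

text \<open>Leading monomials found in \<open>n\<close> variables persist, since a larger upper
  triangular matrix acts on the first \<open>n\<close> variables by its upper left block. A count in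
  each degree excludes further ones.\<close>

lemma GL_ext:
 assumes Z: "upclosed {..<n} Z" and n: "n <= n'"
 and Z': "Z' = {m:Mn n'. mres {..<n} m:Z}"
 shows "GL TYPE('k::field_char_0) n' Z' = {m:Mn n'. mres {..<n} m:GL TYPE('k) n Z}"
proof -
have ZM: "Z <= Mn n" using Z by (simp add: upclosed_def)
have upZ': "upclosed {..<n'} Z'" unfolding upclosed_def Z' using upclosedD[OF Z] by (auto simp: mres_add)
have Z'M: "Z' <= Mn n'" by (auto simp: Z')
have ZZ': "Z <= Z'" using ZM Mon_mono[of "{..<n}" "{..<n'}"] n by (force simp: Z' mres_id)
have eq: "GL TYPE('k) n' Z' Int Deg d = {m:Mn n' Int Deg d. mres {..<n} m:GL TYPE('k) n Z}" (is "?A = ?B") for d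
proof (rule sym, rule card_subset_eq)
 show "finite ?A" by (rule finite_subset[OF _ finite_MD[of n' d]]) (use GL_subset[OF Z'M] in auto)
 show "?B <= ?A"
 proof
  fix m assume m: "m:?B"
  define a c where "a = mres {..<n} m" and "c = mres (- {..<n}) m"
  have mac: "m = a + c" unfolding a_def c_def by (rule mres_split[symmetric])
  obtain g :: "nat=>nat=>'k" where g: "upper_triangular n' g"
   "leads (Wd n Z (mdeg a) g) = glead TYPE('k) n Z (mdeg a)" "leads (Wd n' Z' d g) = glead TYPE('k) n' Z' d"
   using generic_upper_ex[OF generic_upper_conj[OF generic_upper_ext[OF n glead_generic[OF ZM]] glead_generic[OF Z'M]]] by blast
  have "a:glead TYPE('k) n Z (mdeg a)" using m unfolding a_def by (simp add: GL_iff[OF ZM])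
  moreover have "Wd n Z (mdeg a) g <= Wd n' Z' (mdeg a) g"
  proof
   fix f assume "f:Wd n Z (mdeg a) g"
   then obtain h where h: "h:mideal (Z Int Deg (mdeg a))" "f = subst (lin n g) h" by (auto simp: Wd_def)
   have "subst (lin n' g) h = subst (lin n g) h" by (rule subst_cong[of h "{..<n}"])
     (use h ZM in "auto simp: poly_ring_eq mideal_def lin_le[OF n g(1)]")
   moreover have "h:mideal (Z' Int Deg (mdeg a))" using h ZZ' by (auto simp: mideal_def)
   ultimately show "f:Wd n' Z' (mdeg a) g" unfolding Wd_def h by (metis image_eqI)
  qed
  ultimately have "a:leads (Wd n' Z' (mdeg a) g)" using leads_mono g(2) by blast
  moreover have "c:Mn n'" using m mac by auto
  ultimately have "a + c:leads (Wd n' Z' (mdeg a + mdeg c) g)" by (rule lead_upclosed_Wd[OF g(1) upZ'])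
  moreover have "mdeg a + mdeg c = d" using m mac by simp
  ultimately have "m:glead TYPE('k) n' Z' d" using g(3) mac by simp
  thus "m:?A" using GL_Deg[OF Z'M, where 'k = 'k, of d] by simp
 qed
 have "card ?B = (\<Sum>e\<le>d. card (GL TYPE('k) n Z Int Deg e) * card (Mon {n..<n'} Int Deg (d - e)))"
  by (rule card_fiber[OF GL_subset[OF ZM] n])
 also have "... = (\<Sum>e\<le>d. card (Z Int Deg e) * card (Mon {n..<n'} Int Deg (d - e)))"
  by (simp add: GL_Deg[OF ZM] card_glead[OF ZM])
 also have "... = card {m:Mn n' Int Deg d. mres {..<n} m:Z}" by (rule card_fiber[OF ZM n, symmetric])
 also have "{m:Mn n' Int Deg d. mres {..<n} m:Z} = Z' Int Deg d" by (auto simp: Z')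
 also have "card ... = card ?A" by (simp add: GL_Deg[OF Z'M] card_glead[OF Z'M])
 finally show "card ?B = card ?A" .
qed
show ?thesis
proof (rule set_eqI)
 fix m show "m:GL TYPE('k) n' Z' \<longleftrightarrow> m:{m:Mn n'. mres {..<n} m:GL TYPE('k) n Z}"
 proof -
  have "m:GL TYPE('k) n' Z' Int Deg (mdeg m) \<longleftrightarrow> m:{m':Mn n' Int Deg (mdeg m). mres {..<n} m':GL TYPE('k) n Z}"
   by (simp only: eq)
  thus ?thesis by simp
 qed
qed
qed

section \<open>Limits of monomial ideals\<close>

lemma homogeneous_ideal_mideal:
 assumes "upclosed UNIV U"
 shows "homogeneous_ideal (mideal U :: 'k::field_char_0 spoly set)" unfolding homogeneous_ideal_def
proof
show "mideal U <= ideal_gen UNIV (\<Union>d. degree_comp d (mideal U :: 'k spoly set))"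
proof
 fix f :: "'k spoly" assume f: "f:mideal U"
 have "scalar (lookup f m) * mon m:ideal_gen UNIV (\<Union>d. degree_comp d (mideal U :: 'k spoly set))" if "m:keys f" for m
  by (rule ideal_gen_mult_in) (use f that in "auto simp: degree_comp_def mideal_def")
 hence "(SUM m:keys f. scalar (lookup f m) * mon m):ideal_gen UNIV (\<Union>d. degree_comp d (mideal U :: 'k spoly set))"
  by (intro ideal_gen_sum) auto
 thus "f:ideal_gen UNIV (\<Union>d. degree_comp d (mideal U))" using poly_expand[of "keys f" f] by simp
qed
show "ideal_gen UNIV (\<Union>d. degree_comp d (mideal U :: 'k spoly set)) <= mideal U"
proof (rule ideal_gen_least)
 show "c * x:mideal U" if "c:UNIV" "x:mideal U" for c x :: "'k spoly"
 proof (rule mideal_mult[of c UNIV x U])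
  show "a + b:U" if "b:U" for a b using upclosedD[OF assms that, of a] by (simp add: add.commute)
 qed (use that in auto)
qed (auto simp: degree_comp_def intro: mideal_add)
qed

lemma ideal_tendsto_unique:
 assumes "ideal_tendsto J L" "ideal_tendsto J L'"
 shows "L = L'"
proof -
have "degree_comp d L = degree_comp d L'" for d
proof -
 have "\<forall>\<^sub>F k in sequentially. degree_comp d (J k) = degree_comp d L & degree_comp d (J k) = degree_comp d L'"
  using assms unfolding ideal_tendsto_def by (auto intro: eventually_conj)
 hence "\<forall>\<^sub>F k in sequentially. degree_comp d L = degree_comp d L'" by (rule eventually_mono) metis
 thus ?thesis by (simp add: eventually_const_iff)
qed
hence "ideal_gen UNIV (\<Union>d. degree_comp d L) = ideal_gen UNIV (\<Union>d. degree_comp d L')" by simp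
note eq = this
have L: "L = ideal_gen UNIV (\<Union>d. degree_comp d L)" and L': "L' = ideal_gen UNIV (\<Union>d. degree_comp d L')"
 using assms by (simp_all only: ideal_tendsto_def homogeneous_ideal_def)
show ?thesis by (rule trans[OF L trans[OF eq L'[symmetric]]])
qed

lemma ideal_lim_eq: "ideal_tendsto J L ==> ideal_lim J = L"
unfolding ideal_lim_def by (rule the_equality, assumption, rule ideal_tendsto_unique)

lemma ideal_tendsto_mideal:
 assumes "upclosed UNIV U" "!!d. \<forall>\<^sub>F k in sequentially. U' k Int Deg d = U Int Deg d"
 shows "ideal_tendsto (%k. mideal (U' k)) (mideal U :: 'k::field_char_0 spoly set)"
unfolding ideal_tendsto_def degree_comp_eq mideal_Int mideal_inj using homogeneous_ideal_mideal[OF assms(1)] assms(2) by blast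

section \<open>The generic initial ideal in infinitely many variables\<close>

text \<open>\<open>bnd n U\<close>: the monomial ideal is generated in the first \<open>n\<close> variables.\<close>

definition bnd :: "nat=>monom set=>bool" where "bnd n U \<longleftrightarrow> (ALL m. m:U \<longleftrightarrow> mres {..<n} m:U)"

lemma bnd_mono: "bnd n U ==> n <= n' ==> bnd n' U"
proof -
assume b: "bnd n U" and n: "n <= n'"
have "{..<n} Int {..<n'} = {..<n}" using n by auto
thus "bnd n' U" using b unfolding bnd_def by (metis mres_mres)
qed

text \<open>The cylinder over \<open>GL\<close> in the first \<open>n\<close> variables, which is
  the ideal generated by it in infinitely many variables.\<close>

definition ginset :: "'k::field_char_0 itself=>nat=>monom set=>monom set" where
 "ginset k n U = {m. mres {..<n} m:GL k n (U Int Mn n)}"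

lemma upclosed_Int_Mon: "upclosed UNIV U ==> upclosed V (U Int Mon V)" unfolding upclosed_def by auto

lemma ginset_Mon:
 assumes U: "upclosed UNIV U" "bnd n0 U" "n0 <= n"
 shows "ginset TYPE('k::field_char_0) n0 U Int Mn n = GL TYPE('k) n (U Int Mn n)"
proof -
have "U Int Mn n = {m:Mn n. mres {..<n0} m:U Int Mn n0}" using U(2) by (auto simp: bnd_def)
from GL_ext[OF upclosed_Int_Mon[OF U(1)] U(3) this, where 'k = 'k] show ?thesis by (auto simp: ginset_def)
qed

lemma ginset_upclosed:
 assumes U: "upclosed UNIV U"
 shows "upclosed UNIV (ginset TYPE('k::field_char_0) n U)" unfolding upclosed_def ginset_def
using upclosedD[OF GL_upclosed[OF upclosed_Int_Mon[OF U], where 'k = 'k]] by (auto simp: mres_add)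

lemma ginset_bnd: "bnd n (ginset k n U)" by (simp add: bnd_def ginset_def mres_mres)

text \<open>By \<open>GL_ext\<close> the sequence in the definition of \<open>gin\<close> is
  constant from \<open>n0\<close> on.\<close>

lemma gin_mideal:
 assumes U: "upclosed UNIV U" "bnd n0 U"
 shows "gin (mideal U) = (mideal (ginset TYPE('k) n0 U) :: 'k::field_char_0 spoly set)" unfolding gin_def
proof (rule ideal_lim_eq)
let ?N = "ginset TYPE('k) n0 U"
have eq: "ideal_gen UNIV (gin_fin n (mideal U Int PR n)) = (mideal (mup UNIV (?N Int Mn n)) :: 'k spoly set)"
 if "n0 <= n" for n unfolding poly_ring_eq mideal_Int gin_fin_mideal[OF upclosed_Int_Mon[OF U(1)]]
  ginset_Mon[OF U that] by (rule ideal_gen_mideal_UNIV)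
have up: "mup UNIV (?N Int Mn n) = ?N" if n: "n0 <= n" for n
proof
 show "mup UNIV (?N Int Mn n) <= ?N" by (rule mup_least[OF ginset_upclosed[OF U(1)]]) auto
 show "?N <= mup UNIV (?N Int Mn n)"
 proof
  fix m assume "m:?N"
  hence "mres {..<n} m:?N Int Mn n" using bnd_mono[OF ginset_bnd n, of "TYPE('k)" U] by (auto simp: bnd_def)
  hence "mres {..<n} m + mres (- {..<n}) m:mup UNIV (?N Int Mn n)" unfolding mup_def Mon_UNIV by blast
  thus "m:mup UNIV (?N Int Mn n)" by (simp only: mres_split)
 qed
qed
have ev: "\<forall>\<^sub>F n in sequentially. ideal_gen UNIV (gin_fin n (mideal U Int PR n)) = (mideal ?N :: 'k spoly set)"
 unfolding eventually_sequentially using eq up by (intro exI[of _ n0]) auto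
show "ideal_tendsto (%n. ideal_gen UNIV (gin_fin n (mideal U Int PR n))) (mideal ?N :: 'k spoly set)" unfolding ideal_tendsto_def
 using homogeneous_ideal_mideal[OF ginset_upclosed[OF U(1)]] ev by (auto elim: eventually_mono)
qed

lemma card_ginset:
 assumes U: "upclosed UNIV U" "bnd n0 U" "n0 <= n"
 shows "card (ginset TYPE('k::field_char_0) n0 U Int Mn n Int Deg d) = card (U Int Mn n Int Deg d)"
unfolding ginset_Mon[OF U] by (simp add: GL_Deg card_glead)

text \<open>Strong stability in a form without division.\<close>

definition stable :: "monom set=>bool" where
 "stable N \<longleftrightarrow> (ALL m i j. i <= j --> m + sgl j 1:N --> m + sgl i 1:N)"

lemma ginset_stable:
 assumes U: "upclosed UNIV U" "bnd n0 U"
 shows "stable (ginset TYPE('k::field_char_0) n0 U)" unfolding stable_def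
proof (intro allI impI)
fix m and i j :: nat assume ij: "i <= j" and m: "m + sgl j 1:ginset TYPE('k) n0 U"
show "m + sgl i 1:ginset TYPE('k) n0 U"
proof (cases "i = j")
 case False
 define n where "n = Max (insert n0 (insert (Suc j) (Suc ` keys m)))"
 have n: "n0 <= n" "j < n" "keys m <= {..<n}"
  using Max_ge[of "insert n0 (insert (Suc j) (Suc ` keys m))"] by (auto simp: n_def Suc_le_eq[symmetric])
 let ?Z = "U Int Mn n" and ?m = "m + sgl j 1"
 have "?m:GL TYPE('k) n ?Z"
 proof -
  have "?m:ginset TYPE('k) n0 U Int Mn n" using m n by (simp add: Mon_def keys_add_nat)
  thus ?thesis by (simp only: ginset_Mon[OF U n(1)])
 qed
 hence "?m:glead TYPE('k) n ?Z (mdeg ?m)" by (simp only: GL_iff[OF Int_lower2])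
 hence "?m - sgl j 1 + sgl i 1:glead TYPE('k) n ?Z (mdeg ?m)"
  by (rule glead_stable[OF Int_lower2]) (use False ij in "simp_all add: keys_add_nat")
 hence "?m - sgl j 1 + sgl i 1:GL TYPE('k) n ?Z" unfolding GL_def by (rule UN_I[OF UNIV_I])
 hence "m + sgl i 1:GL TYPE('k) n ?Z" by simp
 thus ?thesis unfolding ginset_Mon[OF U n(1), symmetric] by simp
qed (use m in simp)
qed

section \<open>The squarefree operation\<close>

text \<open>Inverse of the squarefree operation, on sets: an element with \<open>p\<close> smaller
  elements in the set is lowered by \<open>p\<close>. Working from the squarefree side keeps sorted
  lists out of the later arguments.\<close>

definition psi :: "nat set=>monom" where "psi F = (SUM f:F. sgl (f - card {x:F. x < f}) 1)"

definition sqm :: "nat set=>monom" where "sqm F = (SUM f:F. sgl f 1)"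

lemma keys_sqm [simp]: "finite F ==> keys (sqm F) = F" by (simp add: sqm_def keys_sum_nat)

lemma mdeg_sqm [simp]: "mdeg (sqm F) = card F" by (simp add: sqm_def mdeg_sum)

lemma lookup_sqm: "finite F ==> lookup (sqm F) i = (if i:F then 1 else 0)"
by (simp add: sqm_def lookup_sum lookup_single when_def)

lemma mdeg_psi [simp]: "mdeg (psi F) = card F" by (simp add: psi_def mdeg_sum)

lemma lookup_sum_singles: "lookup (\<Sum>p<length L. sgl (L ! p) 1) k = count (mset L) (k :: nat)"
proof -
have "(\<Sum>p<length L. sgl (L ! p) (1::nat)) = sum_list (map (%x. sgl x 1) L)" by (simp add: sum_list_sum_nth atLeast0LessThan)
moreover have "lookup (sum_list (map (%x. sgl x (1::nat)) L)) k = count (mset L) k"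
 by (induction L) (auto simp: lookup_add lookup_single when_def)
ultimately show ?thesis by simp
qed

lemma count_blocks: "distinct xs ==> count (mset (concat (map (%i. replicate (l i) i) xs))) k = (if k:set xs then l k else 0)"
by (induction xs) auto

lemma sorted_blocks: "sorted (xs :: nat list) ==> sorted (concat (map (%i. replicate (l i) i) xs))"
by (induction xs) (auto simp: sorted_append)

lemma count_var_list: "count (mset (var_list m)) k = lookup m k"
unfolding var_list_def by (subst count_blocks) (auto simp: in_keys_iff)

lemma sorted_var_list: "sorted (var_list m)" unfolding var_list_def by (rule sorted_blocks) simp

lemma var_list_eqI:
 assumes "sorted L" "(\<Sum>p<length L. sgl (L ! p) 1) = m"
 shows "var_list m = L"
proof -
have "mset (var_list m) = mset L" by (rule multiset_eqI) (simp only: count_var_list lookup_sum_singles flip: assms(2))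
hence "sort L = var_list m" using sorted_var_list by (rule properties_for_sort)
thus ?thesis using assms(1) by (simp add: sorted_sort_id)
qed

lemma var_list_sum: "(\<Sum>p<length (var_list m). sgl (var_list m ! p) 1) = m"
by (rule poly_mapping_eqI) (simp only: lookup_sum_singles count_var_list)

lemma strict_sorted_nth_ge: "sorted_wrt (<) (fl :: nat list) ==> p < length fl ==> p <= fl ! p"
proof (induction p)
case (Suc p)
hence "fl ! p < fl ! Suc p" by (simp add: sorted_wrt_iff_nth_less)
thus ?case using Suc by simp
qed simp

lemma strict_sorted_card:
 assumes "sorted_wrt (<) (fl :: nat list)" "p < length fl"
 shows "card {x:set fl. x < fl ! p} = p"
proof -
have "{x:set fl. x < fl ! p} = (!) fl ` {..<p}"
proof (intro subset_antisym subsetI)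
 fix x assume x: "x:{x:set fl. x < fl ! p}"
 then obtain q where q: "q < length fl" "x = fl ! q" by (auto simp: in_set_conv_nth)
 have "q < p"
 proof (rule ccontr)
  assume "~ q < p"
  hence "p = q \<or> p < q" by linarith
  hence "p = q \<or> fl ! p < fl ! q" using assms(1) q by (auto simp: sorted_wrt_iff_nth_less)
  thus False using x q by auto
 qed
 thus "x:(!) fl ` {..<p}" using q by auto
qed (use assms in "auto simp: sorted_wrt_iff_nth_less")
moreover have "inj_on ((!) fl) {..<p}"
 using assms by (intro inj_onI) (metis lessThan_iff linorder_neqE_nat order.strict_trans sorted_wrt_iff_nth_less less_irrefl)
ultimately show ?thesis by (simp add: card_image)
qed

lemma sum_over_set_list: "sorted_wrt (<) (fl :: nat list) ==> (SUM f:set fl. h f) = (\<Sum>p<length fl. h (fl ! p))"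
by (metis (no_types, lifting) atLeast0LessThan strict_sorted_iff sum.cong sum_list_distinct_conv_sum_set
  sum_list_sum_nth length_map nth_map lessThan_iff)

lemma psi_list:
 assumes "sorted_wrt (<) (fl :: nat list)"
 shows "psi (set fl) = (\<Sum>p<length fl. sgl (fl ! p - p) 1)" unfolding psi_def sum_over_set_list[OF assms]
by (intro sum.cong) (simp_all add: strict_sorted_card[OF assms])

lemma sqfree_op_psi:
 assumes "finite F"
 shows "sqfree_op (psi F) = sqm F"
proof -
define fl where "fl = sorted_list_of_set F"
have fl: "sorted_wrt (<) fl" "set fl = F" using assms by (simp_all add: fl_def)
define L where "L = map (%p. fl ! p - p) [0..<length fl]"
have "sorted L" unfolding sorted_iff_nth_mono_less
proof (intro allI impI)
 fix i j assume ij: "i < j" "j < length L"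
 have "fl ! i + (j - i) <= fl ! j" using ij
 proof (induction j)
  case (Suc j)
  have "fl ! j < fl ! Suc j" using fl(1) Suc.prems by (simp add: sorted_wrt_iff_nth_less L_def)
  thus ?case using Suc by (cases "i = j") auto
 qed simp
 thus "L ! i <= L ! j" using ij by (simp add: L_def)
qed
moreover have "(\<Sum>p<length L. sgl (L ! p) 1) = psi F" using psi_list[OF fl(1)] fl(2) by (simp add: L_def)
ultimately have vl: "var_list (psi F) = L" by (rule var_list_eqI)
have "sqfree_op (psi F) = (\<Sum>p<length fl. sgl (fl ! p) 1)"
 unfolding sqfree_op_def vl by (simp add: L_def strict_sorted_nth_ge[OF fl(1)])
also have "... = sqm F" unfolding sqm_def fl(2)[symmetric] by (rule sum_over_set_list[OF fl(1), symmetric])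
finally show ?thesis .
qed

lemma ex_psi: "EX F. finite F & psi F = u"
proof -
define L where "L = var_list u"
define fl where "fl = map (%p. L ! p + p) [0..<length L]"
have "sorted L" by (simp add: L_def sorted_var_list)
hence "sorted_wrt (<) fl"
 unfolding sorted_wrt_iff_nth_less sorted_iff_nth_mono_less by (auto simp: fl_def intro: add_le_less_mono)
hence "psi (set fl) = (\<Sum>p<length fl. sgl (fl ! p - p) 1)" by (rule psi_list)
also have "... = u" using var_list_sum[of u] by (simp add: fl_def L_def)
finally show ?thesis by blast
qed

lemma position_mono:
 assumes "finite F" "(f::nat) <= f'"
 shows "f - card {x:F. x < f} <= f' - card {x:F. x < f'}"
proof -
have "{x:F. x < f'} <= {x:F. x < f} Un {f..<f'}" by auto
hence "card {x:F. x < f'} <= card ({x:F. x < f} Un {f..<f'})" using assms(1) by (intro card_mono) auto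
also have "... <= card {x:F. x < f} + (f' - f)" using card_Un_le[of "{x:F. x < f}" "{f..<f'}"] by simp
finally have "card {x:F. x < f'} <= card {x:F. x < f} + (f' - f)" .
moreover have "card {x:F. x < f} <= f" using card_mono[of "{..<f}" "{x:F. x < f}"] by auto
ultimately show ?thesis using assms(2) by linarith
qed

lemma psi_insert_max:
 assumes "finite P" "!!x. x:P ==> x < p"
 shows "psi (insert p P) = psi P + sgl (p - card P) 1"
proof -
have "p ~: P" using assms(2) by auto
have "{x:insert p P. x < p} = P" using assms(2) by auto
moreover have "{x:insert p P. x < f} = {x:P. x < f}" if "f:P" for f using assms(2)[OF that] by auto
ultimately show ?thesis unfolding psi_def using \<open>p ~: P\<close> assms(1) by (simp add: add.commute cong: sum.cong)
qed

lemma psi_empty [simp]: "psi {} = 0" by (simp add: psi_def)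

lemma keys_psi: "finite F ==> keys (psi F) = (%f. f - card {x:F. x < f}) ` F" by (auto simp: psi_def keys_sum_nat)

lemma psi_prefix_dvd:
 assumes "finite F"
 shows "EX c. psi F = psi (F Int {..p}) + c"
proof -
have *: "{x:F Int {..p}. x < f} = {x:F. x < f}" if "f <= p" for f using that by auto
have "psi F = (SUM f:F Int {..p}. sgl (f - card {x:F. x < f}) 1) + (SUM f:F - {..p}. sgl (f - card {x:F. x < f}) 1)"
 unfolding psi_def using assms by (subst sum.union_disjoint[symmetric]) (auto intro: sum.cong)
also have "(SUM f:F Int {..p}. sgl (f - card {x:F. x < f}) 1) = psi (F Int {..p})" unfolding psi_def
proof (rule sum.cong[OF refl])
 fix f assume "f:F Int {..p}"
 hence "f <= p" by simp
 show "sgl (f - card {x:F. x < f}) (1::nat) = sgl (f - card {x:F Int {..p}. x < f}) 1" unfolding *[OF \<open>f <= p\<close>] ..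
qed
finally show ?thesis by blast
qed

section \<open>Strongly stable ideals\<close>

definition mingen :: "monom set=>monom set" where "mingen N = {m:N. ALL a:N. ALL c. m = a + c --> a = m}"

lemma mingen_eq: "u:mingen N ==> a:N ==> u = a + c ==> a = u" by (auto simp: mingen_def)

definition sqU :: "nat set set=>monom set" where "sqU \<F> = {m. keys m:\<F>}"

text \<open>Families of nonfaces: passing from faces to nonfaces reverses the direction of shifting,
  so here an element is replaced by a smaller one.\<close>

definition sfam :: "nat set set=>bool" where
 "sfam \<F> \<longleftrightarrow> (ALL F:\<F>. finite F) & (ALL F:\<F>. ALL G. finite G --> F <= G --> G:\<F>) &
 (ALL F:\<F>. ALL j:F. ALL i<j. i ~: F --> insert i (F - {j}):\<F>)"

definition fbnd :: "nat=>nat set set=>bool" where "fbnd n \<F> \<longleftrightarrow> (ALL F:\<F>. F Int {..<n}:\<F>)"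

text \<open>The supports in the squarefree ideal attached to \<open>N\<close>. They are described
  through all of \<open>N\<close>; \<open>sqU_PsF\<close> shows that the images of the minimal
  generators generate the same ideal.\<close>

definition PsF :: "monom set=>nat set set" where "PsF N = {F. finite F & psi F:N}"

lemma stableD: "stable N ==> i <= j ==> m + sgl j 1:N ==> m + sgl i 1:N" by (auto simp: stable_def)

lemma borel_mono:
 assumes "stable N" "finite A" "!!h. h:A ==> b h <= a h" "c + (SUM h:A. sgl (a h) 1):N"
 shows "c + (SUM h:A. sgl (b h) 1):N" using assms(2-4)
proof (induction A arbitrary: c rule: finite_induct)
case (insert x A)
have "(c + sgl (a x) 1) + (SUM h:A. sgl (b h) 1):N" by (rule insert.IH) (use insert in "auto simp: add_ac")
hence "(c + (SUM h:A. sgl (b h) 1)) + sgl (a x) 1:N" by (simp add: add_ac)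
hence "(c + (SUM h:A. sgl (b h) 1)) + sgl (b x) 1:N" by (rule stableD[OF assms(1) insert.prems(1), rotated]) simp
thus ?case using insert.hyps by (simp add: add_ac)
qed simp

locale stable_ideal =
 fixes N :: "monom set"
 assumes up: "upclosed UNIV N" and st: "stable N" and nz: "0 ~: N"
begin

lemma upD: "a:N ==> a + c:N" using upclosedD[OF up] by simp

text \<open>If a proper divisor of \<open>m + sgl q 1\<close> were in \<open>N\<close>, then so
  would be one of degree one less. Stability exchanges its last variable with the missing one and
  puts \<open>m\<close> itself into \<open>N\<close>.\<close>

lemma mingen_if_last:
 assumes "m + sgl q 1:N" "m ~: N" "!!x. x:keys m ==> x <= q"
 shows "m + sgl q 1:mingen N" unfolding mingen_def
proof (intro CollectI conjI assms(1) ballI allI impI)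
fix a c assume a: "a:N" and eq: "m + sgl q 1 = a + c"
show "a = m + sgl q 1"
proof (rule ccontr)
 assume "a ~= m + sgl q 1"
 hence "c ~= 0" using eq by auto
 then obtain x where x: "x:keys c" by (metis keys_eq_empty ex_in_conv)
 define b where "b = a + (c - sgl x 1)"
 have b: "b:N" unfolding b_def by (rule upD[OF a])
 have eq': "m + sgl q 1 = b + sgl x 1" unfolding eq b_def using monom_minus_add[OF x] by (simp add: add.assoc)
 have "x:keys (m + sgl q 1)" unfolding eq using x by (simp add: keys_add_nat)
 hence xq: "x <= q" using assms(3) by (auto simp: keys_add_nat)
 have "x ~= q"
 proof
  assume "x = q"
  hence "m = b" using eq' by simp
  thus False using b assms(2) by simp
 qed
 have "q:keys (b + sgl x 1)" unfolding eq'[symmetric] by (simp add: keys_add_nat)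
 hence "q:keys b" using \<open>x ~= q\<close> by (simp add: keys_add_nat)
 hence bq: "b - sgl q 1 + sgl q 1 = b" by (rule monom_minus_add)
 hence "b - sgl q 1 + sgl x 1:N" using stableD[OF st xq, of "b - sgl q 1"] b by simp
 moreover have "b - sgl q 1 + sgl x 1 = m"
 proof -
  have "m + sgl q 1 = (b - sgl q 1 + sgl x 1) + sgl q 1" unfolding eq' using bq by (metis add.commute add.left_commute)
  thus ?thesis by simp
 qed
 ultimately show False using assms(2) by simp
qed
qed

text \<open>The image of the shortest initial segment of \<open>F\<close> that reaches
  \<open>N\<close> leaves \<open>N\<close> when its last and largest variable is removed, so it is a
  minimal generator.\<close>

lemma psi_prefix_mingen:
 assumes F: "finite F" "psi F:N"
 shows "EX p:F. psi (F Int {..p}):mingen N"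
proof -
define s where "s = (LEAST s. psi (F Int {..<s}):N)"
have "F Int {..<Suc (Max F)} = F" using F by (auto simp: less_Suc_eq_le)
hence ex: "psi (F Int {..<Suc (Max F)}):N" using F by simp
hence s: "psi (F Int {..<s}):N" unfolding s_def by (rule LeastI)
then obtain p where p: "s = Suc p" using nz by (cases s) auto
have np: "psi (F Int {..<p}) ~: N"
proof -
 have "p < (LEAST s. psi (F Int {..<s}):N)" using p by (simp only: s_def[symmetric])
 thus ?thesis by (rule not_less_Least)
qed
have pF: "p:F"
proof (rule ccontr)
 assume "p ~: F"
 hence "F Int {..<s} = F Int {..<p}" using p by (auto simp: less_Suc_eq)
 thus False using s np by simp
qed
let ?P = "F Int {..<p}"
have ins: "F Int {..<s} = insert p ?P" using pF p by auto
have eq: "psi (F Int {..<s}) = psi ?P + sgl (p - card ?P) 1" unfolding ins by (rule psi_insert_max) (use F in auto)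
have "psi ?P + sgl (p - card ?P) 1:mingen N"
proof (rule mingen_if_last[OF _ np])
 show "psi ?P + sgl (p - card ?P) 1:N" using s eq by simp
 fix x assume "x:keys (psi ?P)"
 then obtain f where f: "f:?P" "x = f - card {y:?P. y < f}" using F by (auto simp: keys_psi)
 have "f - card {y:?P. y < f} <= p - card {y:?P. y < p}" by (rule position_mono) (use F f in auto)
 also have "{y:?P. y < p} = ?P" by auto
 finally show "x <= p - card ?P" using f by simp
qed
hence "psi (F Int {..p}):mingen N" using eq p by (simp add: lessThan_Suc_atMost)
thus ?thesis using pF by blast
qed

text \<open>Additional elements push the others to lower positions, which stability allows; the
  factors of the new elements are absorbed by the ideal.\<close>

lemma psi_superset:
 assumes "finite F" "H <= F" "psi H:N"
 shows "psi F:N"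
proof -
have fin: "finite H" using assms finite_subset by blast
have "0 + (SUM h:H. sgl (h - card {x:H. x < h}) 1):N" using assms(3) by (simp add: psi_def)
hence "0 + (SUM h:H. sgl (h - card {x:F. x < h}) 1):N"
proof (rule borel_mono[OF st fin, rotated])
 fix h
 have "card {x:H. x < h} <= card {x:F. x < h}" using assms by (intro card_mono) auto
 thus "h - card {x:F. x < h} <= h - card {x:H. x < h}" by simp
qed
hence "(SUM h:H. sgl (h - card {x:F. x < h}) 1) + (SUM h:F - H. sgl (h - card {x:F. x < h}) 1):N" by (intro upD) simp
thus ?thesis unfolding psi_def
 using assms sum.subset_diff[of H F "%h. sgl (h - card {x:F. x < h}) (1::nat)"] by (simp add: add.commute)
qed

lemma psi_shift:
 assumes "finite F" "psi F:N" "j:F" "i < j" "i ~: F"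
 shows "psi (insert i (F - {j})):N"
proof -
define F' where "F' = insert i (F - {j})"
\<comment> \<open>\<open>b\<close> lists the positions in the new set, with \<open>i\<close> in the
  place of \<open>j\<close>; elements between \<open>i\<close> and \<open>j\<close> drop by
  one.\<close>
define b where "b h = (if h = j then i - card {x:F'. x < i} else h - card {x:F'. x < h})" for h
have fin': "finite F'" using assms by (simp add: F'_def)
have le: "b h <= h - card {x:F. x < h}" if "h:F" for h
proof (cases "h = j")
 case True
 have "{x:F'. x < i} = {x:F. x < i}" using assms by (auto simp: F'_def)
 thus ?thesis using position_mono[OF assms(1), of i j] assms(4) True by (simp add: b_def)
next
 case False
 have "card {x:F. x < h} <= card {x:F'. x < h}"
 proof (cases "j < h")
  case True
  have "{x:F'. x < h} = insert i ({x:F. x < h} - {j})" using assms True by (auto simp: F'_def)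
  moreover have "i ~: {x:F. x < h} - {j}" "finite {x:F. x < h}" "j:{x:F. x < h}" using assms True by auto
  ultimately show ?thesis by simp
 next
  case False
  thus ?thesis using fin' by (intro card_mono) (auto simp: F'_def)
 qed
 thus ?thesis using False by (simp add: b_def)
qed
have "0 + (SUM h:F. sgl (h - card {x:F. x < h}) 1):N" using assms(2) by (simp add: psi_def)
hence "0 + (SUM h:F. sgl (b h) 1):N"     by (rule borel_mono[where a = "%h. h - card {x:F. x < h}" and b = b, OF st assms(1), rotated]) (rule le)
moreover have "(SUM h:F. sgl (b h) (1::nat)) = psi F'"
proof -
 have "(SUM h:F. sgl (b h) (1::nat)) = sgl (b j) 1 + (SUM h:F - {j}. sgl (b h) 1)" using assms by (simp add: sum.remove)
 also have "(SUM h:F - {j}. sgl (b h) (1::nat)) = (SUM h:F - {j}. sgl (h - card {x:F'. x < h}) 1)"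
  by (intro sum.cong) (auto simp: b_def)
 also have "sgl (b j) 1 + ... = psi F'" unfolding psi_def using assms by (simp add: b_def F'_def)
 finally show ?thesis .
qed
ultimately show ?thesis by (simp add: F'_def)
qed

lemma sfam_PsF: "sfam (PsF N)" unfolding sfam_def PsF_def using psi_superset psi_shift by auto

lemma mingen_psi:
 assumes "u:mingen N"
 shows "EX P. finite P & P ~= {} & psi P = u & sqfree_op u = sqm P"
proof -
obtain P where P: "finite P" "psi P = u" using ex_psi by blast
moreover have "P ~= {}" using P assms nz by (auto simp: mingen_def)
ultimately show ?thesis using sqfree_op_psi[OF P(1)] by auto
qed

lemma sqU_PsF: "mup UNIV (sqfree_op ` mingen N) = sqU (PsF N)"
proof (intro subset_antisym subsetI)
fix m assume "m:mup UNIV (sqfree_op ` mingen N)"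
then obtain u c where u: "u:mingen N" "m = sqfree_op u + c" by (auto simp: mup_def)
obtain P where P: "finite P" "psi P = u" "sqfree_op u = sqm P" using mingen_psi[OF u(1)] by blast
have "P <= keys m" using u P by (simp add: keys_add_nat)
hence "psi (keys m):N" using psi_superset[of "keys m" P] P u by (auto simp: mingen_def)
thus "m:sqU (PsF N)" by (simp add: sqU_def PsF_def)
next
fix m assume "m:sqU (PsF N)"
hence "psi (keys m):N" by (simp add: sqU_def PsF_def)
then obtain p where p: "psi (keys m Int {..p}):mingen N" using psi_prefix_mingen[of "keys m"] by auto
let ?P = "keys m Int {..p}"
have "m = sqm ?P + (m - sqm ?P)" by (rule poly_mapping_eqI) (auto simp: lookup_add lookup_minus lookup_sqm in_keys_iff)
moreover have "sqm ?P = sqfree_op (psi ?P)" by (simp add: sqfree_op_psi)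
ultimately show "m:mup UNIV (sqfree_op ` mingen N)" using p unfolding mup_def Mon_UNIV by blast
qed

lemma lex_shift_eq:
 assumes "gin J = (mideal N :: 'k::field_char_0 spoly set)"
 shows "lex_shift J = (mideal (sqU (PsF N)) :: 'k spoly set)"
proof -
have "min_gens (mideal N :: 'k spoly set) = mingen N" by (simp add: min_gens_mideal mingen_def)
thus ?thesis unfolding lex_shift_def assms ideal_gen_mon_UNIV by (simp add: sqU_PsF)
qed

section \<open>Equality of Hilbert functions\<close>

text \<open>Uniqueness in the Eliahou-Kervaire decomposition of a stable ideal: a monomial is a
  minimal generator times a monomial in the variables from the largest one of the generator on. Of
  two such generators one divides the other.\<close>

lemma mingen_prefix_unique:
 assumes uv: "u:mingen N" "u':mingen N" "u + v = u' + v'"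
 and v: "keys v <= {Max (keys u)..}" "keys v' <= {Max (keys u')..}"
 shows "u = u'"
proof -
have main: "u = u'" if uv: "u:mingen N" "u':mingen N" "u + v = u' + v'"
 and v: "keys v <= {Max (keys u)..}" "keys v' <= {Max (keys u')..}"
 and le: "Max (keys u) < Max (keys u') \<or> Max (keys u) = Max (keys u') & lookup u (Max (keys u)) <= lookup u' (Max (keys u))"
 for u u' v v'
proof -
 have "ALL i. lookup u i <= lookup u' i"
 proof
  fix i
  have eq: "lookup u i + lookup v i = lookup u' i + lookup v' i" using uv(3) by (metis lookup_add)
  show "lookup u i <= lookup u' i"
  proof (cases "i:keys u")
   case True
   hence iu: "i <= Max (keys u)" by simp
   show ?thesis
   proof (cases "i < Max (keys u')")
    case True
    hence "lookup v' i = 0" using v(2) by (auto simp: in_keys_iff subset_iff)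
    thus ?thesis using eq by simp
   next
    case False
    hence "i = Max (keys u)" using iu le by linarith
    thus ?thesis using le False by auto
   qed
  qed (simp add: in_keys_iff)
 qed
 then obtain c where "u' = u + c" unfolding mdvd_iff by blast
 thus ?thesis using mingen_eq[OF uv(2)] uv(1) by (auto simp: mingen_def)
qed
consider "Max (keys u) < Max (keys u') \<or> Max (keys u) = Max (keys u') & lookup u (Max (keys u)) <= lookup u' (Max (keys u))"
 | "Max (keys u') < Max (keys u) \<or> Max (keys u') = Max (keys u) & lookup u' (Max (keys u')) <= lookup u (Max (keys u'))"
 by (metis linorder_neqE_nat nle_le)
thus ?thesis by cases (use main[OF uv v] main[OF uv(2,1) uv(3)[symmetric] v(2,1)] in auto)
qed

text \<open>The largest variable is removed until the ideal would be left.\<close>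

lemma mingen_prefix_exists: "m:N ==> EX u:mingen N. EX v. m = u + v & keys v <= {Max (keys u)..}"
proof (induction "mdeg m" arbitrary: m)
case 0
thus ?case using nz by auto
next
case (Suc d)
define q where "q = Max (keys m)"
have "m ~= 0" using Suc nz by auto
hence q: "q:keys m" unfolding q_def by (intro Max_in) auto
define m' where "m' = m - sgl q 1"
have m: "m = m' + sgl q 1" unfolding m'_def using monom_minus_add[OF q] by simp
show ?case
proof (cases "m':N")
 case True
 have "d = mdeg m'" using Suc(2) m by simp
 from Suc(1)[OF this True] obtain u v where u: "u:mingen N" "m' = u + v" "keys v <= {Max (keys u)..}" by blast
 have "u ~= 0" using u nz by (auto simp: mingen_def)
 hence "Max (keys u):keys u" by (intro Max_in) auto
 hence "Max (keys u):keys m" using m u by (simp add: keys_add_nat)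
 hence "Max (keys u) <= q" by (simp add: q_def)
 hence "keys (v + sgl q 1) <= {Max (keys u)..}" using u by (auto simp: keys_add_nat)
 moreover have "m = u + (v + sgl q 1)" using m u by (simp add: add_ac)
 ultimately show ?thesis using u by blast
next
 case False
 have "x <= q" if "x:keys m'" for x
 proof -
  have "x:keys m" using that m by (simp add: keys_add_nat)
  thus ?thesis by (simp add: q_def)
 qed
 hence "m:mingen N" using mingen_if_last[of m' q] False Suc(3) m by simp
 thus ?thesis by (intro bexI[of _ m] exI[of _ 0]) auto
qed
qed

end

lemma card_Mon_le:
 assumes "finite V" "finite W" "card V <= card W"
 shows "card (Mon V Int Deg e) <= card (Mon W Int Deg e)"
proof -
obtain f where f: "inj_on f V" "f ` V <= W" using card_le_inj[OF assms] by blast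
define \<phi> where "\<phi> m = (SUM i:V. sgl (f i) (lookup m i))" for m :: monom
have l: "lookup (\<phi> m) (f i) = lookup m i" if "i:V" for m i
proof -
 have "lookup (\<phi> m) (f i) = (SUM k:V. if k = i then lookup m k else 0)"
  unfolding \<phi>_def lookup_sum lookup_single when_def by (intro sum.cong) (use f that in "auto simp: inj_on_def")
 thus ?thesis using assms that by simp
qed
show ?thesis
proof (rule card_inj_on_le[of \<phi>])
 show "inj_on \<phi> (Mon V Int Deg e)"
 proof (rule inj_onI)
  fix m m' assume m: "m:Mon V Int Deg e" "m':Mon V Int Deg e" "\<phi> m = \<phi> m'"
  show "m = m'"
  proof (rule poly_mapping_eqI)
   fix i show "lookup m i = lookup m' i"
   proof (cases "i:V")
    case True
    thus ?thesis using l[OF True, of m] l[OF True, of m'] m by simp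
   next
    case False
    hence "i ~: keys m" "i ~: keys m'" using m by (auto simp: Mon_def)
    thus ?thesis by (simp add: in_keys_iff)
   qed
  qed
 qed
 show "\<phi> ` (Mon V Int Deg e) <= Mon W Int Deg e"
 proof (rule image_subsetI)
  fix m assume m: "m:Mon V Int Deg e"
  have "mdeg (\<phi> m) = e" using m mdeg_eq[OF assms(1), of m] by (simp add: \<phi>_def mdeg_sum Mon_def)
  moreover have "keys (\<phi> m) <= W" using f assms by (auto simp: \<phi>_def keys_sum_nat split: if_splits)
  ultimately show "\<phi> m:Mon W Int Deg e" by (simp add: Mon_def)
 qed
qed (use assms in simp)
qed

lemma card_Mon_eq:
 assumes "finite V" "finite W" "card V = card W"
 shows "card (Mon V Int Deg e) = card (Mon W Int Deg e)"
using card_Mon_le[OF assms(1,2), of e] card_Mon_le[OF assms(2,1), of e] assms(3) by simp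

lemma card_translate: "card ((+) u ` A) = card (A :: monom set)" by (rule card_image) simp

lemma finite_mingen:
 assumes "upclosed UNIV N" "bnd n N"
 shows "finite (mingen N)" "mingen N <= Mn n"
proof -
show sub: "mingen N <= Mn n"
proof
 fix u assume u: "u:mingen N"
 hence "mres {..<n} u:N" using assms(2) by (auto simp: bnd_def mingen_def)
 hence "mres {..<n} u = u" using mingen_eq[OF u, of "mres {..<n} u" "mres (- {..<n}) u"] mres_split[of "{..<n}" u] by simp
 thus "u:Mn n" by (metis mres_in_Mon)
qed
obtain B where B: "B <= mingen N" "finite B" "ALL a:mingen N. EX b:B. ALL i. lookup b i <= lookup a i"
 using dickson_finite[OF sub] by blast
have "mingen N <= B"
proof
 fix a assume a: "a:mingen N"
 then obtain b c where "b:B" "a = b + c" using B(3) unfolding mdvd_iff by blast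
 thus "a:B" using mingen_eq[OF a, of b c] B(1) by (auto simp: mingen_def)
qed
thus "finite (mingen N)" using B(2) finite_subset by blast
qed

context stable_ideal
begin

text \<open>Both sides are disjoint unions over the minimal generators \<open>u\<close> of
  \<open>N\<close>: by the Eliahou-Kervaire decomposition, and by the initial segment
  \<open>S u\<close> of the support that is the squarefree image of \<open>u\<close>. The two free
  parts have the same number of variables.\<close>

lemma hilbert_psi:
 assumes "bnd n0 N"
 shows "EX n1>=n0. fbnd n1 (PsF N) & (ALL n>=n1. ALL d. card (sqU (PsF N) Int Mn n Int Deg d) = card (N Int Mn n Int Deg d))"
proof -
let ?G = "mingen N"
have finG: "finite ?G" and GM: "?G <= Mn n0" using finite_mingen[OF up assms] by auto
have "ALL u:?G. EX P. finite P & P ~= {} & psi P = u" using mingen_psi by blast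
then obtain S where S: "!!u. u:?G ==> finite (S u) & S u ~= {} & psi (S u) = u" by metis
\<comment> \<open>Large enough for all squarefree generators, which may use later variables than
  those of \<open>N\<close>.\<close>
define n1 where "n1 = Max (insert n0 (Suc ` (UN u:?G. S u)))"
have finS: "finite (UN u:?G. S u)" using finG S by auto
have n1: "n0 <= n1" "!!u. u:?G ==> S u <= {..<n1}"
proof -
 have fin: "finite (insert n0 (Suc ` (UN u:?G. S u)))" using finS by simp
 show "n0 <= n1" unfolding n1_def using fin by (rule Max_ge) simp
 show "S u <= {..<n1}" if "u:?G" for u
 proof
  fix x assume "x:S u"
  hence "Suc x:insert n0 (Suc ` (UN u:?G. S u))" using that by blast
  hence "Suc x <= n1" unfolding n1_def using fin by (intro Max_ge)
  thus "x:{..<n1}" by simp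
 qed
qed
have prefix: "EX p:F. F Int {..p} = S (psi (F Int {..p})) & psi (F Int {..p}):?G" if F: "finite F" "psi F:N" for F
proof -
 obtain p where p: "p:F" "psi (F Int {..p}):?G" using psi_prefix_mingen[OF F] by blast
 let ?P = "F Int {..p}"
 have "sqm ?P = sqm (S (psi ?P))" using sqfree_op_psi[of ?P] sqfree_op_psi[of "S (psi ?P)"] S[OF p(2)] F by simp
 hence "?P = S (psi ?P)" using S[OF p(2)] F by (metis finite_Int keys_sqm)
 thus ?thesis using p by blast
qed
have bnd: "fbnd n1 (PsF N)" unfolding fbnd_def PsF_def
proof clarify
 fix F assume F: "finite F" "psi F:N"
 then obtain p where "p:F" "F Int {..p} = S (psi (F Int {..p}))" "psi (F Int {..p}):?G" using prefix by blast
 hence "F Int {..p} <= F Int {..<n1}" "psi (F Int {..p}):N" using n1(2) by (auto simp: mingen_def)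
 thus "finite (F Int {..<n1}) & psi (F Int {..<n1}):N" using F psi_superset by blast
qed
have main: "card (sqU (PsF N) Int Mn n Int Deg d) = card (N Int Mn n Int Deg d)" if n: "n1 <= n" for n d
proof -
 let ?Gd = "{u:?G. mdeg u <= d}"
 define A where "A u = (+) u ` (Mon {Max (keys u)..<n} Int Deg (d - mdeg u))" for u
 \<comment> \<open>The support has \<open>S u\<close> as initial segment: variables of
   \<open>S u\<close> may be repeated, and further ones come after its maximum.\<close>
 define B where "B u = (+) (sqm (S u)) ` (Mon (S u Un {Suc (Max (S u))..<n}) Int Deg (d - mdeg u))" for u
 have finGd: "finite ?Gd" using finG by simp
 have eqA: "N Int Mn n Int Deg d = (UN u:?Gd. A u)"
 proof (intro subset_antisym subsetI)
  fix m assume m: "m:N Int Mn n Int Deg d"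
  then obtain u v where u: "u:?G" "m = u + v" "keys v <= {Max (keys u)..}" using mingen_prefix_exists by blast
  have "v:Mon {Max (keys u)..<n}" using u m by (auto simp: Mon_def keys_add_nat)
  thus "m:(UN u:?Gd. A u)" using u m by (auto simp: A_def)
 next
  fix m assume "m:(UN u:?Gd. A u)"
  then obtain u v where u: "u:?G" "mdeg u <= d" "m = u + v" "v:Mon {Max (keys u)..<n}" "mdeg v = d - mdeg u" by (auto simp: A_def)
  have "u:Mn n" using GM u n n1(1) Mon_mono[of "{..<n0}" "{..<n}"] by auto
  moreover have "v:Mn n" using u(4) by (auto simp: Mon_def)
  ultimately show "m:N Int Mn n Int Deg d" using u upD by (auto simp: mingen_def)
 qed
 have disA: "A u Int A u' = {}" if "u:?Gd" "u':?Gd" "u ~= u'" for u u'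
 proof (rule ccontr)
  assume "A u Int A u' ~= {}"
  then obtain v v' where v: "u + v = u' + v'" "keys v <= {Max (keys u)..<n}" "keys v' <= {Max (keys u')..<n}"
   unfolding A_def Mon_def by blast
  have "u = u'" by (rule mingen_prefix_unique[OF _ _ v(1)]) (use that v in auto)
  thus False using that by simp
 qed
 have Sn: "S u <= {..<n}" if "u:?G" for u using n1(2)[OF that] n by auto
 have eqB: "sqU (PsF N) Int Mn n Int Deg d = (UN u:?Gd. B u)"
 proof (intro subset_antisym subsetI)
  fix m assume m: "m:sqU (PsF N) Int Mn n Int Deg d"
  hence "psi (keys m):N" by (simp add: sqU_def PsF_def)
  then obtain p where p: "p:keys m" "keys m Int {..p} = S (psi (keys m Int {..p}))" "psi (keys m Int {..p}):?G"
   using prefix[of "keys m"] by auto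
  define u where "u = psi (keys m Int {..p})"
  have Su: "S u = keys m Int {..p}" using p by (simp add: u_def)
  hence Mp: "Max (S u) = p" using p(1) by (intro Max_eqI) auto
  define v where "v = m - sqm (S u)"
  have mv: "m = sqm (S u) + v" unfolding v_def Su
   by (rule poly_mapping_eqI) (auto simp: lookup_add lookup_minus lookup_sqm in_keys_iff)
  have "keys v <= keys m" using mv by (metis keys_add_nat Un_upper2)
  hence "keys v <= S u Un {Suc p..<n}" using m unfolding Su by (auto simp: Mon_def)
  hence "v:Mon (S u Un {Suc (Max (S u))..<n})" by (simp add: Mon_def Mp)
  moreover have "mdeg u = card (S u)" unfolding Su by (simp only: u_def mdeg_psi)
  moreover have "mdeg m = card (S u) + mdeg v" by (subst mv) simp
  ultimately have "mdeg u <= d" "v:Mon (S u Un {Suc (Max (S u))..<n}) Int Deg (d - mdeg u)" using m by auto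
  moreover have "u:?G" using p(3) by (simp only: u_def)
  moreover have "m:B u" unfolding B_def mv by (rule imageI) fact
  ultimately show "m:(UN u:?Gd. B u)" by blast
 next
  fix m assume "m:(UN u:?Gd. B u)"
  then obtain u v where u: "u:?G" "mdeg u <= d" "m = sqm (S u) + v" "keys v <= S u Un {Suc (Max (S u))..<n}" "mdeg v = d - mdeg u"
   by (auto simp: B_def Mon_def)
  have du: "mdeg u = card (S u)" using S[OF u(1)] mdeg_psi by metis
  have km: "keys m = S u Un keys v" using u S by (simp add: keys_add_nat)
  hence "psi (keys m):N" using psi_superset[of "keys m" "S u"] S[OF u(1)] u(1) by (auto simp: mingen_def)
  moreover have "keys m <= {..<n}" unfolding km using Sn[OF u(1)] u(4) by auto
  ultimately show "m:sqU (PsF N) Int Mn n Int Deg d" using u du by (simp add: sqU_def PsF_def Mon_def)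
 qed
 have disB: "B u Int B u' = {}" if uu: "u:?Gd" "u':?Gd" "u ~= u'" for u u'
 proof (rule ccontr)
  assume "B u Int B u' ~= {}"
  then obtain m v v' where v: "m = sqm (S u) + v" "keys v <= S u Un {Suc (Max (S u))..<n}"
   "m = sqm (S u') + v'" "keys v' <= S u' Un {Suc (Max (S u'))..<n}" unfolding B_def Mon_def by blast
  have *: "S u = keys m Int {..Max (S u)}" if "u:?G" "m = sqm (S u) + v" "keys v <= S u Un {Suc (Max (S u))..<n}" for u v
   using that S[OF that(1)] by (auto simp: keys_add_nat subset_iff)
  have dv: "EX c. u' = u + c" if "Max (S u) <= Max (S u')" "u:?G" "u':?G"
   "S u = keys m Int {..Max (S u)}" "S u' = keys m Int {..Max (S u')}" for u u'
  proof -
   have "S u' Int {..Max (S u)} = keys m Int {..Max (S u')} Int {..Max (S u)}"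
    by (rule arg_cong[OF that(5), of "%A. A Int {..Max (S u)}"])
   also have "... = keys m Int {..Max (S u)}" using that(1) by auto
   also have "... = S u" by (rule that(4)[symmetric])
   finally have "S u = S u' Int {..Max (S u)}" by (rule sym)
   thus ?thesis using psi_prefix_dvd[of "S u'" "Max (S u)"] S[OF that(2)] S[OF that(3)] by metis
  qed
  have e: "S u = keys m Int {..Max (S u)}" "S u' = keys m Int {..Max (S u')}" using *[of u v] *[of u' v'] uu v by auto
  have "(EX c. u' = u + c) \<or> (EX c. u = u' + c)" using dv[of u u'] dv[of u' u] uu e by (cases "Max (S u) <= Max (S u')") auto
  thus False using uu mingen_eq by (metis (no_types, lifting) mem_Collect_eq mingen_def)
 qed
 have card_eq: "card (A u) = card (B u)" if "u:?Gd" for u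
 proof -
  have u: "u:?G" using that by simp
  define p where "p = Max (S u)"
  have fS: "finite (S u)" "S u ~= {}" "psi (S u) = u" using S[OF u] by auto
  have pS: "p:S u" unfolding p_def using fS by simp
  hence pn: "p < n" using Sn[OF u] by auto
  have c: "card {x:S u. x < p} = card (S u) - 1"
  proof -
   have "x <= p" if "x:S u" for x unfolding p_def using fS that by simp
   hence "{x:S u. x < p} = S u - {p}" by (auto simp: less_le)
   thus ?thesis using pS fS by simp
  qed
  have "Max (keys u) = p - card {x:S u. x < p}"
  proof (rule Max_eqI)
   show "p - card {x:S u. x < p}:keys u" using keys_psi[OF fS(1)] fS(3) pS by auto
   fix y assume "y:keys u"
   then obtain f where "f:S u" "y = f - card {x:S u. x < f}" using keys_psi[OF fS(1)] fS(3) by auto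
   thus "y <= p - card {x:S u. x < p}" using position_mono[OF fS(1), of f p] fS by (simp add: p_def)
  qed simp
  hence M: "Max (keys u) = p - (card (S u) - 1)" using c by simp
  have "card {x:S u. x < p} <= card {..<p}" by (rule card_mono) auto
  hence cp: "card (S u) - 1 <= p" using c by simp
  have "S u Int {Suc p..<n} = {}"
  proof -
   have "x <= p" if "x:S u" for x unfolding p_def using fS that by simp
   thus ?thesis by fastforce
  qed
  hence "card (S u Un {Suc p..<n}) = card (S u) + (n - Suc p)" using fS by (simp add: card_Un_disjoint)
  moreover have "card (S u) > 0" using fS by (simp add: card_gt_0_iff)
  \<comment> \<open>The squarefree operation moves the last variable up by
    \<open>card (S u) - 1\<close>; this loss of later variables is made up by the repeatable
    variables of \<open>S u\<close>.\<close>
  ultimately have "card {Max (keys u)..<n} = card (S u Un {Suc p..<n})" using M cp pn by simp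
  thus ?thesis unfolding A_def B_def card_translate p_def[symmetric] by (intro card_Mon_eq) (use fS in auto)
 qed
 have "card (N Int Mn n Int Deg d) = (SUM u:?Gd. card (A u))"
  unfolding eqA by (rule card_UN_disjoint) (use finGd disA in "auto simp: A_def")
 moreover have "card (sqU (PsF N) Int Mn n Int Deg d) = (SUM u:?Gd. card (B u))" unfolding eqB
 proof (rule card_UN_disjoint)
  show "ALL i:?Gd. finite (B i)" using S by (auto simp: B_def)
 qed (use finGd disB in auto)
 ultimately show ?thesis using card_eq by simp
qed
show ?thesis using n1(1) bnd main by blast
qed

end

section \<open>Words\<close>

text \<open>A word encodes a finitely generated universal squarefree lexsegment ideal, one letter per variable:
  \<open>True\<close> multiplies all later generators by the variable, \<open>False\<close> makes the variable
  (times the variables marked \<open>True\<close> before it) a generator.\<close>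

fun tmem :: "nat=>bool list=>nat set=>bool" where "tmem r [] F = False"
| "tmem r (b # w) F = (if b then r:F & tmem (Suc r) w F else r:F \<or> tmem (Suc r) w F)"

text \<open>The largest monomial of degree \<open>d\<close> (resp. set of size \<open>d\<close>) not in the ideal of the word,
  before (resp. after) applying the squarefree operation.\<close>

fun tmm :: "nat=>bool list=>nat=>monom" where "tmm i [] d = sgl i d"
| "tmm i (b # w) d = (if b then sgl i 1 + tmm i w (d - 1) else tmm (Suc i) w d)"

fun fnew :: "nat=>bool list=>nat=>nat set" where "fnew r [] d = {r..<r + d}"
| "fnew r (b # w) d = (if b then insert r (fnew (Suc r) w (d - 1)) else fnew (Suc r) w d)"

text \<open>\<open>nA\<close> is the degree of the common factor of all generators that may still
  follow: a \<open>False\<close> appended to \<open>w\<close> creates one of degree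
  \<open>Suc (nA w)\<close>. \<open>nZ\<close> counts the generators and bounds their variables
  before the squarefree operation.\<close>

definition nA :: "bool list=>nat" where "nA w = length (filter (%b. b) w)"
definition nZ :: "bool list=>nat" where "nZ w = length (filter Not w)"

lemma nA_simps [simp]: "nA [] = 0" "nA (True # w) = Suc (nA w)" "nA (False # w) = nA w"
 "nA (v @ w) = nA v + nA w" "nA (replicate s True) = s" by (simp_all add: nA_def)

lemma nZ_simps [simp]: "nZ [] = 0" "nZ (True # w) = nZ w" "nZ (False # w) = Suc (nZ w)"
 "nZ (v @ w) = nZ v + nZ w" "nZ (replicate s True) = 0" by (simp_all add: nZ_def)

lemma tmem_mono: "tmem r w F ==> F <= G ==> tmem r w G" by (induction r w F rule: tmem.induct) (auto split: if_splits)

lemma tmem_cong: "F Int {r..} = G Int {r..} ==> tmem r w F \<longleftrightarrow> tmem r w G"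
proof (induction w arbitrary: r)
case (Cons b w)
have "F Int {Suc r..} = G Int {Suc r..}" "r:F \<longleftrightarrow> r:G" using Cons.prems by force+
thus ?case using Cons.IH[of "Suc r"] by simp
qed simp

lemma finite_fnew: "finite (fnew r w d)" by (induction w arbitrary: r d) auto

lemma fnew_subset: "fnew r w d <= {r..<r + length w + d}"
proof (induction w arbitrary: r d)
case (Cons b w)
thus ?case using Cons[of "Suc r" "d - 1"] Cons[of "Suc r" d] by (auto simp: subset_iff) force+
qed auto

lemma card_fnew: "nA w <= d ==> card (fnew r w d) = d"
proof (induction w arbitrary: r d)
case (Cons b w)
have "r ~: fnew (Suc r) w d'" for d' using fnew_subset[of "Suc r" w d'] by auto
thus ?case using Cons by (cases b) (auto simp: finite_fnew)
qed auto

lemma not_tmem_fnew: "~ tmem r w (fnew r w d)"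
proof (induction w arbitrary: r d)
case (Cons b w)
have n: "r ~: fnew (Suc r) w d'" for d' using fnew_subset[of "Suc r" w d'] by auto
have "tmem (Suc r) w (insert r F) \<longleftrightarrow> tmem (Suc r) w F" for F by (rule tmem_cong) auto
thus ?case using Cons n by (cases b) auto
qed auto

text \<open>The appended letters add a single generator, the lex largest set of size
  \<open>nA w + Suc e\<close> outside the ideal of \<open>w\<close>.\<close>

lemma tmem_snoc: "tmem r (w @ replicate e True @ [False]) F \<longleftrightarrow> tmem r w F \<or> fnew r w (nA w + Suc e) <= F"
proof (induction w arbitrary: r)
case Nil
have "tmem r (replicate e True @ [False]) F \<longleftrightarrow> {r..<r + Suc e} <= F"
proof (induction e arbitrary: r)
 case (Suc e)
 have "{r..<r + Suc (Suc e)} = insert r {Suc r..<Suc r + Suc e}" by auto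
 thus ?case using Suc by simp
qed auto
thus ?case by simp
next
case (Cons b w)
thus ?case by (cases b) auto
qed

lemma tmem_append: "tmem r w F ==> tmem r (w @ w') F" by (induction r w F rule: tmem.induct) auto

lemma keys_tmm: "keys (tmm i w d) <= {i..i + nZ w}"
proof (induction w arbitrary: i d)
case (Cons b w)
show ?case
proof (cases b)
 case True
 thus ?thesis using Cons[of i "d - 1"] by (simp add: keys_add_nat)
next
 case False
 have "{Suc i..Suc i + nZ w} <= {i..i + nZ (b # w)}" using False by auto
 thus ?thesis using Cons[of "Suc i" d] False by (metis order_trans tmm.simps(2))
qed
qed (auto split: if_splits)

lemma mdeg_tmm: "nA w <= d ==> mdeg (tmm i w d) = d" by (induction w arbitrary: i d) (auto simp: nA_def split: if_splits)

text \<open>The invariant \<open>card G + i = r\<close> says that of the \<open>r\<close> variables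
  passed \<open>card G\<close> were taken, so the variable \<open>r\<close> is \<open>i\<close>
  before the squarefree operation.\<close>

lemma psi_fnew:
 assumes "finite G" "G <= {..<r}" "card G + i = r"
 shows "psi (G Un fnew r w d) = psi G + tmm i w d" using assms
proof (induction w arbitrary: r i d G)
case Nil
have "psi (G Un {r..<r + d}) = psi G + sgl i d"
proof (induction d)
 case (Suc d)
 have "psi (insert (r + d) (G Un {r..<r + d})) = psi (G Un {r..<r + d}) + sgl (r + d - card (G Un {r..<r + d})) 1"
  by (rule psi_insert_max) (use Nil in auto)
 moreover have "card (G Un {r..<r + d}) = card G + d" using Nil by (subst card_Un_disjoint) auto
 moreover have "insert (r + d) (G Un {r..<r + d}) = G Un {r..<r + Suc d}" by auto
 moreover have "r + d - (card G + d) = i" using Nil(3) by simp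
 ultimately show ?case using Suc by (simp add: add.assoc single_add[symmetric])
qed simp
thus ?case by simp
next
case (Cons b w)
show ?case
proof (cases b)
 case True
 have n: "r ~: G" using Cons.prems by auto
 have "psi (insert r G Un fnew (Suc r) w (d - 1)) = psi (insert r G) + tmm i w (d - 1)"
  by (rule Cons.IH) (use Cons.prems n in "auto simp: less_Suc_eq")
 moreover have "psi (insert r G) = psi G + sgl (r - card G) 1" by (rule psi_insert_max) (use Cons.prems in auto)
 moreover have "r - card G = i" using Cons.prems(3) by simp
 ultimately show ?thesis using True by (simp add: add.assoc Un_insert_left Un_insert_right)
next
 case False
 have "psi (G Un fnew (Suc r) w d) = psi G + tmm (Suc i) w d" by (rule Cons.IH) (use Cons.prems in "auto simp: less_Suc_eq")
 thus ?thesis using False by simp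
qed
qed

lemma psi_fnew_0: "psi (fnew 0 w d) = tmm 0 w d" using psi_fnew[of "{}" 0 0 w d] by simp

text \<open>Membership in the ideal of the word before the squarefree operation. A letter
  \<open>True\<close> does not advance the variable, because the operation itself shifts every later
  factor by one.\<close>

fun vmem :: "nat=>bool list=>monom=>bool" where "vmem i [] v = False"
| "vmem i (b # w) v = (if b then i:keys v & vmem i w (v - sgl i 1) else i:keys v \<or> vmem (Suc i) w v)"

lemma lex_lookup_first:
 assumes "t <= v" "t:Mon {i..}" "v:Mon {i..}"
 shows "lookup t i <= lookup v i"
proof (cases "t = v")
case False
hence "lex_greater v t" using assms(1) by (simp add: lex_greater_iff)
then obtain k where k: "lookup t k < lookup v k" "ALL j<k. lookup v j = lookup t j" by (auto simp: lex_greater_def)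
hence "k:keys v" by (auto simp: in_keys_iff)
hence "i <= k" using assms(3) by (auto simp: Mon_def)
thus ?thesis using k by (cases "i = k") auto
qed simp

lemma single_max:
 assumes "v:Mon {i..}" "mdeg v = d" "sgl i d <= v"
 shows "v = sgl i d"
proof -
have "d <= lookup v i" using lex_lookup_first[OF assms(3) _ assms(1)] by (auto simp: Mon_def)
then obtain c where c: "v = sgl i d + c" using mdvd_iff[of "sgl i d" v] by (auto simp: lookup_single when_def)
hence "mdeg c = 0" using assms(2) by simp
thus ?thesis using c by simp
qed

lemma tmm_Mon: "tmm i w d:Mon {i..}" using keys_tmm[of i w d] by (auto simp: Mon_def)

lemma Mon_Suc: "v:Mon {i..} ==> i ~: keys v ==> v:Mon {Suc i..}"
by (auto simp: Mon_def subset_iff Suc_le_eq order.order_iff_strict)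

lemma monom_split_first: "i:keys v ==> EX v'. v = sgl i 1 + (v' :: monom)" using monom_minus_add[of i v] by (metis add.commute)

text \<open>Of the monomials of degree \<open>d\<close> from \<open>tmm i w d\<close> upward, all
  but this one come from the generators of the word.\<close>

lemma vmem_if_greater:
 assumes "v:Mon {i..}" "mdeg v = d" "nA w <= d" "tmm i w d < v"
 shows "vmem i w v" using assms
proof (induction w arbitrary: i v d)
case Nil
thus ?case using single_max[of v i d] by (simp add: less_le)
next
case (Cons b w)
show ?case
proof (cases b)
 case True
 have "lookup (tmm i (b # w) d) i <= lookup v i"
  by (rule lex_lookup_first[OF less_imp_le[OF Cons.prems(4)] tmm_Mon Cons.prems(1)])
 hence iv: "i:keys v" using True by (auto simp: lookup_add in_keys_iff)
 then obtain v' where v: "v = sgl i 1 + v'" using monom_split_first by blast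
 have "vmem i w v'" by (rule Cons.IH[of v' i "d - 1"]) (use Cons.prems True v in auto)
 thus ?thesis using True iv v by simp
next
 case False
 thus ?thesis using Cons.IH[of v "Suc i" d] Cons.prems Mon_Suc by (cases "i:keys v") auto
qed
qed

text \<open>Each \<open>False\<close> contributes one generator, determined by the letters
  \<open>w1\<close> in front of it.\<close>

lemma vmem_gens: "vmem i w v ==> EX w1 w2 c. w = w1 @ False # w2 & v = tmm i w1 (Suc (nA w1)) + c"
proof (induction i w v rule: vmem.induct)
case (2 i b w v)
show ?case
proof (cases b)
 case True
 hence "i:keys v" "vmem i w (v - sgl i 1)" using 2(3) by auto
 then obtain w1 w2 c where w: "w = w1 @ False # w2" "v - sgl i 1 = tmm i w1 (Suc (nA w1)) + c" "i:keys v" using 2(1) True by auto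
 hence "v = sgl i 1 + (tmm i w1 (Suc (nA w1)) + c)" using monom_minus_add[OF w(3)] by (metis add.commute)
 hence "v = tmm i (True # w1) (Suc (nA (True # w1))) + c" by (simp add: add.assoc)
 thus ?thesis using True w(1) by (intro exI[of _ "True # w1"] exI[of _ w2] exI[of _ c]) simp
next
 case False
 show ?thesis
 proof (cases "i:keys v")
  case True
  then obtain v' where "v = sgl i 1 + v'" using monom_split_first by blast
  thus ?thesis using False by (intro exI[of _ "[]"] exI[of _ w] exI[of _ v']) simp
 next
  case F: False
  hence "vmem (Suc i) w v" using 2(3) False by simp
  then obtain w1 w2 c where "w = w1 @ False # w2" "v = tmm (Suc i) w1 (Suc (nA w1)) + c" using 2(2) False F by auto
  thus ?thesis using False by (intro exI[of _ "False # w1"] exI[of _ w2] exI[of _ c]) simp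
 qed
qed
qed simp

section \<open>Special coordinates\<close>

lemma lead_mult:
 assumes "f ~= 0" "h ~= (0 :: 'k::field_char_0 spoly)"
 shows "lead (f * h) = lead f + lead h"
proof -
define f' where "f' = f - scalar (lookup f (lead f)) * mon (lead f)"
have kf': "keys f' <= {..<lead f}"
proof
 fix k assume k: "k:keys f'"
 hence "lookup f' k ~= 0" by (simp add: in_keys_iff)
 hence "k ~= lead f" "lookup f k ~= 0" by (auto simp: f'_def lookup_minus lookup_mon split: if_splits)
 thus "k:{..<lead f}" using lead_ge[of k f] by (simp add: in_keys_iff order.order_iff_strict)
qed
have eq: "f * h = scalar (lookup f (lead f)) * (mon (lead f) * h) + f' * h" by (simp add: f'_def algebra_simps)
have z: "lookup (f' * h) k = 0" if "lead f + lead h <= k" for k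
proof (rule ccontr)
 assume "lookup (f' * h) k ~= 0"
 then obtain a b where "k = a + b" "a:keys f'" "b:keys h" using keys_mult[of f' h] by (auto simp: in_keys_iff)
 hence "k < lead f + lead h" using kf' lead_ge[of b h] by (auto intro: add_less_le_mono)
 thus False using that by simp
qed
show ?thesis
proof (rule lead_eqI)
 have "lookup (f * h) (lead f + lead h) = lookup f (lead f) * lookup h (lead h)"
  unfolding eq by (simp add: lookup_add z lookup_mon_mult)
 thus "lead f + lead h:keys (f * h)"
  using lookup_lead_nonzero[OF assms(1)] lookup_lead_nonzero[OF assms(2)] by (simp add: in_keys_iff)
 show "k <= lead f + lead h" if "k:keys (f * h)" for k using keys_mult[of f h] that by (auto intro!: add_mono lead_ge)
qed
qed

lemma lead_add_lower:
 assumes "f ~= 0" "!!k. k:keys l ==> k < lead f"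
 shows "f + l ~= 0" "lead (f + l) = lead f"
proof -
have "lookup (f + l) (lead f) = lookup f (lead f)" using assms(2)[of "lead f"] by (auto simp: lookup_add in_keys_iff)
hence k: "lead f:keys (f + l)" using lookup_lead_nonzero[OF assms(1)] by (simp add: in_keys_iff)
thus "f + l ~= 0" by auto
show "lead (f + l) = lead f"
 by (rule lead_eqI[OF k]) (use Poly_Mapping.keys_add[of f l] assms(2) lead_ge[of _ f] in "force simp: order.order_iff_strict")
qed

text \<open>The ideal generated by the substituted generators in the ring \<open>R\<close> of target polynomials.\<close>

fun TI :: "'k::field_char_0 spoly set=>(nat=>'k spoly)=>nat=>bool list=>'k spoly set" where "TI R l r [] = {0}"
| "TI R l r (b # w) = (if b then {l r * f | f. f:TI R l (Suc r) w}
  else {l r * h + f | h f. h:R & f:TI R l (Suc r) w})"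

lemma TI_cong: "(!!j. r <= j ==> l j = l' j) ==> TI R l r w = TI R l' r w"
proof (induction w arbitrary: r)
case (Cons b w)
have "l r = l' r" "TI R l (Suc r) w = TI R l' (Suc r) w" using Cons by auto
thus ?case by simp
qed simp

lemma TI_mono: "R <= R' ==> TI R l r w <= TI R' l r w"
proof (induction w arbitrary: r)
case (Cons b w)
show ?case
proof (cases b)
 case False
 thus ?thesis using Cons.IH[of "Suc r"] Cons.prems by simp blast
qed (use Cons.IH[of "Suc r"] Cons.prems in auto)
qed simp

lemma TI_FalseI: "h:R ==> f:TI R l (Suc r) w ==> l r * h + f:TI R l r (False # w)" by auto

lemma TI_subset: "(!!j. r <= j ==> l j:poly_ring V) ==> TI (poly_ring V) l r w <= poly_ring V"
proof (induction w arbitrary: r)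
case (Cons b w)
have "TI (poly_ring V) l (Suc r) w <= poly_ring V" by (rule Cons.IH) (use Cons.prems in auto)
thus ?case using Cons.prems by (auto intro!: poly_ring_add poly_ring_mult)
qed simp

lemma TI_add: "f:TI (poly_ring V) l r w ==> h:TI (poly_ring V) l r w ==> f + h:TI (poly_ring V) l r w"
proof (induction w arbitrary: r f h)
case (Cons b w)
show ?case
proof (cases b)
 case True
 then obtain f' h' where "f = l r * f'" "h = l r * h'" "f':TI (poly_ring V) l (Suc r) w" "h':TI (poly_ring V) l (Suc r) w"
  using Cons.prems by auto
 thus ?thesis using True Cons.IH[of f' "Suc r" h'] by (auto simp: distrib_left[symmetric])
next
 case False
 then obtain f' h' a b where *: "f = l r * a + f'" "h = l r * b + h'" "a:poly_ring V" "b:poly_ring V"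
  "f':TI (poly_ring V) l (Suc r) w" "h':TI (poly_ring V) l (Suc r) w" using Cons.prems by auto
 have "f + h = l r * (a + b) + (f' + h')" unfolding * by (simp add: algebra_simps)
 moreover have "l r * (a + b) + (f' + h'):TI (poly_ring V) l r (False # w)"
  by (rule TI_FalseI[OF poly_ring_add[OF *(3,4)] Cons.IH[OF *(5,6)]])
 ultimately show ?thesis using False by simp
qed
qed simp

lemma TI_scalar: "f:TI (poly_ring V) l r w ==> scalar c * f:TI (poly_ring V) l r w"
proof (induction w arbitrary: r f)
case (Cons b w)
show ?case
proof (cases b)
 case True
 then obtain f' where *: "f = l r * f'" "f':TI (poly_ring V) l (Suc r) w" using Cons.prems by auto
 have "scalar c * f = l r * (scalar c * f')" unfolding * by (simp add: mult_ac)
 thus ?thesis using True Cons.IH[OF *(2)] by auto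
next
 case False
 then obtain f' a where *: "f = l r * a + f'" "a:poly_ring V" "f':TI (poly_ring V) l (Suc r) w" using Cons.prems by auto
 have "scalar c * f = l r * (scalar c * a) + scalar c * f'" unfolding * by (simp add: algebra_simps)
 moreover have "scalar c * a:poly_ring V" using * by (auto intro: poly_ring_mult)
 ultimately show ?thesis using False Cons.IH[OF *(3)] by auto
qed
qed simp

text \<open>Adding multiples of \<open>y\<close> to the linear forms changes the ideal only modulo
  \<open>y\<close>, so each element is corrected by a multiple of \<open>y\<close>. The coefficients
  have to be enlarged from \<open>R'\<close> to a ring that contains \<open>y\<close>.\<close>

lemma TI_shift:
 assumes "R' <= poly_ring V" "y:poly_ring V" "!!j. l j:poly_ring V"
 shows "\<tau>:TI R' l r w ==> EX h:poly_ring V. \<tau> + y * h:TI (poly_ring V) (%j. l j + scalar c * y) r w"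
proof (induction w arbitrary: r \<tau>)
case Nil
thus ?case by (intro bexI[of _ 0]) auto
next
case (Cons b w)
let ?l = "%j. l j + scalar c * y"
have TIsub: "TI R' l (Suc r) w <= poly_ring V" using TI_mono[OF assms(1)] TI_subset[of "Suc r" l V w] assms(3) by blast
show ?case
proof (cases b)
 case True
 then obtain f where f: "\<tau> = l r * f" "f:TI R' l (Suc r) w" using Cons.prems by auto
 obtain h where h: "h:poly_ring V" "f + y * h:TI (poly_ring V) ?l (Suc r) w" using Cons.IH[OF f(2)] by blast
 have "\<tau> + y * (l r * h + scalar c * f + scalar c * (y * h)) = ?l r * (f + y * h)" unfolding f by (simp add: algebra_simps)
 moreover have "l r * h + scalar c * f + scalar c * (y * h):poly_ring V"
  using h(1) f(2) TIsub assms by (intro poly_ring_add poly_ring_mult) auto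
 ultimately show ?thesis using True h(2) by (intro bexI[of _ "l r * h + scalar c * f + scalar c * (y * h)"]) auto
next
 case False
 then obtain a f where f: "\<tau> = l r * a + f" "a:R'" "f:TI R' l (Suc r) w" using Cons.prems by auto
 obtain h where h: "h:poly_ring V" "f + y * h:TI (poly_ring V) ?l (Suc r) w" using Cons.IH[OF f(3)] by blast
 have "\<tau> + y * (scalar c * a + h) = ?l r * a + (f + y * h)" unfolding f by (simp add: algebra_simps)
 moreover have "scalar c * a + h:poly_ring V" using h(1) f(2) assms by (intro poly_ring_add poly_ring_mult) auto
 moreover have "a:poly_ring V" using f assms by auto
 ultimately show ?thesis using False h(2) by (intro bexI[of _ "scalar c * a + h"]) auto
qed
qed

text \<open>The bound \<open>r\<close> makes the form an admissible column of an upper triangular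
  matrix; the variables from \<open>i\<close> to \<open>e\<close> generate the target ring.\<close>

definition lform :: "nat=>nat=>nat=>'k::field_char_0 spoly=>bool" where
 "lform i e r f \<longleftrightarrow> f:poly_ring ({i..e} Int {..r}) & homogeneous (Suc 0) f"

text \<open>The ideal of the word in special coordinates, enlarged by the image \<open>F\<close> of
  one further monomial. Scalar multiples of \<open>F\<close> suffice, as the work takes place in the
  degree of \<open>F\<close>.\<close>

definition WT :: "nat=>nat=>(nat=>'k::field_char_0 spoly)=>nat=>bool list=>'k spoly=>'k spoly set" where
 "WT i e l r w F = {\<tau> + scalar c * F | \<tau> c. \<tau>:TI (poly_ring {i..e}) l r w}"

definition full :: "nat=>nat=>nat=>monom=>'k::field_char_0 spoly set=>bool" where
 "full i e d t W \<longleftrightarrow> (ALL v. v:Mon {i..e} & mdeg v = d & t <= v -->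
  (EX f:W. f:poly_ring {i..e} & homogeneous d f & f ~= 0 & lead f = v))"

lemma lformD: "lform i e r f ==> f:poly_ring {i..e}" "lform i e r f ==> homogeneous (Suc 0) f"
unfolding lform_def using poly_ring_mono[of "{i..e} Int {..r}" "{i..e}"] by auto

lemma lform_mono: "lform (Suc i) e r f ==> lform i e r f"
unfolding lform_def using poly_ring_mono[of "{Suc i..e} Int {..r}" "{i..e} Int {..r}"] by auto

lemma lform_X: "i <= j ==> j <= e ==> j <= r ==> lform i e r (X j)" by (simp add: lform_def X_in_poly_ring)

lemma lform_add: "lform i e r f ==> lform i e r h ==> lform i e r (f + h)"
by (auto simp: lform_def intro: poly_ring_add homogeneous_add)

lemma lform_scalar: "lform i e r f ==> lform i e r (scalar c * f)"
by (auto simp: lform_def intro: poly_ring_mult homogeneous_scalar_mult)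

lemma X_nonzero [simp]: "X i ~= (0 :: 'k::field_char_0 spoly)" by (simp add: X_def)

lemma lead_X [simp]: "lead (X i :: 'k::field_char_0 spoly) = sgl i 1" by (simp add: X_def)

lemma single_less: "i < j ==> sgl j (1::nat) < (sgl i 1 :: monom)" unfolding lex_greater_iff[symmetric] lex_greater_def
by (intro exI[of _ i]) (auto simp: lookup_single when_def)

lemma X_plus_lower:
 assumes "i < j"
 shows "X i + scalar c * X j ~= (0 :: 'k::field_char_0 spoly)" "lead (X i + scalar c * X j :: 'k spoly) = sgl i 1"
proof -
have "k < lead (X i :: 'k spoly)" if "k:keys (scalar c * X j :: 'k spoly)" for k
 using that single_less[OF assms] by (auto simp: keys_scalar_mult X_def split: if_splits)
from lead_add_lower[OF X_nonzero this]
show "X i + scalar c * X j ~= (0 :: 'k spoly)" "lead (X i + scalar c * X j :: 'k spoly) = sgl i 1" by auto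
qed

lemma first_var_split:
 assumes "sgl i 1 + t <= v" "t:Mon {i..}" "v:Mon {i..e}"
 obtains v' where "v = sgl i 1 + v'" "v':Mon {i..e}" "t <= v'"
proof -
have "lookup (sgl i 1 + t) i <= lookup v i"
 by (rule lex_lookup_first[OF assms(1)]) (use assms in "auto simp: Mon_def keys_add_nat")
hence "i:keys v" by (auto simp: lookup_add in_keys_iff)
then obtain v' where v: "v = sgl i 1 + v'" using monom_split_first by blast
thus ?thesis using that[of v'] assms by auto
qed

lemma power_diff_factor:
 assumes "a:poly_ring V" "b:poly_ring V"
 shows "EX h:poly_ring V. a ^ d - b ^ d = (a - b) * (h :: 'k::field_char_0 spoly)"
proof (induction d)
case 0
show ?case by (intro bexI[of _ 0]) auto
next
case (Suc d)
then obtain h where h: "h:poly_ring V" "a ^ d - b ^ d = (a - b) * h" by blast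
have p: "a ^ d:poly_ring V" by (induction d) (auto intro: poly_ring_mult assms)
have "a ^ Suc d - b ^ Suc d = (a - b) * a ^ d + b * (a ^ d - b ^ d)" by (simp add: algebra_simps)
also have "... = (a - b) * (a ^ d + b * h)" unfolding h by (simp add: algebra_simps)
finally show ?case using h p assms by (intro bexI[of _ "a ^ d + b * h"]) (auto intro: poly_ring_add poly_ring_mult)
qed

lemma poly_ring_power: "f:poly_ring V ==> f ^ k:poly_ring V" by (induction k) (auto intro: poly_ring_mult)

lemma full_single:
 fixes F :: "'k::field_char_0 spoly"
 assumes "F = X i ^ d" "t = sgl i d" "0:TI (poly_ring {i..i}) l r w"
 shows "full i i d t (WT i i l r w F)" unfolding full_def
proof (intro allI impI)
fix v assume v: "v:Mon {i..i} & mdeg v = d & t <= v"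
hence "v:Mon {i..}" using Mon_mono[of "{i..i}" "{i..}"] by auto
hence vd: "v = sgl i d" using single_max[of v i d] v assms by auto
have "F = mon (sgl i d)" using assms by (simp add: X_power)
moreover have "0 + scalar 1 * F:WT i i l r w F" unfolding WT_def using assms(3) by blast
ultimately show "EX f:WT i i l r w F. f:poly_ring {i..i} & homogeneous d f & f ~= 0 & lead f = v"
 using vd by (intro bexI[of _ F]) (auto simp: Mon_def)
qed

lemma Mon_atLeast: "v:Mon {i..e} ==> v:Mon {i..}" using Mon_mono[of "{i..e}" "{i..}"] by auto

lemma Mon_Suc_le: "v:Mon {i..e} ==> i ~: keys v ==> v:Mon {Suc i..e}"
by (auto simp: Mon_def subset_iff Suc_le_eq order.order_iff_strict)

lemma TI_zero: "0:TI (poly_ring V) l r w"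
proof (induction w arbitrary: r)
case (Cons b w)
thus ?case by (auto intro!: exI[of _ "0 :: 'a spoly"])
qed simp

lemma full_times_X:
 fixes F F' :: "'k::field_char_0 spoly"
 assumes "full i e d t (WT i e l' (Suc r) w F')" "t:Mon {i..}"
 and l: "l r = X i" "!!j. Suc r <= j ==> l j = l' j" and F: "F = X i * F'" and ie: "i <= e"
 shows "full i e (Suc d) (sgl i 1 + t) (WT i e l r (True # w) F)" unfolding full_def
proof (intro allI impI)
fix v assume v: "v:Mon {i..e} & mdeg v = Suc d & sgl i 1 + t <= v"
then obtain v' where v': "v = sgl i 1 + v'" "v':Mon {i..e}" "t <= v'" using first_var_split[of i t v e] assms(2) by blast
have "mdeg v' = d" using v v' by simp
then obtain f where f: "f:WT i e l' (Suc r) w F'" "f:poly_ring {i..e}" "homogeneous d f" "f ~= 0" "lead f = v'"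
 using assms(1) v' unfolding full_def by blast
then obtain \<tau> c where \<tau>: "\<tau>:TI (poly_ring {i..e}) l' (Suc r) w" "f = \<tau> + scalar c * F'" by (auto simp: WT_def)
have "TI (poly_ring {i..e}) l' (Suc r) w = TI (poly_ring {i..e}) l (Suc r) w" by (rule TI_cong) (simp add: l)
hence "X i * \<tau>:TI (poly_ring {i..e}) l r (True # w)" using \<tau>(1) l(1) by auto
moreover have "X i * f = X i * \<tau> + scalar c * F" unfolding \<tau> F by (simp add: algebra_simps)
ultimately have "X i * f:WT i e l r (True # w) F" unfolding WT_def by blast
moreover have "X i * f:poly_ring {i..e}" using f ie by (intro poly_ring_mult) (auto simp: X_in_poly_ring)
moreover have "homogeneous (Suc d) (X i * f)" using homogeneous_mult[OF homogeneous_X f(3)] by simp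
moreover have "X i * f ~= 0" "lead (X i * f) = v" using f v' by (auto simp: lead_mult)
ultimately show "EX f:WT i e l r (True # w) F. f:poly_ring {i..e} & homogeneous (Suc d) f & f ~= 0 & lead f = v" by blast
qed

text \<open>The letter \<open>False\<close>: monomials divisible by \<open>X i\<close> lead
  multiples of the form \<open>l r\<close>, the others come from the rest of the word in the
  variables from \<open>Suc i\<close> on. \<open>F\<close> may be exchanged for \<open>F'\<close>
  modulo \<open>l r\<close>.\<close>

lemma full_plus_X:
 fixes F F' :: "'k::field_char_0 spoly"
 assumes "full (Suc i) e d t (WT (Suc i) e l' (Suc r) w F')"
 and l: "l r = X i + scalar c0 * X (Suc i)" "!!j. Suc r <= j ==> l j = l' j" and ie: "Suc i <= e"
 and F: "EX h:poly_ring {i..e}. F - F' = l r * h"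
 shows "full i e d t (WT i e l r (False # w) F)" unfolding full_def
proof (intro allI impI)
fix v assume v: "v:Mon {i..e} & mdeg v = d & t <= v"
let ?R = "poly_ring {i..e} :: 'k spoly set"
have lr: "l r:?R" "homogeneous (Suc 0) (l r)" "l r ~= 0" "lead (l r) = sgl i 1" unfolding l using ie X_plus_lower[of i "Suc i" c0]
 by (auto intro!: poly_ring_add poly_ring_mult homogeneous_add homogeneous_scalar_mult simp: X_in_poly_ring)
show "EX f:WT i e l r (False # w) F. f:?R & homogeneous d f & f ~= 0 & lead f = v"
proof (cases "i:keys v")
 case True
 then obtain v' where v': "v = sgl i 1 + v'" using monom_split_first by blast
 hence m: "mon v':?R" "mdeg v' = d - 1" "d > 0" using v by auto
 have "l r * mon v' + 0:TI ?R l r (False # w)" using m(1) TI_zero by (rule TI_FalseI)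
 hence "(l r * mon v' + 0) + scalar 0 * F:WT i e l r (False # w) F" unfolding WT_def by blast
 moreover have "homogeneous d (l r * mon v')" using homogeneous_mult[OF lr(2), of "d - 1" "mon v'"] m by simp
 ultimately show ?thesis using lr m v' by (intro bexI[of _ "l r * mon v'"]) (auto simp: lead_mult intro: poly_ring_mult)
next
 case False
 hence "v:Mon {Suc i..e}" using v Mon_Suc_le by blast
 then obtain f where f: "f:WT (Suc i) e l' (Suc r) w F'" "f:poly_ring {Suc i..e}" "homogeneous d f" "f ~= 0" "lead f = v"
  using assms(1) v unfolding full_def by blast
 then obtain \<tau> c where \<tau>: "\<tau>:TI (poly_ring {Suc i..e}) l' (Suc r) w" "f = \<tau> + scalar c * F'" by (auto simp: WT_def)
 have sub: "poly_ring {Suc i..e} <= ?R" by (rule poly_ring_mono) auto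
 have "TI (poly_ring {Suc i..e}) l' (Suc r) w = TI (poly_ring {Suc i..e}) l (Suc r) w" by (rule TI_cong) (simp add: l)
 hence \<tau>': "\<tau>:TI ?R l (Suc r) w" using \<tau>(1) TI_mono[OF sub] by blast
 obtain h where h: "h:?R" "F - F' = l r * h" using F by blast
 have "scalar (- c) * h:?R" using h by (intro poly_ring_mult) auto
 hence "l r * (scalar (- c) * h) + \<tau>:TI ?R l r (False # w)" using \<tau>' by (rule TI_FalseI)
 moreover have "f = (l r * (scalar (- c) * h) + \<tau>) + scalar c * F"
 proof -
  have F': "F' = F - l r * h" using h(2) by (simp add: algebra_simps)
  show ?thesis unfolding \<tau>(2) F' by (simp add: algebra_simps scalar_uminus)
 qed
 ultimately have "f:WT i e l r (False # w) F" unfolding WT_def by blast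
 thus ?thesis using f sub by blast
qed
qed

text \<open>Variant with a power of the first variable in place of the image of a squarefree
  monomial. The forms \<open>X i - X (Suc i)\<close> identify this power with that of the next
  variable.\<close>

lemma special_power:
 assumes "i < r" "nA w < d" "e = i + nZ w"
 shows "EX l :: nat=>'k::field_char_0 spoly. (ALL j>=r. lform i e j (l j)) & full i e d (tmm i w d) (WT i e l r w (X i ^ d))"
using assms
proof (induction w arbitrary: i r d)
case Nil
thus ?case by (intro exI[of _ "%_. X i"]) (auto intro!: full_single lform_X)
next
case (Cons b w)
show ?case
proof (cases b)
 case True
 then obtain d' where d: "d = Suc d'" using Cons.prems by (cases d) auto
 obtain l' :: "nat=>'k spoly" where l': "ALL j>=Suc r. lform i e j (l' j)" "full i e d' (tmm i w d') (WT i e l' (Suc r) w (X i ^ d'))"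
  using Cons.IH[of i "Suc r" d'] Cons.prems True d by auto
 have "full i e (Suc d') (sgl i 1 + tmm i w d') (WT i e (l'(r := X i)) r (True # w) (X i ^ d))"
  by (rule full_times_X[OF l'(2) tmm_Mon]) (use Cons.prems d in auto)
 moreover have "ALL j>=r. lform i e j ((l'(r := X i)) j)" using l'(1) Cons.prems by (auto intro!: lform_X)
 ultimately show ?thesis using True d by (intro exI[of _ "l'(r := X i)"]) (simp del: fun_upd_apply)
next
 case False
 obtain l' :: "nat=>'k spoly" where l': "ALL j>=Suc r. lform (Suc i) e j (l' j)"
   "full (Suc i) e d (tmm (Suc i) w d) (WT (Suc i) e l' (Suc r) w (X (Suc i) ^ d))"
  using Cons.IH[of "Suc i" "Suc r" d] Cons.prems False by auto
 let ?l = "l'(r := X i + scalar (-1) * X (Suc i))"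
 have ie: "Suc i <= e" using Cons.prems False by simp
 have "full i e d (tmm (Suc i) w d) (WT i e ?l r (False # w) (X i ^ d))"
 proof (rule full_plus_X[OF l'(2), where ?c0.0 = "-1"])
  show "EX h:poly_ring {i..e}. X i ^ d - X (Suc i) ^ d = ?l r * h" using power_diff_factor[of "X i" "{i..e}" "X (Suc i)" d] ie
   by (simp add: X_in_poly_ring scalar_uminus)
 qed (use ie in auto)
 moreover have "lform i e r (X i + scalar (-1) * X (Suc i))" using ie Cons.prems by (intro lform_add lform_scalar lform_X) auto
 ultimately show ?thesis using l' False
  by (intro exI[of _ ?l] conjI allI impI) (auto intro: lform_mono simp del: fun_upd_apply simp: fun_upd_def)
qed
qed

text \<open>The top coefficient in the parameter \<open>c\<close> is a power of \<open>y\<close>,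
  whatever the forms \<open>a j\<close> are; this is what makes a good parameter exist.\<close>

lemma prod_shift_expand:
 assumes "finite U" "!!j. j:U ==> a j:poly_ring V & homogeneous (Suc 0) (a j)"
 and y: "y:poly_ring V" "homogeneous (Suc 0) y"
 shows "EX G. (ALL c. (PROD j:U. a j + scalar c * y) = (\<Sum>k\<le>card U. scalar (c ^ k) * G k)) &
 G (card U) = y ^ card U & (ALL k. G k:poly_ring V & homogeneous (card U) (G k :: 'k::field_char_0 spoly))" using assms(1,2)
proof (induction U rule: finite_induct)
case empty
show ?case by (intro exI[of _ "%_. 1"]) (auto simp: homogeneous_def)
next
case (insert x U)
then obtain G where G: "!!c. (PROD j:U. a j + scalar c * y) = (\<Sum>k\<le>card U. scalar (c ^ k) * G k)"
 "G (card U) = y ^ card U" "!!k. G k:poly_ring V & homogeneous (card U) (G k)" by auto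
define H where "H k = (if k <= card U then a x * G k else 0) + (if k = 0 then 0 else y * G (k - 1))" for k
show ?case
proof (intro exI[of _ H] conjI allI)
 fix c
 have "(PROD j:insert x U. a j + scalar c * y) = (\<Sum>k\<le>card U. scalar (c ^ k) * (a x * G k)) + (\<Sum>k\<le>card U. scalar (c ^ Suc k) * (y * G k))"
 proof -
  have "(PROD j:insert x U. a j + scalar c * y) = (a x + scalar c * y) * (PROD j:U. a j + scalar c * y)" using insert.hyps by simp
  also have "... = a x * (\<Sum>k\<le>card U. scalar (c ^ k) * G k) + scalar c * y * (\<Sum>k\<le>card U. scalar (c ^ k) * G k)"
   unfolding G(1) by (rule distrib_right)
  also have "... = (\<Sum>k\<le>card U. scalar (c ^ k) * (a x * G k)) + (\<Sum>k\<le>card U. scalar (c ^ Suc k) * (y * G k))"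
   unfolding sum_distrib_left power_Suc scalar_mult by (intro arg_cong2[of _ _ _ _ "(+)"] sum.cong refl) (simp_all only: mult_ac)
  finally show ?thesis .
 qed
 also have "(\<Sum>k\<le>card U. scalar (c ^ k) * (a x * G k)) = (\<Sum>k\<le>Suc (card U). scalar (c ^ k) * (if k <= card U then a x * G k else 0))"
  by (rule sum.mono_neutral_cong_left) auto
 also have "(\<Sum>k\<le>card U. scalar (c ^ Suc k) * (y * G k)) = (\<Sum>k\<le>Suc (card U). scalar (c ^ k) * (if k = 0 then 0 else y * G (k - 1)))"
  by (subst sum.atMost_Suc_shift) simp
 finally show "(PROD j:insert x U. a j + scalar c * y) = (\<Sum>k\<le>card (insert x U). scalar (c ^ k) * H k)"
  using insert.hyps by (simp add: H_def distrib_left sum.distrib)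
next
 show "H (card (insert x U)) = y ^ card (insert x U)" using insert.hyps by (simp add: H_def G(2))
next
 fix k
 have ax: "a x:poly_ring V" "homogeneous (Suc 0) (a x)" using insert.prems by auto
 show "H k:poly_ring V" unfolding H_def using ax y G(3) by (intro poly_ring_add) (auto intro: poly_ring_mult)
 show "homogeneous (card (insert x U)) (H k)"
  unfolding H_def using insert.hyps homogeneous_mult[OF ax(2)] homogeneous_mult[OF y(2)] G(3) by (intro homogeneous_add) auto
qed
qed

lemma evm_sqm: "finite U ==> evm l (sqm U) = (PROD j:U. l j)" by (simp add: evm_def lookup_sqm)

lemma evm_const: "evm (%_. f) m = f ^ mdeg m" by (induction m rule: monom_induct) (auto simp: evm_add)

lemma TI_replicate: "TI R l r (replicate s True @ w) = {(PROD j:{r..<r + s}. l j) * f | f. f:TI R l (r + s) w}"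
proof (induction s arbitrary: r)
case (Suc s)
have "{r..<r + Suc s} = insert r {Suc r..<Suc r + s}" by auto
hence p: "(PROD j:{r..<r + Suc s}. l j) = l r * (PROD j:{Suc r..<Suc r + s}. l j)" by simp
show ?case unfolding p using Suc[of "Suc r"] by (auto simp: mult.assoc)
qed simp

lemma tmm_replicate: "s <= d ==> tmm i (replicate s True @ w) d = sgl i s + tmm i w (d - s)"
proof (induction s arbitrary: d)
case (Suc s)
have "sgl i (Suc s) = sgl i 1 + sgl i s" by (simp add: single_add[symmetric])
thus ?case using Suc.IH[of "d - 1"] Suc.prems by (simp add: add.assoc)
qed simp

lemma replicate_True_cases: "w = replicate (length w) True \<or> (EX s w'. w = replicate s True @ False # w')"
proof (induction w)
case (Cons b w)
show ?case
proof (cases b)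
 case True
 from Cons show ?thesis
 proof
  assume "EX s w'. w = replicate s True @ False # w'"
  then obtain s w' where "w = replicate s True @ False # w'" by blast
  thus ?thesis using True by (intro disjI2 exI[of _ "Suc s"] exI[of _ w']) simp
 qed (use True in simp)
next
 case False
 thus ?thesis by (intro disjI2 exI[of _ 0] exI[of _ w]) simp
qed
qed simp

text \<open>Division by a family that has all leading monomials from \<open>t\<close> on leaves a
  remainder with monomials below \<open>t\<close>.\<close>

lemma full_decompose:
 fixes Q :: "'k::field_char_0 spoly set"
 assumes full: "full i e d t {q + scalar c * F | q c. q:Q}"
 and Q: "0:Q" "!!a b. a:Q ==> b:Q ==> a + b:Q" "!!a c. a:Q ==> scalar c * a:Q"
 and f: "f:poly_ring {i..e}" "homogeneous d f"
 shows "EX c q u. f = scalar c * F + q + u & q:Q & u:poly_ring {i..e} & homogeneous d u & (ALL k:keys u. k < t)" using f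
proof (induction "card {k:Mon {i..e} Int Deg d. k <= lead f}" arbitrary: f rule: less_induct)
case less
show ?case
proof (cases "f ~= 0 & t <= lead f")
 case False
 hence "ALL k:keys f. k < t" using lead_ge[of _ f] by (cases "f = 0") (auto simp: not_le intro: order.strict_trans1)
 thus ?thesis using less Q by (intro exI[of _ 0] exI[of _ "0::'k spoly"] exI[of _ f]) auto
next
 case True
 have ld: "lead f:Mon {i..e} Int Deg d"
  using less(2,3) lead_in_keys[of f] True by (auto simp: poly_ring_eq mideal_def homogeneous_def)
 then obtain h where h: "h:{q + scalar c * F | q c. q:Q}" "h:poly_ring {i..e}" "homogeneous d h" "h ~= 0" "lead h = lead f"
 proof -
  have "EX h:{q + scalar c * F | q c. q:Q}. h:poly_ring {i..e} & homogeneous d h & h ~= 0 & lead h = lead f"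
   by (rule full[unfolded full_def, rule_format]) (use ld True in simp)
  thus ?thesis using that by blast
 qed
 define a where "a = lookup f (lead f) / lookup h (lead f)"
 define f' where "f' = f - scalar a * h"
 have f': "f':poly_ring {i..e}" "homogeneous d f'"
 proof -
  show "f':poly_ring {i..e}" unfolding f'_def by (intro poly_ring_diff poly_ring_mult less(2) h(2) poly_ring_scalar)
  show "homogeneous d f'" using homogeneous_add[OF less(3) homogeneous_scalar_mult[OF h(3), of "- a"]]
   by (simp add: f'_def scalar_uminus)
 qed
 have z: "lookup f' (lead f) = 0" using lookup_lead_nonzero[OF h(4)] h(5) by (simp add: f'_def lookup_minus a_def)
 have lt: "lead f' < lead f" if "f' ~= 0"
 proof -
  have "lookup f' (lead f') ~= 0" by (rule lookup_lead_nonzero[OF that])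
  hence "~ lead f < lead f'" using lookup_gt_lead[of f "lead f'"] lookup_gt_lead[of h "lead f'"] h(5)
   by (auto simp: f'_def lookup_minus)
  moreover have "lead f' ~= lead f" using z \<open>lookup f' (lead f') ~= 0\<close> by auto
  ultimately show ?thesis by simp
 qed
 have "EX c q u. f' = scalar c * F + q + u & q:Q & u:poly_ring {i..e} & homogeneous d u & (ALL k:keys u. k < t)"
 proof (cases "f' = 0")
  case True
  thus ?thesis using Q by (intro exI[of _ 0] exI[of _ "0::'k spoly"]) auto
 next
  case False
  have "{k:Mon {i..e} Int Deg d. k <= lead f'} \<subset> {k:Mon {i..e} Int Deg d. k <= lead f}"
   using lt[OF False] ld by (auto simp: psubset_eq set_eq_iff intro!: exI[of _ "lead f"])
  hence "card {k:Mon {i..e} Int Deg d. k <= lead f'} < card {k:Mon {i..e} Int Deg d. k <= lead f}"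
   by (rule psubset_card_mono[rotated]) (rule finite_subset[of _ "Mon {i..e} Int Deg d"], auto)
  thus ?thesis using less(1) f' by blast
 qed
 then obtain c q u where cqu: "f' = scalar c * F + q + u" "q:Q" "u:poly_ring {i..e}" "homogeneous d u" "ALL k:keys u. k < t" by blast
 obtain q' c' where h': "h = q' + scalar c' * F" "q':Q" using h(1) by auto
 have "f = scalar (c + a * c') * F + (q + scalar a * q') + u"
 proof -
  have "f = f' + scalar a * h" by (simp add: f'_def)
  thus ?thesis unfolding cqu(1) h'(1) by (simp add: algebra_simps scalar_add scalar_mult)
 qed
 moreover have "q + scalar a * q':Q" using Q cqu h' by blast
 ultimately show ?thesis using cqu by blast
qed
qed

text \<open>The ideal of the word is divisible by the variable \<open>r\<close>, but the monomial of
  \<open>U\<close> is not. The following letters \<open>True\<close> and the next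
  \<open>False\<close> go to one form \<open>y\<close>, and every later form is shifted by
  \<open>c\<close> times \<open>y\<close>. Modulo the ideal and small monomials the image of
  \<open>U\<close> is then \<open>y ^ d\<close> times a monic polynomial in \<open>c\<close>, and
  \<open>y ^ d\<close> is enough to reach all leading monomials.\<close>

lemma special_missing:
 assumes ir: "i <= r" and U: "finite U" "U <= {Suc r..}" "d = card U"
 and d: "Suc (s + nA w) < d" and e: "e = Suc i + nZ w"
 shows "EX l :: nat=>'k::field_char_0 spoly. (ALL j>=r. lform i e j (l j)) &
 full i e d (tmm i (True # replicate s True @ False # w) d) (WT i e l r (True # replicate s True @ False # w) (evm l (sqm U)))"
proof -
let ?W = "True # replicate s True @ False # w" and ?R = "poly_ring {i..e} :: 'k spoly set"
define d' where "d' = d - Suc s"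
have dd': "d = Suc s + d'" using d by (simp add: d'_def)
\<comment> \<open>The variable after the initial block of \<open>s + 2\<close> letters.\<close>
define r' where "r' = r + s + 2"
obtain l' :: "nat=>'k spoly" where l': "ALL j>=r'. lform (Suc i) e j (l' j)"
  "full (Suc i) e d' (tmm (Suc i) w d') (WT (Suc i) e l' r' w (X (Suc i) ^ d'))"
proof -
 have "nA w < d'" using d by (simp add: d'_def)
 thus ?thesis using that special_power[of "Suc i" r' w d' e, where 'k = 'k] ir e by (auto simp: r'_def)
qed
define y :: "'k spoly" where "y = X i + scalar 1 * X (Suc i)"
have ie: "Suc i <= e" using e by simp
have y: "y:?R" "homogeneous (Suc 0) y" "y ~= 0" "lead y = sgl i 1" unfolding y_def using X_plus_lower[of i "Suc i" 1] ie
 by (auto intro!: poly_ring_add homogeneous_add simp: X_in_poly_ring)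
have yl: "lform i e j y" if "Suc r <= j" for j unfolding y_def using that ir ie by (intro lform_add lform_scalar lform_X) auto
define l where "l c j = (if j = r then X i else if j < r' then y else l' j + scalar c * y)" for c :: 'k and j
have lf: "ALL j>=r. lform i e j (l c j)" for c
proof (intro allI impI)
 fix j assume j: "r <= j"
 consider "j = r" | "Suc r <= j" "j < r'" | "r' <= j" "j ~= r" "~ j < r'" "Suc r <= j" using j by linarith
 thus "lform i e j (l c j)"
 proof cases
  case 1
  thus ?thesis using ir ie by (simp add: l_def lform_X)
 next
  case 2
  thus ?thesis using yl by (simp add: l_def)
 next
  case 3
  thus ?thesis using yl[of j] lform_mono[of i e j "l' j"] l'(1) by (simp add: l_def lform_add lform_scalar)
 qed
qed
have t: "tmm i ?W d = sgl i (Suc s) + tmm (Suc i) w d'"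
proof -
 have "tmm i ?W d = sgl i 1 + (sgl i s + tmm (Suc i) w (d - 1 - s))" using d by (simp add: tmm_replicate)
 thus ?thesis by (simp add: d'_def add.assoc[symmetric] single_add[symmetric])
qed
have TIl: "TI ?R (l c) r ?W = {X i * (y ^ s * (y * h + \<tau>)) | h \<tau>. h:?R & \<tau>:TI ?R (%j. l' j + scalar c * y) r' w}" for c
proof -
 have p: "(PROD j:{Suc r..<Suc r + s}. l c j) = y ^ s"
 proof -
  have "(PROD j:{Suc r..<Suc r + s}. l c j) = (PROD j:{Suc r..<Suc r + s}. y)" by (rule prod.cong) (auto simp: l_def r'_def)
  thus ?thesis by simp
 qed
 have a: "l c (Suc r + s) = y" "l c r = X i" by (auto simp: l_def r'_def)
 have b: "TI ?R (l c) (Suc (Suc r + s)) w = TI ?R (%j. l' j + scalar c * y) r' w"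
 proof -
  have "Suc (Suc r + s) = r'" by (simp add: r'_def)
  moreover have "TI ?R (l c) r' w = TI ?R (%j. l' j + scalar c * y) r' w" by (rule TI_cong) (auto simp: l_def r'_def)
  ultimately show ?thesis by simp
 qed
 have "TI ?R (l c) (Suc r) (replicate s True @ False # w)
  = {y ^ s * f | f. f:{y * h + \<tau> | h \<tau>. h:?R & \<tau>:TI ?R (%j. l' j + scalar c * y) r' w}}"
  unfolding TI_replicate p by (simp only: TI.simps if_False simp_thms a b)
 thus ?thesis by (auto simp: a)
qed
\<comment> \<open>The part of the ideal common to all \<open>c\<close>: by \<open>TI_shift\<close> a
  change of \<open>c\<close> alters \<tau> by a multiple of \<open>y\<close>, which the summand
  \<open>y * h\<close> absorbs.\<close>
define Q where "Q = {X i * (y ^ s * (y * h + \<tau>)) | h \<tau>. h:?R & \<tau>:TI (poly_ring {Suc i..e}) l' r' w}"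
have sub: "poly_ring {Suc i..e} <= ?R" by (rule poly_ring_mono) auto
have QTI: "Q <= TI ?R (l c) r ?W" for c
proof
 fix q assume "q:Q"
 then obtain h \<tau> where q: "q = X i * (y ^ s * (y * h + \<tau>))" "h:?R" "\<tau>:TI (poly_ring {Suc i..e}) l' r' w"
  unfolding Q_def by blast
 define l'' where "l'' j = (if r' <= j then l' j else 0)" for j
 have "\<tau>:TI (poly_ring {Suc i..e}) l'' r' w" using q(3) TI_cong[of r' l' l'' "poly_ring {Suc i..e}" w] by (simp add: l''_def)
 moreover have "l'' j:?R" for j
 proof (cases "r' <= j")
  case True
  hence "l' j:poly_ring {Suc i..e}" using l'(1) lformD(1) by blast
  thus ?thesis using True sub by (auto simp: l''_def)
 qed (simp add: l''_def)
 ultimately obtain h' where h': "h':?R" "\<tau> + y * h':TI ?R (%j. l'' j + scalar c * y) r' w"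
  using TI_shift[OF sub y(1)] by blast
 have "TI ?R (%j. l'' j + scalar c * y) r' w = TI ?R (%j. l' j + scalar c * y) r' w" by (rule TI_cong) (simp add: l''_def)
 hence "\<tau> + y * h':TI ?R (%j. l' j + scalar c * y) r' w" using h' by simp
 moreover have "y * h + \<tau> = y * (h - h') + (\<tau> + y * h')" by (simp add: algebra_simps)
 moreover have "h - h':?R" using q h' by (intro poly_ring_diff)
 ultimately show "q:TI ?R (l c) r ?W" unfolding TIl q by (intro CollectI exI[of _ "h - h'"] exI[of _ "\<tau> + y * h'"]) simp
qed
have Q0: "0:Q" unfolding Q_def using TI_zero[of "{Suc i..e}" l' r' w] by (intro CollectI exI[of _ "0::'k spoly"]) auto
have Qadd: "a + b:Q" if "a:Q" "b:Q" for a b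
proof -
 from that obtain h \<tau> h' \<tau>' where *: "a = X i * (y ^ s * (y * h + \<tau>))" "h:?R" "\<tau>:TI (poly_ring {Suc i..e}) l' r' w"
  "b = X i * (y ^ s * (y * h' + \<tau>'))" "h':?R" "\<tau>':TI (poly_ring {Suc i..e}) l' r' w" unfolding Q_def by blast
 have "a + b = X i * (y ^ s * (y * (h + h') + (\<tau> + \<tau>')))" unfolding * by (simp add: algebra_simps)
 thus ?thesis unfolding Q_def using poly_ring_add[OF *(2,5)] TI_add[OF *(3,6)] by blast
qed
have Qscal: "scalar c * a:Q" if "a:Q" for a c
proof -
 from that obtain h \<tau> where *: "a = X i * (y ^ s * (y * h + \<tau>))" "h:?R" "\<tau>:TI (poly_ring {Suc i..e}) l' r' w"
  unfolding Q_def by blast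
 have "scalar c * a = X i * (y ^ s * (y * (scalar c * h) + scalar c * \<tau>))" unfolding * by (simp add: algebra_simps)
 thus ?thesis unfolding Q_def using poly_ring_mult[OF poly_ring_scalar *(2)] TI_scalar[OF *(3)] by blast
qed
have ys: "y ^ s:?R" "homogeneous s (y ^ s)" "y ^ s ~= 0" "lead (y ^ s) = sgl i s"
proof -
 show "y ^ s:?R" by (rule poly_ring_power[OF y(1)])
 show "homogeneous s (y ^ s)" using homogeneous_power[OF y(2), of s] by simp
 show "y ^ s ~= 0" using y(3) by simp
 show "lead (y ^ s) = sgl i s"
 proof (induction s)
  case 0
  show ?case by (simp add: lead_def)
 next
  case (Suc s)
  have "lead (y ^ Suc s) = sgl i 1 + sgl i s" using lead_mult[of y "y ^ s"] y Suc by simp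
  thus ?case by (simp add: single_add[symmetric])
 qed
qed
have full0: "full i e d (tmm i ?W d) {q + scalar c * y ^ d | q c. q:Q}" unfolding full_def t
proof (intro allI impI)
 fix v assume v: "v:Mon {i..e} & mdeg v = d & sgl i (Suc s) + tmm (Suc i) w d' <= v"
 have tM: "tmm (Suc i) w d':Mon {i..}" using tmm_Mon[of "Suc i" w d'] Mon_mono[of "{Suc i..}" "{i..}"] by auto
 have "lookup (sgl i (Suc s) + tmm (Suc i) w d') i <= lookup v i"
 proof (rule lex_lookup_first)
  have "sgl i (Suc s):Mon {i..}" by (simp add: Mon_def)
  thus "sgl i (Suc s) + tmm (Suc i) w d':Mon {i..}" using tM by simp
 qed (use v Mon_atLeast in auto)
 hence vi: "Suc s <= lookup v i" by (simp add: lookup_add)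
 then obtain v0 where v0: "v = sgl i (Suc s) + v0" using mdvd_iff[of "sgl i (Suc s)" v] by (auto simp: lookup_single when_def)
 have v0': "v0:Mon {i..e}" "mdeg v0 = d'" "tmm (Suc i) w d' <= v0" using v v0 dd' by auto
 have Xi: "X i:?R" using ie by (simp add: X_in_poly_ring)
 show "EX f:{q + scalar c * y ^ d | q c. q:Q}. f:?R & homogeneous d f & f ~= 0 & lead f = v"
 proof (cases "i:keys v0")
  case True
  then obtain v1 where v1: "v0 = sgl i 1 + v1" using monom_split_first by blast
  hence m: "(mon v1 :: 'k spoly):?R" "Suc (mdeg v1) = d'" using v0' by auto
  let ?f = "X i * (y ^ s * (y * mon v1 + 0))"
  have "?f:Q" unfolding Q_def using m TI_zero by blast
  hence "?f + scalar 0 * y ^ d:{q + scalar c * y ^ d | q c. q:Q}" by blast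
  moreover have "?f:?R" using m ys y Xi by (auto intro!: poly_ring_mult)
  moreover have "homogeneous d ?f"
  proof -
   have "homogeneous (Suc 0 + (s + (Suc 0 + mdeg v1))) (X i * (y ^ s * (y * mon v1)))"
    by (intro homogeneous_mult homogeneous_X ys y) simp
   thus ?thesis using m(2) dd' by simp
  qed
  moreover have "?f ~= 0" "lead ?f = v"
  proof -
   have "lead (X i * (y ^ s * (y * mon v1))) = sgl i 1 + (sgl i s + (sgl i 1 + v1))" using ys y by (simp add: lead_mult)
   also have "... = v" unfolding v0 v1 by (simp add: add.assoc[symmetric] single_add[symmetric])
   finally show "lead ?f = v" by simp
   show "?f ~= 0" using ys y by simp
  qed
  ultimately show ?thesis by (intro bexI[of _ ?f]) auto
 next
  case False
  hence "v0:Mon {Suc i..e}" using v0'(1) Mon_Suc_le by blast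
  then obtain f where f: "f:WT (Suc i) e l' r' w (X (Suc i) ^ d')" "f:poly_ring {Suc i..e}" "homogeneous d' f" "f ~= 0" "lead f = v0"
   using l'(2) v0' unfolding full_def by blast
  then obtain \<tau> c where \<tau>: "\<tau>:TI (poly_ring {Suc i..e}) l' r' w" "f = \<tau> + scalar c * X (Suc i) ^ d'" by (auto simp: WT_def)
  obtain h0 where h0: "h0:?R" "y ^ d' - X (Suc i) ^ d' = (y - X (Suc i)) * h0"
   using power_diff_factor[OF y(1), of "X (Suc i)" d'] ie by (auto simp: X_in_poly_ring)
  \<comment> \<open>\<open>Q\<close> contains \<open>X i * \<tau>\<close> up to the factor
    \<open>y ^ s\<close> and multiples of \<open>y\<close>, but not the summand of
    \<open>X i * f\<close> with the power of \<open>X (Suc i)\<close>. Adding \<open>c\<close> times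
    \<open>y ^ d\<close> supplies it, at the cost of a power of \<open>X (Suc i)\<close>, which is
    lex smaller.\<close>
  define f1 where "f1 = X i * f + scalar c * X (Suc i) ^ Suc d'"
  let ?q = "X i * (y ^ s * (y * (scalar (- c) * h0) + \<tau>))"
  have "?q:Q" unfolding Q_def using \<tau>(1) poly_ring_mult[OF poly_ring_scalar h0(1), of "- c"] by blast
  hence qin: "?q + scalar c * y ^ d:{q + scalar c * y ^ d | q c. q:Q}" by blast
  have eq: "?q + scalar c * y ^ d = y ^ s * f1"
  proof -
   have yX: "y - X (Suc i) = X i" by (simp add: y_def)
   have "y ^ d' = X (Suc i) ^ d' + X i * h0" using h0(2) yX by (simp add: algebra_simps)
   hence yd: "y ^ d = y ^ s * (y * X (Suc i) ^ d') + y ^ s * (y * (X i * h0))"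
    unfolding dd' by (simp add: power_add algebra_simps)
   have "?q + scalar c * y ^ d = y ^ s * (X i * \<tau> + scalar c * (y * X (Suc i) ^ d'))"
    unfolding yd by (simp add: algebra_simps scalar_uminus)
   also have "X i * \<tau> + scalar c * (y * X (Suc i) ^ d') = f1" unfolding f1_def \<tau>(2) y_def by (simp add: algebra_simps)
   finally show ?thesis .
  qed
  have lXf: "lead (X i * f) = sgl i 1 + v0" "X i * f ~= 0" using f by (simp_all add: lead_mult)
  have low: "k < lead (X i * f)" if "k:keys (scalar c * X (Suc i) ^ Suc d')" for k
  proof -
   have "k = sgl (Suc i) (Suc d')" using that unfolding X_power by (auto simp: keys_scalar_mult split: if_splits)
   moreover have "lookup v0 j = 0" if "j < i" for j using v0'(1) that in_keys_iff[of j v0] by (auto simp: Mon_def)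
   hence "sgl (Suc i) (Suc d') < sgl i 1 + v0" unfolding lex_greater_iff[symmetric] lex_greater_def
    by (intro exI[of _ i]) (auto simp: lookup_add lookup_single when_def)
   ultimately show ?thesis using lXf by simp
  qed
  have f1: "f1 ~= 0" "lead f1 = sgl i 1 + v0" using lead_add_lower[OF lXf(2) low] lXf(1) by (simp_all add: f1_def)
  have "homogeneous (Suc d') f1" unfolding f1_def
   using homogeneous_mult[OF homogeneous_X f(3)] homogeneous_power[OF homogeneous_X, of "Suc d'" "Suc i"]
   by (intro homogeneous_add homogeneous_scalar_mult) auto
  hence "homogeneous d (y ^ s * f1)" using homogeneous_mult[OF ys(2)] dd' by fastforce
  moreover have "y ^ s * f1:?R" unfolding f1_def using f(2) sub y(1) Xi ie
   by (intro poly_ring_mult poly_ring_add poly_ring_power) (auto simp: X_in_poly_ring)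
  moreover have "y ^ s * f1 ~= 0" "lead (y ^ s * f1) = v"
   using ys f1 v0 by (simp_all add: lead_mult add.assoc[symmetric] single_add[symmetric])
  moreover have "y ^ s * f1:{q + scalar c * y ^ d | q c. q:Q}" using qin unfolding eq .
  ultimately show ?thesis by blast
 qed
qed
let ?U1 = "U Int {..<r'}" and ?U2 = "U Int {r'..}"
have Usplit: "?U1 Un ?U2 = U" "?U1 Int ?U2 = {}" by auto
have cardU: "card ?U1 + card ?U2 = d" using card_Un_disjoint[of ?U1 ?U2] U Usplit by simp
obtain G where G: "!!c. (PROD j:?U2. l' j + scalar c * y) = (\<Sum>k\<le>card ?U2. scalar (c ^ k) * G k)"
 "G (card ?U2) = y ^ card ?U2" "!!k. G k:?R & homogeneous (card ?U2) (G k)"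
proof -
 have "!!j. j:?U2 ==> l' j:?R & homogeneous (Suc 0) (l' j)" using l'(1) lformD sub by blast
 moreover have "finite ?U2" using U(1) by simp
 ultimately obtain G where "!!c. (PROD j:?U2. l' j + scalar c * y) = (\<Sum>k\<le>card ?U2. scalar (c ^ k) * G k)"
  "G (card ?U2) = y ^ card ?U2" "!!k. G k:?R & homogeneous (card ?U2) (G k)"
  using prod_shift_expand[of ?U2 l' "{i..e}" y] y(1,2) by blast
 thus ?thesis by (rule that)
qed
have F: "evm (l c) (sqm U) = (\<Sum>k\<le>card ?U2. scalar (c ^ k) * (y ^ card ?U1 * G k))" for c
proof -
 have "evm (l c) (sqm U) = (PROD j:?U1. l c j) * (PROD j:?U2. l c j)"
  unfolding evm_sqm[OF U(1)] using prod.union_disjoint[of ?U1 ?U2 "l c"] U(1) Usplit by simp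
 also have "(PROD j:?U1. l c j) = (PROD j:?U1. y)" by (rule prod.cong) (use U(2) in "auto simp: l_def")
 also have "... = y ^ card ?U1" by simp
 also have "(PROD j:?U2. l c j) = (PROD j:?U2. l' j + scalar c * y)" by (rule prod.cong) (auto simp: l_def r'_def)
 finally show ?thesis unfolding G(1) by (simp add: sum_distrib_left mult_ac)
qed
have "EX a q u. y ^ card ?U1 * G k = scalar a * y ^ d + q + u & q:Q & u:?R & homogeneous d u & (ALL m:keys u. m < tmm i ?W d)" for k
proof (rule full_decompose[OF full0 Q0 Qadd Qscal])
 show "y ^ card ?U1 * G k:?R" using G(3) y(1) by (intro poly_ring_mult poly_ring_power) auto
 have "homogeneous (card ?U1 * Suc 0 + card ?U2) (y ^ card ?U1 * G k)"
  using G(3) by (intro homogeneous_mult homogeneous_power y) auto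
 thus "homogeneous d (y ^ card ?U1 * G k)" using cardU by simp
qed
then obtain a q u where aqu: "!!k. y ^ card ?U1 * G k = scalar (a k) * y ^ d + q k + u k" "!!k. q k:Q" "!!k. u k:?R"
 "!!k. homogeneous d (u k)" "!!k m. m:keys (u k) ==> m < tmm i ?W d" by metis
define K where "K = card ?U2"
\<comment> \<open>The coefficient of \<open>y ^ d\<close> in the image of \<open>U\<close> as a
  polynomial in \<open>c\<close>. It is monic of degree \<open>K\<close>, because the coefficient of
  \<open>c ^ K\<close> is \<open>y ^ d\<close> itself.\<close>
define p where "p = Polynomial.monom 1 K + (\<Sum>k<K. Polynomial.monom (a k) k)"
have "coeff p K = 1 + (\<Sum>k<K. 0)" unfolding p_def coeff_add coeff_sum by (intro arg_cong2[of _ _ _ _ "(+)"] sum.cong) auto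
hence "p ~= 0" by auto
then obtain c where c: "poly p c ~= 0"
 using poly_roots_finite[of p] ex_new_if_finite[OF infinite_UNIV_char_0, of "{x. poly p x = 0}"] by auto
define qs where "qs = (\<Sum>k<K. scalar (c ^ k) * q k)"
define us where "us = (\<Sum>k<K. scalar (c ^ k) * u k)"
have qs: "qs:Q"
proof -
 have "(SUM k:A. scalar (c ^ k) * q k):Q" if "finite A" for A
  using that by (induction A rule: finite_induct) (auto intro: Q0 Qadd Qscal aqu)
 thus ?thesis by (simp add: qs_def)
qed
have us: "us:?R" "homogeneous d us" "!!m. m:keys us ==> m < tmm i ?W d"
proof -
 show "us:?R" unfolding us_def by (intro poly_ring_sum poly_ring_mult aqu) auto
 show "homogeneous d us" unfolding us_def by (intro homogeneous_sum homogeneous_scalar_mult aqu)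
 have "keys us <= {..<tmm i ?W d}" unfolding us_def
  by (rule keys_sum_subset) (use aqu(5) in "auto simp: keys_scalar_mult split: if_splits")
 thus "m < tmm i ?W d" if "m:keys us" for m using that by auto
qed
have Fc: "evm (l c) (sqm U) = scalar (poly p c) * y ^ d + qs + us"
proof -
 have "evm (l c) (sqm U) = (\<Sum>k<K. scalar (c ^ k) * (y ^ card ?U1 * G k)) + scalar (c ^ K) * (y ^ card ?U1 * G K)"
  unfolding F by (simp add: K_def lessThan_Suc_atMost[symmetric])
 also have "y ^ card ?U1 * G K = y ^ d" unfolding K_def G(2) by (simp add: power_add[symmetric] cardU)
 also have "(\<Sum>k<K. scalar (c ^ k) * (y ^ card ?U1 * G k)) = scalar (\<Sum>k<K. a k * c ^ k) * y ^ d + qs + us"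
  unfolding aqu(1) qs_def us_def scalar_sum sum_distrib_right by (simp add: distrib_left sum.distrib scalar_mult mult_ac)
 finally have "evm (l c) (sqm U) = scalar (\<Sum>k<K. a k * c ^ k) * y ^ d + qs + us + scalar (c ^ K) * y ^ d" .
 moreover have "poly p c = c ^ K + (\<Sum>k<K. a k * c ^ k)" by (simp add: p_def poly_sum poly_monom)
 ultimately show ?thesis by (simp add: scalar_add algebra_simps)
qed
have "full i e d (tmm i ?W d) (WT i e (l c) r ?W (evm (l c) (sqm U)))" unfolding full_def
proof (intro allI impI)
 fix v assume v: "v:Mon {i..e} & mdeg v = d & tmm i ?W d <= v"
 then obtain f where f: "f:{q + scalar c * y ^ d | q c. q:Q}" "f:?R" "homogeneous d f" "f ~= 0" "lead f = v"
  using full0 unfolding full_def by blast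
 then obtain q0 b where qb: "f = q0 + scalar b * y ^ d" "q0:Q" by blast
 \<comment> \<open>The rescaling exchanges \<open>y ^ d\<close> for the image of \<open>U\<close>;
   the error \<open>us\<close> has monomials below the threshold and does not disturb the leading
   monomial.\<close>
 define b' where "b' = b / poly p c"
 let ?f = "f + scalar b' * us"
 have "?f = (q0 + scalar (- b') * qs) + scalar b' * evm (l c) (sqm U)"
 proof -
  have "scalar b * y ^ d = scalar b' * (scalar (poly p c) * y ^ d)"
   using c by (simp add: b'_def mult.assoc[symmetric] scalar_mult[symmetric])
  thus ?thesis unfolding qb Fc by (simp add: algebra_simps scalar_uminus)
 qed
 moreover have "q0 + scalar (- b') * qs:TI ?R (l c) r ?W" using QTI Qadd Qscal qs qb(2) by blast
 ultimately have "?f:WT i e (l c) r ?W (evm (l c) (sqm U))" unfolding WT_def by blast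
 moreover have "?f:?R" using f us by (intro poly_ring_add poly_ring_mult) auto
 moreover have "homogeneous d ?f" using f us by (intro homogeneous_add homogeneous_scalar_mult) auto
 moreover have "?f ~= 0 & lead ?f = lead f"
 proof -
  have "k < lead f" if "k:keys (scalar b' * us)" for k
   using that us(3)[of k] v f(5) by (auto simp: keys_scalar_mult split: if_splits)
  from lead_add_lower[OF f(4) this] show ?thesis by blast
 qed
 ultimately show "EX f:WT i e (l c) r ?W (evm (l c) (sqm U)). f:?R & homogeneous d f & f ~= 0 & lead f = v"
  using f(5) by (intro bexI[of _ ?f]) auto
qed
thus ?thesis using lf by blast
qed

text \<open>At \<open>False\<close> the variable is absent from \<open>U\<close>, since otherwise
  \<open>U\<close> would be in the ideal. At \<open>True\<close> it is split off if present; its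
  absence is the case of \<open>special_missing\<close>, or there are only letters
  \<open>True\<close> left and a single target variable.\<close>

lemma special_coordinates:
 assumes "i <= r" "finite U" "U <= {r..}" "~ tmem r w U" "nA w < card U" "e = i + nZ w"
 shows "EX l :: nat=>'k::field_char_0 spoly. (ALL j>=r. lform i e j (l j)) &
 full i e (card U) (tmm i w (card U)) (WT i e l r w (evm l (sqm U)))" using assms
proof (induction w arbitrary: i r U)
case Nil
show ?case by (intro exI[of _ "%_. X i"]) (use Nil in "auto intro!: full_single lform_X simp: evm_const")
next
case (Cons b w)
let ?d = "card U"
show ?case
proof (cases b)
 case False
 hence rU: "r ~: U" "~ tmem (Suc r) w U" using Cons.prems by auto
 have U': "U <= {Suc r..}" using Cons.prems(3) rU(1) by (auto simp: Suc_le_eq order.order_iff_strict)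
 obtain l' :: "nat=>'k spoly" where l': "ALL j>=Suc r. lform (Suc i) e j (l' j)"
   "full (Suc i) e ?d (tmm (Suc i) w ?d) (WT (Suc i) e l' (Suc r) w (evm l' (sqm U)))"
  using Cons.IH[of "Suc i" "Suc r" U] Cons.prems False rU U' by auto
 let ?l = "l'(r := X i + scalar 0 * X (Suc i))"
 have ie: "Suc i <= e" using Cons.prems False by simp
 have ev: "evm ?l (sqm U) = evm l' (sqm U)" by (rule evm_cong) (use rU Cons.prems(2) in auto)
 have "full i e ?d (tmm (Suc i) w ?d) (WT i e ?l r (False # w) (evm ?l (sqm U)))"
  by (rule full_plus_X[OF l'(2), where ?c0.0 = 0]) (use ie ev in "auto intro!: bexI[of _ 0]")
 moreover have "ALL j>=r. lform i e j (?l j)" using l'(1) ie Cons.prems by (auto intro!: lform_X intro: lform_mono)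
 ultimately show ?thesis using False by (intro exI[of _ ?l]) (simp del: fun_upd_apply TI.simps)
next
 case True
 show ?thesis
 proof (cases "r:U")
  case rU: True
  define U' where "U' = U - {r}"
  have U': "finite U'" "U' <= {Suc r..}" "U = insert r U'" "r ~: U'"
   using Cons.prems rU by (auto simp: U'_def Suc_le_eq order.order_iff_strict)
  have d: "?d = Suc (card U')" using U' by simp
  have "tmem (Suc r) w U' \<longleftrightarrow> tmem (Suc r) w U" by (rule tmem_cong) (use U' in auto)
  hence "~ tmem (Suc r) w U'" using Cons.prems True rU by simp
  then obtain l' :: "nat=>'k spoly" where l': "ALL j>=Suc r. lform i e j (l' j)"
    "full i e (card U') (tmm i w (card U')) (WT i e l' (Suc r) w (evm l' (sqm U')))"
   using Cons.IH[of i "Suc r" U'] Cons.prems True U' d by auto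
  let ?l = "l'(r := X i)"
  have "evm ?l (sqm U') = evm l' (sqm U')" by (rule evm_cong) (use U' in auto)
  hence ev: "evm ?l (sqm U) = X i * evm l' (sqm U')" using U' by (simp add: evm_sqm)
  have "full i e (Suc (card U')) (sgl i 1 + tmm i w (card U')) (WT i e ?l r (True # w) (evm ?l (sqm U)))"
   by (rule full_times_X[OF l'(2) tmm_Mon _ _ ev]) (use Cons.prems in auto)
  moreover have "ALL j>=r. lform i e j (?l j)" using l'(1) Cons.prems by (auto intro!: lform_X)
  ultimately show ?thesis using True d by (intro exI[of _ ?l]) (simp del: fun_upd_apply TI.simps)
 next
  case rU: False
  have U': "U <= {Suc r..}" using Cons.prems(3) rU by (auto simp: Suc_le_eq order.order_iff_strict)
  from replicate_True_cases[of w] show ?thesis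
  proof
   assume w: "w = replicate (length w) True"
   obtain s where s: "w = replicate s True" using w by blast
   have ei: "e = i" using Cons.prems True s by simp
   have t: "tmm i (b # w) ?d = sgl i ?d"
   proof -
    have "s <= ?d - 1" using Cons.prems True s by simp
    hence "tmm i (b # w) ?d = sgl i 1 + (sgl i s + sgl i (?d - 1 - s))" using tmm_replicate[of s "?d - 1" i "[]"] True s by simp
    thus ?thesis using Cons.prems True s by (simp add: single_add[symmetric])
   qed
   have "full i i ?d (sgl i ?d) (WT i i (%_. X i) r (b # w) (evm (%_. X i) (sqm U) :: 'k spoly))"
    by (rule full_single) (auto simp: evm_const intro: TI_zero simp del: TI.simps)
   thus ?thesis using t ei Cons.prems(1) by (intro exI[of _ "%_. X i"]) (auto intro!: lform_X simp del: tmm.simps)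
  next
   assume "EX s w'. w = replicate s True @ False # w'"
   then obtain s w' where w: "w = replicate s True @ False # w'" by blast
   have "EX l :: nat=>'k spoly. (ALL j>=r. lform i e j (l j)) &
     full i e ?d (tmm i (True # replicate s True @ False # w') ?d)
      (WT i e l r (True # replicate s True @ False # w') (evm l (sqm U)))"
    by (rule special_missing) (use Cons.prems U' w True in auto)
   thus ?thesis using True w by simp
  qed
 qed
qed
qed

section \<open>Lexsegment generators in the generic initial ideal\<close>

lemma linear_form_expand:
 assumes "f:PR n" "homogeneous (Suc 0) (f :: 'k::field_char_0 spoly)"
 shows "f = (\<Sum>a<n. scalar (lookup f (sgl a 1)) * X a)"
proof -
have k: "keys f <= (%a. sgl a 1) ` {..<n}"
proof
 fix m assume m: "m:keys f"
 hence d: "mdeg m = 1" "m:Mn n" using assms by (auto simp: homogeneous_def poly_ring_def Mon_def)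
 hence "m ~= 0" by auto
 then obtain a where a: "a:keys m" by (metis keys_eq_empty ex_in_conv)
 have "mdeg (m - sgl a 1) = 0" using mdeg_minus_single[OF a] d by simp
 hence "m = sgl a 1" using monom_minus_add[OF a] by simp
 thus "m:(%a. sgl a 1) ` {..<n}" using a d by (auto simp: Mon_def)
qed
have inj: "inj_on (%a. sgl a (1::nat)) {..<n}" by (intro inj_onI) (auto dest: arg_cong[of _ _ keys])
have "f = (SUM m:(%a. sgl a 1) ` {..<n}. scalar (lookup f m) * mon m)" by (rule poly_expand[OF _ k]) simp
also have "... = (\<Sum>a<n. scalar (lookup f (sgl a 1)) * X a)" by (subst sum.reindex[OF inj]) (simp add: X_def)
finally show ?thesis .
qed

lemma subst_rename: "f:poly_ring V ==> subst (%a. X (s a)) f:poly_ring (s ` V)"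
unfolding subst_expand[of "keys f" f "%a. X (s a)", simplified]
proof (intro poly_ring_sum poly_ring_mult poly_ring_scalar evm_in_poly_ring)
fix m j assume "m:keys f" "f:poly_ring V" "j:keys m"
hence "j:V" by (auto simp: poly_ring_def)
thus "X (s j):poly_ring (s ` V)" by (simp add: X_in_poly_ring)
qed

text \<open>Coefficients in the ideal of the word range over the whole ring \<open>R\<close>, so the
  substitution must reach this ring; otherwise one multiplies by the variables of the word.\<close>

lemma TI_preimage:
 fixes g :: "nat=>nat=>'k::field_char_0"
 assumes l: "!!j. j < R0 ==> lin n g j = l j" and "R0 <= n"
 and pre: "!!h. h:R ==> EX p:PR n. subst (lin n g) p = h"
 shows "\<tau>:TI R l r w ==> r + length w <= R0 ==>
 EX p:mideal {m:Mn n. tmem r w (keys m)}. subst (lin n g) p = \<tau>"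
proof (induction w arbitrary: r \<tau>)
case Nil
thus ?case by (intro bexI[of _ 0]) auto
next
case (Cons b w)
have rn: "r < n" "r < R0" using Cons.prems(2) assms(2) by auto
have X1: "(X r :: 'k spoly):mideal {m:Mn n. r:keys m}" using rn by (simp add: X_def Mon_def)
show ?case
proof (cases b)
 case True
 then obtain f where f: "\<tau> = l r * f" "f:TI R l (Suc r) w" using Cons.prems by auto
 obtain p where p: "p:mideal {m:Mn n. tmem (Suc r) w (keys m)}" "subst (lin n g) p = f"
  using Cons.IH[OF f(2)] Cons.prems(2) by auto
 have "X r * p:mideal {m:Mn n. tmem r (b # w) (keys m)}"
  using X1 p(1) by (rule mideal_mult) (use True in "auto simp: keys_add_nat intro: tmem_mono")
 moreover have "subst (lin n g) (X r * p) = \<tau>" using p f l[OF rn(2)] by (simp add: subst_mult)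
 ultimately show ?thesis by blast
next
 case False
 then obtain h f where f: "\<tau> = l r * h + f" "h:R" "f:TI R l (Suc r) w" using Cons.prems by auto
 obtain p where p: "p:mideal {m:Mn n. tmem (Suc r) w (keys m)}" "subst (lin n g) p = f"
  using Cons.IH[OF f(3)] Cons.prems(2) by auto
 obtain q where q: "q:PR n" "subst (lin n g) q = h" using pre[OF f(2)] by blast
 have "X r * q:mideal {m:Mn n. tmem r (b # w) (keys m)}"
  using X1 q(1)[unfolded poly_ring_eq] by (rule mideal_mult) (use False in "auto simp: keys_add_nat")
 moreover have "p:mideal {m:Mn n. tmem r (b # w) (keys m)}" using p(1) False by (auto simp: mideal_def)
 ultimately have "X r * q + p:mideal {m:Mn n. tmem r (b # w) (keys m)}" by (rule mideal_add)
 moreover have "subst (lin n g) (X r * q + p) = \<tau>" using p q f l[OF rn(2)] by (simp add: subst_mult subst_add)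
 ultimately show ?thesis by blast
qed
qed

text \<open>The forms \<open>l j\<close> need not generate the target ring, so \<open>Suc e\<close>
  spare variables from \<open>R0\<close> on are mapped to the target variables. This makes the
  matrix singular in general, and it is one reason for taking \<open>n\<close> large.\<close>

lemma special_matrix:
 fixes l :: "nat=>'k::field_char_0 spoly"
 assumes l: "ALL j>=0. lform 0 e j (l j)" and n: "R0 + Suc e <= n"
 obtains g :: "nat=>nat=>'k" where "lowz n g" "!!j. j < R0 ==> lin n g j = l j" "!!a. a <= e ==> lin n g (R0 + a) = X a"
proof -
define g where "g a j = (if j < R0 then lookup (l j) (sgl a 1) else if j = R0 + a & a <= e then 1 else 0)" for a j
have lj: "l j:poly_ring ({..<n} Int {..j})" "homogeneous (Suc 0) (l j)" for j
proof -
 have "{0..e} Int {..j} <= {..<n} Int {..j}" using n by auto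
 from poly_ring_mono[OF this] show "l j:poly_ring ({..<n} Int {..j})" using l unfolding lform_def by blast
 show "homogeneous (Suc 0) (l j)" using l unfolding lform_def by blast
qed
have "lowz n g" unfolding lowz_def
proof (intro allI impI)
 fix a j assume aj: "a < n" "j < a"
 show "g a j = 0"
 proof (cases "j < R0")
  case True
  have "sgl a (1::nat) ~: keys (l j)" using lj(1)[of j] aj by (auto simp: poly_ring_def)
  thus ?thesis using True by (simp add: g_def in_keys_iff)
 qed (use aj in "auto simp: g_def")
qed
moreover have "lin n g j = l j" if "j < R0" for j
proof -
 have "l j:PR n" using lj(1)[of j] poly_ring_mono[of "{..<n} Int {..j}" "{..<n}"] by auto
 from linear_form_expand[OF this lj(2)] show ?thesis using that by (simp add: lin_def g_def)
qed
moreover have "lin n g (R0 + a) = X a" if "a <= e" for a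
proof -
 have "lin n g (R0 + a) = (\<Sum>b<n. if b = a then X b else 0)"
  unfolding lin_def by (intro sum.cong) (use that in "auto simp: g_def")
 thus ?thesis using that n by simp
qed
ultimately show ?thesis using that by blast
qed

text \<open>The leading monomials \<open>v \<ge> tmm 0 w d\<close> involving only the first variables come from
  special coordinates; the others are multiples of generators of smaller degree by a later variable.\<close>

lemma next_lex_in_GL:
 assumes Z: "upclosed {..<n} Z"
 and T: "!!m. m:Mn n ==> tmem 0 w (keys m) ==> m:Z"
 and U: "finite U" "sqm U:Z" "~ tmem 0 w U" "nA w < card U"
 and gens: "!!w1 w2. w = w1 @ False # w2 ==> tmm 0 w1 (Suc (nA w1)):GL TYPE('k::field_char_0) n Z"
 and n: "length w <= R0" "U <= {..<R0}" "R0 + Suc (nZ w) <= n"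
 shows "tmm 0 w (card U):GL TYPE('k) n Z"
proof -
let ?d = "card U" and ?e = "nZ w"
let ?t = "tmm 0 w ?d"
have ZM: "Z <= Mn n" using Z by (simp add: upclosed_def)
obtain l :: "nat=>'k spoly" where l: "ALL j>=0. lform 0 ?e j (l j)" "full 0 ?e ?d ?t (WT 0 ?e l 0 w (evm l (sqm U)))"
 using special_coordinates[of 0 0 U w ?e, where 'k = 'k] U by auto
obtain g0 :: "nat=>nat=>'k" where g0: "lowz n g0" "!!j. j < R0 ==> lin n g0 j = l j" "!!a. a <= ?e ==> lin n g0 (R0 + a) = X a"
 using special_matrix[OF l(1) n(3)] by blast
have pre: "EX p:PR n. subst (lin n g0) p = h" if h: "h:poly_ring {0..?e}" for h
proof (rule bexI)
 show "subst (lin n g0) (subst (%a. X (R0 + a)) h) = h" unfolding subst_subst subst_X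
  using subst_cong[OF h, of "%a. lin n g0 (R0 + a)" X] g0(3) by simp
 show "subst (%a. X (R0 + a)) h:PR n"
 proof -
  have "(+) R0 ` {0..?e} <= {..<n}" using n(3) by auto
  from poly_ring_mono[OF this] show ?thesis using subst_rename[OF h, of "(+) R0"] by blast
 qed
qed
\<comment> \<open>The monomials in the target variables alone, for which the special coordinates are
  used.\<close>
let ?C = "{v:Mon {0..?e} Int Deg ?d. ?t <= v}"
have "EX p. p:mideal (Z Int Deg ?d) & subst (lin n g0) p ~= 0 & lead (subst (lin n g0) p) = v" if v: "v:?C" for v
proof -
 obtain f where f: "f:WT 0 ?e l 0 w (evm l (sqm U))" "f:poly_ring {0..?e}" "homogeneous ?d f" "f ~= 0" "lead f = v"
  using l(2) v unfolding full_def by auto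
 obtain \<tau> c where \<tau>: "\<tau>:TI (poly_ring {0..?e}) l 0 w" "f = \<tau> + scalar c * evm l (sqm U)"
  using f(1) by (auto simp: WT_def)
 obtain p where p: "p:mideal {m:Mn n. tmem 0 w (keys m)}" "subst (lin n g0) p = \<tau>"
  using TI_preimage[where ?R0.0 = R0, OF g0(2) _ pre \<tau>(1)] n by auto
 \<comment> \<open>The preimage of the ideal part need not be homogeneous; since \<open>f\<close>
   is, its component of degree \<open>?d\<close> does the same service.\<close>
 define q where "q = pr (Deg ?d) p + scalar c * mon (sqm U)"
 have "pr (Deg ?d) p:mideal (Z Int Deg ?d)" using p(1) T by (auto simp: mideal_def keys_pr)
 moreover have "scalar c * mon (sqm U):(mideal (Z Int Deg ?d) :: 'k spoly set)" using U(2) by (intro mideal_scalar) simp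
 ultimately have "q:mideal (Z Int Deg ?d)" unfolding q_def by (rule mideal_add)
 moreover have "subst (lin n g0) q = f"
 proof -
  have ev: "subst (lin n g0) (mon (sqm U)) = evm l (sqm U)" unfolding subst_mon by (rule evm_cong) (use U(1) n(2) g0(2) in auto)
  have "homogeneous ?d (evm l (sqm U))" unfolding ev[symmetric] by (rule homogeneous_subst) simp_all
  hence "pr (Deg ?d) (scalar c * evm l (sqm U)) = scalar c * evm l (sqm U)"
   by (intro pr_id) (auto simp: keys_scalar_mult homogeneous_def)
  moreover have "pr (Deg ?d) f = f" by (rule pr_id) (use f(3) in "auto simp: homogeneous_def")
  ultimately have "pr (Deg ?d) \<tau> + scalar c * evm l (sqm U) = f"
   using pr_add[of "Deg ?d" \<tau> "scalar c * evm l (sqm U)"] \<tau>(2) by simp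
  thus ?thesis unfolding q_def subst_add subst_scalar_mult ev using pr_Deg_subst[of "lin n g0" ?d p] p(2) by simp
 qed
 ultimately show ?thesis using f by blast
qed
then obtain p where p: "!!v. v:?C ==> p v:mideal (Z Int Deg ?d) & subst (lin n g0) (p v) ~= 0 & lead (subst (lin n g0) (p v)) = v"
 by metis
have finC: "finite ?C" by (rule finite_subset[of _ "Mon {0..?e} Int Deg ?d"]) auto
have "indep_at (%v. lookup (subst (lin n g0) (p v))) ?C ?C" by (rule indep_at_leads[OF finC]) (use p in auto)
moreover have "p v:PR n" if "v:?C" for v using p[OF that] ZM by (auto simp: poly_ring_eq mideal_def)
ultimately have gen: "generic_upper n (%g :: nat=>nat=>'k. indep_at (%v. lookup (subst (lin n g) (p v))) ?C ?C)"
 by (intro generic_indep[OF g0(1) finC])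
obtain g :: "nat=>nat=>'k" where g: "upper_triangular n g"
 "indep_at (%v. lookup (subst (lin n g) (p v))) ?C ?C" "!!d. leads (Wd n Z d g) = glead TYPE('k) n Z d"
 using generic_upper_ex[OF generic_upper_conj[OF gen generic_all_degrees[OF Z]]] by blast
let ?A = "{v:Mn n Int Deg ?d. ?t <= v}"
have finA: "finite ?A" by (rule finite_subset[OF _ finite_MD[of n ?d]]) auto
have "{0..?e} <= {..<n}" using n(3) by auto
from Mon_mono[OF this] have CA: "?C <= ?A" by blast
have tC: "?t:?C" using keys_tmm[of 0 w ?d] mdeg_tmm[of w ?d 0] U(4) by (auto simp: Mon_def)
\<comment> \<open>The other monomials are multiples of generators known to be initial. The
  multiplier involves a variable beyond \<open>?e\<close>, so these polynomials have no monomials in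
  the target variables, and independence can be tested on \<open>?C\<close> separately.\<close>
have "EX f. f:Wd n Z ?d g & f ~= 0 & lead f = v & keys f Int Mon {0..?e} = {}" if v: "v:?A - ?C" for v
proof -
 have "?t < v" using v tC by (auto simp: order.order_iff_strict)
 hence "vmem 0 w v" using v U(4) by (intro vmem_if_greater[of v 0 ?d]) (auto simp: Mon_def)
 then obtain w1 w2 c where w1: "w = w1 @ False # w2" "v = tmm 0 w1 (Suc (nA w1)) + c" using vmem_gens by blast
 define a where "a = tmm 0 w1 (Suc (nA w1))"
 have "a:GL TYPE('k) n Z" unfolding a_def by (rule gens[OF w1(1)])
 hence "a:leads (Wd n Z (mdeg a) g)" using GL_iff[OF ZM] g(3) by blast
 then obtain f where f: "f:Wd n Z (mdeg a) g" "f ~= 0" "lead f = a" by (auto simp: leads_def)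
 have c: "c:Mn n" "mdeg a + mdeg c = ?d" using v w1(2) by (auto simp: a_def)
 have "mon c * f:Wd n Z ?d g" using Wd_mult_mon[OF g(1) Z f(1) c(1)] c(2) by simp
 moreover have "mon c * f ~= 0" "lead (mon c * f) = v" using f lead_mon_mult[OF f(2), of c] w1(2) by (auto simp: a_def add.commute)
 moreover have "keys (mon c * f) Int Mon {0..?e} = {}"
 proof -
  have "a:Mon {0..?e}" using keys_tmm[of 0 w1 "Suc (nA w1)"] w1(1) by (auto simp: a_def Mon_def subset_iff)
  hence "c ~: Mon {0..?e}" using v w1(2) by (auto simp: a_def)
  thus ?thesis by (auto simp: keys_mon_mult)
 qed
 ultimately show ?thesis by blast
qed
hence "ALL v:?A - ?C. EX f. f:Wd n Z ?d g & f ~= 0 & lead f = v & keys f Int Mon {0..?e} = {}" by (rule ballI)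
from bchoice[OF this] obtain E where
 "ALL v:?A - ?C. E v:Wd n Z ?d g & E v ~= 0 & lead (E v) = v & keys (E v) Int Mon {0..?e} = {}" by (rule exE)
hence E: "!!v. v:?A - ?C ==> E v:Wd n Z ?d g & E v ~= 0 & lead (E v) = v & keys (E v) Int Mon {0..?e} = {}" by (rule bspec)
define q where "q v = (if v:?C then subst (lin n g) (p v) else E v)" for v
have ind: "indep_at (%v. lookup (q v)) ?A ?A" unfolding indep_at_def
proof (intro allI impI)
 fix c assume c: "ALL m:?A. (SUM v:?A. c v * lookup (q v) m) = 0"
 have split: "(SUM v:?A. c v * lookup (q v) m) = (SUM v:?C. c v * lookup (subst (lin n g) (p v)) m) + (SUM v:?A - ?C. c v * lookup (E v) m)" for m
 proof -
  have "(SUM v:?A. c v * lookup (q v) m) = (SUM v:?C. c v * lookup (q v) m) + (SUM v:?A - ?C. c v * lookup (q v) m)"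
   using sum.subset_diff[OF CA finA] by (simp add: add.commute)
  moreover have "(SUM v:?C. c v * lookup (q v) m) = (SUM v:?C. c v * lookup (subst (lin n g) (p v)) m)"
   by (rule sum.cong) (auto simp: q_def)
  moreover have "(SUM v:?A - ?C. c v * lookup (q v) m) = (SUM v:?A - ?C. c v * lookup (E v) m)"
   by (rule sum.cong) (simp_all only: q_def Diff_iff if_False)
  ultimately show ?thesis by simp
 qed
 have "(SUM v:?C. c v * lookup (subst (lin n g) (p v)) m) = 0" if m: "m:?C" for m
 proof -
  have "(SUM v:?A - ?C. c v * lookup (E v) m) = 0"
  proof (rule sum.neutral, rule ballI)
   fix v assume "v:?A - ?C"
   hence "m ~: keys (E v)" using E m by blast
   thus "c v * lookup (E v) m = 0" by (simp add: in_keys_iff)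
  qed
  moreover have "m:?A" using m CA by blast
  ultimately show ?thesis using c split[of m] by simp
 qed
 hence c0: "ALL v:?C. c v = 0" using g(2) unfolding indep_at_def by blast
 have "indep_at (%v. lookup (E v)) (?A - ?C) ?A" by (rule indep_at_leads) (use finA E in auto)
 moreover have "(SUM v:?A - ?C. c v * lookup (E v) m) = 0" if "m:?A" for m using c[rule_format, OF that] c0 split[of m] by simp
 ultimately have "ALL v:?A - ?C. c v = 0" unfolding indep_at_def by blast
 thus "ALL v:?A. c v = 0" using c0 by blast
qed
have "card ?A <= card (leads (Wd n Z ?d g) Int {?t..})"
proof (rule family_leads_Wd[OF finA _ _ ind])
 show "q v:Wd n Z ?d g" if "v:?A" for v
 proof (cases "v:?C")
  case True
  thus ?thesis using p[OF True] by (auto simp: q_def Wd_def)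
 next
  case False
  hence "v:?A - ?C" using that by blast
  thus ?thesis using E False by (simp add: q_def)
 qed
qed auto
moreover have "leads (Wd n Z ?d g) Int {?t..} <= ?A" using leads_Wd_subset[of n Z ?d g] by auto
ultimately have "leads (Wd n Z ?d g) Int {?t..} = ?A" using finA by (intro card_seteq) auto
hence "?t:leads (Wd n Z ?d g)" using tC CA by blast
thus ?thesis using g(3) unfolding GL_def by blast
qed

lemma sfam_finite: "sfam \<F> ==> F:\<F> ==> finite F" by (simp add: sfam_def)

lemma sfam_up: "sfam \<F> ==> F:\<F> ==> finite G ==> F <= G ==> G:\<F>" unfolding sfam_def by blast

lemma sfam_shift: "sfam \<F> ==> F:\<F> ==> j:F ==> i < j ==> i ~: F ==> insert i (F - {j}):\<F>" unfolding sfam_def by blast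

lemma upclosed_sqU: "sfam \<F> ==> upclosed UNIV (sqU \<F>)"
unfolding upclosed_def sqU_def by (auto simp: keys_add_nat intro: sfam_up)

lemma bnd_sqU: "sfam \<F> ==> fbnd n \<F> ==> bnd n (sqU \<F>)"
unfolding bnd_def sqU_def fbnd_def by (auto simp: keys_mres intro: sfam_up)

text \<open>Strong induction over the prefixes of the word: the generator that ends a prefix is
  obtained with \<open>U\<close> the set \<open>fnew\<close> of this prefix, and the last claim uses
  all these generators. The number of variables is chosen depending on \<open>w\<close> and
  \<open>U\<close>.\<close>

lemma lexsegment_in_ginset:
 assumes F: "sfam \<F>" "fbnd n0 \<F>" and T: "!!F. finite F ==> tmem 0 w F ==> F:\<F>"
 shows "!!w1 w2. w = w1 @ False # w2 ==> tmm 0 w1 (Suc (nA w1)):ginset TYPE('k::field_char_0) n0 (sqU \<F>)"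
 and "!!U. U:\<F> ==> ~ tmem 0 w U ==> nA w < card U ==> tmm 0 w (card U):ginset TYPE('k) n0 (sqU \<F>)"
proof -
let ?N = "ginset TYPE('k) n0 (sqU \<F>)"
have up: "upclosed UNIV (sqU \<F>)" and bnd: "bnd n0 (sqU \<F>)" using upclosed_sqU[OF F(1)] bnd_sqU[OF F] .
have key: "tmm 0 w (card U):?N"
 if T: "!!F. finite F ==> tmem 0 w F ==> F:\<F>" and U: "U:\<F>" "~ tmem 0 w U" "nA w < card U"
  and gens: "!!w1 w2. w = w1 @ False # w2 ==> tmm 0 w1 (Suc (nA w1)):?N" for w U
proof -
 have finU: "finite U" using F(1) U(1) by (auto simp: sfam_def)
 define R0 where "R0 = Max (insert (length w) (insert n0 (Suc ` U)))"
 have fin: "finite (insert (length w) (insert n0 (Suc ` U)))" using finU by simp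
 have R0: "length w <= R0" "n0 <= R0" unfolding R0_def by (rule Max_ge[OF fin], simp)+
 have UR0: "U <= {..<R0}"
 proof
  fix x assume "x:U"
  hence "Suc x <= R0" unfolding R0_def by (intro Max_ge[OF fin]) simp
  thus "x:{..<R0}" by simp
 qed
 define n where "n = R0 + Suc (nZ w)"
 have n: "n0 <= n" using R0 by (simp add: n_def)
 have "tmm 0 w (card U):GL TYPE('k) n (sqU \<F> Int Mn n)"
 proof (rule next_lex_in_GL[OF upclosed_Int_Mon[OF up] _ finU _ U(2,3) _ R0(1) UR0])
  show "m:sqU \<F> Int Mn n" if "m:Mn n" "tmem 0 w (keys m)" for m using T[of "keys m"] that by (simp add: sqU_def)
  show "sqm U:sqU \<F> Int Mn n" using U(1) finU UR0 by (auto simp: sqU_def Mon_def n_def)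
  show "tmm 0 w1 (Suc (nA w1)):GL TYPE('k) n (sqU \<F> Int Mn n)" if w: "w = w1 @ False # w2" for w1 w2
  proof -
   have "tmm 0 w1 (Suc (nA w1)):Mn n" using keys_tmm[of 0 w1 "Suc (nA w1)"] w by (auto simp: Mon_def n_def subset_iff)
   thus ?thesis using gens[OF w] unfolding ginset_Mon[OF up bnd n, symmetric] by simp
  qed
  show "R0 + Suc (nZ w) <= n" by (simp add: n_def)
 qed
 thus ?thesis unfolding ginset_Mon[OF up bnd n, symmetric] by simp
qed
have all: "tmm 0 w1 (Suc (nA w1)):?N" if "w = w1 @ False # w2" for w1 w2 using that
proof (induction "length w1" arbitrary: w1 w2 rule: less_induct)
 case less
 let ?U = "fnew 0 w1 (Suc (nA w1))"
 have T1: "F:\<F>" if "finite F" "tmem 0 w1 F" for F using T[OF that(1)] tmem_append[OF that(2)] less.prems by simp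
 have c: "card ?U = Suc (nA w1)" by (rule card_fnew) simp
 have "tmem 0 (w1 @ replicate 0 True @ [False]) ?U" unfolding tmem_snoc by simp
 hence "tmem 0 (w1 @ [False]) ?U" by simp
 from tmem_append[OF this, of w2] have "?U:\<F>" using T[of ?U] less.prems finite_fnew by simp
 have "tmm 0 w1 (card ?U):?N"
 proof (rule key[OF T1 \<open>?U:\<F>\<close> not_tmem_fnew])
  show "nA w1 < card ?U" using c by simp
  fix v1 v2 assume v: "w1 = v1 @ False # v2"
  show "tmm 0 v1 (Suc (nA v1)):?N" by (rule less.hyps[of v1 "v2 @ False # w2"]) (use v less.prems in auto)
 qed
 thus ?case using c by simp
qed
thus "!!w1 w2. w = w1 @ False # w2 ==> tmm 0 w1 (Suc (nA w1)):?N" by blast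
show "!!U. U:\<F> ==> ~ tmem 0 w U ==> nA w < card U ==> tmm 0 w (card U):?N" by (rule key[OF T]) (use all in auto)
qed

section \<open>Counting squarefree monomials\<close>

definition scount :: "nat=>nat=>nat=>nat set set=>nat" where "scount r N d \<F> = card {F:\<F>. F <= {r..<N} & card F = d}"

lemma finite_scount [simp]: "finite {F:\<F>. F <= {r..<N::nat} & card F = d}" by (rule finite_subset[of _ "Pow {r..<N}"]) auto

lemma keys_exact:
 assumes "finite F"
 shows "{m. keys m = F & mdeg m = d} = (if card F <= d then (+) (sqm F) ` (Mon F Int Deg (d - card F)) else {})"
proof -
have "m:(+) (sqm F) ` (Mon F Int Deg (d - card F)) & card F <= d" if m: "keys m = F" "mdeg m = d" for m
proof -
 have "ALL i. lookup (sqm F) i <= lookup m i" using m assms by (auto simp: lookup_sqm in_keys_iff Suc_le_eq)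
 then obtain c where c: "m = sqm F + c" using mdvd_iff[of "sqm F" m] by auto
 have "keys c <= F" using m c by (auto simp: keys_add_nat)
 moreover have "card F + mdeg c = d" using m c assms by (simp add: mdeg_sqm)
 ultimately show ?thesis using c by (auto simp: Mon_def)
qed
moreover have "keys (sqm F + c) = F" if "c:Mon F" for c using that assms by (auto simp: keys_add_nat Mon_def keys_sqm)
ultimately show ?thesis using assms by (auto simp: mdeg_sqm)
qed

lemma card_keys_exact:
 assumes "finite F"
 shows "card {m. keys m = F & mdeg m = d} = (if card F <= d then card (Mon {..<card F} Int Deg (d - card F)) else 0)"
using card_Mon_eq[OF assms, of "{..<card F}"] by (simp add: keys_exact[OF assms] card_translate)

lemma finite_keys_exact: "finite F ==> finite {m. keys m = F & mdeg m = (d::nat)}"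
by (rule finite_subset[OF _ finite_Mon_Deg[of F d]]) (auto simp: Mon_def)

text \<open>Monomials are grouped by support; the number with a given support depends on its size
  alone.\<close>

lemma card_sqU:
 assumes "!!F. F:\<F> ==> finite F"
 shows "card (sqU \<F> Int Mn n Int Deg d) = (\<Sum>k\<le>d. scount 0 n k \<F> * card (Mn k Int Deg (d - k)))"
proof -
let ?A = "{F:\<F>. F <= {0..<n} & card F <= d}" and ?h = "%k. card (Mn k Int Deg (d - k))"
have finA: "finite ?A" by (rule finite_subset[of _ "Pow {0..<n}"]) auto
have "card (keys m) <= mdeg m" for m using card_keys_exact[of "keys m" "mdeg m"] finite_keys_exact[of "keys m" "mdeg m"]
 by (auto split: if_splits simp: card_eq_0_iff)
hence "sqU \<F> Int Mn n Int Deg d = (UN F:?A. {m. keys m = F & mdeg m = d})" by (auto simp: sqU_def Mon_def subset_iff)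
hence "card (sqU \<F> Int Mn n Int Deg d) = (SUM F:?A. card {m. keys m = F & mdeg m = d})"
 using assms by (auto intro!: card_UN_disjoint finA finite_keys_exact)
also have "... = (SUM F:?A. ?h (card F))" by (rule sum.cong) (use assms in "auto simp: card_keys_exact")
also have "... = (\<Sum>k\<le>d. SUM F:{F:?A. card F = k}. ?h (card F))" by (rule sum.group[symmetric]) (use finA in auto)
also have "... = (\<Sum>k\<le>d. scount 0 n k \<F> * ?h k)"
proof (rule sum.cong[OF refl])
 fix k assume "k:{..d}"
 hence "{F:?A. card F = k} = {F:\<F>. F <= {0..<n} & card F = k}" by auto
 thus "(SUM F:{F:?A. card F = k}. ?h (card F)) = scount 0 n k \<F> * ?h k" by (simp add: scount_def)
qed
finally show ?thesis .
qed

text \<open>The relation between the Hilbert function and the numbers of squarefree monomials is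
  unitriangular, hence invertible degree by degree.\<close>

lemma scount_eq:
 assumes "!!F. F:\<F> ==> finite F" "!!F. F:\<G> ==> finite F"
 and "!!d. d <= e ==> card (sqU \<F> Int Mn n Int Deg d) = card (sqU \<G> Int Mn n Int Deg d)"
 shows "d <= e ==> scount 0 n d \<F> = scount 0 n d \<G>"
proof (induction d rule: less_induct)
case (less d)
let ?h = "%k. card (Mn k Int Deg (d - k))"
have "Mn d Int Deg 0 = {0}" by auto
hence h: "?h d = 1" by simp
have "(\<Sum>k\<le>d. scount 0 n k \<F> * ?h k) = (\<Sum>k\<le>d. scount 0 n k \<G> * ?h k)"
 using assms(3)[OF less.prems] card_sqU[of \<F> n d] card_sqU[of \<G> n d] assms(1,2) by simp
moreover have "(\<Sum>k<d. scount 0 n k \<F> * ?h k) = (\<Sum>k<d. scount 0 n k \<G> * ?h k)"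
 by (rule sum.cong) (use less in auto)
ultimately have "scount 0 n d \<F> * ?h d = scount 0 n d \<G> * ?h d"
 by (simp only: lessThan_Suc_atMost[symmetric] sum.lessThan_Suc add_left_cancel)
thus ?case unfolding h by simp
qed

section \<open>Families of words\<close>

definition Tw :: "nat=>bool list=>nat set set" where "Tw r w = {F. finite F & F <= {r..} & tmem r w F}"

definition slex :: "nat set=>nat set=>bool" where
 "slex G F \<longleftrightarrow> (EX i. i:G & i ~: F & (ALL j<i. j:G \<longleftrightarrow> j:F))"

lemma lex_greater_sqm: "finite F ==> finite G ==> lex_greater (sqm G) (sqm F) \<longleftrightarrow> slex G F"
unfolding lex_greater_def slex_def by (auto simp: lookup_sqm split: if_splits)

lemma slex_total: "F = G \<or> slex F G \<or> slex G F"
proof (cases "F = G")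
case False
hence ex: "EX i. (i:F) ~= (i:G)" by blast
define i where "i = (LEAST i. (i:F) ~= (i:G))"
have "(i:F) ~= (i:G)" unfolding i_def by (rule LeastI_ex[OF ex])
moreover have "ALL j<i. (j:F) = (j:G)" unfolding i_def using not_less_Least by blast
ultimately show ?thesis unfolding slex_def by blast
qed simp

lemma tmem_slex: "tmem r w F ==> i:G ==> i ~: F ==> r <= i ==> ALL j<i. j:G \<longleftrightarrow> j:F ==> tmem r w G"
proof (induction w arbitrary: r)
case (Cons b w)
show ?case
proof (cases "i = r")
 case True
 thus ?thesis using Cons.prems by (cases b) auto
next
 case False
 thus ?thesis using Cons.prems Cons.IH[of "Suc r"] by (auto split: if_splits)
qed
qed simp

text \<open>The sets of exponents of squarefree lexsegment ideals in the variables from \<open>r\<close> on.\<close>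

definition lexfam :: "nat=>nat set set=>bool" where
 "lexfam r \<F> \<longleftrightarrow> (ALL F:\<F>. finite F & F <= {r..}) & (ALL F:\<F>. ALL G. finite G --> G <= {r..} --> F <= G --> G:\<F>) &
 (ALL F:\<F>. ALL G. finite G --> G <= {r..} --> card G = card F --> slex G F --> G:\<F>)"

lemma lexfamD:
 assumes "lexfam r \<F>" "F:\<F>"
 shows "finite F" "F <= {r..}" "finite G ==> G <= {r..} ==> F <= G ==> G:\<F>"
 "finite G ==> G <= {r..} ==> card G = card F ==> slex G F ==> G:\<F>"
proof -
note * = assms(1)[unfolded lexfam_def]
show "finite F" "F <= {r..}" using bspec[OF conjunct1[OF *] assms(2)] by simp_all
show "G:\<F>" if "finite G" "G <= {r..}" "F <= G" using bspec[OF conjunct1[OF conjunct2[OF *]] assms(2), rule_format, OF that] .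
show "G:\<F>" if "finite G" "G <= {r..}" "card G = card F" "slex G F"
 using bspec[OF conjunct2[OF conjunct2[OF *]] assms(2), rule_format, OF that] .
qed

lemma lexfam_Tw: "lexfam r (Tw r w)" unfolding lexfam_def Tw_def slex_def by (auto intro: tmem_mono tmem_slex)

text \<open>The word is read off one variable at a time: \<open>False\<close> if the singleton is a
  member, and \<open>True\<close> otherwise, when every member contains the variable.\<close>

lemma lexfam_word:
 assumes "lexfam r \<F>" "fbnd n \<F>" "{} ~: \<F>"
 shows "EX w. \<F> = Tw r w" using assms
proof (induction "n - r" arbitrary: r \<F>)
case 0
have "F ~: \<F>" for F
proof
 assume F: "F:\<F>"
 hence "F Int {..<n} = {}" using lexfamD(2)[OF 0(2) F] 0(1) by fastforce
 thus False using 0(3,4) F by (auto simp: fbnd_def)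
qed
hence "\<F> = Tw r []" by (auto simp: Tw_def)
thus ?case by blast
next
case (Suc k)
have fin: "finite F" "F <= {r..}" if "F:\<F>" for F by (fact lexfamD[OF Suc.prems(1) that])+
have up: "G:\<F>" if "F:\<F>" "finite G" "G <= {r..}" "F <= G" for F G by (rule lexfamD(3)[OF Suc.prems(1) that])
have lx: "G:\<F>" if "F:\<F>" "finite G" "G <= {r..}" "card G = card F" "slex G F" for F G
 by (rule lexfamD(4)[OF Suc.prems(1) that])
have b: "F Int {..<n}:\<F>" if "F:\<F>" for F using Suc.prems(2) that by (auto simp: fbnd_def)
have sub: "G <= {r..} \<longleftrightarrow> G <= {Suc r..}" if "r ~: G" for G
 using that by (auto simp: subset_iff Suc_le_eq order.order_iff_strict)
have rn: "r < n" using Suc.hyps(2) by simp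
show ?case
proof (cases "{r}:\<F>")
 case True
 let ?F' = "{F:\<F>. r ~: F}"
 have "lexfam (Suc r) ?F'" unfolding lexfam_def
 proof (intro conjI ballI allI impI CollectI)
  fix F G assume FG: "F:?F'" "finite G" "G <= {Suc r..}"
  hence G: "r ~: G" "G <= {r..}" using sub[of G] by auto
  { assume "F <= G" thus "G:\<F>" "r ~: G" using up[of F G] FG G by auto }
  { assume "card G = card F" "slex G F" thus "G:\<F>" "r ~: G" using lx[of F G] FG G by auto }
 qed (use fin in "simp_all add: sub[symmetric]")
 moreover have "fbnd n ?F'" using b by (auto simp: fbnd_def)
 moreover have "{} ~: ?F'" using Suc.prems by auto
 moreover have "k = n - Suc r" using Suc.hyps(2) by simp
 ultimately obtain w where w: "?F' = Tw (Suc r) w" using Suc.hyps(1)[of "Suc r" ?F'] by blast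
 have "F:\<F> \<longleftrightarrow> F:Tw r (False # w)" for F
 proof (cases "r:F")
  case rF: True
  thus ?thesis using up[OF True, of F] fin[of F] by (auto simp: Tw_def)
 next
  case False
  hence "F:\<F> \<longleftrightarrow> F:Tw (Suc r) w" using w by blast
  thus ?thesis using False sub[of F] by (auto simp: Tw_def)
 qed
 thus ?thesis by blast
next
 case False
 have all: "r:F" if F: "F:\<F>" for F
 proof (rule ccontr)
  assume r: "r ~: F"
  let ?H = "F Int {..<n}"
  have H: "?H:\<F>" using b[OF F] .
  hence "?H ~= {}" using Suc.prems(3) by auto
  hence c: "card ?H > 0" by (simp add: card_gt_0_iff)
  \<comment> \<open>A member without \<open>r\<close> is preceded in lex order by \<open>r\<close>
    together with elements beyond \<open>n\<close>, and truncating these at \<open>n\<close> leaves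
    the singleton.\<close>
  let ?G = "insert r {n..<n + (card ?H - 1)}"
  have "?G:\<F>"
  proof (rule lx[OF H])
   show "card ?G = card ?H" using rn c by (subst card_insert_disjoint) auto
   show "slex ?G ?H" unfolding slex_def using r fin[OF F] rn by (intro exI[of _ r]) auto
  qed (use rn in auto)
  from b[OF this] have "{r}:\<F>"
  proof -
   have "?G Int {..<n} = {r}" using rn by auto
   thus ?thesis using \<open>?G Int {..<n}:\<F>\<close> by simp
  qed
  thus False using False by simp
 qed
 let ?F' = "{G. r ~: G & insert r G:\<F>}"
 have fin': "finite G" "G <= {Suc r..}" if "G:?F'" for G using fin[of "insert r G"] sub[of G] that by auto
 have "lexfam (Suc r) ?F'" unfolding lexfam_def
 proof (intro conjI ballI allI impI CollectI)
  fix F G assume FG: "F:?F'" "finite G" "G <= {Suc r..}"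
  hence G: "r ~: G" "insert r G <= {r..}" using sub[of G] by auto
  { assume "F <= G" thus "insert r G:\<F>" "r ~: G" using up[of "insert r F" "insert r G"] FG G by auto }
  { assume a: "card G = card F" "slex G F"
   have "slex (insert r G) (insert r F)"
   proof -
    obtain i where i: "i:G" "i ~: F" "ALL j<i. j:G \<longleftrightarrow> j:F" using a(2) by (auto simp: slex_def)
    hence "i ~= r" using G(1) by blast
    thus ?thesis unfolding slex_def using i by (intro exI[of _ i]) auto
   qed
   thus "insert r G:\<F>" "r ~: G" using lx[of "insert r F" "insert r G"] FG G a(1) fin'(1)[OF FG(1)] by auto }
 qed (use fin' in auto)
 moreover have "fbnd n ?F'"
 proof -
  have "insert r (G Int {..<n}) = insert r G Int {..<n}" for G using rn by auto
  thus ?thesis using b by (auto simp: fbnd_def)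
 qed
 moreover have "{} ~: ?F'" using False by auto
 moreover have "k = n - Suc r" using Suc.hyps(2) by simp
 ultimately obtain w where w: "?F' = Tw (Suc r) w" using Suc.hyps(1)[of "Suc r" ?F'] by blast
 have "F:\<F> \<longleftrightarrow> F:Tw r (True # w)" for F
 proof (cases "r:F")
  case rF: True
  have "F:\<F> \<longleftrightarrow> F - {r}:?F'" using rF by (auto simp: insert_absorb)
  also have "... \<longleftrightarrow> F - {r}:Tw (Suc r) w" using w by blast
  also have "... \<longleftrightarrow> F:Tw r (True # w)"
  proof -
   have "(F - {r}) Int {Suc r..} = F Int {Suc r..}" by auto
   from tmem_cong[OF this, of w] show ?thesis using rF sub[of "F - {r}"] by (auto simp: Tw_def)
  qed
  finally show ?thesis .
 qed (use all in "auto simp: Tw_def")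
 thus ?thesis by blast
qed
qed

text \<open>Lex segments among the sets of size \<open>d\<close> are nested, so a set in only one of
  them would make the counts differ.\<close>

lemma lexfam_count_unique:
 assumes "lexfam 0 \<F>" "lexfam 0 \<G>" "scount 0 N d \<F> = scount 0 N d \<G>"
 and F: "F:\<F>" "F <= {..<N}" "card F = d"
 shows "F:\<G>"
proof (rule ccontr)
assume nG: "F ~: \<G>"
have finF: "finite F" using F(2) finite_subset by blast
have "{H:\<G>. H <= {0..<N} & card H = d} \<subset> {H:\<F>. H <= {0..<N} & card H = d}"
proof (intro psubsetI subsetI)
 fix H assume H: "H:{H:\<G>. H <= {0..<N} & card H = d}"
 hence finH: "finite H" using finite_subset by blast
 have "slex H F"
 proof -
  have "H ~= F" using nG H by auto
  moreover have "~ slex F H" using lexfamD(4)[OF assms(2), of H F] nG H F(3) finF by auto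
  ultimately show ?thesis using slex_total[of H F] by blast
 qed
 hence "H:\<F>" using lexfamD(4)[OF assms(1) F(1), of H] H F(3) finH by auto
 thus "H:{H:\<F>. H <= {0..<N} & card H = d}" using H by simp
next
 show "{H:\<G>. H <= {0..<N} & card H = d} ~= {H:\<F>. H <= {0..<N} & card H = d}" using F nG by (auto simp: atLeast0LessThan)
qed
hence "scount 0 N d \<G> < scount 0 N d \<F>" unfolding scount_def by (intro psubset_card_mono) simp
thus False using assms(3) by simp
qed

section \<open>Shifted families determined by their counting functions\<close>

definition rfam :: "nat=>nat set set=>bool" where
 "rfam r \<F> \<longleftrightarrow> (ALL F:\<F>. finite F & F <= {r..}) & (ALL F:\<F>. ALL G. finite G --> G <= {r..} --> F <= G --> G:\<F>) &
 (ALL F:\<F>. ALL j:F. ALL i<j. r <= i --> i ~: F --> insert i (F - {j}):\<F>)"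

lemma rfamD:
 assumes "rfam r \<F>" "F:\<F>"
 shows "finite F" "F <= {r..}" "finite G ==> G <= {r..} ==> F <= G ==> G:\<F>"
 "j:F ==> i < j ==> r <= i ==> i ~: F ==> insert i (F - {j}):\<F>"
proof -
note * = assms(1)[unfolded rfam_def]
show "finite F" "F <= {r..}" using bspec[OF conjunct1[OF *] assms(2)] by simp_all
show "G:\<F>" if "finite G" "G <= {r..}" "F <= G" using bspec[OF conjunct1[OF conjunct2[OF *]] assms(2), rule_format, OF that] .
show "insert i (F - {j}):\<F>" if "j:F" "i < j" "r <= i" "i ~: F"
 using bspec[OF conjunct2[OF conjunct2[OF *]] assms(2), rule_format, OF that] .
qed

lemma scount_first_generator:
 assumes "!!F. finite F ==> F <= {r..} ==> r:F ==> F:\<G>"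
 shows "scount r N d \<G> = card {F. r:F & F <= {r..<N} & card F = d} + scount (Suc r) N d {F:\<G>. r ~: F}"
proof -
let ?A = "{F. r:F & F <= {r..<N} & card F = d}"
have 1: "{F:\<G>. F <= {r..<N} & card F = d} = ?A Un {F:{F:\<G>. r ~: F}. F <= {Suc r..<N} & card F = d}"
proof (intro subset_antisym subsetI)
 fix F assume F: "F:{F:\<G>. F <= {r..<N} & card F = d}"
 show "F:?A Un {F:{F:\<G>. r ~: F}. F <= {Suc r..<N} & card F = d}"
  using F by (cases "r:F") (auto simp: subset_iff Suc_le_eq order.order_iff_strict)
next
 fix F assume F: "F:?A Un {F:{F:\<G>. r ~: F}. F <= {Suc r..<N} & card F = d}"
 hence s: "F <= {r..<N}" "card F = d" by force+
 have "F:\<G>"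
 proof (cases "r:F")
  case True
  have "finite F" using s finite_subset by blast
  moreover have "F <= {r..}" using s by auto
  ultimately show ?thesis using True assms by blast
 qed (use F in auto)
 thus "F:{F:\<G>. F <= {r..<N} & card F = d}" using s by simp
qed
have "finite ?A" by (rule finite_subset[of _ "Pow {r..<N}"]) auto
thus ?thesis unfolding scount_def 1 by (intro card_Un_disjoint) auto
qed

lemma scount_common_element:
 assumes "r < N"
 shows "card {F:\<G>. r:F & F <= {r..<N} & card F = Suc d} = scount (Suc r) N d {G. r ~: G & insert r G:\<G>}"
unfolding scount_def
proof (rule bij_betw_same_card[symmetric])
show "bij_betw (insert r) {F:{G. r ~: G & insert r G:\<G>}. F <= {Suc r..<N} & card F = d}
 {F:\<G>. r:F & F <= {r..<N} & card F = Suc d}" unfolding bij_betw_def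
proof (intro conjI subset_antisym subsetI)
 show "inj_on (insert r) {F:{G. r ~: G & insert r G:\<G>}. F <= {Suc r..<N} & card F = d}" by (rule inj_onI) auto
next
 fix F assume "F:insert r ` {F:{G. r ~: G & insert r G:\<G>}. F <= {Suc r..<N} & card F = d}"
 then obtain G where G: "F = insert r G" "r ~: G" "F:\<G>" "G <= {Suc r..<N}" "card G = d" by auto
 have "finite G" using G(4) finite_subset by blast
 thus "F:{F:\<G>. r:F & F <= {r..<N} & card F = Suc d}" using G assms by auto
next
 fix F assume F: "F:{F:\<G>. r:F & F <= {r..<N} & card F = Suc d}"
 have "finite F" using F finite_subset by blast
 moreover have "F - {r} <= {Suc r..<N}" using F by (auto simp: subset_iff Suc_le_eq order.order_iff_strict)
 ultimately have "F - {r}:{F:{G. r ~: G & insert r G:\<G>}. F <= {Suc r..<N} & card F = d}" using F by (auto simp: insert_absorb)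
 moreover have "F = insert r (F - {r})" using F by auto
 ultimately show "F:insert r ` {F:{G. r ~: G & insert r G:\<G>}. F <= {Suc r..<N} & card F = d}" by (rule rev_image_eqI)
qed
qed

text \<open>If some member of \<open>\<F>\<close> missed \<open>r\<close> in the case of the letter \<open>True\<close>, then by shiftedness \<open>\<F>\<close>
  would contain all subsets of \<open>{r..<N}\<close> with one element removed, one more than \<open>Tw r (True # w)\<close> can have.\<close>

lemma shifted_count_unique:
 assumes "rfam r \<F>" "!!N d. N0 <= N ==> scount r N d \<F> = scount r N d (Tw r w)"
 shows "\<F> = Tw r w" using assms
proof (induction w arbitrary: r \<F> N0)
case Nil
have "F ~: \<F>" for F
proof
 assume F: "F:\<F>"
 hence fin: "finite F" "F <= {r..}" using rfamD[OF Nil.prems(1) F] by blast+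
 define N where "N = max N0 (Suc (Max (insert 0 F)))"
 have "x < N" if "x:F" for x using Max_ge[of "insert 0 F" x] fin that by (auto simp: N_def less_Suc_eq_le le_max_iff_disj less_max_iff_disj)
 hence "F:{F:\<F>. F <= {r..<N} & card F = card F}" using F fin by auto
 hence "F:{G:\<F>. G <= {r..<N} & card G = card F}" by simp
 hence "scount r N (card F) \<F> ~= 0" unfolding scount_def by (auto simp: card_eq_0_iff simp del: mem_Collect_eq)
 moreover have "scount r N (card F) (Tw r []) = 0" by (simp add: scount_def Tw_def)
 ultimately show False using Nil.prems(2)[of N "card F"] by (simp add: N_def)
qed
thus ?case by (auto simp: Tw_def)
next
case (Cons b w)
have fin: "finite F" "F <= {r..}" if "F:\<F>" for F by (fact rfamD[OF Cons.prems(1) that])+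
have up: "G:\<F>" if "F:\<F>" "finite G" "G <= {r..}" "F <= G" for F G by (rule rfamD(3)[OF Cons.prems(1) that])
have sh: "insert i (F - {j}):\<F>" if "F:\<F>" "j:F" "i < j" "r <= i" "i ~: F" for F i j by (rule rfamD(4)[OF Cons.prems(1) that])
have sub: "G <= {r..} \<longleftrightarrow> G <= {Suc r..}" if "r ~: G" for G
 using that by (auto simp: subset_iff Suc_le_eq order.order_iff_strict)
define N1 where "N1 = max N0 (Suc r)"
have N1: "N0 <= N" "r < N" if "N1 <= N" for N using that by (auto simp: N1_def)
show ?case
proof (cases b)
 case False
 have T1: "F:Tw r (False # w)" if "finite F" "F <= {r..}" "r:F" for F using that by (simp add: Tw_def)
 have T2: "{F:Tw r (False # w). r ~: F} = Tw (Suc r) w" using sub by (auto simp: Tw_def)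
 \<comment> \<open>The counts provide some singleton, and shifting moves it to
   \<open>r\<close>.\<close>
 have r1: "{r}:\<F>"
 proof -
  have "{r}:{F:Tw r (False # w). F <= {r..<N1} & card F = 1}" using N1[of N1] by (simp add: Tw_def)
  hence "scount r N1 1 (Tw r (False # w)) ~= 0" unfolding scount_def by (auto simp: card_eq_0_iff simp del: mem_Collect_eq)
  hence "scount r N1 1 \<F> ~= 0" using Cons.prems(2)[of N1 1] N1[of N1] False by simp
  hence "{F:\<F>. F <= {r..<N1} & card F = 1} ~= {}" unfolding scount_def by (metis card.empty)
  then obtain F where F: "F:\<F>" "card F = 1" by blast
  then obtain j where j: "F = {j}" by (meson card_1_singletonE)
  have "r <= j" using fin[OF F(1)] j by simp
  thus ?thesis using sh[OF F(1), of j r] j F(1) by (cases "j = r") auto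
 qed
 have F1: "F:\<F>" if "finite F" "F <= {r..}" "r:F" for F using up[OF r1] that by simp
 have eqF: "{F:\<F>. r ~: F} = Tw (Suc r) w"
 proof (rule Cons.IH)
  show "rfam (Suc r) {F:\<F>. r ~: F}" unfolding rfam_def
  proof (intro conjI ballI allI impI CollectI)
   fix F G assume FG: "F:{F:\<F>. r ~: F}" "finite G" "G <= {Suc r..}" "F <= G"
   hence G: "r ~: G" "G <= {r..}" using sub[of G] by auto
   thus "G:\<F>" "r ~: G" using up[of F G] FG by auto
  next
   fix F j i assume "F:{F:\<F>. r ~: F}" "j:F" "i < j" "Suc r <= i" "i ~: F"
   thus "insert i (F - {j}):\<F>" "r ~: insert i (F - {j})" using sh[of F j i] by auto
  qed (use fin in "simp_all add: sub[symmetric]")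
  show "scount (Suc r) N d {F:\<F>. r ~: F} = scount (Suc r) N d (Tw (Suc r) w)" if "N0 <= N" for N d
   using scount_first_generator[of r, OF F1, of N d] scount_first_generator[of r, OF T1, of N d] Cons.prems(2)[OF that, of d]
   unfolding T2 using False by simp
 qed
 moreover have "F:\<F> \<longleftrightarrow> F:Tw r (False # w)" if "r:F" for F
 proof
  assume "F:\<F>" from T1[OF fin[OF this] that] show "F:Tw r (False # w)" .
 next
  assume "F:Tw r (False # w)"
  hence "finite F" "F <= {r..}" unfolding Tw_def by blast+
  from F1[OF this that] show "F:\<F>" .
 qed
 moreover have "F:\<F> \<longleftrightarrow> F:Tw r (False # w)" if "r ~: F" for F
 proof -
  have "F:{F:\<F>. r ~: F} \<longleftrightarrow> F:{F:Tw r (False # w). r ~: F}" unfolding eqF T2 ..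
  thus ?thesis using that by simp
 qed
 ultimately have "F:\<F> \<longleftrightarrow> F:Tw r (False # w)" for F by blast
 thus ?thesis using False by (simp add: set_eq_iff)
next
 case True
 have all: "r:F" if F: "F:\<F>" for F
 proof (rule ccontr)
  assume r: "r ~: F"
  define N where "N = max N1 (Suc (Max (insert 0 F)))"
  have "x < N" if "x:F" for x using Max_ge[of "insert 0 F" x] fin[OF F] that by (auto simp: N_def less_Suc_eq_le le_max_iff_disj less_max_iff_disj)
  hence "F <= {Suc r..<N}" using r fin[OF F] sub[OF r] by auto
  hence "{Suc r..<N}:\<F>" using up[OF F, of "{Suc r..<N}"] by (simp add: subset_iff)
  have rN: "N0 <= N" "r < N" using N1[of N] by (auto simp: N_def)
  \<comment> \<open>\<open>{Suc r..<N}\<close> is a member, and shifting its element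
    \<open>j\<close> down to \<open>r\<close> makes \<open>j\<close> the missing element.\<close>
  have in1: "{r..<N} - {j}:\<F>" if j: "r <= j" "j < N" for j
  proof (cases "j = r")
   case True
   hence "{r..<N} - {j} = {Suc r..<N}" by auto
   thus ?thesis using \<open>{Suc r..<N}:\<F>\<close> by simp
  next
   case False
   hence "insert r ({Suc r..<N} - {j}):\<F>" using j by (intro sh \<open>{Suc r..<N}:\<F>\<close>) auto
   moreover have "{r..<N} - {j} = insert r ({Suc r..<N} - {j})" using False j by auto
   ultimately show ?thesis by simp
  qed
  let ?d = "N - r - 1"
  have eqd: "{G. G <= {r..<N} & card G = ?d} = (%j. {r..<N} - {j}) ` {r..<N}"
  proof (intro subset_antisym subsetI)
   fix G assume G: "G:{G. G <= {r..<N} & card G = ?d}"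
   hence "card ({r..<N} - G) = 1" using rN by (subst card_Diff_subset) (auto intro: finite_subset)
   then obtain j where j: "{r..<N} - G = {j}" by (meson card_1_singletonE)
   hence "G = {r..<N} - {j}" using G by auto
   thus "G:(%j. {r..<N} - {j}) ` {r..<N}" using j by blast
  qed (auto simp: card_Diff_singleton_if)
  have "{G:\<F>. G <= {r..<N} & card G = ?d} = {G. G <= {r..<N} & card G = ?d}" using in1 eqd by auto
  moreover have "{G:Tw r (True # w). G <= {r..<N} & card G = ?d} \<subset> {G. G <= {r..<N} & card G = ?d}"
  proof -
   have "{Suc r..<N}:{G. G <= {r..<N} & card G = ?d}" by auto
   moreover have "{Suc r..<N} ~: Tw r (True # w)" by (simp add: Tw_def)
   ultimately show ?thesis by blast
  qed
  moreover have "finite {G. G <= {r..<N} & card G = ?d}" by (rule finite_subset[of _ "Pow {r..<N}"]) auto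
  ultimately have "scount r N ?d (Tw r (True # w)) < scount r N ?d \<F>" unfolding scount_def by (simp add: psubset_card_mono)
  thus False using Cons.prems(2)[OF rN(1), of ?d] True by simp
 qed
 let ?F' = "{G. r ~: G & insert r G:\<F>}"
 have fin': "finite G" "G <= {Suc r..}" if "G:?F'" for G using fin[of "insert r G"] sub[of G] that by auto
 have Tr: "{G. r ~: G & insert r G:Tw r (True # w)} = Tw (Suc r) w"
 proof (intro subset_antisym subsetI)
  fix G assume G: "G:{G. r ~: G & insert r G:Tw r (True # w)}"
  hence "tmem (Suc r) w G" using tmem_cong[of "insert r G" "Suc r" G w] by (auto simp: Tw_def)
  thus "G:Tw (Suc r) w" using G sub[of G] by (auto simp: Tw_def)
 next
  fix G assume G: "G:Tw (Suc r) w"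
  hence "r ~: G" by (auto simp: Tw_def)
  moreover have "tmem (Suc r) w (insert r G)" using G by (auto simp: Tw_def intro: tmem_mono)
  ultimately show "G:{G. r ~: G & insert r G:Tw r (True # w)}" using G sub[of G] by (auto simp: Tw_def)
 qed
 have eq: "?F' = Tw (Suc r) w"
 proof (rule Cons.IH)
  show "rfam (Suc r) ?F'" unfolding rfam_def
  proof (intro conjI ballI allI impI CollectI)
   fix F G assume FG: "F:?F'" "finite G" "G <= {Suc r..}" "F <= G"
   hence G: "r ~: G" "insert r G <= {r..}" using sub[of G] by auto
   thus "insert r G:\<F>" "r ~: G" using up[of "insert r F" "insert r G"] FG by auto
  next
   fix F j i assume F: "F:?F'" "j:F" "i < j" "Suc r <= i" "i ~: F"
   have "insert i (insert r F - {j}):\<F>" using sh[of "insert r F" j i] F by auto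
   moreover have "insert r (insert i (F - {j})) = insert i (insert r F - {j})" using F by auto
   ultimately show "insert r (insert i (F - {j})):\<F>" "r ~: insert i (F - {j})" using F by auto
  qed (use fin' in auto)
  show "scount (Suc r) N d ?F' = scount (Suc r) N d (Tw (Suc r) w)" if N: "N1 <= N" for N d
  proof -
   have "scount (Suc r) N d ?F' = card {F:\<F>. r:F & F <= {r..<N} & card F = Suc d}"
    by (rule scount_common_element[OF N1(2)[OF N], symmetric])
   also have "... = scount r N (Suc d) \<F>" unfolding scount_def using all by (intro arg_cong[of _ _ card]) auto
   also have "... = scount r N (Suc d) (Tw r (True # w))" using Cons.prems(2)[OF N1(1)[OF N]] True by simp
   also have "... = card {F:Tw r (True # w). r:F & F <= {r..<N} & card F = Suc d}"
    unfolding scount_def by (intro arg_cong[of _ _ card]) (auto simp: Tw_def)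
   also have "... = scount (Suc r) N d (Tw (Suc r) w)" unfolding scount_common_element[OF N1(2)[OF N]] Tr ..
   finally show ?thesis .
  qed
 qed
 have "F:\<F> \<longleftrightarrow> F:Tw r (True # w)" for F
 proof (cases "r:F")
  case rF: True
  have i: "F = insert r (F - {r})" using rF by auto
  have "F:\<F> \<longleftrightarrow> F - {r}:?F'" using i by auto
  also have "... \<longleftrightarrow> F - {r}:{G. r ~: G & insert r G:Tw r (True # w)}" unfolding eq Tr ..
  also have "... \<longleftrightarrow> F:Tw r (True # w)" using i by auto
  finally show ?thesis .
 qed (use all in "auto simp: Tw_def")
 thus ?thesis using True by (simp add: set_eq_iff)
qed
qed

section \<open>Iterated lex shifting of set families\<close>

definition fam :: "nat set set=>bool" where "fam \<F> \<longleftrightarrow> sfam \<F> & {} ~: \<F> & (EX n. fbnd n \<F>)"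

text \<open>Lex shifting on the level of supports; \<open>LEAST\<close> selects one of the
  admissible numbers of variables.\<close>

definition fstep :: "'k::field_char_0 itself=>nat set set=>nat set set" where
 "fstep k \<F> = PsF (ginset k (LEAST n. fbnd n \<F>) (sqU \<F>))"

text \<open>Strong stability of the generic initial set makes the step well behaved. The set stays
  proper because its degree 0 part is as large as that of the ideal, hence empty.\<close>

lemma
 assumes "fam \<F>"
 shows fam_fstep: "fam (fstep TYPE('k::field_char_0) \<F>)"
 and lex_shift_fstep: "lex_shift (mideal (sqU \<F>)) = (mideal (sqU (fstep TYPE('k) \<F>)) :: 'k spoly set)"
 and card_fstep: "EX N0. ALL N>=N0. ALL d. card (sqU (fstep TYPE('k) \<F>) Int Mn N Int Deg d) = card (sqU \<F> Int Mn N Int Deg d)"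
proof -
have sf: "sfam \<F>" and ne: "{} ~: \<F>" and ex: "EX n. fbnd n \<F>" using assms by (auto simp: fam_def)
define n0 where "n0 = (LEAST n. fbnd n \<F>)"
have n0: "fbnd n0 \<F>" unfolding n0_def by (rule LeastI_ex[OF ex])
let ?N = "ginset TYPE('k) n0 (sqU \<F>)"
note U = upclosed_sqU[OF sf] bnd_sqU[OF sf n0]
have e0: "sqU \<F> Int Mn n0 Int Deg 0 = {}" using ne by (auto simp: sqU_def)
have "card (?N Int Mn n0 Int Deg 0) = 0" unfolding card_ginset[OF U order_refl] e0 by simp
moreover have "finite (?N Int Mn n0 Int Deg 0)" by (rule finite_subset[OF _ finite_MD[of n0 0]]) blast
ultimately have "?N Int Mn n0 Int Deg 0 = {}" by simp
hence z: "0 ~: ?N" by auto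
interpret stable_ideal ?N by standard (rule ginset_upclosed[OF U(1)], rule ginset_stable[OF U], rule z)
obtain n1 where n1: "n0 <= n1" "fbnd n1 (PsF ?N)"
 "!!n d. n1 <= n ==> card (sqU (PsF ?N) Int Mn n Int Deg d) = card (?N Int Mn n Int Deg d)"
 using hilbert_psi[OF ginset_bnd] by blast
have fs: "fstep TYPE('k) \<F> = PsF ?N" by (simp add: fstep_def n0_def)
have "{} ~: PsF ?N" using z by (simp add: PsF_def)
thus "fam (fstep TYPE('k) \<F>)" unfolding fs fam_def using sfam_PsF n1(2) by blast
show "lex_shift (mideal (sqU \<F>)) = (mideal (sqU (fstep TYPE('k) \<F>)) :: 'k spoly set)"
 unfolding fs by (rule lex_shift_eq[OF gin_mideal[OF U]])
have "card (sqU (PsF ?N) Int Mn N Int Deg d) = card (sqU \<F> Int Mn N Int Deg d)" if "n1 <= N" for N d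
 using n1(3)[OF that, of d] card_ginset[OF U, of N d, where 'k = 'k] n1(1) that by simp
thus "EX N0. ALL N>=N0. ALL d. card (sqU (fstep TYPE('k) \<F>) Int Mn N Int Deg d) = card (sqU \<F> Int Mn N Int Deg d)"
 unfolding fs by blast
qed

lemma fam_finite: "fam \<F> ==> F:\<F> ==> finite F" by (simp add: fam_def sfam_def)

lemma scount_fstep:
 assumes "fam \<F>"
 shows "EX N0. ALL N>=N0. ALL d. scount 0 N d (fstep TYPE('k::field_char_0) \<F>) = scount 0 N d \<F>"
proof -
obtain N0 where N0: "!!N d. N0 <= N ==> card (sqU (fstep TYPE('k) \<F>) Int Mn N Int Deg d) = card (sqU \<F> Int Mn N Int Deg d)"
 using card_fstep[OF assms, where 'k = 'k] by blast
have "scount 0 N d (fstep TYPE('k) \<F>) = scount 0 N d \<F>" if "N0 <= N" for N d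
 by (rule scount_eq[where e = d]) (use fam_finite[OF assms] fam_finite[OF fam_fstep[OF assms]] N0[OF that] in auto)
thus ?thesis by blast
qed

lemma tmem_gens: "tmem r w F ==> EX w1 w2. w = w1 @ False # w2 & fnew r w1 (Suc (nA w1)) <= F"
proof (induction w arbitrary: r)
case (Cons b w)
show ?case
proof (cases "~ b & r:F")
 case True
 thus ?thesis by (intro exI[of _ "[]"] exI[of _ w]) auto
next
 case False
 hence "tmem (Suc r) w F" using Cons.prems by (auto split: if_splits)
 then obtain w1 w2 where w: "w = w1 @ False # w2" "fnew (Suc r) w1 (Suc (nA w1)) <= F" using Cons.IH by blast
 thus ?thesis using Cons.prems False by (intro exI[of _ "b # w1"] exI[of _ w2]) (cases b; simp)
qed
qed simp

text \<open>The generators of the word, and the new one of the size of \<open>U\<close>, are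
  squarefree images of monomials already known to be initial.\<close>

lemma
 assumes f: "fam \<F>" and T: "Tw 0 w <= \<F>"
 shows Tw_fstep: "Tw 0 w <= fstep TYPE('k::field_char_0) \<F>"
 and Tw_fstep_next: "U:\<F> ==> ~ tmem 0 w U ==> nA w < card U ==>
  Tw 0 (w @ replicate (card U - 1 - nA w) True @ [False]) <= fstep TYPE('k) \<F>"
proof -
define n0 where "n0 = (LEAST n. fbnd n \<F>)"
have sf: "sfam \<F>" and n0: "fbnd n0 \<F>" using f unfolding n0_def fam_def by (auto intro: LeastI_ex)
have T': "F:\<F>" if "finite F" "tmem 0 w F" for F using T that by (auto simp: Tw_def)
have in_fs: "F:fstep TYPE('k) \<F>" if "psi F':ginset TYPE('k) n0 (sqU \<F>)" "F' <= F" "finite F" for F F'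
proof -
 have "F':fstep TYPE('k) \<F>" unfolding fstep_def n0_def[symmetric] PsF_def using that finite_subset by blast
 thus ?thesis using fam_fstep[OF f, where 'k = 'k] sfam_up that unfolding fam_def by blast
qed
show *: "Tw 0 w <= fstep TYPE('k) \<F>"
proof
 fix F assume "F:Tw 0 w"
 hence F: "finite F" "tmem 0 w F" by (auto simp: Tw_def)
 obtain w1 w2 where w: "w = w1 @ False # w2" "fnew 0 w1 (Suc (nA w1)) <= F" using tmem_gens[OF F(2)] by blast
 have "psi (fnew 0 w1 (Suc (nA w1))):ginset TYPE('k) n0 (sqU \<F>)"
  unfolding psi_fnew_0 by (rule lexsegment_in_ginset(1)[OF sf n0 T' w(1)])
 thus "F:fstep TYPE('k) \<F>" by (rule in_fs[OF _ w(2) F(1)])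
qed
show "Tw 0 (w @ replicate (card U - 1 - nA w) True @ [False]) <= fstep TYPE('k) \<F>"
 if U: "U:\<F>" "~ tmem 0 w U" "nA w < card U"
proof
 fix F assume "F:Tw 0 (w @ replicate (card U - 1 - nA w) True @ [False])"
 hence F: "finite F" "tmem 0 w F \<or> fnew 0 w (nA w + Suc (card U - 1 - nA w)) <= F"
  unfolding Tw_def by (simp_all add: tmem_snoc)
 show "F:fstep TYPE('k) \<F>"
 proof (cases "tmem 0 w F")
  case True
  thus ?thesis using * F(1) by (auto simp: Tw_def)
 next
  case False
  moreover have "nA w + Suc (card U - 1 - nA w) = card U" using U(3) by simp
  ultimately have sub: "fnew 0 w (card U) <= F" using F(2) by simp
  have "psi (fnew 0 w (card U)):ginset TYPE('k) n0 (sqU \<F>)"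
   unfolding psi_fnew_0 by (rule lexsegment_in_ginset(2)[OF sf n0 T' U])
  thus ?thesis by (rule in_fs[OF _ sub F(1)])
 qed
qed
qed

section \<open>Words attached to the iterates, and their limit\<close>

lemma scount_subset_eq:
 assumes "\<T> <= \<F>" "scount 0 N (card F) \<F> <= scount 0 N (card F) \<T>" "F:\<F>" "F <= {..<N}"
 shows "F:\<T>"
proof -
have "{G:\<T>. G <= {0..<N} & card G = card F} = {G:\<F>. G <= {0..<N} & card G = card F}"
 by (rule card_seteq) (use assms in "auto simp: scount_def")
moreover have "F:{G:\<F>. G <= {0..<N} & card G = card F}" using assms by (simp add: atLeast0LessThan)
ultimately show ?thesis by blast
qed

text \<open>\<open>good \<F> w d\<close>: below size \<open>d\<close>, the word \<open>w\<close> already describes \<open>\<F>\<close> (as \<open>Tw 0 w <= \<F>\<close> throughout).\<close>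

definition good :: "nat set set=>bool list=>nat=>bool" where
 "good \<F> w d \<longleftrightarrow> (ALL F:\<F>. card F < d --> tmem 0 w F)"

definition bad :: "nat set set=>bool list=>nat=>nat set set" where "bad \<F> w d = {F:\<F>. ~ tmem 0 w F & card F = d}"

text \<open>The number of letters \<open>True\<close> is fixed by \<open>tmem_snoc\<close>: the new
  generator gets the least size of a member outside the ideal of \<open>w\<close>.\<close>

definition wstep :: "nat set set=>bool list=>bool list" where "wstep \<F> w = (if EX U:\<F>. ~ tmem 0 w U
  then w @ replicate ((LEAST d. bad \<F> w d ~= {}) - 1 - nA w) True @ [False] else w)"

text \<open>By the last condition every member outside the ideal of \<open>w\<close> has more than
  \<open>nA w\<close> elements, so that the word can be continued.\<close>

definition inv_word :: "nat set set=>bool list=>bool" where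
 "inv_word \<F> w \<longleftrightarrow> fam \<F> & Tw 0 w <= \<F> & good \<F> w (Suc (nA w))"

lemma exists_bound: "finite F ==> EX N>=N0. F <= {..<N::nat}"
by (metis finite_nat_iff_bounded lessThan_subset_iff linorder_le_cases order_trans order_refl)

text \<open>In sizes below \<open>d\<close> the family is that of the word. This part survives the
  step, and equal counts leave no room for other sets.\<close>

lemma good_fstep:
 assumes f: "fam \<F>" and T: "Tw 0 w <= \<F>" and g: "good \<F> w d"
 shows "good (fstep TYPE('k::field_char_0) \<F>) w d" unfolding good_def
proof (intro ballI impI)
fix F assume F: "F:fstep TYPE('k) \<F>" "card F < d"
obtain N0 where N0: "!!N d. N0 <= N ==> scount 0 N d (fstep TYPE('k) \<F>) = scount 0 N d \<F>"
 using scount_fstep[OF f, where 'k = 'k] by blast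
obtain N where N: "N0 <= N" "F <= {..<N}" using exists_bound[OF fam_finite[OF fam_fstep[OF f] F(1)]] by blast
have "{G:\<F>. G <= {0..<N} & card G = card F} = {G:Tw 0 w. G <= {0..<N} & card G = card F}"
 using T g F(2) fam_finite[OF f] by (auto simp: good_def Tw_def)
hence "scount 0 N (card F) (fstep TYPE('k) \<F>) = scount 0 N (card F) (Tw 0 w)"
 using N0[OF N(1), of "card F"] by (simp add: scount_def)
hence "F:Tw 0 w" by (intro scount_subset_eq[OF Tw_fstep[OF f T] _ F(1) N(2)]) simp
thus "tmem 0 w F" by (simp add: Tw_def)
qed

text \<open>If the part of such a set below \<open>n\<close> were proper, it would be a smaller
  member, hence in the ideal of the word, and so would be the set itself. This makes the uncaptured
  sets of the least size finite in number.\<close>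

lemma bad_subset:
 assumes f: "fam \<F>" "fbnd n \<F>" and g: "good \<F> w d" and F: "F:bad \<F> w d"
 shows "F <= {..<n}"
proof (rule ccontr)
assume "~ F <= {..<n}"
hence "F Int {..<n} \<subset> F" by blast
moreover have "finite F" using F fam_finite[OF f(1)] by (auto simp: bad_def)
ultimately have "card (F Int {..<n}) < card F" by (rule psubset_card_mono[rotated])
moreover have "F Int {..<n}:\<F>" using F f(2) by (auto simp: bad_def fbnd_def)
ultimately have "tmem 0 w (F Int {..<n})" using g F by (auto simp: good_def bad_def)
hence "tmem 0 w F" by (rule tmem_mono) simp
thus False using F by (simp add: bad_def)
qed

lemma finite_bad:
 assumes "fam \<F>" "good \<F> w d"
 shows "finite (bad \<F> w d)"
proof -
obtain n where n: "fbnd n \<F>" using assms(1) by (auto simp: fam_def)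
have "bad \<F> w d <= Pow {..<n}" using bad_subset[OF assms(1) n assms(2)] by blast
thus ?thesis by (rule finite_subset) simp
qed

lemma wstep_cases:
 assumes "inv_word \<F> w"
 obtains (stop) "!!U. U:\<F> ==> tmem 0 w U" "wstep \<F> w = w"
 | (go) U where "U:\<F>" "~ tmem 0 w U" "nA w < card U" "good \<F> w (card U)"
  "wstep \<F> w = w @ replicate (card U - 1 - nA w) True @ [False]"
proof (cases "EX U:\<F>. ~ tmem 0 w U")
case True
hence ex: "EX d. bad \<F> w d ~= {}" by (auto simp: bad_def)
define d where "d = (LEAST d. bad \<F> w d ~= {})"
have "bad \<F> w d ~= {}" unfolding d_def by (rule LeastI_ex[OF ex])
then obtain U where U: "U:\<F>" "~ tmem 0 w U" "card U = d" by (auto simp: bad_def)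
have "good \<F> w d" unfolding good_def
proof (intro ballI impI)
 fix F assume F: "F:\<F>" "card F < d"
 hence "bad \<F> w (card F) = {}" unfolding d_def using not_less_Least by blast
 thus "tmem 0 w F" using F by (auto simp: bad_def)
qed
moreover have "nA w < card U" using assms U unfolding inv_word_def good_def by (metis leI less_Suc_eq_le)
moreover have "wstep \<F> w = w @ replicate (d - 1 - nA w) True @ [False]" using True by (simp add: wstep_def d_def)
ultimately show ?thesis using go U by blast
next
case False
thus ?thesis using stop by (simp add: wstep_def)
qed

lemma tmem_wstep: "tmem 0 w F ==> tmem 0 (wstep \<F> w) F" unfolding wstep_def by (simp add: tmem_append)

lemma good_step:
 assumes i: "inv_word \<F> w" and g: "good \<F> w d"
 shows "good (fstep TYPE('k::field_char_0) \<F>) (wstep \<F> w) d"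
proof -
have "good (fstep TYPE('k) \<F>) w d" using good_fstep g i by (auto simp: inv_word_def)
thus ?thesis using tmem_wstep by (auto simp: good_def)
qed

lemma inv_word_step:
 assumes i: "inv_word \<F> w"
 shows "inv_word (fstep TYPE('k::field_char_0) \<F>) (wstep \<F> w)" using i
proof (cases rule: wstep_cases)
case stop
have f: "fam \<F>" "Tw 0 w <= \<F>" using i by (auto simp: inv_word_def)
have "good \<F> w (Suc (nA w))" using stop by (auto simp: good_def)
thus ?thesis using fam_fstep[OF f(1), where 'k = 'k] Tw_fstep[OF f, where 'k = 'k] good_fstep[OF f, where 'k = 'k] stop by (simp add: inv_word_def)
next
case (go U)
have f: "fam \<F>" "Tw 0 w <= \<F>" using i by (auto simp: inv_word_def)
have "Suc (nA (wstep \<F> w)) = card U" unfolding go(5) using go(3) by simp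
hence "good (fstep TYPE('k) \<F>) (wstep \<F> w) (Suc (nA (wstep \<F> w)))" using good_step[OF i go(4), where 'k = 'k] by simp
thus ?thesis using fam_fstep[OF f(1), where 'k = 'k] Tw_fstep_next[OF f go(1-3), where 'k = 'k] go(5) by (simp add: inv_word_def)
qed

text \<open>The number of members of size \<open>d\<close> is constant, while the family of the word
  gains at least the set \<open>fnew 0 w d\<close>.\<close>

lemma card_bad_step:
 assumes i: "inv_word \<F> w" and g: "good \<F> w d" and b: "bad \<F> w d ~= {}"
 shows "card (bad (fstep TYPE('k::field_char_0) \<F>) (wstep \<F> w) d) < card (bad \<F> w d)"
proof -
let ?F' = "fstep TYPE('k) \<F>" and ?w' = "wstep \<F> w"
have f: "fam \<F>" "Tw 0 w <= \<F>" using i by (auto simp: inv_word_def)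
have f': "fam ?F'" "Tw 0 ?w' <= ?F'" using inv_word_step[OF i, where 'k = 'k] by (auto simp: inv_word_def)
have g': "good ?F' ?w' d" by (rule good_step[OF i g])
obtain U where U: "nA w < d" "?w' = w @ replicate (d - 1 - nA w) True @ [False]" using i
proof (cases rule: wstep_cases)
 case stop
 thus ?thesis using b by (auto simp: bad_def)
next
 case (go U)
 obtain V where V: "V:\<F>" "~ tmem 0 w V" "card V = d" using b by (auto simp: bad_def)
 have "card U = d" using go(1,2,4) V g by (auto simp: good_def) (metis linorder_neqE_nat)
 thus ?thesis using that go by simp
qed
obtain n where n: "fbnd n \<F>" using f(1) by (auto simp: fam_def)
obtain n' where n': "fbnd n' ?F'" using f'(1) by (auto simp: fam_def)
obtain N0 where N0: "!!N d. N0 <= N ==> scount 0 N d ?F' = scount 0 N d \<F>" using scount_fstep[OF f(1), where 'k = 'k] by blast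
let ?P = "fnew 0 w d"
obtain N where N: "N0 + n + n' <= N" "?P <= {..<N}" using exists_bound[OF finite_fnew] by blast
have split: "scount 0 N d \<G> = scount 0 N d (Tw 0 v) + card (bad \<G> v d)"
 if G: "fam \<G>" "Tw 0 v <= \<G>" "good \<G> v d" "fbnd k \<G>" "k <= N" for \<G> v k
proof -
 have "F <= {0..<N}" if "F:bad \<G> v d" for F using bad_subset[OF G(1,4,3) that] G(5) by auto
 hence "{F:\<G>. F <= {0..<N} & card F = d} = {F:Tw 0 v. F <= {0..<N} & card F = d} Un bad \<G> v d"
  using G(2) fam_finite[OF G(1)] by (auto simp: bad_def Tw_def)
 thus ?thesis unfolding scount_def using finite_bad[OF G(1,3)] by (simp add: card_Un_disjoint bad_def Tw_def disjoint_iff)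
qed
have "{F:Tw 0 w. F <= {0..<N} & card F = d} \<subset> {F:Tw 0 ?w'. F <= {0..<N} & card F = d}"
proof (rule psubsetI)
 show "{F:Tw 0 w. F <= {0..<N} & card F = d} <= {F:Tw 0 ?w'. F <= {0..<N} & card F = d}" using tmem_wstep by (auto simp: Tw_def)
 have "nA w + Suc (d - 1 - nA w) = d" using U(1) by simp
 hence "tmem 0 ?w' ?P" unfolding U(2) tmem_snoc by simp
 hence "?P:{F:Tw 0 ?w'. F <= {0..<N} & card F = d}" using N(2) U(1) by (simp add: Tw_def finite_fnew card_fnew atLeast0LessThan)
 moreover have "?P ~: Tw 0 w" using not_tmem_fnew by (simp add: Tw_def)
 ultimately show "{F:Tw 0 w. F <= {0..<N} & card F = d} ~= {F:Tw 0 ?w'. F <= {0..<N} & card F = d}" by blast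
qed
hence "scount 0 N d (Tw 0 w) < scount 0 N d (Tw 0 ?w')" unfolding scount_def by (intro psubset_card_mono) simp_all
moreover have "scount 0 N d \<F> = scount 0 N d (Tw 0 w) + card (bad \<F> w d)" using N by (intro split[OF f g n]) simp
moreover have "scount 0 N d ?F' = scount 0 N d (Tw 0 ?w') + card (bad ?F' ?w' d)" using N by (intro split[OF f' g' n']) simp
moreover have "scount 0 N d ?F' = scount 0 N d \<F>" using N by (intro N0) simp
ultimately show ?thesis by linarith
qed

primrec wseq :: "'k::field_char_0 itself=>nat set set=>nat=>bool list" where "wseq k \<F> 0 = []"
| "wseq k \<F> (Suc i) = wstep ((fstep k ^^ i) \<F>) (wseq k \<F> i)"

lemma inv_wseq: "fam \<F> ==> inv_word ((fstep TYPE('k::field_char_0) ^^ i) \<F>) (wseq TYPE('k) \<F> i)"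
proof (induction i)
case 0
thus ?case using fam_finite[OF 0] by (auto simp: inv_word_def good_def Tw_def fam_def card_eq_0_iff)
next
case (Suc i)
thus ?case using inv_word_step by simp
qed

lemma fam_fstep_iter: "fam \<F> ==> fam ((fstep TYPE('k::field_char_0) ^^ i) \<F>)"
using inv_wseq[of \<F> i, where 'k = 'k] by (simp add: inv_word_def)

lemma good_wseq_mono:
 assumes "fam \<F>" "good ((fstep TYPE('k::field_char_0) ^^ i) \<F>) (wseq TYPE('k) \<F> i) d" "i <= j"
 shows "good ((fstep TYPE('k) ^^ j) \<F>) (wseq TYPE('k) \<F> j) d" using assms(3)
proof (induction j rule: dec_induct)
case (step j)
thus ?case using good_step[OF inv_wseq[OF assms(1)]] by simp
qed (rule assms(2))

lemma wseq_mono: "i <= j ==> tmem 0 (wseq k \<F> i) F ==> tmem 0 (wseq k \<F> j) F"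
by (induction j rule: dec_induct) (auto intro: tmem_wstep)

text \<open>Each size is settled after finitely many steps, as the finite number of uncaptured sets
  of that size decreases strictly while it is positive.\<close>

lemma good_wseq_eventually:
 assumes "fam \<F>"
 shows "EX i. good ((fstep TYPE('k::field_char_0) ^^ i) \<F>) (wseq TYPE('k) \<F> i) d"
proof (induction d)
case 0
show ?case by (simp add: good_def)
next
case (Suc d)
let ?F = "%i. (fstep TYPE('k) ^^ i) \<F>" and ?w = "%i. wseq TYPE('k) \<F> i"
have "EX i. good (?F i) (?w i) (Suc d)" if "good (?F i) (?w i) d" for i using that
proof (induction "card (bad (?F i) (?w i) d)" arbitrary: i rule: less_induct)
 case less
 show ?case
 proof (cases "bad (?F i) (?w i) d = {}")
  case True
  hence "good (?F i) (?w i) (Suc d)" using less.prems by (auto simp: good_def bad_def less_Suc_eq)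
  thus ?thesis by blast
 next
  case False
  show ?thesis
  proof (rule less.hyps[of "Suc i"])
   show "card (bad (?F (Suc i)) (?w (Suc i)) d) < card (bad (?F i) (?w i) d)"
    using card_bad_step[OF inv_wseq[OF assms] less.prems False] by simp
   show "good (?F (Suc i)) (?w (Suc i)) d" using good_wseq_mono[OF assms less.prems, of "Suc i"] by simp
  qed
 qed
qed
thus ?case using Suc by blast
qed

theorem fstep_limit:
 assumes f: "fam \<F>"
 shows "EX \<M>. lexfam 0 \<M> & {} ~: \<M> & (ALL d. EX i0. ALL i>=i0. ALL F. finite F --> card F <= d -->
 (F:(fstep TYPE('k::field_char_0) ^^ i) \<F> \<longleftrightarrow> F:\<M>))"
proof -
let ?F = "%i. (fstep TYPE('k) ^^ i) \<F>" and ?w = "%i. wseq TYPE('k) \<F> i"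
define \<M> where "\<M> = (\<Union>i. Tw 0 (?w i))"
have T: "Tw 0 (?w i) <= ?F i" for i using inv_wseq[OF f, of i, where 'k = 'k] by (simp add: inv_word_def)
have agree: "EX i0. ALL i>=i0. ALL F. finite F --> card F <= d --> (F:?F i \<longleftrightarrow> F:\<M>)" for d
proof -
 obtain i0 where i0: "good (?F i0) (?w i0) (Suc d)" using good_wseq_eventually[OF f] by blast
 have "F:?F i \<longleftrightarrow> F:\<M>" if i: "i0 <= i" and F: "finite F" "card F <= d" for i F
 proof
  assume "F:?F i"
  moreover have "good (?F i) (?w i) (Suc d)" by (rule good_wseq_mono[OF f i0 i])
  ultimately have "tmem 0 (?w i) F" using F by (simp add: good_def)
  thus "F:\<M>" using F by (auto simp: \<M>_def Tw_def)
 next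
  assume "F:\<M>"
  then obtain j where "tmem 0 (?w j) F" by (auto simp: \<M>_def Tw_def)
  hence t: "tmem 0 (?w (max i j)) F" by (rule wseq_mono[rotated]) simp
  \<comment> \<open>Once the sizes up to \<open>d\<close> are settled, a later word captures no new
    sets of these sizes: its family lies in an iterate already described by the word before
    it.\<close>
  have "tmem 0 (?w k) F ==> tmem 0 (?w i) F" if "i <= k" for k using that
  proof (induction k rule: dec_induct)
   case (step k)
   have g: "good (?F k) (?w k) (Suc d)" using good_wseq_mono[OF f i0] step(1) i by simp
   have "good (fstep TYPE('k) (?F k)) (?w k) (Suc d)" by (rule good_fstep[OF fam_fstep_iter[OF f] T g])
   moreover have "F:?F (Suc k)" using T[of "Suc k"] step.prems F(1) by (auto simp: Tw_def)
   ultimately have "tmem 0 (?w k) F" using F(2) by (simp add: good_def)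
   thus ?case by (rule step.IH)
  qed
  from this[OF max.cobounded1 t] have "tmem 0 (?w i) F" .
  thus "F:?F i" using T[of i] F(1) by (auto simp: Tw_def)
 qed
 thus ?thesis by blast
qed
moreover have "lexfam 0 \<M>" unfolding lexfam_def
proof (intro conjI ballI allI impI)
 fix F G :: "nat set" assume F: "F:\<M>" and G: "finite G" "G <= {0..}"
 then obtain i where i: "F:Tw 0 (?w i)" by (auto simp: \<M>_def)
 { assume "F <= G" thus "G:\<M>" using lexfamD(3)[OF lexfam_Tw i G] by (auto simp: \<M>_def) }
 { assume "card G = card F" "slex G F" thus "G:\<M>" using lexfamD(4)[OF lexfam_Tw i G] by (auto simp: \<M>_def) }
qed (auto simp: \<M>_def Tw_def)
moreover have "{} ~: \<M>"
proof
 assume "{}:\<M>"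
 then obtain i where "{}:?F i" using agree[of 0] by auto
 thus False using fam_fstep_iter[OF f, of i] by (auto simp: fam_def)
qed
ultimately show ?thesis by blast
qed

lemma fstep_Tw:
 assumes f: "fam \<F>" and w: "\<F> = Tw 0 w"
 shows "fstep TYPE('k::field_char_0) \<F> = \<F>"
proof
show "\<F> <= fstep TYPE('k) \<F>" using Tw_fstep[OF f, of w] w by simp
show "fstep TYPE('k) \<F> <= \<F>"
proof
 fix F assume F: "F:fstep TYPE('k) \<F>"
 have "good \<F> w (Suc (card F))" using w by (simp add: good_def Tw_def)
 from good_fstep[OF f _ this, where 'k = 'k] F w have "tmem 0 w F" by (auto simp: good_def)
 thus "F:\<F>" using w fam_finite[OF fam_fstep[OF f] F] by (simp add: Tw_def)
qed
qed

lemma fam_lexfam_word: "fam \<F> ==> lexfam 0 \<F> ==> EX w. \<F> = Tw 0 w" using lexfam_word unfolding fam_def by blast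

theorem fstep_fixed: "fam \<F> ==> lexfam 0 \<F> ==> fstep TYPE('k::field_char_0) \<F> = \<F>"
using fstep_Tw fam_lexfam_word by blast

theorem card_fstep_iter:
 assumes "fam \<F>"
 shows "EX N0. ALL N>=N0. ALL d. card (sqU ((fstep TYPE('k::field_char_0) ^^ i) \<F>) Int Mn N Int Deg d)
 = card (sqU \<F> Int Mn N Int Deg d)"
proof (induction i)
case (Suc i)
obtain N0 where N0: "ALL N>=N0. ALL d. card (sqU ((fstep TYPE('k) ^^ i) \<F>) Int Mn N Int Deg d) = card (sqU \<F> Int Mn N Int Deg d)"
 using Suc by blast
obtain N1 where N1: "ALL N>=N1. ALL d. card (sqU (fstep TYPE('k) ((fstep TYPE('k) ^^ i) \<F>)) Int Mn N Int Deg d)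
  = card (sqU ((fstep TYPE('k) ^^ i) \<F>) Int Mn N Int Deg d)" using card_fstep[OF fam_fstep_iter[OF assms]] by blast
show ?case using N0 N1 by (intro exI[of _ "max N0 N1"]) simp
qed auto

text \<open>If the sequence repeated, it would be periodic from some point on, so it would contain its limit,
  a family \<open>Tw 0 w\<close>; but the counting function of \<open>Tw 0 w\<close> determines a shifted family.\<close>

theorem fstep_inj:
 assumes f: "fam \<F>" and l: "~ lexfam 0 \<F>"
 shows "inj (%i. (fstep TYPE('k::field_char_0) ^^ i) \<F>)"
proof (rule ccontr)
let ?s = "fstep TYPE('k)"
let ?F = "%i. (?s ^^ i) \<F>"
assume "~ inj ?F"
then obtain a b where ab: "a < b" "?F a = ?F b" unfolding inj_def by (metis linorder_neqE_nat)
have per: "?F (a + k * (b - a)) = ?F a" for k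
proof (induction k)
 case (Suc k)
 have "?F (a + Suc k * (b - a)) = (?s ^^ (b - a)) (?F (a + k * (b - a)))"
  by (simp add: funpow_add[symmetric, THEN fun_cong, simplified o_def] add_ac)
 also have "... = (?s ^^ (b - a)) (?F a)" using Suc by simp
 also have "... = (?s ^^ ((b - a) + a)) \<F>" unfolding funpow_add by simp
 also have "(b - a) + a = b" using ab by simp
 finally show ?case using ab by simp
qed simp
obtain \<M> where M: "lexfam 0 \<M>" "!!d. EX i0. ALL i>=i0. ALL F. finite F --> card F <= d --> (F:?F i \<longleftrightarrow> F:\<M>)"
 using fstep_limit[OF f, where 'k = 'k] by blast
have fa: "fam (?F a)" by (rule fam_fstep_iter[OF f])
have "F:?F a \<longleftrightarrow> F:\<M>" if F: "finite F" for F
proof -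
 obtain i0 where i0: "!!i F'. i0 <= i ==> finite F' ==> card F' <= card F ==> (F':?F i \<longleftrightarrow> F':\<M>)"
  using M(2)[of "card F"] by blast
 \<comment> \<open>The period \<open>b - a\<close> is at least 1, so the index
   \<open>a + i0 * (b - a)\<close> is not below \<open>i0\<close>, and \<open>?F a\<close> already
   agrees with the limit.\<close>
 have "i0 * 1 <= i0 * (b - a)" by (rule mult_le_mono2) (use ab in simp)
 also have "... <= a + i0 * (b - a)" by simp
 finally have "i0 <= a + i0 * (b - a)" by (simp only: mult_1_right)
 from i0[OF this F order_refl] show ?thesis using per[of i0] by simp
qed
hence "?F a = \<M>" using fam_finite[OF fa] lexfamD(1)[OF M(1)] by blast
then obtain w where w: "?F a = Tw 0 w" using fam_lexfam_word fa M(1) by metis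
obtain N0 where N0: "!!N d. N0 <= N ==> card (sqU (?F a) Int Mn N Int Deg d) = card (sqU \<F> Int Mn N Int Deg d)"
 using card_fstep_iter[OF f, where 'k = 'k] by blast
have "scount 0 N d \<F> = scount 0 N d (Tw 0 w)" if "N0 <= N" for N d
proof (rule scount_eq[where e = d])
 show "card (sqU \<F> Int Mn N Int Deg d') = card (sqU (Tw 0 w) Int Mn N Int Deg d')" for d'
  using N0[OF that, of d', symmetric] unfolding w .
qed (auto simp: fam_finite[OF f] Tw_def)
moreover have "rfam 0 \<F>"
proof -
 have s: "sfam \<F>" using f by (simp add: fam_def)
 show ?thesis unfolding rfam_def by (intro conjI ballI allI impI)
   (erule sfam_finite[OF s], simp, erule (2) sfam_up[OF s], erule (3) sfam_shift[OF s])
qed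
ultimately have "\<F> = Tw 0 w" using shifted_count_unique by blast
thus False using l lexfam_Tw by simp
qed

section \<open>Linear algebra for polynomials\<close>

definition klin :: "('k::field_char_0 spoly=>'k spoly)=>bool" where
 "klin T \<longleftrightarrow> (ALL f g. T (f + g) = T f + T g) & (ALL c f. T (scalar c * f) = scalar c * T f)"

lemma klin_add: "klin T ==> T (f + g) = T f + T g"
 and klin_scalar: "klin T ==> T (scalar c * f) = scalar c * T f" by (simp_all add: klin_def)

lemma klin_zero: "klin T ==> T 0 = 0" using klin_scalar[of T 0 0] by simp

lemma klin_sum: "klin T ==> T (SUM x:A. f x) = (SUM x:A. T (f x))"
by (induction A rule: infinite_finite_induct) (auto simp: klin_zero klin_add)

lemma klin_diff: "klin T ==> T (f - g) = T f - T g"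
using klin_add[of T f "scalar (-1) * g"] klin_scalar[of T "-1" g] by (simp add: scalar_uminus)

lemma subspace_klin_image: "klin T ==> vs.subspace V ==> vs.subspace (T ` V)"
unfolding vs.subspace_def by (auto simp: klin_zero klin_add[symmetric] klin_scalar[symmetric] intro: rev_image_eqI)

lemma rank_nullity:
 fixes T :: "'k::field_char_0 spoly=>'k spoly"
 assumes T: "klin T" and V: "vs.subspace V" "V <= vs.span S" "finite S"
 shows "vs.dim V = vs.dim (T ` V) + vs.dim {f:V. T f = 0}"
proof -
obtain B where B: "B <= {f:V. T f = 0}" "vs.independent B" "{f:V. T f = 0} <= vs.span B" "card B = vs.dim {f:V. T f = 0}"
 by (rule vs.basis_exists)
have "B <= V" using B(1) by blast
then obtain C where C: "B <= C" "C <= V" "vs.independent C" "V <= vs.span C"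
 using vs.maximal_independent_subset_extend[OF _ B(2)] by blast
have finC: "finite C" using vs.independent_span_bound[OF V(3) C(3)] C(2) V(2) by blast
hence finB: "finite B" using C(1) finite_subset by blast
define D where "D = C - B"
have D: "finite D" "C = B Un D" "B Int D = {}" "D <= V" using finC C by (auto simp: D_def)
have zero: "ALL v:D. c v = 0" if c: "(SUM v:D. scalar (c v) * T v) = 0" for c
proof -
 let ?x = "SUM v:D. scalar (c v) * v"
 have "T ?x = 0" using c by (simp add: klin_sum[OF T] klin_scalar[OF T])
 moreover have "?x:V" by (intro vs.subspace_sum[OF V(1)] vs.subspace_scale[OF V(1)]) (use D in auto)
 ultimately have "?x:vs.span B" using B(3) by blast
 then obtain u where u: "?x = (SUM v:B. scalar (u v) * v)" using vs.span_finite[OF finB] by auto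
 let ?w = "%v. if v:D then c v else - u v"
 have "(SUM v:C. scalar (?w v) * v) = (SUM v:B. scalar (?w v) * v) + (SUM v:D. scalar (?w v) * v)"
  unfolding D(2) by (rule sum.union_disjoint) (use D finB in auto)
 also have "(SUM v:B. scalar (?w v) * v) = - (SUM v:B. scalar (u v) * v)"
  unfolding sum_negf[symmetric] by (rule sum.cong) (use D(3) in "auto simp: scalar_uminus")
 also have "(SUM v:D. scalar (?w v) * v) = ?x" by (rule sum.cong) auto
 finally have "(SUM v:C. scalar (?w v) * v) = 0" using u by simp
 hence "?w v = 0" if "v:C" for v using vs.independentD[OF C(3) finC order_refl, of ?w v] that by simp
 thus ?thesis using D(2) by (metis UnI2)
qed
note ind = independent_family[of D T, OF D(1) zero]
have span: "T ` V <= vs.span (T ` D)"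
proof
 fix y assume "y:T ` V"
 then obtain x where x: "x:V" "y = T x" by blast
 then obtain u where u: "x = (SUM v:C. scalar (u v) * v)" using C(4) vs.span_finite[OF finC] by auto
 have "y = (SUM v:C. scalar (u v) * T v)" unfolding x(2) u by (simp add: klin_sum[OF T] klin_scalar[OF T])
 also have "... = (SUM v:D. scalar (u v) * T v)" by (rule sum.mono_neutral_right) (use finC B(1) D_def in auto)
 finally show "y:vs.span (T ` D)" by (simp only:) (rule vs.span_sum, rule vs.span_scale, rule vs.span_base, simp)
qed
have "vs.dim (T ` V) = card (T ` D)" by (rule vs.dim_unique[OF _ span ind(2) refl]) (use D in auto)
moreover have "vs.dim V = card C" by (rule vs.dim_unique[OF C(2) C(4) C(3) refl])
moreover have "card C = card B + card D" unfolding D(2) using D finB by (intro card_Un_disjoint) auto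
ultimately show ?thesis using B(4) card_image[OF ind(1)] by simp
qed

lemma mideal_span:
 assumes "finite D"
 shows "mideal D <= vs.span (mon ` D :: 'k::field_char_0 spoly set)"
proof
fix f :: "'k spoly" assume "f:mideal D"
hence "f = (SUM m:D. scalar (lookup f m) * mon m)" using poly_expand[OF assms, of f] by (simp add: mideal_def)
also have "...:vs.span (mon ` D)" by (rule vs.span_sum, rule vs.span_scale, rule vs.span_base, simp)
finally show "f:vs.span (mon ` D)" .
qed

lemma dim_mideal:
 assumes "finite D"
 shows "vs.dim (mideal D :: 'k::field_char_0 spoly set) = card D"
proof (rule vs.dim_unique[OF _ mideal_span[OF assms]])
have inj: "inj_on (mon :: monom=>'k spoly) D" by (rule inj_onI) (metis lead_mon)
show "card (mon ` D :: 'k spoly set) = card D" by (rule card_image[OF inj])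
show "vs.independent (mon ` D :: 'k spoly set)" by (rule independent_leads) (auto simp: inj_on_def)
qed auto

lemma Mon_lookup_zero: "m:Mon V ==> i ~: V ==> lookup m i = 0" using in_keys_iff[of i m] by (auto simp: Mon_def)

section \<open>Free modules\<close>

text \<open>The vector \<open>v\<close> of the free module of rank \<open>r\<close> over the polynomials in the first \<open>n\<close> variables is
  encoded as the polynomial \<open>\<Sum>p<r. v p * X n ^ p\<close>, so that the earlier results on leading monomials apply.\<close>

definition FMm :: "nat=>nat=>monom set" where "FMm n r = {m:Mon {..n}. lookup m n < r}"

definition FM :: "nat=>nat=>'k::field_char_0 spoly set" where "FM n r = mideal (FMm n r)"

text \<open>The coefficient, a polynomial in the first \<open>n\<close> variables, of the monomial
  \<open>c\<close> in the later ones. With \<open>c\<close> a power of \<open>X n\<close> it reads a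
  coordinate of an encoded vector; with general \<open>c\<close> it decomposes polynomials in more
  variables.\<close>

definition coef :: "nat=>monom=>'k::field_char_0 spoly=>'k spoly" where
 "coef n c f = pr (Mn n) (Poly_Mapping.map_key (%m. m + c) f)"

definition dec :: "nat=>nat=>'k::field_char_0 spoly=>'k spoly" where "dec n p = coef n (sgl n p)"

text \<open>The linear map on the free module that sends the basis vector \<open>X n ^ p\<close> to
  \<open>g p\<close>.\<close>

definition app :: "nat=>nat=>(nat=>'k::field_char_0 spoly)=>'k spoly=>'k spoly" where "app n r g f = (\<Sum>p<r. dec n p f * g p)"

lemma lookup_coef: "lookup (coef n c f) m = (if m:Mn n then lookup f (m + c) else 0)"
proof -
have "inj (%m. m + c :: monom)" by (rule injI) simp
thus ?thesis by (simp add: coef_def lookup_pr Poly_Mapping.map_key.rep_eq)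
qed

lemma coef_add: "coef n c (f + g) = coef n c f + coef n c g" by (rule poly_mapping_eqI) (simp add: lookup_coef lookup_add)

lemma keys_coef: "m:keys (coef n c f) ==> m:Mn n & m + c:keys f" by (auto simp: in_keys_iff lookup_coef split: if_splits)

lemma coef_in_R [simp]: "coef n c f:PR n" using keys_coef[of _ n c f] by (auto simp: poly_ring_eq mideal_def)

lemma coef_zero [simp]: "coef n c 0 = 0" by (rule poly_mapping_eqI) (simp add: lookup_coef)

lemma coef_sum: "coef n c (SUM x:A. f x) = (SUM x:A. coef n c (f x))"
by (induction A rule: infinite_finite_induct) (auto simp: coef_add)

lemma coef_mon_mult:
 assumes "a:Mn n" "c:Mon {n..}"
 shows "coef n c (mon a * f) = mon a * coef n c f"
proof (rule poly_mapping_eqI)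
fix m
show "lookup (coef n c (mon a * f)) m = lookup (mon a * coef n c f) m"
proof (cases "EX b. m = a + b")
 case True
 then obtain b where b: "m = a + b" by blast
 have "a + b + c = a + (b + c)" by (simp add: add.assoc)
 thus ?thesis using assms b by (simp add: lookup_coef lookup_mon_mult)
next
 case False
 have "~ (EX b. m + c = a + b)" if m: "m:Mn n"
 proof
  assume "EX b. m + c = a + b"
  hence le: "ALL i. lookup a i <= lookup (m + c) i" using mdvd_iff[of a "m + c"] by blast
  have "lookup a i <= lookup m i" for i
  proof (cases "i < n")
   case True
   thus ?thesis using le[rule_format, of i] Mon_lookup_zero[OF assms(2), of i] by (simp add: lookup_add)
  next
   case False
   thus ?thesis using Mon_lookup_zero[OF assms(1), of i] by simp
  qed
  thus False using False mdvd_iff[of a m] by auto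
 qed
 thus ?thesis using False by (simp add: lookup_coef lookup_mon_mult_if)
qed
qed

lemma coef_scalar: "coef n c (scalar b * f) = scalar b * coef n c f" by (rule poly_mapping_eqI) (simp add: lookup_coef)

lemma coef_mult:
 assumes "h:PR n" "c:Mon {n..}"
 shows "coef n c (h * f) = h * coef n c f"
proof -
have h: "h = (SUM m:keys h. scalar (lookup h m) * mon m)" by (rule poly_expand) auto
have "coef n c (h * f) = (SUM m:keys h. coef n c (scalar (lookup h m) * (mon m * f)))"
 by (subst h) (simp add: sum_distrib_right coef_sum mult.assoc)
also have "... = (SUM m:keys h. scalar (lookup h m) * (mon m * coef n c f))"
 by (rule sum.cong) (use assms in "auto simp: coef_scalar coef_mon_mult poly_ring_def Mon_def")
also have "... = h * coef n c f" by (subst (3) h) (simp add: sum_distrib_right mult.assoc)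
finally show ?thesis .
qed

lemma lookup_dec: "lookup (dec n p f) m = (if m:Mn n then lookup f (m + sgl n p) else 0)" by (simp add: dec_def lookup_coef)

lemma keys_dec: "m:keys (dec n p f) ==> m:Mn n & m + sgl n p:keys f" unfolding dec_def by (rule keys_coef)

lemma dec_add: "dec n p (f + g) = dec n p f + dec n p g"
 and dec_in_R [simp]: "dec n p f:PR n"
 and dec_zero [simp]: "dec n p 0 = 0"
 and dec_sum: "dec n p (SUM x:A. F x) = (SUM x:A. dec n p (F x))"
 and dec_scalar: "dec n p (scalar c * f) = scalar c * dec n p f" by (simp_all add: dec_def coef_add coef_sum coef_scalar)

lemma dec_mult: "h:PR n ==> dec n p (h * f) = h * dec n p f" unfolding dec_def by (rule coef_mult) (auto simp: Mon_def)

lemma dec_X_power: "dec n p (X n ^ q) = (if p = q then 1 else 0)"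
proof (rule poly_mapping_eqI)
fix m
have "m + sgl n p = sgl n q \<longleftrightarrow> m = 0 & p = q" if "m:Mn n"
proof
 assume eq: "m + sgl n p = sgl n q"
 have "n ~: keys m" using that by (auto simp: Mon_def)
 hence "p = q" using arg_cong[OF eq, of "%x. lookup x n"] by (simp add: lookup_add in_keys_iff)
 thus "m = 0 & p = q" using eq by simp
qed simp
thus "lookup (dec n p (X n ^ q)) m = lookup (if p = q then 1 else 0) m"
 by (auto simp: lookup_dec X_power lookup_mon lookup_one when_def)
qed

lemma klin_app: "klin (app n r g)"
by (simp add: klin_def app_def dec_add dec_scalar distrib_right sum.distrib sum_distrib_left mult.assoc)

lemma app_mult: "h:PR n ==> app n r g (h * f) = h * app n r g f" by (simp add: app_def dec_mult sum_distrib_left mult.assoc)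

lemma app_X: "q < r ==> app n r g (X n ^ q) = g q" by (simp add: app_def dec_X_power if_distrib[of "%x. x * _"] cong: if_cong)

lemma R_X_in_FM:
 assumes "h:PR n" "q < r"
 shows "h * X n ^ q:FM n r" unfolding FM_def
proof (rule mideal_mult)
show "h:mideal (Mn n)" using assms by (simp add: poly_ring_eq)
show "X n ^ q:mideal {sgl n q}" by (simp add: X_power)
show "a + b:FMm n r" if "a:Mn n" "b:{sgl n q}" for a b using that assms(2) Mon_lookup_zero[of a "{..<n}" n]
 by (auto simp: FMm_def Mon_def keys_add_nat lookup_add split: if_splits)
qed

lemma FM_add: "f:FM n r ==> g:FM n r ==> f + g:FM n r" by (simp add: FM_def mideal_add)

lemma FM_mult: "h:PR n ==> f:FM n r ==> h * f:FM n r" unfolding FM_def poly_ring_eq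
by (rule mideal_mult, assumption+, use Mon_lookup_zero[of _ "{..<n}" n] in "auto simp: FMm_def lookup_add") (auto simp: Mon_def)

lemma Mon_split_last:
 assumes "m:Mon {..n}"
 shows "mres {..<n} m + sgl n (lookup m n) = m"
proof (rule poly_mapping_eqI)
fix i
have "lookup m i = 0" if "n < i" using assms that in_keys_iff[of i m] by (auto simp: Mon_def)
thus "lookup (mres {..<n} m + sgl n (lookup m n)) i = lookup m i"
 by (cases i n rule: linorder_cases) (simp_all add: lookup_add lookup_mres lookup_single)
qed

lemma FM_expand:
 fixes f :: "'k::field_char_0 spoly"
 assumes "f:FM n r"
 shows "f = (\<Sum>p<r. dec n p f * X n ^ p)"
proof -
have f: "f = (SUM m:keys f. scalar (lookup f m) * mon m)" by (rule poly_expand) auto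
have m: "(mon m :: 'k spoly) = (\<Sum>p<r. dec n p (mon m) * X n ^ p)" if "m:keys f" for m :: monom
proof -
 have mF: "m:FMm n r" using that assms by (auto simp: FM_def mideal_def)
 define q where "q = lookup m n"
 define m' where "m' = mres {..<n} m"
 have "m = m' + sgl n q" using mF Mon_split_last[of m n] by (simp add: m'_def q_def FMm_def)
 hence mm: "(mon m :: 'k spoly) = mon m' * X n ^ q" by (simp add: X_power mon_add)
 have d: "dec n p (mon m :: 'k spoly) = (if p = q then mon m' else 0)" for p
 proof -
  have "dec n p (mon m' * X n ^ q :: 'k spoly) = mon m' * dec n p (X n ^ q)" by (rule dec_mult) (simp add: m'_def)
  thus ?thesis unfolding mm by (simp add: dec_X_power)
 qed
 have "q < r" using mF by (simp add: FMm_def q_def)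
 have "(\<Sum>p<r. dec n p (mon m) * X n ^ p) = (\<Sum>p<r. if p = q then mon m' * X n ^ p else 0 :: 'k spoly)"
  by (rule sum.cong) (simp_all add: d)
 also have "... = mon m" unfolding mm using \<open>q < r\<close> by simp
 finally show ?thesis by simp
qed
have "(\<Sum>p<r. dec n p f * X n ^ p) = (\<Sum>p<r. SUM m:keys f. scalar (lookup f m) * (dec n p (mon m) * X n ^ p))"
 by (subst f) (simp add: dec_sum dec_scalar sum_distrib_right mult.assoc)
also have "... = (SUM m:keys f. scalar (lookup f m) * (\<Sum>p<r. dec n p (mon m) * X n ^ p))"
 by (subst sum.swap) (simp add: sum_distrib_left)
also have "... = (SUM m:keys f. scalar (lookup f m) * mon m)" by (rule sum.cong) (simp_all add: m[symmetric])
finally show ?thesis using f by simp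
qed

lemma dec_enc:
 assumes "!!q. q < r ==> h q:PR n"
 shows "dec n p (\<Sum>q<r. h q * X n ^ q) = (if p < r then h p else 0)"
proof -
have "dec n p (\<Sum>q<r. h q * X n ^ q) = (\<Sum>q<r. if p = q then h q else 0)"
 unfolding dec_sum by (rule sum.cong) (use assms in "auto simp: dec_mult dec_X_power")
thus ?thesis by simp
qed

subsection \<open>Gradings\<close>

text \<open>Degree in the free module whose basis vector \<open>p\<close> has degree
  \<open>a p\<close>. With \<open>a\<close> constantly 0 it is the usual degree on polynomials in
  the first \<open>n\<close> variables.\<close>

definition gwt :: "nat=>(nat=>nat)=>monom=>nat" where "gwt n a m = mdeg (mres {..<n} m) + a (lookup m n)"

definition Dg :: "nat=>(nat=>nat)=>nat=>monom set" where "Dg n a d = {m. gwt n a m = d}"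

lemma gwt_add: "m:Mn n ==> gwt n a (m + k) = mdeg m + gwt n a k"
proof -
assume m: "m:Mn n"
hence "lookup m n = 0" by (rule Mon_lookup_zero) simp
thus ?thesis using m by (simp add: gwt_def mres_add mres_id lookup_add)
qed

lemma gwt_single: "gwt n a (sgl n p) = a p"
proof -
have "mres {..<n} (sgl n p) = 0" unfolding mres_zero_iff by auto
thus ?thesis by (simp add: gwt_def)
qed

lemma dec_Dg:
 assumes "f:mideal {m. P (gwt n a m)}"
 shows "dec n p f:mideal {m:Mn n. P (mdeg m + a p)}" unfolding mideal_def
proof (intro CollectI subsetI)
fix m assume "m:keys (dec n p f)"
hence "m:Mn n" "m + sgl n p:keys f" using keys_dec by blast+
thus "m:Mn n & P (mdeg m + a p)" using assms by (auto simp: mideal_def gwt_add gwt_single)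
qed

lemma app_gwt:
 assumes g: "!!q. q < r ==> g q:mideal (Dg n c (a q))" and f: "f:mideal {m. P (gwt n a m)}"
 shows "app n r g f:mideal {m. P (gwt n c m)}" unfolding app_def
proof (rule mideal_sum)
fix q assume "q:{..<r}"
thus "dec n q f * g q:mideal {m. P (gwt n c m)}"
 using dec_Dg[OF f, of q] g[of q] by (intro mideal_mult) (auto simp: Dg_def gwt_add)
qed

lemma pr_zero_disjoint: "f:mideal (- C) ==> pr C f = 0" by (rule poly_mapping_eqI) (auto simp: lookup_pr mideal_def in_keys_iff)

lemma pr_in_mideal [simp]: "pr C f:mideal C" by (simp add: mideal_def keys_pr)

lemma pr_split: "pr C f + pr (- C) f = f" by (rule poly_mapping_eqI) (simp add: lookup_pr lookup_add)

lemma app_pr: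
 assumes g: "!!q. q < r ==> g q:mideal (Dg n c (a q))"
 shows "app n r g (pr (Dg n a d) f) = pr (Dg n c d) (app n r g f)"
proof -
have D: "Dg n a d = {m. gwt n a m = d}" "- Dg n a d = {m. gwt n a m ~= d}" "Dg n c d = {m. gwt n c m = d}" "- Dg n c d = {m. gwt n c m ~= d}"
 by (auto simp: Dg_def)
have 1: "app n r g (pr (Dg n a d) f):mideal (Dg n c d)"
 unfolding D(3) by (rule app_gwt[OF g]) (auto simp: Dg_def mideal_def keys_pr)
have 2: "app n r g (pr (- Dg n a d) f):mideal (- Dg n c d)"
 unfolding D(4) by (rule app_gwt[OF g]) (auto simp: Dg_def mideal_def keys_pr)
have "app n r g f = app n r g (pr (Dg n a d) f) + app n r g (pr (- Dg n a d) f)"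
 unfolding klin_add[OF klin_app, symmetric] pr_split ..
hence "pr (Dg n c d) (app n r g f) = pr (Dg n c d) (app n r g (pr (Dg n a d) f)) + pr (Dg n c d) (app n r g (pr (- Dg n a d) f))"
 by (simp add: pr_add)
also have "... = app n r g (pr (Dg n a d) f)"
 using pr_zero_disjoint[OF 2] pr_id[of "app n r g (pr (Dg n a d) f)" "Dg n c d"] 1 by (simp add: mideal_def)
finally show ?thesis by simp
qed

text \<open>Graded submodules over the ring in the first \<open>n\<close> variables, for the degrees
  \<open>c\<close>; gradedness is closure under the projections to components.\<close>

definition gsub :: "nat=>(nat=>nat)=>'k::field_char_0 spoly set=>bool" where
 "gsub n c Z \<longleftrightarrow> 0:Z & (ALL f:Z. ALL g:Z. f + g:Z) & (ALL h:PR n. ALL f:Z. h * f:Z) &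
 (ALL f:Z. ALL d. pr (Dg n c d) f:Z)"

lemma gsubD:
 assumes "gsub n c Z"
 shows "0:Z" "f:Z ==> g:Z ==> f + g:Z" "h:PR n ==> f:Z ==> h * f:Z" "f:Z ==> pr (Dg n c d) f:Z"
using assms by (auto simp: gsub_def)

lemma gsub_sum: "gsub n c Z ==> (!!x. x:A ==> f x:Z) ==> (SUM x:A. f x):Z"
by (induction A rule: infinite_finite_induct) (auto intro: gsubD)

lemma gsub_subspace: "gsub n c Z ==> vs.subspace Z" unfolding vs.subspace_def using gsubD poly_ring_scalar by blast

lemma pr_components:
 assumes "finite A" "!!m. m:keys f ==> gwt n c m:A"
 shows "f = (SUM d:A. pr (Dg n c d) f)"
proof (rule poly_mapping_eqI)
fix m
have "lookup (SUM d:A. pr (Dg n c d) f) m = (SUM d:A. if gwt n c m = d then lookup f m else 0)"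
 unfolding lookup_sum by (rule sum.cong) (auto simp: lookup_pr Dg_def)
thus "lookup f m = lookup (SUM d:A. pr (Dg n c d) f) m" using assms by (auto simp: in_keys_iff)
qed

lemma gsub_homogeneous_cover:
 assumes Z: "gsub n c Z" and M: "gsub n c M" and sub: "!!d f. f:Z ==> f:mideal (Dg n c d) ==> f:M"
 shows "Z <= M"
proof
fix f assume f: "f:Z"
have "f = (SUM d:gwt n c ` keys f. pr (Dg n c d) f)" by (rule pr_components) auto
also have "...:M" by (rule gsub_sum[OF M], rule sub[OF gsubD(4)[OF Z f] pr_in_mideal])
finally show "f:M" .
qed

lemma gsub_FM: "gsub n a (FM n r)" unfolding gsub_def by (auto intro: FM_add FM_mult) (auto simp: FM_def mideal_def keys_pr)

lemma gsub_app_image: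
 fixes g :: "nat=>'k::field_char_0 spoly"
 assumes g: "!!q. q < r ==> g q:mideal (Dg n c (a q))"
 shows "gsub n c (app n r g ` FM n r)" unfolding gsub_def
proof (intro conjI ballI allI)
note FM = gsubD[OF gsub_FM[of n a r]]
show "0:app n r g ` FM n r" by (rule rev_image_eqI[OF FM(1)]) (simp add: klin_zero[OF klin_app])
fix x assume "x:app n r g ` FM n r"
then obtain f where f: "x = app n r g f" "f:FM n r" by blast
{ fix y assume "y:app n r g ` FM n r"
 then obtain f' where f': "y = app n r g f'" "f':FM n r" by blast
 show "x + y:app n r g ` FM n r" unfolding f(1) f'(1) klin_add[OF klin_app, symmetric] by (intro imageI FM(2) f(2) f'(2)) }
{ fix d show "pr (Dg n c d) x:app n r g ` FM n r"
 proof -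
  have "pr (Dg n c d) x = app n r g (pr (Dg n a d) f)" unfolding f(1) by (rule app_pr[symmetric]) (rule g)
  thus ?thesis by (simp only:) (intro imageI FM(4) f(2))
 qed }
next
fix h x :: "'k spoly" assume h: "h:PR n" and "x:app n r g ` FM n r"
then obtain f where f: "x = app n r g f" "f:FM n r" by blast
show "h * x:app n r g ` FM n r" unfolding f(1) app_mult[OF h, symmetric] by (intro imageI FM_mult[OF h f(2)])
qed

definition Ker :: "nat=>nat=>(nat=>'k::field_char_0 spoly)=>'k spoly set" where "Ker n r g = {f:FM n r. app n r g f = 0}"

lemma gsub_Ker:
 assumes g: "!!q. q < r ==> g q:mideal (Dg n c (a q))"
 shows "gsub n a (Ker n r g)" using gsub_FM[of n a r] unfolding gsub_def Ker_def
by (auto simp: klin_zero[OF klin_app] klin_add[OF klin_app] app_mult app_pr[of r g n c a, OF g])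

lemma finite_FMm_Dg: "finite (FMm n s Int Dg n c d)"
proof (rule finite_subset)
show "FMm n s Int Dg n c d <= (%(m, p). m + sgl n p) ` ((\<Union>e\<le>d. Mn n Int Deg e) \<times> {..<s})"
proof
 fix m assume m: "m:FMm n s Int Dg n c d"
 hence "m = mres {..<n} m + sgl n (lookup m n)" using Mon_split_last[of m n] by (simp add: FMm_def)
 moreover have "mres {..<n} m:(\<Union>e\<le>d. Mn n Int Deg e)" using m by (auto simp: Dg_def gwt_def)
 moreover have "lookup m n < s" using m by (simp add: FMm_def)
 ultimately show "m:(%(m, p). m + sgl n p) ` ((\<Union>e\<le>d. Mn n Int Deg e) \<times> {..<s})"
  by (intro image_eqI[of _ _ "(mres {..<n} m, lookup m n)"]) auto
qed
show "finite ((%(m, p). m + sgl n p) ` ((\<Union>e\<le>d. Mn n Int Deg e) \<times> {..<s}))"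
 by (intro finite_imageI finite_cartesian_product finite_UN_I finite_MD finite_atMost finite_lessThan)
qed

section \<open>Minimal generators and their relations\<close>

text \<open>A minimal homogeneous system of generators of \<open>Z\<close>. Minimality is a
  condition on relations: none of their coordinates has a nonzero constant term.\<close>

definition stage :: "nat=>(nat=>nat)=>'k::field_char_0 spoly set=>nat=>(nat=>nat)=>(nat=>'k spoly)=>bool" where
 "stage n c Z r a g \<longleftrightarrow> (ALL q<r. g q:mideal (Dg n c (a q))) & app n r g ` FM n r = Z &
 (ALL f:Ker n r g. ALL p<r. lookup f (sgl n p) = 0)"

lemma stageD:
 assumes "stage n c Z r a g"
 shows "q < r ==> g q:mideal (Dg n c (a q))" "app n r g ` FM n r = Z" "f:Ker n r g ==> p < r ==> lookup f (sgl n p) = 0"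
using assms by (simp_all add: stage_def)

lemma app_image_subset:
 assumes "gsub n c M" "!!q. q < r ==> g q:M"
 shows "app n r g f:M" unfolding app_def by (rule gsub_sum[OF assms(1)]) (auto intro: gsubD(3)[OF assms(1)] assms(2))

lemma X_power_in_FM: "q < r ==> X n ^ q:FM n r" using R_X_in_FM[of 1 n q r] by simp

lemma gen_in_image: "q < r ==> g q:app n r g ` FM n r" using app_X[of q r n g] X_power_in_FM[of q r n] by (metis imageI)

lemma leads_lift:
 fixes Z :: "'k::field_char_0 spoly set"
 assumes Z: "gsub n c Z" and t: "t:leads Z"
 shows "EX f:Z. f ~= 0 & lead f = t & f:mideal (Dg n c (gwt n c t))"
proof -
obtain f where f: "f:Z" "f ~= 0" "lead f = t" using t by (auto simp: leads_def)
let ?f = "pr (Dg n c (gwt n c t)) f"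
have "t:keys f" using f lead_in_keys by blast
hence t: "t:keys ?f" by (simp add: keys_pr Dg_def)
moreover have "lead ?f = t" by (rule lead_eqI[OF t]) (use f lead_ge[of _ f] in "auto simp: keys_pr")
moreover have "?f ~= 0" using t by auto
ultimately show ?thesis using gsubD(4)[OF Z f(1)] by (intro bexI[of _ ?f]) auto
qed

text \<open>Groebner basis argument: Dickson's lemma is applied to the leading monomials in each of
  the \<open>s\<close> coordinates, and division in each degree shows that homogeneous elements with
  these leading monomials generate.\<close>

lemma gens_exist:
 fixes Z :: "'k::field_char_0 spoly set"
 assumes Z: "gsub n c Z" "Z <= FM n s"
 shows "EX r a g. (ALL q<r. g q:mideal (Dg n c (a q))) & app n r g ` FM n r = Z"
proof -
have lM: "leads Z <= FMm n s"
proof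
 fix t assume "t:leads Z"
 then obtain f where "f:Z" "f ~= 0" "lead f = t" by (auto simp: leads_def)
 thus "t:FMm n s" using Z(2) lead_in_keys[of f] by (auto simp: FM_def mideal_def)
qed
define L where "L p = {m:leads Z. lookup m n = p}" for p
have "L p <= Mon {..<Suc n}" for p using lM by (auto simp: L_def FMm_def lessThan_Suc_atMost)
hence "\<exists>B\<subseteq>L p. finite B & (ALL a:L p. EX b:B. ALL i. lookup b i <= lookup a i)" for p by (rule dickson_finite)
then obtain B where B: "!!p. B p <= L p" "!!p. finite (B p)" "!!p a. a:L p ==> EX b:B p. ALL i. lookup b i <= lookup a i" by metis
let ?B = "\<Union>p<s. B p"
have finB: "finite ?B" using B(2) by simp
have BL: "?B <= leads Z" using B(1) by (auto simp: L_def)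
have "ALL b:?B. EX f:Z. f ~= 0 & lead f = b & f:mideal (Dg n c (gwt n c b))" using leads_lift[OF Z(1)] BL by blast
from bchoice[OF this[unfolded Bex_def]] obtain \<phi> where
 \<phi>: "!!b. b:?B ==> \<phi> b:Z & \<phi> b ~= 0 & lead (\<phi> b) = b & \<phi> b:mideal (Dg n c (gwt n c b))" by blast
define r where "r = card ?B"
obtain \<rho> where \<rho>: "bij_betw \<rho> {0..<r} ?B" unfolding r_def using ex_bij_betw_nat_finite[OF finB] by blast
define g where "g q = \<phi> (\<rho> q)" for q
define a where "a q = gwt n c (\<rho> q)" for q
have \<rho>B: "\<rho> q:?B" if "q < r" for q using \<rho> that by (auto simp: bij_betw_def)
have gZ: "g q:Z" and gD: "g q:mideal (Dg n c (a q))" if "q < r" for q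
 using \<phi>[OF \<rho>B[OF that]] by (simp_all add: g_def a_def)
let ?M = "app n r g ` FM n r"
have M: "gsub n c ?M" by (rule gsub_app_image[OF gD])
have MZ: "?M <= Z" by (rule image_subsetI, rule app_image_subset[OF Z(1)], rule gZ)
have "Z <= ?M"
proof (rule gsub_homogeneous_cover[OF Z(1) M])
 fix d f assume f: "f:Z" "f:mideal (Dg n c d)"
 let ?W = "Z Int mideal (Dg n c d)"
 have W: "vs.subspace ?W" by (intro vs.subspace_inter gsub_subspace[OF Z(1)] subspace_mideal)
 let ?B' = "{x:?M Int ?W. x ~= 0}"
 have "?W <= vs.span ?B'"
 proof (rule span_leads[OF W finite_FMm_Dg[of n s c d]])
  show "keys f <= FMm n s Int Dg n c d" if "f:?W" for f using that Z(2) by (auto simp: FM_def mideal_def)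
  show "leads ?W <= lead ` ?B'"
  proof
   fix t assume t: "t:leads ?W"
   hence tZ: "t:leads Z" using leads_mono[of ?W Z] by blast
   have td: "gwt n c t = d"
   proof -
    obtain x where "x:?W" "x ~= 0" "lead x = t" using t by (auto simp: leads_def)
    thus ?thesis using lead_in_keys[of x] by (auto simp: mideal_def Dg_def)
   qed
   have ts: "lookup t n < s" "t:Mon {..n}" using lM tZ by (auto simp: FMm_def)
   obtain b where b: "b:B (lookup t n)" "ALL i. lookup b i <= lookup t i" using B(3)[of t "lookup t n"] tZ by (auto simp: L_def)
   have bn: "lookup b n = lookup t n" using B(1) b(1) by (auto simp: L_def)
   have bB: "b:?B" using b(1) ts by blast
   obtain k where k: "t = b + k" using b(2) mdvd_iff[of b t] by blast
   have "lookup k n = 0" using bn k by (simp add: lookup_add)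
   hence "n ~: keys k" by (simp add: in_keys_iff)
   moreover have "keys k <= {..n}" using ts(2) k by (auto simp: Mon_def keys_add_nat)
   ultimately have kM: "k:Mn n" unfolding Mon_def using order.order_iff_strict by auto
   obtain q where q: "q < r" "\<rho> q = b" using \<rho> bB by (force simp: bij_betw_def)
   let ?x = "mon k * \<phi> b"
   have "?x:?M" using gsubD(3)[OF M _ gen_in_image[OF q(1), of g n], of "mon k"] kM q(2) by (simp add: g_def)
   moreover have "?x:mideal (Dg n c d)"
   proof (rule mideal_mult)
    show "\<phi> b:mideal (Dg n c (gwt n c b))" using \<phi>[OF bB] by blast
    show "mon k:mideal {k}" by simp
    show "x + y:Dg n c d" if "x:{k}" "y:Dg n c (gwt n c b)" for x y
     using that kM td k gwt_add[OF kM, of c b] by (simp add: Dg_def gwt_add add.commute)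
   qed
   moreover have "?x ~= 0" using \<phi>[OF bB] by simp
   moreover have "lead ?x = t" using \<phi>[OF bB] lead_mon_mult[of "\<phi> b" k] k by (simp add: add.commute)
   ultimately have "?x:?B'" using MZ by blast
   thus "t:lead ` ?B'" using \<open>lead ?x = t\<close> by blast
  qed
 qed auto
 moreover have "vs.span ?B' <= ?M" by (rule vs.span_minimal[OF _ gsub_subspace[OF M]]) blast
 ultimately show "f:?M" using f by blast
qed
hence "?M = Z" using MZ by blast
thus ?thesis using gD by blast
qed

text \<open>A generating system with the least number of elements is minimal: a relation with a nonzero
  constant coefficient would allow to remove a generator.\<close>

lemma stage_exists:
 fixes Z :: "'k::field_char_0 spoly set"
 assumes Z: "gsub n c Z" "Z <= FM n s"
 shows "EX r a g. stage n c Z r a g"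
proof -
define P where "P r \<longleftrightarrow> (EX a g. (ALL q<r. g q:mideal (Dg n c (a q))) & app n r g ` FM n r = Z)" for r
have ex: "EX r. P r" using gens_exist[OF Z] by (auto simp: P_def)
define r where "r = (LEAST r. P r)"
have "P r" unfolding r_def by (rule LeastI_ex[OF ex])
then obtain a g where g: "!!q. q < r ==> g q:mideal (Dg n c (a q))" and im: "app n r g ` FM n r = Z" by (auto simp: P_def)
have gZ: "g q:Z" if "q < r" for q using gen_in_image[OF that, of g n] im by simp
have "lookup f (sgl n p) = 0" if f: "f:Ker n r g" and p: "p < r" for f p
proof (rule ccontr)
 assume nz: "lookup f (sgl n p) ~= 0"
 \<comment> \<open>In the component of degree \<open>a p\<close> the coordinate at \<open>p\<close>
   is a constant.\<close>
 define f' where "f' = pr (Dg n a (a p)) f"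
 have "app n r g f' = pr (Dg n c (a p)) (app n r g f)" unfolding f'_def by (rule app_pr) (rule g)
 hence app0: "app n r g f' = 0" using f by (simp add: Ker_def)
 define \<kappa> where "\<kappa> = lookup f (sgl n p)"
 have "dec n p f' = scalar \<kappa>"
 proof (rule poly_mapping_eqI)
  fix m
  show "lookup (dec n p f') m = lookup (scalar \<kappa>) m"
   by (cases "m = 0") (auto simp: lookup_dec f'_def lookup_pr Dg_def gwt_add gwt_single \<kappa>_def scalar_def lookup_single)
 qed
 let ?rest = "SUM q:{..<r} - {p}. dec n q f' * g q"
 have "app n r g f' = scalar \<kappa> * g p + ?rest"
  unfolding app_def using p \<open>dec n p f' = scalar \<kappa>\<close> by (subst sum.remove[of _ p]) auto
 hence "scalar \<kappa> * g p = scalar (- 1) * ?rest" using app0 by (simp add: scalar_uminus eq_neg_iff_add_eq_0)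
 hence "scalar (inverse \<kappa>) * (scalar \<kappa> * g p) = scalar (inverse \<kappa>) * (scalar (- 1) * ?rest)" by simp
 hence gp: "g p = scalar (inverse \<kappa> * - 1) * ?rest"
  using nz by (simp only: mult.assoc[symmetric] scalar_mult[symmetric]) (simp add: \<kappa>_def)
 \<comment> \<open>The redundant generator is overwritten by the last one, so that the rest have
   indices below \<open>r - 1\<close>.\<close>
 define g' where "g' = g(p := g (r - 1))"
 define a' where "a' = a(p := a (r - 1))"
 have g'D: "g' q:mideal (Dg n c (a' q))" and g'Z: "g' q:Z" if "q < r - 1" for q using g gZ that by (auto simp: g'_def a'_def)
 let ?M = "app n (r - 1) g' ` FM n (r - 1)"
 have M: "gsub n c ?M" by (rule gsub_app_image[OF g'D])
 have in_M: "g q:?M" if q: "q < r" "q ~= p" for q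
 proof (cases "q = r - 1")
  case True
  hence "p < r - 1" using p q by simp
  from gen_in_image[OF this, of g' n] show ?thesis using True by (simp add: g'_def)
 next
  case False
  hence "q < r - 1" using q by simp
  from gen_in_image[OF this, of g' n] show ?thesis using q by (simp add: g'_def)
 qed
 have "?rest:?M" by (intro gsub_sum[OF M] gsubD(3)[OF M dec_in_R] in_M) auto
 hence gpM: "g p:?M" unfolding gp by (rule gsubD(3)[OF M poly_ring_scalar])
 have "g q:?M" if "q < r" for q using in_M[OF that] gpM by (cases "q = p") auto
 hence "Z <= ?M" unfolding im[symmetric] using app_image_subset[OF M] by blast
 moreover have "?M <= Z" by (rule image_subsetI, rule app_image_subset[OF Z(1)], rule g'Z)
 ultimately have "P (r - 1)" unfolding P_def using g'D by blast
 hence "r <= r - 1" unfolding r_def by (rule Least_le)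
 thus False using p by simp
qed
hence "stage n c Z r a g" unfolding stage_def using g im by blast
thus ?thesis by blast
qed

section \<open>Comparison of minimal systems of generators\<close>

definition cmp :: "nat=>(nat=>nat)=>'k::field_char_0 spoly set=>nat=>'k spoly set" where "cmp n c Z d = Z Int mideal (Dg n c d)"

definition rlin :: "nat=>('k::field_char_0 spoly=>'k spoly)=>bool" where
 "rlin n T \<longleftrightarrow> (ALL f g. T (f + g) = T f + T g) & (ALL h:PR n. ALL f. T (h * f) = h * T f)"

lemma rlin_klin: "rlin n T ==> klin T" by (simp add: rlin_def klin_def)

lemma rlin_mult: "rlin n T ==> h:PR n ==> T (h * f) = h * T f" by (simp add: rlin_def)

lemma rlin_app: "rlin n (app n r g)" by (simp add: rlin_def klin_add[OF klin_app] app_mult)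

lemma cmp_subspace: "gsub n c Z ==> vs.subspace (cmp n c Z d)"
unfolding cmp_def by (intro vs.subspace_inter gsub_subspace subspace_mideal)

lemma stage_lift_degree:
 assumes S: "stage n c Z r a g" and z: "z:cmp n c Z d"
 shows "EX u:cmp n a (FM n r) d. app n r g u = z"
proof -
obtain f where f: "f:FM n r" "z = app n r g f" using z stageD(2)[OF S] by (auto simp: cmp_def)
have "app n r g (pr (Dg n a d) f) = pr (Dg n c d) z" unfolding f(2) by (rule app_pr) (rule stageD(1)[OF S])
also have "... = z" by (rule pr_id) (use z in "auto simp: cmp_def mideal_def")
finally show ?thesis using gsubD(4)[OF gsub_FM f(1), of a d] by (intro bexI[of _ "pr (Dg n a d) f"]) (auto simp: cmp_def)
qed

lemma app_cmp:
 assumes S: "stage n c Z r a g" and f: "f:cmp n a (FM n r) d"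
 shows "app n r g f:cmp n c Z d"
proof -
have "app n r g f:mideal {m. gwt n c m = d}" by (rule app_gwt[OF stageD(1)[OF S]]) (use f in "auto simp: cmp_def Dg_def")
thus ?thesis using stageD(2)[OF S] f by (auto simp: cmp_def Dg_def)
qed

lemma dec_zero_degree:
 assumes "f:mideal (Dg n a d)" "d < a q"
 shows "dec n q f = 0"
proof -
have "dec n q f:mideal {m:Mn n. mdeg m + a q = d}" using dec_Dg[of f "%x. x = d" n a q] assms(1) by (simp add: Dg_def)
moreover have "{m:Mn n. mdeg m + a q = d} = {}" using assms(2) by auto
ultimately show ?thesis by (simp add: mideal_def)
qed

text \<open>Without constant terms, each monomial of a relation is a variable times a monomial of
  degree one less; this drives the inductions on the degree.\<close>

lemma minimal_relation_monomial:
 assumes min: "!!p. p < r ==> lookup w (sgl n p) = 0"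
 and w: "w:FM n r" "w:mideal (Dg n a d)" and k: "k:keys w"
 shows "EX i k'. i < n & k = sgl i 1 + k' & k':FMm n r & Suc (gwt n a k') = d"
proof -
have kF: "k:Mon {..n}" "lookup k n < r" using w(1) k by (auto simp: FM_def mideal_def FMm_def)
have "k ~= sgl n (lookup k n)" using min[OF kF(2)] k by (auto simp: in_keys_iff)
hence "mres {..<n} k ~= 0" using Mon_split_last[OF kF(1)] by auto
then obtain i where i: "i:keys k" "i < n" unfolding mres_zero_iff by auto
then obtain k' where k': "k = sgl i 1 + k'" using monom_split_first by blast
have "k':FMm n r" using kF k' i by (auto simp: FMm_def lookup_add lookup_single)
moreover have "Suc (gwt n a k') = d" using gwt_add[of "sgl i 1" n a k'] i w(2) k k' by (auto simp: Mon_def mideal_def Dg_def)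
ultimately show ?thesis using i k' by blast
qed

text \<open>Generators are sent to lifts of their images. Surjectivity is Nakayama's lemma, by
  induction on the degree: what is missed is a relation of the minimal system \<open>g'\<close>, and
  its monomials have a variable as factor.\<close>

lemma lift_map:
 fixes T :: "'k::field_char_0 spoly=>'k spoly"
 assumes S: "stage n c Z r a g" and S': "stage n c' Z' r' a' g'" and T: "rlin n T"
 and bij: "!!d. d <= j ==> bij_betw T (cmp n c Z d) (cmp n c' Z' d)"
 shows "EX T2. rlin n T2 & (ALL d<=j. T2 ` cmp n a (FM n r) d = cmp n a' (FM n r') d) &
 (ALL d<=j. ALL f:cmp n a (FM n r) d. app n r' g' (T2 f) = T (app n r g f))"
proof -
have "EX h. h:FM n r' & h:mideal (Dg n a' (a q)) & (a q <= j --> app n r' g' h = T (g q))" if q: "q < r" for q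
proof (cases "a q <= j")
 case True
 have "g q:cmp n c Z (a q)" using stageD(1)[OF S q] gen_in_image[OF q, of g n] stageD(2)[OF S] by (simp add: cmp_def)
 hence "T (g q):cmp n c' Z' (a q)" using bij[OF True] by (auto simp: bij_betw_def)
 from stage_lift_degree[OF S' this] show ?thesis by (auto simp: cmp_def)
next
 case False
 \<comment> \<open>A generator of degree above \<open>j\<close> has coordinate 0 in all elements of
   degree up to \<open>j\<close>, so 0 is an admissible value.\<close>
 thus ?thesis using gsubD(1)[OF gsub_FM] by (intro exI[of _ 0]) auto
qed
hence "ALL q:{..<r}. EX h. h:FM n r' & h:mideal (Dg n a' (a q)) & (a q <= j --> app n r' g' h = T (g q))" by simp
from bchoice[OF this] obtain h where h: "!!q. q < r ==> h q:FM n r'" "!!q. q < r ==> h q:mideal (Dg n a' (a q))"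
 "!!q. q < r ==> a q <= j ==> app n r' g' (h q) = T (g q)" by auto
define T2 where "T2 = app n r h"
have T2: "rlin n T2" unfolding T2_def by (rule rlin_app)
have into: "T2 f:cmp n a' (FM n r') d" if f: "f:cmp n a (FM n r) d" for f d
proof -
 have "T2 f:mideal {m. gwt n a' m = d}" unfolding T2_def by (rule app_gwt[OF h(2)]) (use f in "auto simp: cmp_def Dg_def")
 moreover have "T2 f:FM n r'" unfolding T2_def by (rule app_image_subset[OF gsub_FM h(1)])
 ultimately show ?thesis by (simp add: cmp_def Dg_def)
qed
have comm: "app n r' g' (T2 f) = T (app n r g f)" if d: "d <= j" and f: "f:cmp n a (FM n r) d" for f d
proof -
 have "app n r' g' (T2 f) = (\<Sum>q<r. dec n q f * app n r' g' (h q))"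
  unfolding T2_def app_def[of n r h] by (simp add: klin_sum[OF klin_app] app_mult)
 also have "... = (\<Sum>q<r. dec n q f * T (g q))"
 proof (rule sum.cong[OF refl])
  fix q assume "q:{..<r}"
  thus "dec n q f * app n r' g' (h q) = dec n q f * T (g q)"
   using h(3)[of q] dec_zero_degree[of f n a d q] f d by (cases "a q <= j") (auto simp: cmp_def)
 qed
 also have "... = T (app n r g f)" unfolding app_def[of n r g] by (simp add: klin_sum[OF rlin_klin[OF T]] rlin_mult[OF T])
 finally show ?thesis .
qed
have onto: "d <= j ==> x:cmp n a' (FM n r') d ==> x:T2 ` cmp n a (FM n r) d" for d x
proof (induction d arbitrary: x rule: less_induct)
 case (less d)
 let ?V = "cmp n a (FM n r) d"
 have V: "vs.subspace ?V" by (rule cmp_subspace[OF gsub_FM])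
 have TV: "vs.subspace (T2 ` ?V)" by (rule subspace_klin_image[OF rlin_klin[OF T2] V])
 have "app n r' g' x:cmp n c' Z' d" by (rule app_cmp[OF S' less.prems(2)])
 hence "app n r' g' x:T ` cmp n c Z d" using bij[OF less.prems(1)] by (simp add: bij_betw_def)
 then obtain z where z: "z:cmp n c Z d" "app n r' g' x = T z" by blast
 obtain u where u: "u:?V" "app n r g u = z" using stage_lift_degree[OF S z(1)] by blast
 define w where "w = x - T2 u"
 have wV: "w:cmp n a' (FM n r') d" unfolding w_def
  by (rule vs.subspace_diff[OF cmp_subspace[OF gsub_FM] less.prems(2) into[OF u(1)]])
 have "app n r' g' w = 0" unfolding w_def klin_diff[OF klin_app] comm[OF less.prems(1) u(1)] u(2) z(2) by simp
 hence "w:Ker n r' g'" using wV by (simp add: Ker_def cmp_def)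
 note min = stageD(3)[OF S' this]
 have mon: "mon k:T2 ` ?V" if k: "k:keys w" for k
 proof -
  obtain i k' where ik: "i < n" "k = sgl i 1 + k'" "k':FMm n r'" "Suc (gwt n a' k') = d"
   using minimal_relation_monomial[of r' w n a' d k] min wV k by (auto simp: cmp_def)
  have "(mon k' :: 'k spoly):cmp n a' (FM n r') (gwt n a' k')" using ik by (simp add: cmp_def FM_def Dg_def)
  hence "mon k':T2 ` cmp n a (FM n r) (gwt n a' k')" by (rule less.IH[rotated 2]) (use ik less.prems in auto)
  then obtain v where v: "v:cmp n a (FM n r) (gwt n a' k')" "mon k' = T2 v" by blast
  have Xi: "(X i :: 'k spoly):PR n" using ik(1) by (simp add: X_in_poly_ring)
  have "mon k = X i * T2 v" unfolding v(2)[symmetric] ik(2) by (simp add: X_def mon_add)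
  also have "... = T2 (X i * v)" by (rule rlin_mult[OF T2 Xi, symmetric])
  also have "X i * v:?V"
  proof -
   have "X i * v:FM n r" by (rule FM_mult[OF Xi]) (use v(1) in "simp add: cmp_def")
   moreover have "X i * v:mideal (Dg n a d)"
   proof (rule mideal_mult)
    show "X i:mideal {sgl i 1}" by (simp add: X_def)
    show "v:mideal (Dg n a (gwt n a' k'))" using v(1) by (simp add: cmp_def)
    show "y + y':Dg n a d" if "y:{sgl i 1}" "y':Dg n a (gwt n a' k')" for y y'
     using that ik gwt_add[of "sgl i 1" n a y'] by (simp add: Dg_def Mon_def)
   qed
   ultimately show ?thesis by (simp add: cmp_def)
  qed
  ultimately show ?thesis by blast
 qed
 have "w = (SUM k:keys w. scalar (lookup w k) * mon k)" by (rule poly_expand) auto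
 also have "...:T2 ` ?V" by (rule vs.subspace_sum[OF TV], rule vs.subspace_scale[OF TV], rule mon)
 finally have "w:T2 ` ?V" .
 hence "w + T2 u:T2 ` ?V" by (rule vs.subspace_add[OF TV]) (use u in blast)
 thus ?case by (simp add: w_def)
qed
have "T2 ` cmp n a (FM n r) d = cmp n a' (FM n r') d" if "d <= j" for d using into onto[OF that] by blast
thus ?thesis using T2 comm by blast
qed

lemma cmp_finite_dim:
 assumes "V <= FM n r"
 shows "cmp n a V d <= vs.span (mon ` (FMm n r Int Dg n a d))" "finite ((mon :: monom=>'k::field_char_0 spoly) ` (FMm n r Int Dg n a d))"
proof -
have "cmp n a V d <= mideal (FMm n r Int Dg n a d)" using assms unfolding cmp_def FM_def mideal_Int[symmetric] by blast
thus "cmp n a V d <= vs.span (mon ` (FMm n r Int Dg n a d))" using mideal_span[OF finite_FMm_Dg] by blast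
show "finite ((mon :: monom=>'k spoly) ` (FMm n r Int Dg n a d))" by (intro finite_imageI finite_FMm_Dg)
qed

lemma dim_zero_subset:
 assumes "vs.dim K = 0" "K <= vs.span S" "finite S"
 shows "K <= {0 :: 'k::field_char_0 spoly}"
proof -
obtain B where B: "B <= K" "vs.independent B" "K <= vs.span B" "card B = vs.dim K" by (rule vs.basis_exists)
have "finite B" using vs.independent_span_bound[OF assms(3) B(2)] B(1) assms(2) by blast
hence "B = {}" using B(4) assms(1) by simp
thus ?thesis using B(3) by simp
qed

lemma mutual_surjections_inj:
 fixes T T' :: "'k::field_char_0 spoly=>'k spoly"
 assumes T: "klin T" "klin T'" and V: "vs.subspace V" "V <= vs.span S" "finite S"
 and W: "vs.subspace W" "W <= vs.span S'" "finite S'" and im: "T ` V = W" "T' ` W = V"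
 shows "inj_on T V" "vs.dim V = vs.dim W"
proof -
have 1: "vs.dim V = vs.dim W + vs.dim {f:V. T f = 0}" using rank_nullity[OF T(1) V] im by simp
have 2: "vs.dim W = vs.dim V + vs.dim {f:W. T' f = 0}" using rank_nullity[OF T(2) W] im by simp
show "vs.dim V = vs.dim W" using 1 2 by simp
have "vs.dim {f:V. T f = 0} = 0" using 1 2 by simp
hence K: "{f:V. T f = 0} <= {0}" by (rule dim_zero_subset[OF _ _ V(3)]) (use V(2) in blast)
show "inj_on T V"
proof (rule inj_onI)
 fix x y assume xy: "x:V" "y:V" "T x = T y"
 hence "x - y:{f:V. T f = 0}" by (simp add: klin_diff[OF T(1)] vs.subspace_diff[OF V(1)])
 thus "x = y" using K by auto
qed
qed

text \<open>One step of the uniqueness of minimal resolutions in degrees up to \<open>j\<close>.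
  Lifts in both directions are surjective, hence bijective by dimension, and they restrict to the
  kernels. The conclusion has the form of the hypothesis, so the step can be iterated.\<close>

lemma compare_step:
 fixes T T' :: "'k::field_char_0 spoly=>'k spoly"
 assumes S: "stage n c Z r a g" and S': "stage n c' Z' r' a' g'" and T: "rlin n T" "rlin n T'"
 and bij: "!!d. d <= j ==> bij_betw T (cmp n c Z d) (cmp n c' Z' d)"
 and bij': "!!d. d <= j ==> bij_betw T' (cmp n c' Z' d) (cmp n c Z d)"
 and Z: "gsub n c Z"
 shows "EX T2. rlin n T2 & (ALL d<=j. bij_betw T2 (cmp n a (Ker n r g) d) (cmp n a' (Ker n r' g') d))"
 "!!d. d <= j ==> vs.dim (cmp n a (FM n r :: 'k spoly set) d) = vs.dim (cmp n a' (FM n r' :: 'k spoly set) d)"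
proof -
let ?V = "cmp n a (FM n r :: 'k spoly set)" and ?W = "cmp n a' (FM n r' :: 'k spoly set)"
have "EX T2. rlin n T2 & (ALL d<=j. T2 ` ?V d = ?W d) & (ALL d<=j. ALL f:?V d. app n r' g' (T2 f) = T (app n r g f))"
 by (rule lift_map[OF S S' T(1)]) (rule bij)
then obtain T2 where "rlin n T2 & (ALL d<=j. T2 ` ?V d = ?W d) & (ALL d<=j. ALL f:?V d. app n r' g' (T2 f) = T (app n r g f))"
 by (rule exE)
hence T2: "rlin n T2" "!!d. d <= j ==> T2 ` ?V d = ?W d"
 "!!d f. d <= j ==> f:?V d ==> app n r' g' (T2 f) = T (app n r g f)" by simp_all
have "EX T3. rlin n T3 & (ALL d<=j. T3 ` ?W d = ?V d) & (ALL d<=j. ALL f:?W d. app n r g (T3 f) = T' (app n r' g' f))"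
 by (rule lift_map[OF S' S T(2)]) (rule bij')
then obtain T3 where "rlin n T3 & (ALL d<=j. T3 ` ?W d = ?V d) & (ALL d<=j. ALL f:?W d. app n r g (T3 f) = T' (app n r' g' f))"
 by (rule exE)
hence T3: "rlin n T3" "!!d. d <= j ==> T3 ` ?W d = ?V d" by simp_all
have V: "vs.subspace (?V d)" and W: "vs.subspace (?W d)" for d by (intro cmp_subspace gsub_FM)+
note ms = mutual_surjections_inj[OF rlin_klin[OF T2(1)] rlin_klin[OF T3(1)]
 V cmp_finite_dim[OF order_refl] W cmp_finite_dim[OF order_refl] T2(2) T3(2)]
show "vs.dim (?V d) = vs.dim (?W d)" if "d <= j" for d using ms(2)[OF that that] .
have "bij_betw T2 (cmp n a (Ker n r g) d) (cmp n a' (Ker n r' g') d)" if d: "d <= j" for d unfolding bij_betw_def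
proof (intro conjI subset_antisym subsetI)
 have sub: "cmp n a (Ker n r g) d <= ?V d" by (auto simp: cmp_def Ker_def)
 show "inj_on T2 (cmp n a (Ker n r g) d)" by (rule inj_on_subset[OF ms(1)[OF d d] sub])
 { fix x assume "x:T2 ` cmp n a (Ker n r g) d"
  then obtain f where f: "f:cmp n a (Ker n r g) d" "x = T2 f" by blast
  have fV: "f:?V d" using f(1) sub by blast
  have "x:?W d" using T2(2)[OF d] fV f(2) by blast
  moreover have "app n r' g' x = 0" unfolding f(2) T2(3)[OF d fV]
   using f(1) klin_zero[OF rlin_klin[OF T(1)]] by (simp add: cmp_def Ker_def)
  ultimately show "x:cmp n a' (Ker n r' g') d" by (simp add: cmp_def Ker_def) }
 { fix x assume x: "x:cmp n a' (Ker n r' g') d"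
  hence "x:?W d" by (auto simp: cmp_def Ker_def)
  then obtain f where f: "f:?V d" "x = T2 f" using T2(2)[OF d] by blast
  have "T (app n r g f) = T 0" using T2(3)[OF d f(1)] f(2) x klin_zero[OF rlin_klin[OF T(1)]] by (simp add: cmp_def Ker_def)
  moreover have "0:cmp n c Z d" using vs.subspace_0[OF cmp_subspace[OF Z]] .
  ultimately have "app n r g f = 0" using bij[OF d] app_cmp[OF S f(1)] unfolding bij_betw_def by (blast dest: inj_onD)
  hence "f:cmp n a (Ker n r g) d" using f(1) by (simp add: cmp_def Ker_def)
  thus "x:T2 ` cmp n a (Ker n r g) d" using f(2) by blast }
qed
thus "EX T2. rlin n T2 & (ALL d<=j. bij_betw T2 (cmp n a (Ker n r g) d) (cmp n a' (Ker n r' g') d))" using T2(1) by blast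
qed

section \<open>Graded ranks\<close>

definition nm :: "nat=>nat=>nat" where "nm n e = card (Mn n Int Deg e)"

lemma nm_0 [simp]: "nm n 0 = 1"
proof -
have "Mn n Int Deg 0 = {0}" by auto
thus ?thesis by (simp add: nm_def)
qed

lemma dim_FM:
 "vs.dim (cmp n a (FM n r :: 'k::field_char_0 spoly set) d) = (\<Sum>j\<le>d. card {q. q < r & a q = j} * nm n (d - j))"
proof -
let ?h = "%j. nm n (d - j)"
let ?A = "{q:{..<r}. a q <= d}"
let ?S = "%q. (%m. m + sgl n q) ` (Mn n Int Deg (d - a q))"
have U: "FMm n r Int Dg n a d = (UN q:?A. ?S q)"
proof (intro subset_antisym subsetI)
 fix k assume k: "k:FMm n r Int Dg n a d"
 hence "k = mres {..<n} k + sgl n (lookup k n)" "lookup k n < r" using Mon_split_last[of k n] by (simp_all add: FMm_def)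
 moreover have "mdeg (mres {..<n} k) + a (lookup k n) = d" using k by (simp add: Dg_def gwt_def)
 ultimately show "k:(UN q:?A. ?S q)" by (intro UN_I[of "lookup k n"] image_eqI[of _ _ "mres {..<n} k"]) auto
next
 fix k assume "k:(UN q:?A. ?S q)"
 then obtain q m where k: "q < r" "a q <= d" "k = m + sgl n q" "m:Mn n" "mdeg m = d - a q" by auto
 have "Mn n <= Mon {..n}" by (rule Mon_mono) auto
 hence "m:Mon {..n}" "sgl n q:Mon {..n}" using k(4) by (auto simp: Mon_def[of "{..n}"])
 hence "k:Mon {..n}" unfolding k(3) Mon_add ..
 thus "k:FMm n r Int Dg n a d" using k Mon_lookup_zero[OF k(4), of n] by (simp add: FMm_def lookup_add Dg_def gwt_add gwt_single)
qed
have lk: "lookup k n = q" if "k:?S q" for k q using that Mon_lookup_zero[of _ "{..<n}" n] by (auto simp: lookup_add)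
have "vs.dim (cmp n a (FM n r :: 'k spoly set) d) = card (FMm n r Int Dg n a d)"
 unfolding cmp_def FM_def mideal_Int by (rule dim_mideal[OF finite_FMm_Dg])
also have "... = (SUM q:?A. card (?S q))" unfolding U
proof (rule card_UN_disjoint)
 show "ALL q:?A. ALL q':?A. q ~= q' --> ?S q Int ?S q' = {}"
 proof (intro ballI impI, rule ccontr)
  fix q q' assume "q ~= q'" "?S q Int ?S q' ~= {}"
  then obtain k where "k:?S q" "k:?S q'" by blast
  thus False using lk[of k q] lk[of k q'] \<open>q ~= q'\<close> by simp
 qed
qed auto
also have "... = (SUM q:?A. ?h (a q))" by (rule sum.cong) (simp_all add: nm_def card_image inj_on_def)
also have "... = (\<Sum>j\<le>d. SUM q:{q:?A. a q = j}. ?h (a q))" by (rule sum.group[symmetric]) auto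
also have "... = (\<Sum>j\<le>d. card {q. q < r & a q = j} * ?h j)"
proof (rule sum.cong[OF refl])
 fix j assume "j:{..d}"
 hence "{q:?A. a q = j} = {q. q < r & a q = j}" by auto
 thus "(SUM q:{q:?A. a q = j}. ?h (a q)) = card {q. q < r & a q = j} * ?h j" by simp
qed
finally show ?thesis .
qed

lemma triangular_unique:
 fixes b b' :: "nat=>int"
 assumes "!!d. d <= j ==> (\<Sum>i\<le>d. b i * int (nm n (d - i))) = (\<Sum>i\<le>d. b' i * int (nm n (d - i)))"
 shows "i <= j ==> b i = b' i"
proof (induction i rule: less_induct)
case (less i)
have "(\<Sum>k<i. b k * int (nm n (i - k))) = (\<Sum>k<i. b' k * int (nm n (i - k)))" by (rule sum.cong) (use less in auto)
moreover have "(\<Sum>k<i. b k * int (nm n (i - k))) + b i * int (nm n (i - i)) = (\<Sum>k<i. b' k * int (nm n (i - k))) + b' i * int (nm n (i - i))"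
 using assms[OF less.prems] by (simp only: lessThan_Suc_atMost[symmetric] sum.lessThan_Suc)
ultimately show ?case by simp
qed

section \<open>Resolutions as chains of stages\<close>

definition chain :: "nat=>'k::field_char_0 spoly set=>(nat=>nat)=>(nat=>nat=>nat)=>(nat=>nat=>'k spoly)=>bool" where
 "chain n J r a g \<longleftrightarrow> stage n (%_. 0) J (r 0) (a 0) (g 0) &
 (ALL i. stage n (a i) (Ker n (r i) (g i)) (r (Suc i)) (a (Suc i)) (g (Suc i)))"

definition Zc :: "nat=>'k::field_char_0 spoly set=>(nat=>nat)=>(nat=>nat=>'k spoly)=>nat=>'k spoly set" where
 "Zc n J r g i = (case i of 0=>J | Suc k=>Ker n (r k) (g k))"

definition wc :: "(nat=>nat=>nat)=>nat=>nat=>nat" where "wc a i = (case i of 0=>%_. 0 | Suc k=>a k)"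

lemma Zc_simps [simp]: "Zc n J r g 0 = J" "Zc n J r g (Suc k) = Ker n (r k) (g k)" "wc a 0 = (%_. 0)" "wc a (Suc k) = a k"
by (simp_all add: Zc_def wc_def)

lemma chain_stage: "chain n J r a g ==> stage n (wc a i) (Zc n J r g i) (r i) (a i) (g i)" by (cases i) (auto simp: chain_def)

lemma stage_gsub: "stage n c Z r a g ==> gsub n c Z" using gsub_app_image[of r g n c a] stageD[of n c Z r a g] by auto

text \<open>Betti numbers of internal degree \<open>j\<close> depend on the ideal up to degree
  \<open>j\<close>. In this form the uniqueness also compares an ideal in many variables with the
  extension of one in few.\<close>

lemma chain_unique:
 fixes J J' :: "'k::field_char_0 spoly set"
 assumes C: "chain n J r a g" and C': "chain n J' r' a' g'"
 and eq: "!!d. d <= j ==> cmp n (%_. 0) J d = cmp n (%_. 0) J' d"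
 shows "card {q. q < r i & a i q = j} = card {q. q < r' i & a' i q = j}"
proof -
let ?Z = "%i. cmp n (wc a i) (Zc n J r g i)" and ?Z' = "%i. cmp n (wc a' i) (Zc n J' r' g' i)"
have iso: "EX T T'. rlin n T & rlin n T' & (ALL d<=j. bij_betw T (?Z i d) (?Z' i d)) & (ALL d<=j. bij_betw T' (?Z' i d) (?Z i d))" for i
proof (induction i)
 case 0
 show ?case using eq by (intro exI[of _ "%x. x"]) (auto simp: rlin_def bij_betw_def)
next
 case (Suc i)
 then obtain T T' where T: "rlin n T" "rlin n T'" "!!d. d <= j ==> bij_betw T (?Z i d) (?Z' i d)" "!!d. d <= j ==> bij_betw T' (?Z' i d) (?Z i d)"
  by blast
 note S = chain_stage[OF C, of i] and S' = chain_stage[OF C', of i]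
 show ?case using compare_step(1)[OF S S' T(1,2,3,4) stage_gsub[OF S]]
   compare_step(1)[OF S' S T(2,1,4,3) stage_gsub[OF S']] by simp blast
qed
obtain T T' where T: "rlin n T" "rlin n T'" "!!d. d <= j ==> bij_betw T (?Z i d) (?Z' i d)" "!!d. d <= j ==> bij_betw T' (?Z' i d) (?Z i d)"
 using iso by blast
note S = chain_stage[OF C, of i] and S' = chain_stage[OF C', of i]
have dim: "vs.dim (cmp n (a i) (FM n (r i) :: 'k spoly set) d) = vs.dim (cmp n (a' i) (FM n (r' i) :: 'k spoly set) d)" if "d <= j" for d
 by (rule compare_step(2)[OF S S' T(1,2,3,4) stage_gsub[OF S] that])
have "int (card {q. q < r i & a i q = j}) = int (card {q. q < r' i & a' i q = j})"
proof (rule triangular_unique[where b = "%k. int (card {q. q < r i & a i q = k})" and b' = "%k. int (card {q. q < r' i & a' i q = k})" and j = j and n = n])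
 fix d assume "d <= j"
 from dim[OF this] show "(\<Sum>k\<le>d. int (card {q. q < r i & a i q = k}) * int (nm n (d - k))) = (\<Sum>k\<le>d. int (card {q. q < r' i & a' i q = k}) * int (nm n (d - k)))"
  unfolding dim_FM by (simp flip: of_nat_mult of_nat_sum)
qed simp
thus ?thesis by simp
qed

lemma chain_exists:
 fixes J :: "'k::field_char_0 spoly set"
 assumes J: "gsub n (%_. 0) J" "J <= FM n s"
 shows "EX r a g. chain n J r a g"
proof -
let ?P = "%k (x :: nat \<times> (nat=>nat) \<times> (nat=>'k spoly)). case x of (r, a, g) =>
 (EX c. ALL q<r. g q:mideal (Dg n c (a q))) & (k = 0 --> stage n (%_. 0) J r a g)"
let ?Q = "%k (x :: nat \<times> (nat=>nat) \<times> (nat=>'k spoly)) (y :: nat \<times> (nat=>nat) \<times> (nat=>'k spoly)).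
 case x of (r, a, g)=>case y of (r', a', g')=>stage n a (Ker n r g) r' a' g'"
have "EX f. ALL k. ?P k (f k) & ?Q k (f k) (f (Suc k))"
proof (rule dependent_nat_choice)
 obtain r a g where S: "stage n (%_. 0) J r a g" using stage_exists[OF J] by blast
 hence "?P 0 (r, a, g)" using stageD(1)[OF S] by auto
 thus "EX x. ?P 0 x" by blast
next
 fix x and k :: nat assume "?P k x"
 then obtain r a g c where x: "x = (r, a, g)" "!!q. q < r ==> g q:mideal (Dg n c (a q))" by (cases x) auto
 have "gsub n a (Ker n r g)" by (rule gsub_Ker) (rule x(2))
 moreover have "Ker n r g <= FM n r" by (auto simp: Ker_def)
 ultimately obtain r' a' g' where S: "stage n a (Ker n r g) r' a' g'" using stage_exists by blast
 hence "?P (Suc k) (r', a', g') & ?Q k x (r', a', g')" using stageD(1)[OF S] x(1) by auto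
 thus "EX y. ?P (Suc k) y & ?Q k x y" by blast
qed
then obtain f where f0: "ALL k. ?P k (f k) & ?Q k (f k) (f (Suc k))" by (rule exE)
have f: "?P k (f k)" "?Q k (f k) (f (Suc k))" for k by (rule conjunct1[OF spec[OF f0]], rule conjunct2[OF spec[OF f0]])
have "chain n J (%i. fst (f i)) (%i. fst (snd (f i))) (%i. snd (snd (f i)))"
 unfolding chain_def using f(1)[of 0] f(2) by (auto simp: case_prod_beta)
thus ?thesis by blast
qed

text \<open>Each syzygy step raises the degree by at least one, so the resolution is finite in every
  fixed degree; this takes the place of a bound on its length.\<close>

lemma chain_weight_ge:
 fixes J :: "'k::field_char_0 spoly set"
 assumes C: "chain n J r a g"
 shows "q < r i ==> i <= a i q"
proof (induction i arbitrary: q)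
case (Suc i)
note S = chain_stage[OF C, of i] and S' = chain_stage[OF C, of "Suc i"]
have "g (Suc i) q ~= 0"
proof
 assume "g (Suc i) q = 0"
 hence "X n ^ q:Ker n (r (Suc i)) (g (Suc i))"
  using X_power_in_FM[OF Suc.prems, of n, where 'a = 'k] app_X[OF Suc.prems, of n "g (Suc i)"] by (simp add: Ker_def)
 from stageD(3)[OF S' this Suc.prems] show False by (simp add: X_power)
qed
then obtain k where k: "k:keys (g (Suc i) q)" by (metis keys_eq_empty ex_in_conv)
have K: "g (Suc i) q:Ker n (r i) (g i)" using gen_in_image[OF Suc.prems, of "g (Suc i)" n] stageD(2)[OF S'] by simp
have D: "g (Suc i) q:mideal (Dg n (a i) (a (Suc i) q))" using stageD(1)[OF S' Suc.prems] by simp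
obtain i' k' where k': "k':FMm n (r i)" "Suc (gwt n (a i) k') = a (Suc i) q"
 using minimal_relation_monomial[of "r i" "g (Suc i) q" n "a i" "a (Suc i) q" k] stageD(3)[OF S K] K D k by (auto simp: Ker_def)
hence "i <= a i (lookup k' n)" using Suc.IH by (simp add: FMm_def)
thus ?case using k'(2) by (simp add: gwt_def)
qed simp

text \<open>Dimensions in degree \<open>d\<close> telescope by rank-nullity, and the free module
  with index \<open>Suc d\<close> has no part in that degree.\<close>

lemma chain_euler:
 fixes J :: "'k::field_char_0 spoly set"
 assumes C: "chain n J r a g"
 shows "int (vs.dim (cmp n (%_. 0) J d)) =
 (\<Sum>j\<le>d. (\<Sum>i=0..j. (-1) ^ i * int (card {q. q < r i & a i q = j})) * int (nm n (d - j)))"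
proof -
let ?F = "%i. int (vs.dim (cmp n (a i) (FM n (r i) :: 'k spoly set) d))"
let ?Z = "%i. int (vs.dim (cmp n (wc a i) (Zc n J r g i) d))"
let ?b = "%i j. int (card {q. q < r i & a i q = j})"
have step: "?F i = ?Z i + ?Z (Suc i)" for i
proof -
 note S = chain_stage[OF C, of i]
 let ?V = "cmp n (a i) (FM n (r i) :: 'k spoly set) d"
 have "app n (r i) (g i) ` ?V = cmp n (wc a i) (Zc n J r g i) d" using app_cmp[OF S] stage_lift_degree[OF S] by blast
 moreover have "{f:?V. app n (r i) (g i) f = 0} = cmp n (a i) (Ker n (r i) (g i)) d" by (auto simp: cmp_def Ker_def)
 moreover have "vs.subspace ?V" by (rule cmp_subspace[OF gsub_FM])
 ultimately show ?thesis
  using rank_nullity[OF klin_app[of n "r i" "g i"] _ cmp_finite_dim[OF order_refl[of "FM n (r i)"], of "a i" d]] by simp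
qed
have alt: "?Z 0 = (\<Sum>i<k. (-1) ^ i * ?F i) + (-1) ^ k * ?Z k" for k
proof (induction k)
 case (Suc k)
 thus ?case using step[of k] by (simp add: algebra_simps)
qed simp
have "card {q. q < r (Suc d) & a (Suc d) q = j} = 0" if "j <= d" for j
proof -
 have "{q. q < r (Suc d) & a (Suc d) q = j} = {}" using chain_weight_ge[OF C, of _ "Suc d"] that by fastforce
 thus ?thesis by (simp only: card.empty)
qed
hence "(\<Sum>j\<le>d. card {q. q < r (Suc d) & a (Suc d) q = j} * nm n (d - j)) = 0" by (intro sum.neutral) simp
hence "?F (Suc d) = 0" by (simp only: dim_FM of_nat_0)
hence Z0: "?Z (Suc d) = 0" using step[of "Suc d"] by linarith
have "int (vs.dim (cmp n (%_. 0) J d)) = (\<Sum>i\<le>d. (-1) ^ i * ?F i)"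
 using alt[of "Suc d"] Z0 by (simp add: lessThan_Suc_atMost)
also have "... = (\<Sum>i\<le>d. \<Sum>j\<le>d. (-1) ^ i * ?b i j * int (nm n (d - j)))"
 by (simp add: dim_FM sum_distrib_left mult.assoc)
also have "... = (\<Sum>j\<le>d. \<Sum>i\<le>d. (-1) ^ i * ?b i j * int (nm n (d - j)))" by (rule sum.swap)
also have "... = (\<Sum>j\<le>d. (\<Sum>i=0..j. (-1) ^ i * ?b i j) * int (nm n (d - j)))"
proof (rule sum.cong[OF refl])
 fix j assume j: "j:{..d}"
 have "?b i j = 0" if "j < i" for i
 proof -
  have "{q. q < r i & a i q = j} = {}" using chain_weight_ge[OF C, of _ i] that by fastforce
  thus ?thesis by simp
 qed
 hence "(\<Sum>i\<le>d. (-1) ^ i * ?b i j) = (\<Sum>i=0..j. (-1) ^ i * ?b i j)"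
  by (intro sum.mono_neutral_right) (use j in "auto simp: not_le")
 thus "(\<Sum>i\<le>d. (-1) ^ i * ?b i j * int (nm n (d - j))) = (\<Sum>i=0..j. (-1) ^ i * ?b i j) * int (nm n (d - j))"
  by (simp only: sum_distrib_right[symmetric])
qed
finally show ?thesis .
qed

section \<open>Minimal free resolutions\<close>

definition enc :: "nat=>nat=>(nat=>'k::field_char_0 spoly)=>'k spoly" where "enc n s v = (\<Sum>p<s. v p * X n ^ p)"

lemma enc_in_FM: "(!!p. p < s ==> v p:PR n) ==> enc n s v:FM n s"
unfolding enc_def by (rule gsub_sum[OF gsub_FM]) (auto intro: R_X_in_FM)

lemma dec_enc_eq: "(!!p. p < s ==> v p:PR n) ==> p < s ==> dec n p (enc n s v) = v p"
unfolding enc_def using dec_enc[of s v n p] by simp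

lemma enc_dec: "f:FM n s ==> enc n s (%p. dec n p f) = f" unfolding enc_def using FM_expand[of f n s] by simp

lemma enc_cong: "(!!p. p < s ==> v p = v' p) ==> enc n s v = enc n s v'" unfolding enc_def by (rule sum.cong) auto

lemma app_enc: "(!!p. p < s ==> v p:PR n) ==> app n s g (enc n s v) = (\<Sum>q<s. v q * g q)"
unfolding app_def by (rule sum.cong) (auto simp: dec_enc_eq)

lemma free_mod_R: "v:free_mod R s ==> p < s ==> v p:R" by (simp add: free_mod_def)

lemma enc_bij: "inj_on (enc n s) (free_mod (PR n :: 'k::field_char_0 spoly set) s)"
 "enc n s ` free_mod (PR n) s = (FM n s :: 'k spoly set)"
proof -
show "inj_on (enc n s) (free_mod (PR n :: 'k spoly set) s)"
proof (rule inj_onI, rule ext)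
 fix v w :: "nat=>'k spoly" and p
 assume vw: "v:free_mod (PR n) s" "w:free_mod (PR n) s" "enc n s v = enc n s w"
 show "v p = w p"
 proof (cases "p < s")
  case True
  thus ?thesis using dec_enc_eq[of s v n p] dec_enc_eq[of s w n p] vw free_mod_R by metis
 qed (use vw in "simp add: free_mod_def")
qed
show "enc n s ` free_mod (PR n) s = (FM n s :: 'k spoly set)"
proof (intro subset_antisym subsetI)
 fix f :: "'k spoly" assume f: "f:FM n s"
 let ?v = "%p. if p < s then dec n p f else 0"
 have "enc n s ?v = f" using enc_dec[OF f] enc_cong[of s ?v "%p. dec n p f" n] by simp
 moreover have "?v:free_mod (PR n) s" by (simp add: free_mod_def)
 ultimately show "f:enc n s ` free_mod (PR n) s" by (rule rev_image_eqI[rotated, OF sym])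
qed (auto intro: enc_in_FM free_mod_R)
qed

lemma enc_mat_app: "enc n s (mat_app s t D v) = (\<Sum>q<t. v q * enc n s (%p. D p q))"
proof -
have "enc n s (mat_app s t D v) = (\<Sum>p<s. \<Sum>q<t. v q * (D p q * X n ^ p))"
 unfolding enc_def mat_app_def by (rule sum.cong) (simp_all add: sum_distrib_right sum_distrib_left mult_ac)
also have "... = (\<Sum>q<t. \<Sum>p<s. v q * (D p q * X n ^ p))" by (rule sum.swap)
finally show ?thesis by (simp add: enc_def sum_distrib_left)
qed

lemma mat_app_free_mod:
 assumes "!!p q. p < s ==> q < t ==> D p q:poly_ring V" "v:free_mod (poly_ring V) t"
 shows "mat_app s t D v:free_mod (poly_ring V) s" unfolding free_mod_def mat_app_def using assms
by (auto intro!: poly_ring_sum poly_ring_mult simp: free_mod_R)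

text \<open>\<open>enc\<close> is a bijection onto the encoded free module, so exactness may be read
  on either side.\<close>

lemma exact_iff:
 assumes D: "!!p q. p < s ==> q < t ==> D p q:PR n"
 and G: "!!q. q < t ==> G q = enc n s (%p. D p q)"
 and K: "K <= free_mod (PR n) s" "enc n s ` K = Kf"
 shows "K = mat_app s t D ` free_mod (PR n) t \<longleftrightarrow> Kf = app n t G ` FM n t"
proof -
let ?A = "free_mod (PR n) t"
have "enc n s (mat_app s t D v) = app n t G (enc n t v)" if "v:?A" for v
 unfolding enc_mat_app using app_enc[OF free_mod_R[OF that], where g = G] G by simp
hence "enc n s ` mat_app s t D ` ?A = app n t G ` enc n t ` ?A" unfolding image_image by (rule image_cong[OF refl])
hence im: "enc n s ` mat_app s t D ` ?A = app n t G ` FM n t" unfolding enc_bij(2) .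
have "mat_app s t D ` ?A <= free_mod (PR n) s" by (rule image_subsetI, rule mat_app_free_mod[OF D])
from inj_on_image_eq_iff[OF enc_bij(1) K(1) this] show ?thesis unfolding im K(2) by blast
qed

lemma enc_Dg:
 assumes "!!p. p < s ==> v p:PR n"
 shows "enc n s v:mideal (Dg n a d) \<longleftrightarrow> (ALL p<s. ALL m:keys (v p). d = a p + mdeg m)"
proof
assume L: "enc n s v:mideal (Dg n a d)"
show "ALL p<s. ALL m:keys (v p). d = a p + mdeg m"
proof (intro allI impI ballI)
 fix p m assume p: "p < s" "m:keys (v p)"
 have "dec n p (enc n s v):mideal {m:Mn n. mdeg m + a p = d}" by (rule dec_Dg[of _ "%x. x = d"]) (use L in "simp add: Dg_def")
 thus "d = a p + mdeg m" using p by (auto simp: dec_enc_eq[OF assms] mideal_def)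
qed
next
assume R: "ALL p<s. ALL m:keys (v p). d = a p + mdeg m"
show "enc n s v:mideal (Dg n a d)" unfolding enc_def
proof (rule mideal_sum)
 fix p assume p: "p:{..<s}"
 show "v p * X n ^ p:mideal (Dg n a d)"
 proof (rule mideal_mult)
  show "v p:mideal {m:Mn n. mdeg m + a p = d}" using R assms[of p] p by (auto simp: mideal_def poly_ring_eq)
  show "X n ^ p:mideal {sgl n p}" by (simp add: X_power)
 qed (auto simp: Dg_def gwt_add gwt_single)
qed
qed

lemma homogeneous_Dg:
 assumes "f:PR n"
 shows "f:mideal (Dg n (%_. 0) d) \<longleftrightarrow> homogeneous d f"
proof -
have "gwt n (%_. 0) m = mdeg m" if "m:keys f" for m
 using assms that mres_id[of m "{..<n}"] by (auto simp: gwt_def poly_ring_eq mideal_def)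
thus ?thesis by (auto simp: mideal_def Dg_def homogeneous_def)
qed

lemma mult_no_constant: "(f :: 'k::field_char_0 spoly):mideal (- {0}) ==> f * g:mideal (- {0})"
proof (rule mideal_mult[where B = UNIV])
show "a + b:- {0}" if "a:- {0}" for a b :: monom
 using that keys_add_nat[of a b] by (metis Compl_iff Un_empty keys_eq_empty singletonD singletonI)
qed auto

lemma no_constant_iff: "(f :: 'k::field_char_0 spoly):mideal (- {0}) \<longleftrightarrow> lookup f 0 = 0"
by (auto simp: mideal_def in_keys_iff)

definition gens_of :: "nat=>(nat=>nat)=>(nat=>'k::field_char_0 spoly)=>(nat=>nat=>nat=>'k spoly)=>nat=>nat=>'k spoly" where
 "gens_of n r e D i = (case i of 0=>e | Suc k=>%q. enc n (r k) (%p. D k p q))"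

lemma enc_kernel_0: "enc n s ` {v:free_mod (PR n) s. (\<Sum>q<s. e q * v q) = 0} = Ker n s (e :: nat=>'k::field_char_0 spoly)"
proof -
have "(\<Sum>q<s. e q * v q) = app n s e (enc n s v)" if "v:free_mod (PR n) s" for v
 using app_enc[OF free_mod_R[OF that], where g = e] by (simp add: mult.commute)
hence "{v:free_mod (PR n) s. (\<Sum>q<s. e q * v q) = 0} = {v:free_mod (PR n) s. app n s e (enc n s v) = 0}" by auto
thus ?thesis unfolding Ker_def enc_bij(2)[symmetric, of n s] by (auto simp del: enc_bij)
qed

lemma enc_kernel_Suc:
 assumes D: "!!p q. p < s ==> q < t ==> D p q:PR n"
 and G: "!!q. q < t ==> G q = enc n s (%p. D p q)"
 shows "enc n t ` {v:free_mod (PR n) t. mat_app s t D v = (%_. 0)} = Ker n t (G :: nat=>'k::field_char_0 spoly)"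
proof -
have z: "(%_. 0):free_mod (PR n :: 'k spoly set) s" "enc n s (%_. 0) = (0 :: 'k spoly)" by (simp_all add: free_mod_def enc_def)
have "mat_app s t D v = (%_. 0) \<longleftrightarrow> app n t G (enc n t v) = 0" if v: "v:free_mod (PR n) t" for v
proof -
 have "app n t G (enc n t v) = enc n s (mat_app s t D v)"
  unfolding enc_mat_app using app_enc[OF free_mod_R[OF v], where g = G] G by simp
 thus ?thesis using inj_on_eq_iff[OF enc_bij(1) mat_app_free_mod[OF D v] z(1)] z(2) by simp
qed
hence "{v:free_mod (PR n) t. mat_app s t D v = (%_. 0)} = {v:free_mod (PR n) t. app n t G (enc n t v) = 0}" by auto
thus ?thesis unfolding Ker_def enc_bij(2)[symmetric, of n t] by (auto simp del: enc_bij)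
qed

lemma image_free_mod_0: "(%v. \<Sum>q<s. e q * v q) ` free_mod (PR n) s = app n s (e :: nat=>'k::field_char_0 spoly) ` FM n s"
proof -
have "(%v. \<Sum>q<s. e q * v q) ` free_mod (PR n) s = (%v. app n s e (enc n s v)) ` free_mod (PR n) s"
proof (rule image_cong[OF refl])
 fix v assume "v:free_mod (PR n :: 'k spoly set) s"
 from app_enc[OF free_mod_R[OF this], where g = e] show "(\<Sum>q<s. e q * v q) = app n s e (enc n s v)" by (simp add: mult.commute)
qed
thus ?thesis unfolding enc_bij(2)[symmetric, of n s] image_image .
qed

lemma chain_if_min_free_res:
 fixes J :: "'k::field_char_0 spoly set"
 assumes "min_free_res n J r a e D"
 shows "chain n J r a (gens_of n r e D)"
proof -
let ?R = "PR n :: 'k spoly set" and ?G = "gens_of n r e D"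
note res = assms[unfolded min_free_res_def Let_def]
note res2 = conjunct2[OF res] note res3 = conjunct2[OF res2] note res4 = conjunct2[OF res3] note res5 = conjunct2[OF res4]
have e: "e q:?R" "homogeneous (a 0 q) (e q)" if "q < r 0" for q
 using conjunct1[OF res, THEN spec[of _ q], THEN mp, OF that] by simp_all
have D: "D i p q:?R" "ALL m:keys (D i p q). a (Suc i) q = a i p + mdeg m" if "p < r i" "q < r (Suc i)" for i p q
 using conjunct1[OF res2, THEN spec[of _ i], THEN spec[of _ p], THEN mp, OF that(1), THEN spec[of _ q], THEN mp, OF that(2)]
 by simp_all
note im = conjunct1[OF res3]
note k0 = conjunct1[OF res4]
note kS = conjunct1[OF res5, THEN spec]
have mn: "lookup (D i p q) 0 = 0" if "p < r i" "q < r (Suc i)" for i p q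
 by (rule conjunct2[OF res5, THEN spec[of _ i], THEN spec[of _ p], THEN mp, OF that(1), THEN spec[of _ q], THEN mp, OF that(2)])
have G0: "?G 0 = e" and GS: "?G (Suc i) q = enc n (r i) (%p. D i p q)" for i q by (simp_all add: gens_of_def)
have K: "Ker n (r i) (?G i) = app n (r (Suc i)) (?G (Suc i)) ` FM n (r (Suc i))" for i
proof (cases i)
 case 0
 show ?thesis unfolding 0 G0 using exact_iff[of "r 0" "r (Suc 0)" "D 0" n "?G (Suc 0)", OF D(1) GS _ enc_kernel_0] k0 by simp
next
 case (Suc k)
 have ek: "enc n (r (Suc k)) ` {v:free_mod ?R (r (Suc k)). mat_app (r k) (r (Suc k)) (D k) v = (%_. 0)} = Ker n (r (Suc k)) (?G (Suc k))"
  by (rule enc_kernel_Suc) (use D(1) GS in auto)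
 from exact_iff[of "r (Suc k)" "r (Suc (Suc k))" "D (Suc k)" n "?G (Suc (Suc k))", OF D(1) GS _ ek] kS[of k]
 show ?thesis unfolding Suc by auto
qed
have min: "lookup f (sgl n p) = 0" if f: "f:Ker n (r i) (?G i)" and p: "p < r i" for i f p
proof -
 obtain h where h: "f = app n (r (Suc i)) (?G (Suc i)) h" using f K by blast
 have "dec n p f = (\<Sum>q<r (Suc i). dec n q h * dec n p (?G (Suc i) q))" unfolding h app_def by (simp add: dec_sum dec_mult)
 also have "... = (\<Sum>q<r (Suc i). D i p q * dec n q h)" by (rule sum.cong) (simp_all add: GS dec_enc_eq D(1) p mult.commute)
 \<comment> \<open>A relation is a combination of the columns of \<open>D i\<close>, whose entries
   have no constant term.\<close>
 also have "...:mideal (- {0})" by (rule mideal_sum, rule mult_no_constant) (use mn p in "simp add: no_constant_iff")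
 finally show ?thesis by (simp add: no_constant_iff lookup_dec)
qed
have "stage n (%_. 0) J (r 0) (a 0) (?G 0)" unfolding stage_def
proof (intro conjI)
 show "ALL q<r 0. ?G 0 q:mideal (Dg n (%_. 0) (a 0 q))" using e by (simp add: G0 homogeneous_Dg)
 show "app n (r 0) (?G 0) ` FM n (r 0) = J" unfolding G0 image_free_mod_0[symmetric] by (rule im)
 show "ALL f:Ker n (r 0) (?G 0). ALL p<r 0. lookup f (sgl n p) = 0" using min by blast
qed
moreover have "stage n (a i) (Ker n (r i) (?G i)) (r (Suc i)) (a (Suc i)) (?G (Suc i))" for i unfolding stage_def
proof (intro conjI)
 show "ALL q<r (Suc i). ?G (Suc i) q:mideal (Dg n (a i) (a (Suc i) q))" using D by (simp add: GS enc_Dg)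
 show "app n (r (Suc i)) (?G (Suc i)) ` FM n (r (Suc i)) = Ker n (r i) (?G i)" using K by simp
 show "ALL f:Ker n (r (Suc i)) (?G (Suc i)). ALL p<r (Suc i). lookup f (sgl n p) = 0" using min by blast
qed
ultimately show ?thesis by (simp add: chain_def)
qed

lemma min_free_res_if_chain:
 fixes J :: "'k::field_char_0 spoly set"
 assumes C: "chain n J r a g" and J: "J <= PR n"
 shows "min_free_res n J r a (g 0) (%i p q. dec n p (g (Suc i) q))"
proof -
let ?R = "PR n :: 'k spoly set" and ?D = "%i p q. dec n p (g (Suc i) q)"
have S0: "stage n (%_. 0) J (r 0) (a 0) (g 0)" and S: "stage n (a i) (Ker n (r i) (g i)) (r (Suc i)) (a (Suc i)) (g (Suc i))" for i
 using C by (auto simp: chain_def)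
have gK: "g (Suc i) q:Ker n (r i) (g i)" if "q < r (Suc i)" for i q
 using gen_in_image[OF that, of "g (Suc i)" n] stageD(2)[OF S] by simp
have G: "g (Suc i) q = enc n (r i) (%p. ?D i p q)" if "q < r (Suc i)" for i q
 using gK[OF that] enc_dec[of "g (Suc i) q" n "r i"] by (simp add: Ker_def)
have K: "Ker n (r i) (g i) = app n (r (Suc i)) (g (Suc i)) ` FM n (r (Suc i))" for i using stageD(2)[OF S] by simp
have eR: "g 0 q:?R" if "q < r 0" for q using gen_in_image[OF that, of "g 0" n] stageD(2)[OF S0] J by blast
show ?thesis unfolding min_free_res_def Let_def
proof (intro conjI allI impI)
 show "g 0 q:?R" "homogeneous (a 0 q) (g 0 q)" if "q < r 0" for q
  using eR[OF that] stageD(1)[OF S0 that] by (simp_all add: homogeneous_Dg)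
 show "(%v. \<Sum>q<r 0. g 0 q * v q) ` free_mod ?R (r 0) = J" unfolding image_free_mod_0 by (rule stageD(2)[OF S0])
 show "{v:free_mod ?R (r 0). (\<Sum>q<r 0. g 0 q * v q) = 0} = mat_app (r 0) (r 1) (?D 0) ` free_mod ?R (r 1)"
  using exact_iff[of "r 0" "r (Suc 0)" "?D 0" n "g (Suc 0)", OF _ G _ enc_kernel_0] K[of 0] by simp
 fix i
 show "{v:free_mod ?R (r (Suc i)). mat_app (r i) (r (Suc i)) (?D i) v = (%_. 0)}
   = mat_app (r (Suc i)) (r (Suc (Suc i))) (?D (Suc i)) ` free_mod ?R (r (Suc (Suc i)))"
 proof -
  have ek: "enc n (r (Suc i)) ` {v:free_mod ?R (r (Suc i)). mat_app (r i) (r (Suc i)) (?D i) v = (%_. 0)} = Ker n (r (Suc i)) (g (Suc i))"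
   by (rule enc_kernel_Suc) (use G in auto)
  from exact_iff[of "r (Suc i)" "r (Suc (Suc i))" "?D (Suc i)" n "g (Suc (Suc i))", OF _ G _ ek] K[of "Suc i"]
  show ?thesis by auto
 qed
 fix p q assume pq: "p < r i" "q < r (Suc i)"
 show "?D i p q:?R" by simp
 show "ALL m:keys (?D i p q). a (Suc i) q = a i p + mdeg m"
  using stageD(1)[OF S pq(2)] enc_Dg[of "r i" "%p. ?D i p q" n "a i" "a (Suc i) q"] pq G[OF pq(2)] by simp
 show "lookup (?D i p q) 0 = 0"
 proof (cases i)
  case 0
  thus ?thesis using stageD(3)[OF S0, of "g (Suc 0) q" p] gK[of q 0] pq by (simp add: lookup_dec)
 next
  case (Suc k)
  thus ?thesis using stageD(3)[OF S[of k], of "g (Suc i) q" p] gK[of q i] pq by (simp add: lookup_dec)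
 qed
qed
qed

lemma betti_fin_eq:
 fixes J :: "'k::field_char_0 spoly set"
 assumes C: "chain n J r a g" and J: "J <= PR n"
 shows "betti_fin n J i j = card {q. q < r i & a i q = j}" unfolding betti_fin_def
proof (rule the_equality)
show "EX r' a' e D. min_free_res n J r' a' e D & card {q. q < r i & a i q = j} = card {q. q < r' i & a' i q = j}"
 using min_free_res_if_chain[OF C J] by blast
fix b assume "EX r' a' e D. min_free_res n J r' a' e D & b = card {q. q < r' i & a' i q = j}"
then obtain r' a' e D where "min_free_res n J r' a' e D" "b = card {q. q < r' i & a' i q = j}" by blast
thus "b = card {q. q < r i & a i q = j}" using chain_unique[OF chain_if_min_free_res C] by blast
qed

lemma chain_mideal:
 assumes "upclosed {..<n} U"
 obtains r a and g :: "nat=>nat=>'k::field_char_0 spoly" where "chain n (mideal U) r a g"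
proof -
have UM: "U <= Mn n" using assms by (simp add: upclosed_def)
have p: "pr C f:mideal U" if "f:mideal U" for C and f :: "'k spoly" using that by (auto simp: mideal_def keys_pr)
have "gsub n (%_. 0) (mideal U :: 'k spoly set)" unfolding gsub_def
proof (intro conjI ballI allI)
 fix h f :: "'k spoly" assume "h:PR n" "f:mideal U"
 thus "h * f:mideal U" unfolding poly_ring_eq by (rule mideal_mult) (metis upclosedD[OF assms] add.commute)
qed (auto simp: mideal_add p)
moreover have "(mideal U :: 'k spoly set) <= FM n 1" unfolding FM_def mideal_subset_iff
proof
 fix m assume "m:U"
 hence m: "m:Mn n" using UM by blast
 have "Mn n <= Mon {..n}" by (rule Mon_mono) auto
 thus "m:FMm n 1" using m Mon_lookup_zero[OF m, of n] by (auto simp: FMm_def)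
qed
ultimately show ?thesis using chain_exists that by blast
qed

section \<open>Adjoining variables to a resolution\<close>

lemma coef_expand:
 assumes f: "f:PR N" and C: "finite C" "!!m. m:keys f ==> mres (- {..<n}) m:C" "C <= Mon {n..}"
 shows "f = (SUM c:C. mon c * coef n c f)"
proof (rule poly_mapping_eqI)
fix m
have "lookup (mon c * coef n c f) m = (if c = mres (- {..<n}) m then lookup f m else 0)" if c: "c:C" for c
proof (cases "c = mres (- {..<n}) m")
 case True
 have m: "m = c + mres {..<n} m" unfolding True using mres_split[of "{..<n}" m] by (simp add: add.commute)
 have "lookup (mon c * coef n c f) (c + mres {..<n} m) = lookup (coef n c f) (mres {..<n} m)" by (rule lookup_mon_mult)
 also have "... = lookup f (mres {..<n} m + c)" by (simp add: lookup_coef)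
 finally show ?thesis using True m by (simp add: add.commute)
next
 case False
 have "m ~: keys (mon c * coef n c f)"
 proof
  assume "m:keys (mon c * coef n c f)"
  then obtain k where k: "k:keys (coef n c f)" "m = c + k" by (auto simp: keys_mon_mult)
  have "k:Mn n" using keys_coef[OF k(1)] by blast
  hence "mres (- {..<n}) k = 0" unfolding mres_zero_iff by (auto simp: Mon_def)
  moreover have "mres (- {..<n}) c = c"
  proof (rule mres_id)
   have "{n..} = - {..<n}" by auto
   thus "c:Mon (- {..<n})" using c C(3) by auto
  qed
  ultimately show False using False k(2) by (simp only: mres_add) simp
 qed
 thus ?thesis using False by (simp add: in_keys_iff)
qed
hence "lookup (SUM c:C. mon c * coef n c f) m = (SUM c:C. if c = mres (- {..<n}) m then lookup f m else 0)"
 unfolding lookup_sum by (rule sum.cong[OF refl])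
also have "... = (if mres (- {..<n}) m:C then lookup f m else 0)" using C(1) by simp
also have "... = lookup f m" using C(2)[of m] by (auto simp: in_keys_iff)
finally show "lookup f m = lookup (SUM c:C. mon c * coef n c f) m" by simp
qed

lemma Mon_interval: "Mon {n..<N} <= Mon {n..}" "Mon {n..<N} <= Mn N" by (rule Mon_mono, force)+

lemma coef_support:
 fixes v :: "nat=>'k::field_char_0 spoly"
 assumes "!!q. q < t ==> v q:PR N"
 shows "EX C. finite C & C <= Mon {n..<N} & (ALL q<t. v q = (SUM c:C. mon c * coef n c (v q)))"
proof -
define C where "C = (\<Union>q<t. mres (- {..<n}) ` keys (v q))"
have C: "finite C" "C <= Mon {n..<N}" using assms by (auto simp: C_def Mon_def keys_mres poly_ring_def subset_iff)
have "Mon {n..<N} <= Mon {n..}" by (rule Mon_mono) auto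
hence "v q = (SUM c:C. mon c * coef n c (v q))" if "q < t" for q
 by (intro coef_expand[OF assms[OF that] C(1)]) (use that C(2) in "auto simp: C_def")
thus ?thesis using C by blast
qed

lemma coef_linear:
 assumes "!!q. q < t ==> A q:PR n" "c:Mon {n..}"
 shows "coef n c (\<Sum>q<t. A q * v q) = (\<Sum>q<t. A q * coef n c (v q))"
unfolding coef_sum by (rule sum.cong) (use assms in "auto simp: coef_mult")

lemma coef_all_zero:
 assumes "f:PR N" "!!c. c:Mon {n..} ==> coef n c f = 0"
 shows "(f :: 'k::field_char_0 spoly) = 0"
proof -
obtain C where C: "finite C" "C <= Mon {n..<N}" "!!q. q < Suc 0 ==> f = (SUM c:C. mon c * coef n c f)"
 using coef_support[of "Suc 0" "%_. f" N n] assms(1) by auto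
have "Mon {n..<N} <= Mon {n..}" by (rule Mon_mono) auto
hence "(SUM c:C. mon c * coef n c f) = 0" by (intro sum.neutral) (use C(2) assms(2) in auto)
thus ?thesis using C(3)[of 0] by simp
qed

text \<open>Flat base change: equations over the small ring are solved coefficient by coefficient
  with respect to the later variables. The index set \<open>P\<close> covers both the single
  equation at the start of a resolution and the matrices after it.\<close>

lemma exact_extend:
 fixes A B :: "nat=>nat=>'k::field_char_0 spoly"
 assumes nN: "n <= N"
 and A: "!!p q. p:P ==> q < t ==> A p q:PR n"
 and B: "!!p q. p < t ==> q < u ==> B p q:PR n"
 and ex: "{v:free_mod (PR n) t. ALL p:P. (\<Sum>q<t. A p q * v q) = 0} = mat_app t u B ` free_mod (PR n) u"
 shows "{v:free_mod (PR N) t. ALL p:P. (\<Sum>q<t. A p q * v q) = 0} = mat_app t u B ` free_mod (PR N) u"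
proof (intro subset_antisym subsetI)
have RN: "PR n <= (PR N :: 'k spoly set)" by (rule poly_ring_mono) (use nN in auto)
{ fix v assume v: "v:{v:free_mod (PR N) t. ALL p:P. (\<Sum>q<t. A p q * v q) = 0}"
 hence "v:free_mod (PR N) t" by simp
 from free_mod_R[OF this] have vR: "!!q. q < t ==> v q:PR N" .
 have "EX C. finite C & C <= Mon {n..<N} & (ALL q<t. v q = (SUM c:C. mon c * coef n c (v q)))" by (rule coef_support) (rule vR)
 then obtain C where "finite C & C <= Mon {n..<N} & (ALL q<t. v q = (SUM c:C. mon c * coef n c (v q)))" by (rule exE)
 hence C: "finite C" "C <= Mon {n..<N}" "!!q. q < t ==> v q = (SUM c:C. mon c * coef n c (v q))" by simp_all
 have CM: "C <= Mon {n..}" using C(2) Mon_interval(1) by (rule order_trans)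
 have "EX w. w:free_mod (PR n) u & (%q. coef n c (v q)) = mat_app t u B w" if c: "c:C" for c
 proof -
  have "(%q. coef n c (v q)):{v:free_mod (PR n) t. ALL p:P. (\<Sum>q<t. A p q * v q) = 0}"
  proof (intro CollectI conjI ballI)
   show "(%q. coef n c (v q)):free_mod (PR n) t" using v by (simp add: free_mod_def)
   fix p assume p: "p:P"
   have "(\<Sum>q<t. A p q * coef n c (v q)) = coef n c (\<Sum>q<t. A p q * v q)"
    by (rule coef_linear[symmetric]) (use A[OF p] c CM in auto)
   thus "(\<Sum>q<t. A p q * coef n c (v q)) = 0" using v p by simp
  qed
  thus ?thesis unfolding ex by blast
 qed
 hence "ALL c:C. EX w. w:free_mod (PR n) u & (%q. coef n c (v q)) = mat_app t u B w" by blast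
 from bchoice[OF this] obtain w where w: "!!c. c:C ==> w c:free_mod (PR n) u" "!!c. c:C ==> (%q. coef n c (v q)) = mat_app t u B (w c)"
  by auto
 define w' where "w' q = (SUM c:C. mon c * w c q)" for q
 have "w':free_mod (PR N) u" unfolding free_mod_def
 proof (intro CollectI conjI allI impI)
  fix q assume q: "q < u"
  have "(mon c :: 'k spoly):PR N" if "c:C" for c using that C(2) Mon_interval(2)[of n N] by auto
  thus "w' q:PR N" unfolding w'_def using w(1) RN q by (intro poly_ring_sum poly_ring_mult) (auto dest: free_mod_R)
 next
  fix q assume "u <= q"
  thus "w' q = 0" unfolding w'_def using w(1) by (intro sum.neutral) (simp add: free_mod_def)
 qed
 moreover have "v = mat_app t u B w'"
 proof
  fix p
  show "v p = mat_app t u B w' p"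
  proof (cases "p < t")
   case True
   have "v p = (SUM c:C. mon c * coef n c (v p))" by (rule C(3)[OF True])
   also have "... = (SUM c:C. mon c * (\<Sum>q<u. B p q * w c q))"
   proof (rule sum.cong[OF refl])
    fix c assume "c:C"
    from fun_cong[OF w(2)[OF this], of p] True
    show "mon c * coef n c (v p) = mon c * (\<Sum>q<u. B p q * w c q)" by (simp add: mat_app_def)
   qed
   also have "... = (\<Sum>q<u. B p q * w' q)" unfolding w'_def sum_distrib_left by (subst sum.swap) (simp add: mult_ac)
   finally show ?thesis using True by (simp add: mat_app_def)
  qed (use v in "simp add: mat_app_def free_mod_def")
 qed
 ultimately show "v:mat_app t u B ` free_mod (PR N) u" by blast }
{ fix v assume "v:mat_app t u B ` free_mod (PR N) u"
 then obtain w where w: "w:free_mod (PR N) u" "v = mat_app t u B w" by blast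
 have BN: "B p q:PR N" if "p < t" "q < u" for p q using B[OF that] RN by blast
 have vN: "v:free_mod (PR N) t" unfolding w(2) by (rule mat_app_free_mod[OF BN w(1)])
 have "(\<Sum>q<t. A p q * v q) = 0" if p: "p:P" for p
 proof (rule coef_all_zero)
  show "(\<Sum>q<t. A p q * v q):PR N" using A[OF p] RN vN by (intro poly_ring_sum poly_ring_mult) (auto dest: free_mod_R)
  fix c assume c: "c:Mon {n..}"
  have "(%q. coef n c (v q)) = mat_app t u B (%q. coef n c (w q))"
  proof
   fix q
   show "coef n c (v q) = mat_app t u B (%q. coef n c (w q)) q"
    unfolding w(2) mat_app_def using coef_linear[of u "B q" n c w] B c by auto
  qed
  moreover have "(%q. coef n c (w q)):free_mod (PR n) u" using w(1) by (simp add: free_mod_def)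
  ultimately have "(%q. coef n c (v q)):{v:free_mod (PR n) t. ALL p:P. (\<Sum>q<t. A p q * v q) = 0}"
   unfolding ex by (rule image_eqI)
  hence "(\<Sum>q<t. A p q * coef n c (v q)) = 0" using p by simp
  thus "coef n c (\<Sum>q<t. A p q * v q) = 0" using coef_linear[of t "A p" n c v] A[OF p] c by simp
 qed
 thus "v:{v:free_mod (PR N) t. ALL p:P. (\<Sum>q<t. A p q * v q) = 0}" using vN by simp }
qed

definition extm :: "nat=>nat=>monom set=>monom set" where "extm n N U = {m:Mn N. mres {..<n} m:U}"

lemma extm_coef:
 fixes f :: "'k::field_char_0 spoly"
 assumes "f:PR N" "U <= Mn n"
 shows "f:mideal (extm n N U) \<longleftrightarrow> (ALL c:Mon {n..}. coef n c f:mideal U)"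
proof
assume L: "f:mideal (extm n N U)"
show "ALL c:Mon {n..}. coef n c f:mideal U"
proof (intro ballI)
 fix c :: monom assume c: "c:Mon {n..}"
 have "m:U" if "m:keys (coef n c f)" for m
 proof -
  have "m:Mn n" "m + c:keys f" using keys_coef[OF that] by auto
  moreover have "mres {..<n} c = 0" unfolding mres_zero_iff using c by (auto simp: Mon_def)
  ultimately show ?thesis using L by (auto simp: mideal_def extm_def mres_add mres_id)
 qed
 thus "coef n c f:mideal U" by (auto simp: mideal_def)
qed
next
assume R: "ALL c:Mon {n..}. coef n c f:mideal U"
have "m:extm n N U" if m: "m:keys f" for m
proof -
 let ?c = "mres (- {..<n}) m"
 have "- {..<n} = {n..}" by auto
 hence c: "?c:Mon {n..}" using mres_in_Mon[of "- {..<n}" m] by metis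
 have "mres {..<n} m + ?c = m" by (rule mres_split)
 hence "lookup (coef n ?c f) (mres {..<n} m) ~= 0" using m by (simp only: lookup_coef mres_in_Mon if_True) (simp add: in_keys_iff)
 hence "mres {..<n} m:U" using R c by (auto simp: mideal_def in_keys_iff[symmetric])
 thus ?thesis using m assms(1) by (auto simp: extm_def poly_ring_def Mon_def)
qed
thus "f:mideal (extm n N U)" by (auto simp: mideal_def)
qed

lemma min_free_res_extend:
 fixes e :: "nat=>'k::field_char_0 spoly"
 assumes res: "min_free_res n (mideal U) r a e D" and nN: "n <= N" and U: "U <= Mn n"
 shows "min_free_res N (mideal (extm n N U)) r a e D"
proof -
let ?R = "PR n :: 'k spoly set" and ?R' = "PR N :: 'k spoly set"
have RN: "?R <= ?R'" by (rule poly_ring_mono) (use nN in auto)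
note res1 = res[unfolded min_free_res_def Let_def]
note res2 = conjunct2[OF res1] note res3 = conjunct2[OF res2] note res4 = conjunct2[OF res3] note res5 = conjunct2[OF res4]
have e: "e q:?R" "homogeneous (a 0 q) (e q)" if "q < r 0" for q
 using conjunct1[OF res1, THEN spec[of _ q], THEN mp, OF that] by simp_all
have D: "D i p q:?R" "ALL m:keys (D i p q). a (Suc i) q = a i p + mdeg m" if "p < r i" "q < r (Suc i)" for i p q
 using conjunct1[OF res2, THEN spec[of _ i], THEN spec[of _ p], THEN mp, OF that(1), THEN spec[of _ q], THEN mp, OF that(2)]
 by simp_all
note im = conjunct1[OF res3]
note k0 = conjunct1[OF res4]
note kS = conjunct1[OF res5, THEN spec]
note mn = conjunct2[OF res5]
show ?thesis unfolding min_free_res_def Let_def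
proof (intro conjI)
 show "ALL q<r 0. e q:?R' & homogeneous (a 0 q) (e q)" using e RN by blast
 show "ALL i p. p < r i --> (ALL q<r (Suc i). D i p q:?R' & (ALL m:keys (D i p q). a (Suc i) q = a i p + mdeg m))"
  using D RN by blast
 show "ALL i p. p < r i --> (ALL q<r (Suc i). lookup (D i p q) 0 = 0)" by (rule mn)
 show "{v:free_mod ?R' (r 0). (\<Sum>q<r 0. e q * v q) = 0} = mat_app (r 0) (r 1) (D 0) ` free_mod ?R' (r 1)"
  using exact_extend[OF nN, of "{0::nat}" "r 0" "%_. e" "r 1" "D 0"] k0 e(1) D(1) by simp
 show "ALL i. {v:free_mod ?R' (r (Suc i)). mat_app (r i) (r (Suc i)) (D i) v = (%_. 0)}
   = mat_app (r (Suc i)) (r (Suc (Suc i))) (D (Suc i)) ` free_mod ?R' (r (Suc (Suc i)))"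
 proof
  fix i
  have z: "mat_app (r i) (r (Suc i)) (D i) v = (%_. 0) \<longleftrightarrow> (ALL p:{..<r i}. (\<Sum>q<r (Suc i). D i p q * v q) = 0)" for v
   by (auto simp: mat_app_def fun_eq_iff)
  show "{v:free_mod ?R' (r (Suc i)). mat_app (r i) (r (Suc i)) (D i) v = (%_. 0)}
    = mat_app (r (Suc i)) (r (Suc (Suc i))) (D (Suc i)) ` free_mod ?R' (r (Suc (Suc i)))"
   unfolding z by (rule exact_extend[OF nN]) (use D(1) kS[of i, unfolded z] in auto)
 qed
 show "(%v. \<Sum>q<r 0. e q * v q) ` free_mod ?R' (r 0) = mideal (extm n N U)"
 proof (intro subset_antisym subsetI)
  fix f :: "'k spoly" assume "f:(%v. \<Sum>q<r 0. e q * v q) ` free_mod ?R' (r 0)"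
  then obtain v where v: "v:free_mod ?R' (r 0)" "f = (\<Sum>q<r 0. e q * v q)" by blast
  have fR: "f:?R'" unfolding v(2) using e(1) RN v(1) by (intro poly_ring_sum poly_ring_mult) (auto dest: free_mod_R)
  have "coef n c f:mideal U" if c: "c:Mon {n..}" for c
  proof -
   have "coef n c f = (\<Sum>q<r 0. e q * coef n c (v q))" unfolding v(2) by (rule coef_linear) (use e(1) c in auto)
   moreover have "(%q. coef n c (v q)):free_mod ?R (r 0)" using v(1) by (simp add: free_mod_def)
   ultimately show ?thesis unfolding im[symmetric] by (rule image_eqI)
  qed
  thus "f:mideal (extm n N U)" unfolding extm_coef[OF fR U] by blast
 next
  fix f :: "'k spoly" assume f: "f:mideal (extm n N U)"
  hence fR: "f:?R'" by (auto simp: mideal_def extm_def poly_ring_def Mon_def)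
  obtain C where C: "finite C" "C <= Mon {n..<N}" "!!q. q < Suc 0 ==> f = (SUM c:C. mon c * coef n c f)"
   using coef_support[of "Suc 0" "%_. f" N n] fR by auto
  have CM: "C <= Mon {n..}" using C(2) Mon_interval(1) by (rule order_trans)
  have "ALL c:C. EX v. v:free_mod ?R (r 0) & coef n c f = (\<Sum>q<r 0. e q * v q)"
   using f CM unfolding extm_coef[OF fR U] im[symmetric] by blast
  from bchoice[OF this] obtain v where v: "!!c. c:C ==> v c:free_mod ?R (r 0)" "!!c. c:C ==> coef n c f = (\<Sum>q<r 0. e q * v c q)"
   by auto
  define w where "w q = (SUM c:C. mon c * v c q)" for q
  have "w:free_mod ?R' (r 0)" unfolding free_mod_def
  proof (intro CollectI conjI allI impI)
   fix q assume q: "q < r 0"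
   have "(mon c :: 'k spoly):?R'" if "c:C" for c using that C(2) Mon_interval(2)[of n N] by auto
   thus "w q:?R'" unfolding w_def using v(1) RN q by (intro poly_ring_sum poly_ring_mult) (auto dest: free_mod_R)
  next
   fix q assume "r 0 <= q"
   thus "w q = 0" unfolding w_def using v(1) by (intro sum.neutral) (simp add: free_mod_def)
  qed
  moreover have "f = (\<Sum>q<r 0. e q * w q)"
  proof -
   have "f = (SUM c:C. mon c * (\<Sum>q<r 0. e q * v c q))" using C(3)[of 0] v(2) by simp
   also have "... = (\<Sum>q<r 0. e q * w q)" unfolding w_def sum_distrib_left by (subst sum.swap) (simp add: mult_ac)
   finally show ?thesis .
  qed
  ultimately show "f:(%v. \<Sum>q<r 0. e q * v q) ` free_mod ?R' (r 0)" by blast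
 qed
qed
qed

section \<open>Betti numbers of monomial ideals\<close>

lemma cmp_mideal: "U <= Mn n ==> cmp n (%_. 0) (mideal U) d = mideal (U Int Deg d)"
proof -
assume U: "U <= Mn n"
have "U Int Dg n (%_. 0) d = U Int Deg d" using U mres_id[of _ "{..<n}"] by (auto simp: Dg_def gwt_def)
thus ?thesis unfolding cmp_def mideal_Int by simp
qed

lemma mideal_poly_ring: "U <= Mon V ==> mideal U <= poly_ring V" by (auto simp: mideal_def poly_ring_def Mon_def)

lemma betti_extm:
 assumes U: "upclosed {..<n} U" and nN: "n <= N" and V: "upclosed {..<N} V"
 and eq: "!!d. d <= j ==> V Int Deg d = extm n N U Int Deg d"
 shows "betti_fin N (mideal V :: 'k::field_char_0 spoly set) i j = betti_fin n (mideal U :: 'k spoly set) i j"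
proof -
have UM: "U <= Mn n" and VM: "V <= Mn N" using U V by (auto simp: upclosed_def)
have EM: "extm n N U <= Mn N" by (auto simp: extm_def)
obtain r a and g :: "nat=>nat=>'k spoly" where C: "chain n (mideal U) r a g" by (rule chain_mideal[OF U])
obtain r' a' and g' :: "nat=>nat=>'k spoly" where C': "chain N (mideal V) r' a' g'" by (rule chain_mideal[OF V])
note E = chain_if_min_free_res[OF min_free_res_extend[OF min_free_res_if_chain[OF C mideal_poly_ring[OF UM]] nN UM]]
have "card {q. q < r' i & a' i q = j} = card {q. q < r i & a i q = j}"
 by (rule chain_unique[OF C' E]) (simp add: cmp_mideal VM EM eq)
thus ?thesis using betti_fin_eq[OF C mideal_poly_ring[OF UM]] betti_fin_eq[OF C' mideal_poly_ring[OF VM]] by simp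
qed

text \<open>The Hilbert function is the convolution of the B-sequence, with index 0 included, with
  the Hilbert function of the ring.\<close>

lemma B_seq_euler:
 assumes U: "upclosed {..<n} U"
 shows "int (card (U Int Deg d)) = (\<Sum>j\<le>d. B_seq (betti_fin n (mideal U :: 'k::field_char_0 spoly set)) j * int (nm n (d - j)))"
proof -
have UM: "U <= Mn n" using U by (auto simp: upclosed_def)
obtain r a and g :: "nat=>nat=>'k spoly" where C: "chain n (mideal U) r a g" by (rule chain_mideal[OF U])
have "finite (U Int Deg d)" by (rule finite_subset[OF _ finite_MD[of n d]]) (use UM in auto)
hence "vs.dim (cmp n (%_. 0) (mideal U :: 'k spoly set) d) = card (U Int Deg d)" unfolding cmp_mideal[OF UM] by (rule dim_mideal)
thus ?thesis using chain_euler[OF C, of d] betti_fin_eq[OF C mideal_poly_ring[OF UM]] by (simp add: B_seq_def)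
qed

text \<open>\<open>bndd j n V\<close>: up to degree \<open>j\<close>, the monomial ideal is generated in the first \<open>n\<close> variables.\<close>

definition bndd :: "nat=>nat=>monom set=>bool" where "bndd j n V \<longleftrightarrow> (ALL m:V. mdeg m <= j --> mres {..<n} m:V)"

text \<open>Beyond the variables of the generators of degree at most \<open>j\<close>, the sequence
  in the definition of \<open>betti\<close> is constant.\<close>

lemma betti_eq:
 assumes V: "upclosed UNIV V" and b: "bndd j n V" and nN: "n <= N"
 shows "betti_fin N (mideal (V Int Mn N) :: 'k::field_char_0 spoly set) i j = betti (mideal V :: 'k spoly set) i j"
proof -
have ext: "(V Int Mn N) Int Deg d = extm n N (V Int Mn n) Int Deg d" if "d <= j" for d N
proof (intro subset_antisym subsetI)
 fix m assume "m:extm n N (V Int Mn n) Int Deg d"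
 hence m: "m:Mn N" "mres {..<n} m:V" "m:Deg d" by (auto simp: extm_def)
 have "mres {..<n} m + mres (- {..<n}) m:V" by (rule upclosedD[OF V m(2)]) (unfold Mon_UNIV, rule UNIV_I)
 hence "m:V" by (simp only: mres_split)
 thus "m:(V Int Mn N) Int Deg d" using m by simp
qed (use b that in "auto simp: extm_def bndd_def")
have const: "betti_fin N (mideal (V Int Mn N) :: 'k spoly set) i j = betti_fin n (mideal (V Int Mn n) :: 'k spoly set) i j" if "n <= N" for N
 by (rule betti_extm[OF upclosed_Int_Mon[OF V] that upclosed_Int_Mon[OF V] ext])
have "(%N. betti_fin N (mideal V Int PR N :: 'k spoly set) i j) \<longlonglongrightarrow> betti_fin n (mideal (V Int Mn n) :: 'k spoly set) i j"
 by (rule tendsto_eventually) (unfold eventually_sequentially poly_ring_eq mideal_Int, use const in blast)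
from limI[OF this] show ?thesis unfolding betti_def const[OF nN] by (rule sym)
qed

lemma B_seq_betti_eq:
 assumes "upclosed UNIV V" "bndd j n V" "n <= N"
 shows "B_seq (betti_fin N (mideal (V Int Mn N) :: 'k::field_char_0 spoly set)) j = B_seq (betti (mideal V :: 'k spoly set)) j"
unfolding B_seq_def by (simp add: betti_eq[OF assms])

lemma B_seq_0:
 assumes "upclosed {..<n} U"
 shows "B_seq (betti_fin n (mideal U :: 'k::field_char_0 spoly set)) 0 = (if 0:U then 1 else 0)"
proof -
have "U Int Deg 0 = (if 0:U then {0} else {})" by auto
hence "card (U Int Deg 0) = (if 0:U then 1 else 0)" by simp
thus ?thesis using B_seq_euler[OF assms, of 0, where 'k = 'k] by (auto split: if_splits)
qed

section \<open>Squarefree monomial ideals and complexes\<close>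

text \<open>These families correspond to arbitrary squarefree monomial ideals, as required for the
  competitors in the uniqueness statement; the unit ideal, with the empty set as a member, is
  included.\<close>

definition upfam :: "nat set set=>bool" where
 "upfam \<F> \<longleftrightarrow> (ALL F:\<F>. finite F) & (ALL F:\<F>. ALL G. finite G --> F <= G --> G:\<F>)"

lemma upfam_finite: "upfam \<F> ==> F:\<F> ==> finite F" by (simp add: upfam_def)

lemma upfam_up: "upfam \<F> ==> F:\<F> ==> finite G ==> F <= G ==> G:\<F>" unfolding upfam_def by blast

lemma upfam_if_sfam: "sfam \<F> ==> upfam \<F>"
unfolding upfam_def by (intro conjI ballI allI impI) (erule (1) sfam_finite, erule (3) sfam_up)

lemma upfam_if_lexfam: "lexfam 0 \<F> ==> upfam \<F>"
unfolding upfam_def by (intro conjI ballI allI impI) (erule (1) lexfamD(1), erule (1) lexfamD(3), auto)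

lemma upclosed_upfam: "upfam \<F> ==> upclosed UNIV (sqU \<F>)"
unfolding upclosed_def sqU_def by (auto simp: keys_add_nat intro: upfam_up)

lemma sqm_in_sqU: "upfam \<F> ==> finite F ==> sqm F:sqU \<F> \<longleftrightarrow> F:\<F>" by (simp add: sqU_def)

lemma sqU_inj:
 assumes "upfam \<F>" "upfam \<G>" "sqU \<F> = sqU \<G>"
 shows "\<F> = \<G>"
proof -
have "F:\<F> \<longleftrightarrow> F:\<G>" if "finite F" for F
 using sqm_in_sqU[OF assms(1) that] sqm_in_sqU[OF assms(2) that] assms(3) by simp
thus ?thesis using upfam_finite[OF assms(1)] upfam_finite[OF assms(2)] by blast
qed

lemma sqm_dvd: "EX c. m = sqm (keys m) + (c :: monom)"
unfolding mdvd_iff[symmetric] by (auto simp: lookup_sqm in_keys_iff Suc_le_eq)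

lemma card_keys_le: "card (keys m) <= mdeg (m :: monom)"
proof -
obtain c where "m = sqm (keys m) + c" using sqm_dvd by blast
hence "mdeg m = card (keys m) + mdeg c" by (metis mdeg_add mdeg_sqm)
thus ?thesis by simp
qed

lemma sr_ideal_mideal:
 assumes "simplicial_complex V \<Gamma>"
 shows "sr_ideal V \<Gamma> = (mideal {m:Mon V. keys m ~: \<Gamma>} :: 'k::field_char_0 spoly set)"
proof -
let ?A = "{sqm F | F. finite F & F <= V & F ~: \<Gamma>}"
have X: "(PROD i:F. X i) = (mon (sqm F) :: 'k spoly)" if "finite F" for F using that unfolding sqm_def X_def
 by (induction F rule: finite_induct) (simp_all add: mon_add)
have "{PROD i:F. X i | F. finite F & F <= V & F ~: \<Gamma>} = (mon ` ?A :: 'k spoly set)"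
 using X by (auto simp: image_def) metis+
moreover have "?A <= Mon V" by (auto simp: Mon_def)
ultimately have "sr_ideal V \<Gamma> = (mideal (mup V ?A) :: 'k spoly set)" unfolding sr_ideal_def by (simp add: ideal_gen_mon)
also have "mup V ?A = {m:Mon V. keys m ~: \<Gamma>}"
proof (intro subset_antisym subsetI)
 fix m assume "m:mup V ?A"
 then obtain F c where m: "finite F" "F <= V" "F ~: \<Gamma>" "c:Mon V" "m = sqm F + c" by (auto simp: mup_def)
 hence "F <= keys m" "m:Mon V" by (auto simp: keys_add_nat Mon_def)
 thus "m:{m:Mon V. keys m ~: \<Gamma>}" using assms m(3) by (auto simp: simplicial_complex_def)
next
 fix m assume m: "m:{m:Mon V. keys m ~: \<Gamma>}"
 obtain c where c: "m = sqm (keys m) + c" using sqm_dvd by blast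
 have "sqm (keys m) + c:Mon V" using m c by simp
 hence "c:Mon V" by simp
 moreover have "sqm (keys m):?A" using m by (auto simp: Mon_def)
 ultimately show "m:mup V ?A" using c by (auto simp: mup_def)
qed
finally show ?thesis .
qed

lemma sr_complex_mideal:
 assumes F: "upfam \<F>"
defines "J \<equiv> (mideal (sqU \<F>) :: 'k::field_char_0 spoly set)"
 shows "simplicial_complex UNIV (sr_complex J)" "sr_ideal UNIV (sr_complex J) = J"
proof -
let ?G = "{F. finite F & F ~: \<F>}"
have G: "simplicial_complex UNIV ?G" unfolding simplicial_complex_def using upfam_up[OF F] by (auto intro: finite_subset)
have eq: "sr_ideal UNIV \<Gamma> = (mideal (sqU {F. finite F & F ~: \<Gamma>}) :: 'k spoly set)" if "simplicial_complex UNIV \<Gamma>" for \<Gamma>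
 unfolding sr_ideal_mideal[OF that] by (simp add: sqU_def)
have "{F. finite F & F ~: ?G} = \<F>" using upfam_finite[OF F] by auto
hence GJ: "sr_ideal UNIV ?G = J" unfolding eq[OF G] J_def by simp
have u: "\<Gamma> = ?G" if \<Gamma>: "simplicial_complex UNIV \<Gamma>" "sr_ideal UNIV \<Gamma> = J" for \<Gamma>
proof -
 let ?H = "{F. finite F & F ~: \<Gamma>}"
 have "upfam ?H" using \<Gamma>(1) unfolding upfam_def simplicial_complex_def by blast
 moreover have "sqU ?H = sqU \<F>" using \<Gamma>(2) unfolding eq[OF \<Gamma>(1)] J_def mideal_inj .
 ultimately have "?H = \<F>" using sqU_inj F by blast
 thus ?thesis using \<Gamma>(1) unfolding simplicial_complex_def by blast
qed
have c: "sr_complex J = ?G" unfolding sr_complex_def by (rule the_equality) (rule conjI[OF G GJ], elim conjE, erule (1) u)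
show "simplicial_complex UNIV (sr_complex J)" "sr_ideal UNIV (sr_complex J) = J" unfolding c by (rule G, rule GJ)
qed

section \<open>Universal squarefree lexsegment ideals\<close>

lemma sqfree_mon_iff: "sqfree_mon m \<longleftrightarrow> m = sqm (keys m)"
proof
assume s: "sqfree_mon m"
show "m = sqm (keys m)"
proof (rule poly_mapping_eqI)
 fix i
 have "lookup m i <= 1" using s by (simp add: sqfree_mon_def)
 thus "lookup m i = lookup (sqm (keys m)) i" by (auto simp: lookup_sqm in_keys_iff)
qed
next
assume m: "m = sqm (keys m)"
have "lookup (sqm (keys m)) i <= 1" for i by (simp add: lookup_sqm)
thus "sqfree_mon m" unfolding sqfree_mon_def m[symmetric] by blast
qed

lemma sqfree_mon_ideal_iff: "sqfree_mon_ideal (J :: 'k::field_char_0 spoly set) \<longleftrightarrow> (EX \<F>. upfam \<F> & J = mideal (sqU \<F>))"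
proof
assume "sqfree_mon_ideal J"
then obtain A where A: "!!m. m:A ==> sqfree_mon m" "J = ideal_gen UNIV (mon ` A)" by (auto simp: sqfree_mon_ideal_def)
let ?F = "{F. finite F & (EX m:A. keys m <= F)}"
have "mup UNIV A = sqU ?F"
proof (intro subset_antisym subsetI)
 fix m assume "m:sqU ?F"
 then obtain a where a: "a:A" "keys a <= keys m" by (auto simp: sqU_def)
 have "ALL i. lookup a i <= lookup m i"
 proof
  fix i
  have "lookup a i <= 1" using A(1)[OF a(1)] by (simp add: sqfree_mon_def)
  moreover have "lookup m i ~= 0" if "lookup a i ~= 0"
  proof -
   have "i:keys a" using that by (simp add: in_keys_iff)
   hence "i:keys m" using a(2) by blast
   thus ?thesis by (simp add: in_keys_iff)
  qed
  ultimately show "lookup a i <= lookup m i" by linarith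
 qed
 thus "m:mup UNIV A" using a(1) unfolding mdvd_iff mup_def by auto
qed (auto simp: mup_def sqU_def keys_add_nat)
hence "J = mideal (sqU ?F)" using A(2) by (simp add: ideal_gen_mon_UNIV)
moreover have "upfam ?F" unfolding upfam_def by blast
ultimately show "EX \<F>. upfam \<F> & J = mideal (sqU \<F>)" by blast
next
assume "EX \<F>. upfam \<F> & J = mideal (sqU \<F>)"
then obtain \<F> where F: "upfam \<F>" "J = mideal (sqU \<F>)" by blast
let ?A = "sqm ` \<F>"
have "mup UNIV ?A = sqU \<F>"
proof (intro subset_antisym subsetI)
 fix m assume m: "m:sqU \<F>"
 obtain c where "m = sqm (keys m) + c" using sqm_dvd by blast
 thus "m:mup UNIV ?A" using m by (auto simp: mup_def sqU_def)
next
 fix m assume "m:mup UNIV ?A"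
 then obtain G c where "G:\<F>" "m = sqm G + c" by (auto simp: mup_def)
 thus "m:sqU \<F>" using upfam_up[OF F(1), of G "keys m"] upfam_finite[OF F(1)] by (auto simp: sqU_def keys_add_nat)
qed
hence "J = ideal_gen UNIV (mon ` ?A)" using F(2) by (simp add: ideal_gen_mon_UNIV)
moreover have "ALL m:?A. sqfree_mon m" using upfam_finite[OF F(1)] by (auto simp: sqfree_mon_iff)
ultimately show "sqfree_mon_ideal J" unfolding sqfree_mon_ideal_def by blast
qed

lemma lexsegment_iff:
 assumes F: "upfam \<F>"
 shows "sqfree_lexsegment (mideal (sqU \<F>) :: 'k::field_char_0 spoly set) \<longleftrightarrow> lexfam 0 \<F>"
proof
assume L: "sqfree_lexsegment (mideal (sqU \<F>) :: 'k spoly set)"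
show "lexfam 0 \<F>" unfolding lexfam_def
proof (intro conjI ballI allI impI)
 fix F' G assume a: "F':\<F>" "finite G" "card G = card F'" "slex G F'"
 have finF: "finite F'" by (rule upfam_finite[OF F a(1)])
 have "mon (sqm F'):(mideal (sqU \<F>) :: 'k spoly set) & sqfree_mon (sqm G) & mdeg (sqm G) = mdeg (sqm F') & lex_greater (sqm G) (sqm F')"
  using a sqm_in_sqU[OF F finF] lex_greater_sqm[OF finF a(2)] by (simp add: sqfree_mon_iff)
 hence "mon (sqm G):(mideal (sqU \<F>) :: 'k spoly set)" using L unfolding sqfree_lexsegment_def by blast
 hence "sqm G:sqU \<F>" by simp
 thus "G:\<F>" using sqm_in_sqU[OF F \<open>finite G\<close>] by simp
qed (erule upfam_finite[OF F], simp, erule (2) upfam_up[OF F])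
next
assume L: "lexfam 0 \<F>"
have "m':sqU \<F>" if m: "m:sqU \<F>" and m': "sqfree_mon m'" "mdeg m' = mdeg m" "lex_greater m' m" for m m'
proof -
 let ?F = "keys m" and ?G = "keys m'"
 have G: "m' = sqm ?G" using m'(1) by (simp add: sqfree_mon_iff)
 obtain i where i: "lookup m i < lookup m' i" "ALL j<i. lookup m' j = lookup m j" using m'(3) by (auto simp: lex_greater_def)
 have iG: "i:?G" "i ~: ?F"
 proof -
  show "i:?G" using i(1) by (simp add: in_keys_iff)
  have "lookup m' i <= 1" using m'(1) by (simp add: sqfree_mon_def)
  thus "i ~: ?F" using i(1) by (simp add: in_keys_iff)
 qed
 have ij: "ALL j<i. j:?G \<longleftrightarrow> j:?F" using i(2) by (simp add: in_keys_iff)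
 have "mdeg m' = card ?G" using arg_cong[OF G, of mdeg] by simp
 hence c: "card ?F <= card ?G" using card_keys_le[of m] m'(2) by simp
 obtain N where N: "?F Un {i} <= {..<N}" using exists_bound[of "?F Un {i}" 0] by auto
 \<comment> \<open>\<open>m\<close> may have repeated variables, so its support can be smaller than
   its degree; it is filled up with variables so far out that the lex comparison is
   unaffected.\<close>
 let ?F' = "?F Un {N..<N + (card ?G - card ?F)}"
 have disj: "?F Int {N..<N + (card ?G - card ?F)} = {}" using N by auto
 have "?F':\<F>" by (rule upfam_up[OF F, of ?F]) (use m in "auto simp: sqU_def")
 moreover have "card ?G = card ?F'" using c disj by (simp add: card_Un_disjoint)
 moreover have "slex ?G ?F'" unfolding slex_def using iG ij N by (intro exI[of _ i]) auto
 ultimately have "?G:\<F>" using lexfamD(4)[OF L, of ?F' ?G] by simp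
 thus ?thesis by (simp add: sqU_def)
qed
thus "sqfree_lexsegment (mideal (sqU \<F>) :: 'k spoly set)" unfolding sqfree_lexsegment_def sqfree_mon_ideal_iff using F by auto
qed

section \<open>Minimal generators, B-sequences and Hilbert functions\<close>

lemma mingen_below:
 assumes "m:N"
 shows "EX u:mingen N. EX c. m = u + c" using assms
proof (induction "mdeg m" arbitrary: m rule: less_induct)
case less
show ?case
proof (cases "m:mingen N")
 case True
 thus ?thesis by (metis add.right_neutral)
next
 case False
 then obtain a c where a: "a:N" "m = a + c" "a ~= m" using less.prems by (auto simp: mingen_def)
 hence "c ~= 0" by auto
 hence "0 < mdeg c" using mdeg_eq_0_iff[of c] by linarith
 hence "mdeg a < mdeg m" using a(2) by simp
 then obtain u c' where "u:mingen N" "a = u + c'" using less.hyps a(1) by blast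
 thus ?thesis using a(2) by (metis add.assoc)
qed
qed

lemma fin_gen_iff: "fin_gen_each_degree (mideal U :: 'k::field_char_0 spoly set) \<longleftrightarrow> (ALL d. finite (mingen U Int Deg d))"
proof -
have "{m:min_gens (mideal U :: 'k spoly set). mdeg m = d} = mingen U Int Deg d" for d by (auto simp: min_gens_mideal mingen_def)
thus ?thesis by (simp add: fin_gen_each_degree_def)
qed

lemma bndd_if_fin_gen:
 assumes U: "upclosed UNIV U" and fin: "!!d. finite (mingen U Int Deg d)"
 shows "EX n. bndd j n U"
proof -
let ?V = "UN u:(\<Union>d\<le>j. mingen U Int Deg d). keys u"
have "finite ?V" by (intro finite_UN_I finite_atMost fin finite_keys)
then obtain n where n: "?V <= {..<n}" using exists_bound by blast
have "mres {..<n} m:U" if m: "m:U" "mdeg m <= j" for m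
proof -
 obtain u c where u: "u:mingen U" "m = u + c" using mingen_below[OF m(1)] by blast
 have "u:mingen U Int Deg (mdeg u)" "mdeg u <= j" using u m(2) by auto
 hence uV: "u:(\<Union>d\<le>j. mingen U Int Deg d)" by blast
 have "keys u <= ?V" by (rule UN_upper[OF uV])
 hence "u:Mn n" unfolding Mon_def using order_trans[OF _ n] by simp
 hence "mres {..<n} m = u + mres {..<n} c" using u(2) by (simp add: mres_add mres_id)
 moreover have "u:U" using u(1) by (simp add: mingen_def)
 ultimately show ?thesis using upclosedD[OF U] by simp
qed
thus ?thesis by (auto simp: bndd_def)
qed

lemma bndd_if_bnd: "bnd n U ==> bndd j n U" by (auto simp: bnd_def bndd_def)

lemma bndd_mono: "bndd j n U ==> i <= j ==> bndd i n U" by (simp add: bndd_def)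

text \<open>In a ring with enough variables for both ideals, the two kinds of data determine each
  other by the unitriangular relation of \<open>B_seq_euler\<close>.\<close>

lemma B_seq_eq_iff_card:
 assumes V: "upclosed UNIV V" "bndd j n V" and V': "upclosed UNIV V'" "bndd j n' V'" and N: "n <= N" "n' <= N"
 shows "(ALL i<=j. B_seq (betti (mideal V :: 'k::field_char_0 spoly set)) i = B_seq (betti (mideal V' :: 'k spoly set)) i) \<longleftrightarrow>
 (ALL d<=j. card (V Int Mn N Int Deg d) = card (V' Int Mn N Int Deg d))"
proof -
have e: "int (card (W Int Mn N Int Deg d)) = (\<Sum>i\<le>d. B_seq (betti (mideal W :: 'k spoly set)) i * int (nm N (d - i)))"
 if W: "upclosed UNIV W" "bndd j k W" "k <= N" "d <= j" for W k d
proof -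
 have "B_seq (betti_fin N (mideal (W Int Mn N) :: 'k spoly set)) i = B_seq (betti (mideal W :: 'k spoly set)) i" if "i <= d" for i
  by (rule B_seq_betti_eq[OF W(1) bndd_mono[OF W(2)] W(3)]) (use that W(4) in simp)
 thus ?thesis unfolding B_seq_euler[OF upclosed_Int_Mon[OF W(1)], where 'k = 'k] by (intro sum.cong) auto
qed
note e1 = e[OF V N(1)] and e2 = e[OF V' N(2)]
show ?thesis
proof
 assume B: "ALL i<=j. B_seq (betti (mideal V :: 'k spoly set)) i = B_seq (betti (mideal V' :: 'k spoly set)) i"
 show "ALL d<=j. card (V Int Mn N Int Deg d) = card (V' Int Mn N Int Deg d)"
 proof (intro allI impI)
  fix d assume d: "d <= j"
  have "int (card (V Int Mn N Int Deg d)) = int (card (V' Int Mn N Int Deg d))"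
   unfolding e1[OF d] e2[OF d] by (rule sum.cong) (use B d in auto)
  thus "card (V Int Mn N Int Deg d) = card (V' Int Mn N Int Deg d)" by simp
 qed
next
 assume C: "ALL d<=j. card (V Int Mn N Int Deg d) = card (V' Int Mn N Int Deg d)"
 have "(\<Sum>i\<le>d. B_seq (betti (mideal V :: 'k spoly set)) i * int (nm N (d - i))) = (\<Sum>i\<le>d. B_seq (betti (mideal V' :: 'k spoly set)) i * int (nm N (d - i)))"
  if "d <= j" for d unfolding e1[OF that, symmetric] e2[OF that, symmetric] using C that by simp
 from triangular_unique[OF this]
 show "ALL i<=j. B_seq (betti (mideal V :: 'k spoly set)) i = B_seq (betti (mideal V' :: 'k spoly set)) i" by blast
qed
qed

lemma lexfam_card_unique:
 assumes V: "lexfam 0 \<F>" and V': "lexfam 0 \<G>"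
 and c: "!!j. EX N0. ALL N>=N0. ALL d<=j. card (sqU \<F> Int Mn N Int Deg d) = card (sqU \<G> Int Mn N Int Deg d)"
 shows "\<F> = \<G>"
proof -
have "EX N. F <= {..<N} & scount 0 N (card F) \<F> = scount 0 N (card F) \<G>" if "finite F" for F
proof -
 obtain N0 where N0: "ALL N>=N0. ALL d<=card F. card (sqU \<F> Int Mn N Int Deg d) = card (sqU \<G> Int Mn N Int Deg d)"
  using c by blast
 obtain N where N: "N0 <= N" "F <= {..<N}" using exists_bound[OF \<open>finite F\<close>] by blast
 have "scount 0 N (card F) \<F> = scount 0 N (card F) \<G>"
  by (rule scount_eq[where e = "card F"]) (use N0 N(1) lexfamD(1)[OF V] lexfamD(1)[OF V'] in auto)
 thus ?thesis using N(2) by blast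
qed
hence "F:\<F> \<longleftrightarrow> F:\<G>" if "finite F" for F
 using lexfam_count_unique[OF V V'] lexfam_count_unique[OF V' V] that by metis
thus ?thesis using lexfamD(1)[OF V] lexfamD(1)[OF V'] by blast
qed

section \<open>The limit of iterated lex shifting\<close>

text \<open>The properties of the iterates from which the remaining claims follow. For proper ideals
  they come from the analysis of \<open>fstep\<close>, for the void complex they are immediate; the
  locale lets both cases share the argument.\<close>

locale shifting_sequence =
 fixes \<Delta> :: "nat=>'k::field_char_0 spoly set" and fs :: "nat=>nat set set" and n :: nat
 and \<M> :: "nat set set" and I\<^sub>\<Gamma> :: "'k spoly set"
 assumes D: "!!i. \<Delta> i = mideal (sqU (fs i))"
 and up: "!!i. upfam (fs i)"
 and fb: "!!i. EX n. bnd n (sqU (fs i))"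
 and IG: "I\<^sub>\<Gamma> = mideal (sqU (fs 0) Int Mn n)" "bnd n (sqU (fs 0))"
 and lex: "lexfam 0 \<M>"
 and lim: "!!d. EX i0. ALL i>=i0. ALL F. finite F --> card F <= d --> (F:fs i \<longleftrightarrow> F:\<M>)"
 and cnt: "!!i. EX N0. ALL N>=N0. ALL d. card (sqU (fs i) Int Mn N Int Deg d) = card (sqU (fs 0) Int Mn N Int Deg d)"
 and empty: "{}:\<M> \<longleftrightarrow> {}:fs 0"
begin

abbreviation "M' \<equiv> (mideal (sqU \<M>) :: 'k spoly set)"

lemma upM: "upfam \<M>" by (rule upfam_if_lexfam[OF lex])

lemma agree: "EX i0. ALL i>=i0. ALL m. mdeg m <= d --> (m:sqU (fs i) \<longleftrightarrow> m:sqU \<M>)"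
proof -
obtain i0 where i0: "ALL i>=i0. ALL F. finite F --> card F <= d --> (F:fs i \<longleftrightarrow> F:\<M>)" using lim by blast
have "m:sqU (fs i) \<longleftrightarrow> m:sqU \<M>" if "i0 <= i" "mdeg m <= d" for i m
 using i0 that card_keys_le[of m] unfolding sqU_def by simp
thus ?thesis by blast
qed

lemma tendsto: "ideal_tendsto \<Delta> M'"
proof -
have eq: "\<Delta> = (%i. mideal (sqU (fs i)))" by (rule ext) (rule D)
have ev: "\<forall>\<^sub>F i in sequentially. sqU (fs i) Int Deg d = sqU \<M> Int Deg d" for d
proof -
 obtain i0 where i0: "ALL i>=i0. ALL m. mdeg m <= d --> (m:sqU (fs i) \<longleftrightarrow> m:sqU \<M>)" using agree by blast
 have "sqU (fs i) Int Deg d = sqU \<M> Int Deg d" if "i0 <= i" for i using i0 that by auto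
 thus ?thesis unfolding eventually_sequentially by blast
qed
show ?thesis unfolding eq by (rule ideal_tendsto_mideal[OF upclosed_upfam[OF upM]]) (rule ev)
qed

lemma lim_eq: "ideal_lim \<Delta> = M'" by (rule ideal_lim_eq[OF tendsto])

lemma tendsto_ex1: "EX! L. ideal_tendsto \<Delta> L" using tendsto ideal_tendsto_unique by blast

text \<open>Minimal generators of degree \<open>d\<close> of the limit are minimal generators of a
  late iterate, which is finitely generated.\<close>

lemma finite_mingen_M: "finite (mingen (sqU \<M>) Int Deg d)"
proof -
obtain i where i: "ALL m. mdeg m <= d --> (m:sqU (fs i) \<longleftrightarrow> m:sqU \<M>)" using agree by blast
obtain k where k: "bnd k (sqU (fs i))" using fb by blast
have "mingen (sqU \<M>) Int Deg d <= mingen (sqU (fs i))"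
proof
 fix u assume u: "u:mingen (sqU \<M>) Int Deg d"
 hence "u:sqU (fs i)" using i by (auto simp: mingen_def)
 moreover have "a = u" if a: "a:sqU (fs i)" "u = a + c" for a c
 proof -
  have "mdeg a <= d" using u a(2) by auto
  hence "a:sqU \<M>" using a(1) i by blast
  thus ?thesis using mingen_eq[of u "sqU \<M>" a c] u a(2) by blast
 qed
 ultimately show "u:mingen (sqU (fs i))" unfolding mingen_def by blast
qed
thus ?thesis by (rule finite_subset) (rule finite_mingen[OF upclosed_upfam[OF up] k])
qed

lemma usli_M: "usli M'" unfolding usli_def fin_gen_iff lexsegment_iff[OF upM] using finite_mingen_M lex by blast

lemma B_initial: "B_seq (betti_fin n I\<^sub>\<Gamma>) j = B_seq (betti (mideal (sqU (fs 0)) :: 'k spoly set)) j"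
unfolding IG(1) by (rule B_seq_betti_eq[OF upclosed_upfam[OF up] bndd_if_bnd[OF IG(2)] order_refl])

lemma B_M: "B_seq (betti M') j = B_seq (betti_fin n I\<^sub>\<Gamma>) j"
proof -
obtain n1 where n1: "bndd j n1 (sqU \<M>)" using bndd_if_fin_gen[OF upclosed_upfam[OF upM] finite_mingen_M] by blast
obtain i where i: "ALL m. mdeg m <= j --> (m:sqU (fs i) \<longleftrightarrow> m:sqU \<M>)" using agree by blast
obtain N0 where N0: "ALL N>=N0. ALL d. card (sqU (fs i) Int Mn N Int Deg d) = card (sqU (fs 0) Int Mn N Int Deg d)"
 using cnt by blast
define N where "N = N0 + n1 + n"
have N: "N0 <= N" "n1 <= N" "n <= N" by (simp_all add: N_def)
have "card (sqU \<M> Int Mn N Int Deg d) = card (sqU (fs 0) Int Mn N Int Deg d)" if "d <= j" for d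
proof -
 have "sqU \<M> Int Mn N Int Deg d = sqU (fs i) Int Mn N Int Deg d" using i that by auto
 thus ?thesis using N0 N(1) by simp
qed
hence "ALL i<=j. B_seq (betti M') i = B_seq (betti (mideal (sqU (fs 0)) :: 'k spoly set)) i"
 using B_seq_eq_iff_card[OF upclosed_upfam[OF upM] n1 upclosed_upfam[OF up] bndd_if_bnd[OF IG(2)] N(2,3), where 'k = 'k] by blast
thus ?thesis unfolding B_initial by simp
qed

text \<open>The value of the B-sequence at 0 records whether the ideal is the whole ring, and the
  condition on 1 supplies it. The Hilbert functions then agree in all large rings, degree by
  degree.\<close>

lemma unique_M:
 assumes L: "usli L" and one: "1:L \<longleftrightarrow> 1:\<Delta> 0"
 and B: "!!j. 1 <= j ==> B_seq (betti L) j = B_seq (betti_fin n I\<^sub>\<Gamma>) j"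
 shows "L = M'"
proof -
have "sqfree_mon_ideal L" using L by (simp add: usli_def sqfree_lexsegment_def)
then obtain \<L> where uL: "upfam \<L>" and LL: "L = mideal (sqU \<L>)" unfolding sqfree_mon_ideal_iff by blast
have lexL: "lexfam 0 \<L>" using L unfolding usli_def LL lexsegment_iff[OF uL] by blast
have finL: "finite (mingen (sqU \<L>) Int Deg d)" for d using L unfolding usli_def LL fin_gen_iff by blast
have one_iff: "(1 :: 'k spoly):mideal (sqU \<F>) \<longleftrightarrow> {}:\<F>" for \<F>
 unfolding mon_zero[symmetric] mon_in_mideal by (simp add: sqU_def)
have e: "{}:\<L> \<longleftrightarrow> {}:\<M>" using one unfolding LL D one_iff empty .
have B0: "B_seq (betti (mideal V :: 'k spoly set)) 0 = (if 0:V then 1 else 0)" if V: "upclosed UNIV V" "bndd 0 k V" for V k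
 using B_seq_0[OF upclosed_Int_Mon[OF V(1)], of k, where 'k = 'k] B_seq_betti_eq[OF V order_refl, where 'k = 'k] by simp
have "\<L> = \<M>"
proof (rule lexfam_card_unique[OF lexL lex])
 fix j
 obtain n1 where n1: "bndd j n1 (sqU \<L>)" using bndd_if_fin_gen[OF upclosed_upfam[OF uL] finL] by blast
 obtain n2 where n2: "bndd j n2 (sqU \<M>)" using bndd_if_fin_gen[OF upclosed_upfam[OF upM] finite_mingen_M] by blast
 have "B_seq (betti (mideal (sqU \<L>) :: 'k spoly set)) i = B_seq (betti M') i" if "i <= j" for i
 proof (cases "i = 0")
  case True
  show ?thesis unfolding True B0[OF upclosed_upfam[OF uL] bndd_mono[OF n1 le0]] B0[OF upclosed_upfam[OF upM] bndd_mono[OF n2 le0]]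
   using e by (simp add: sqU_def)
 next
  case False
  hence "1 <= i" by simp
  from B[OF this] show ?thesis unfolding B_M LL .
 qed
 hence "ALL i<=j. B_seq (betti (mideal (sqU \<L>) :: 'k spoly set)) i = B_seq (betti M') i" by blast
 hence "ALL d<=j. card (sqU \<L> Int Mn N Int Deg d) = card (sqU \<M> Int Mn N Int Deg d)" if "n1 + n2 <= N" for N
  using B_seq_eq_iff_card[OF upclosed_upfam[OF uL] n1 upclosed_upfam[OF upM] n2, of N, where 'k = 'k] that by simp
 thus "EX N0. ALL N>=N0. ALL d<=j. card (sqU \<L> Int Mn N Int Deg d) = card (sqU \<M> Int Mn N Int Deg d)" by blast
qed
thus ?thesis using LL by simp
qed

lemma sr_\<Delta>: "simplicial_complex UNIV (sr_complex (\<Delta> i)) & sr_ideal UNIV (sr_complex (\<Delta> i)) = \<Delta> i"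
unfolding D using sr_complex_mideal[OF up, where 'k = 'k] by blast

end

text \<open>\<open>stable_ideal\<close> is restricted to proper ideals, so the void complex needs
  its own argument: a count in degree 0 puts 1 into the generic initial ideal.\<close>

lemma lex_shift_UNIV: "lex_shift (UNIV :: 'k::field_char_0 spoly set) = UNIV"
proof -
have U: "upclosed UNIV (UNIV :: monom set)" "bnd 0 UNIV" by (simp_all add: upclosed_def bnd_def)
let ?N = "ginset TYPE('k) 0 UNIV"
have "UNIV Int Mn 0 Int Deg 0 = {0}" by auto
hence "card (?N Int Mn 0 Int Deg 0) = 1" using card_ginset[OF U order_refl, of 0, where 'k = 'k] by simp
hence "?N Int Mn 0 Int Deg 0 ~= {}" by (metis card.empty zero_neq_one)
hence "0:?N" by auto
hence "?N = UNIV" using upclosedD[OF ginset_upclosed[OF U(1)], of 0] by auto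
hence "gin (UNIV :: 'k spoly set) = UNIV" using gin_mideal[OF U, where 'k = 'k] by simp
moreover have "min_gens (UNIV :: 'k spoly set) = {0}"
proof -
 have z: "a = 0" if "0 = a + c" for a c :: monom using arg_cong[OF that, of mdeg] by simp
 have "m:mingen UNIV \<longleftrightarrow> m = 0" for m
 proof
  assume "m:mingen UNIV"
  thus "m = 0" using mingen_eq[of m UNIV 0 m] by simp
 next
  assume m: "m = 0"
  show "m:mingen UNIV" unfolding mingen_def
  proof (intro CollectI conjI ballI allI impI UNIV_I)
   fix a c assume "m = a + c"
   thus "a = m" using z[of a c] m by simp
  qed
 qed
 thus ?thesis using min_gens_mideal[of UNIV, where 'k = 'k] by (auto simp: mingen_def)
qed
moreover have "sqfree_op 0 = 0" using sqfree_op_psi[of "{}"] by (simp add: sqm_def)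
ultimately have "lex_shift (UNIV :: 'k spoly set) = ideal_gen UNIV (mon ` {0})" by (simp add: lex_shift_def)
also have "... = mideal UNIV" unfolding ideal_gen_mon_UNIV by (simp add: mup_def)
finally show ?thesis by simp
qed

text \<open>Shifting up preserves faces, so shifting down preserves nonfaces; membership is tested
  on the part of a set below \<open>n\<close>.\<close>

lemma fam_of_complex:
 assumes "simplicial_complex {..<n} \<Gamma>" "shifted n \<Gamma>" "{}:\<Gamma>"
 shows "fam {F. finite F & F Int {..<n} ~: \<Gamma>}" (is "fam ?F")
proof -
have sub: "G:\<Gamma>" if "F:\<Gamma>" "G <= F" for F G using assms(1) that unfolding simplicial_complex_def by blast
have "sfam ?F" unfolding sfam_def
proof (intro conjI ballI allI impI)
 fix F G assume "F:?F" "finite G" "F <= G"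
 thus "G:?F" using sub[of "G Int {..<n}" "F Int {..<n}"] by blast
next
 fix F j i assume F: "F:?F" "j:F" "i < j" "i ~: F"
 let ?G = "insert i (F - {j})"
 have "?G Int {..<n} ~: \<Gamma>"
 proof
  assume G: "?G Int {..<n}:\<Gamma>"
  have "F Int {..<n}:\<Gamma>"
  proof (cases "j < n")
   case True
   hence "insert j (?G Int {..<n} - {i}):\<Gamma>" using assms(2) G F(3) unfolding shifted_def by auto
   moreover have "insert j (?G Int {..<n} - {i}) = F Int {..<n}" using F True by auto
   ultimately show ?thesis by simp
  next
   \<comment> \<open>If \<open>j\<close> lies outside the vertex set, the part of \<open>F\<close>
     below \<open>n\<close> is contained in that of \<open>?G\<close>.\<close>
   case False
   show ?thesis by (rule sub[OF G]) (use False in auto)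
  qed
  thus False using F by simp
 qed
 thus "?G:?F" using F by simp
qed simp
moreover have "fbnd n ?F" by (simp add: fbnd_def Int_assoc)
ultimately show ?thesis using assms(3) unfolding fam_def by auto
qed

theorem theorem1p2:
  fixes n :: nat and \<Gamma> :: "nat set set"
    and I\<^sub>\<Gamma> I M :: "'k::field_char_0 spoly set"
    and \<Delta> :: "nat \<Rightarrow> 'k spoly set"
  assumes "simplicial_complex {..<n} \<Gamma>"
    and "shifted n \<Gamma>"
    and "I\<^sub>\<Gamma> = sr_ideal {..<n} \<Gamma>"
    and "I = ideal_gen UNIV I\<^sub>\<Gamma>"
    and "\<Delta> = (\<lambda>i. (lex_shift ^^ i) I)"
    and "M = ideal_lim \<Delta>"
  shows "(lex_shift I = I \<longleftrightarrow> usli I) \<and>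
    (\<forall>i. simplicial_complex UNIV (sr_complex (\<Delta> i)) \<and>
       sr_ideal UNIV (sr_complex (\<Delta> i)) = \<Delta> i) \<and>
    (\<not> usli I \<longrightarrow> inj \<Delta> \<and> inj (\<lambda>i. sr_complex (\<Delta> i))) \<and>
    (\<exists>!L. ideal_tendsto \<Delta> L) \<and>
    usli M \<and>
    simplicial_complex UNIV (sr_complex M) \<and> sr_ideal UNIV (sr_complex M) = M \<and>
    (\<forall>j\<ge>1. B_seq (betti M) j = B_seq (betti_fin n I\<^sub>\<Gamma>) j) \<and>
    (\<forall>L. usli L \<and> (1 \<in> L \<longleftrightarrow> 1 \<in> I) \<and>
       (\<forall>j\<ge>1. B_seq (betti L) j = B_seq (betti_fin n I\<^sub>\<Gamma>) j) \<longrightarrow> L = M)"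
proof -
let ?F = "{F. finite F & F Int {..<n} ~: \<Gamma>}"
have sub: "G:\<Gamma>" if "F:\<Gamma>" "G <= F" for F G using assms(1) that unfolding simplicial_complex_def by blast
have upF: "upfam ?F" unfolding upfam_def
proof (intro conjI ballI allI impI)
 fix F G assume "F:?F" "finite G" "F <= G"
 thus "G:?F" using sub[of "G Int {..<n}" "F Int {..<n}"] by blast
qed simp
have bF: "bnd n (sqU ?F)" by (simp add: bnd_def sqU_def keys_mres Int_assoc)
have IG: "I\<^sub>\<Gamma> = mideal (sqU ?F Int Mn n)"
proof -
 have "{m:Mn n. keys m ~: \<Gamma>} = sqU ?F Int Mn n" by (auto simp: sqU_def Mon_def inf.absorb1)
 thus ?thesis using assms(3) sr_ideal_mideal[OF assms(1), where 'k = 'k] by simp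
qed
have "mup UNIV (sqU ?F Int Mn n) = sqU ?F"
proof
 show "mup UNIV (sqU ?F Int Mn n) <= sqU ?F" by (rule mup_least[OF upclosed_upfam[OF upF]]) simp
 show "sqU ?F <= mup UNIV (sqU ?F Int Mn n)"
 proof
  fix m assume "m:sqU ?F"
  hence "mres {..<n} m:sqU ?F Int Mn n" using bF by (auto simp: bnd_def)
  hence "mres {..<n} m + mres (- {..<n}) m:mup UNIV (sqU ?F Int Mn n)" unfolding mup_def Mon_UNIV by blast
  thus "m:mup UNIV (sqU ?F Int Mn n)" by (simp only: mres_split)
 qed
qed
hence I: "I = mideal (sqU ?F)" unfolding assms(4) IG ideal_gen_mideal_UNIV by simp
have \<Delta>0: "\<Delta> 0 = I" using assms(5) by simp
have \<Delta>S: "\<Delta> (Suc i) = lex_shift (\<Delta> i)" for i using assms(5) by simp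
have main: "EX fs \<M>. shifting_sequence \<Delta> fs n \<M> I\<^sub>\<Gamma> & (lex_shift I = I \<longleftrightarrow> usli I) & (~ usli I --> inj \<Delta>)"
proof (cases "\<Gamma> = {}")
 case True
 hence F: "?F = Collect finite" by simp
 hence UN: "sqU ?F = UNIV" by (simp add: sqU_def)
 have IU: "I = UNIV" unfolding I UN by simp
 have \<Delta>: "\<Delta> i = UNIV" for i by (induction i) (simp_all add: \<Delta>0 \<Delta>S IU lex_shift_UNIV)
 have lex: "lexfam 0 ?F" unfolding F lexfam_def by auto
 interpret shifting_sequence \<Delta> "%_. ?F" n ?F I\<^sub>\<Gamma> by standard (use \<Delta> UN upF bF IG lex in auto)
 have "usli I" using usli_M I by simp
 moreover have "lex_shift I = I" unfolding IU by (rule lex_shift_UNIV)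
 ultimately show ?thesis using shifting_sequence_axioms by blast
next
 case False
 hence "{}:\<Gamma>" using sub by blast
 hence f: "fam ?F" by (rule fam_of_complex[OF assms(1,2)])
 let ?fs = "%i. (fstep TYPE('k) ^^ i) ?F"
 have fi: "fam (?fs i)" for i by (rule fam_fstep_iter[OF f])
 have upfs: "upfam (?fs i)" for i using fi[of i] upfam_if_sfam by (simp add: fam_def)
 have \<Delta>: "\<Delta> i = mideal (sqU (?fs i))" for i
  by (induction i) (simp_all add: \<Delta>0 \<Delta>S I lex_shift_fstep[OF fi])
 have fb: "EX k. bnd k (sqU (?fs i))" for i using fi[of i] bnd_sqU unfolding fam_def by blast
 obtain \<M> where \<M>: "lexfam 0 \<M>" "{} ~: \<M>" "!!d. EX i0. ALL i>=i0. ALL F. finite F --> card F <= d --> (F:?fs i \<longleftrightarrow> F:\<M>)"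
  using fstep_limit[OF f, where 'k = 'k] by blast
 have e: "{}:\<M> \<longleftrightarrow> {}:?fs 0" using \<M>(2) f by (simp add: fam_def)
 interpret shifting_sequence \<Delta> ?fs n \<M> I\<^sub>\<Gamma>
  using \<Delta> upfs fb IG bF \<M>(1,3) card_fstep_iter[OF f, where 'k = 'k] e by unfold_locales simp_all
 have us: "usli I \<longleftrightarrow> lexfam 0 ?F"
 proof
  assume "usli I"
  thus "lexfam 0 ?F" unfolding usli_def I lexsegment_iff[OF upF] by blast
 next
  assume "lexfam 0 ?F"
  moreover have "finite (mingen (sqU ?F) Int Deg d)" for d using finite_mingen(1)[OF upclosed_upfam[OF upF] bF] by blast
  ultimately show "usli I" unfolding usli_def I lexsegment_iff[OF upF] fin_gen_iff by blast
 qed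
 have inj: "inj \<Delta>" if "~ usli I"
 proof (rule injI)
  fix x y assume "\<Delta> x = \<Delta> y"
  hence "sqU (?fs x) = sqU (?fs y)" unfolding \<Delta> mideal_inj .
  hence eq: "?fs x = ?fs y" using sqU_inj[OF upfs upfs] by blast
  have "inj ?fs" by (rule fstep_inj[OF f]) (use that us in blast)
  from injD[OF this, of x y] eq show "x = y" by blast
 qed
 \<comment> \<open>A fixed ideal that is not a USLI would violate injectivity at the indices 0 and
   1.\<close>
 have c: "lex_shift I = I \<longleftrightarrow> usli I"
 proof
  assume "lex_shift I = I"
  hence "\<Delta> 1 = \<Delta> 0" using \<Delta>S[of 0] \<Delta>0 by simp
  thus "usli I" using injD[OF inj, of 1 0] by auto
 next
  assume "usli I"
  hence "fstep TYPE('k) ?F = ?F" using us fstep_fixed[OF f] by blast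
  thus "lex_shift I = I" unfolding I lex_shift_fstep[OF f] by simp
 qed
 have i: "~ usli I --> inj \<Delta>" using inj by blast
 show ?thesis using shifting_sequence_axioms c i by blast
qed
then obtain fs \<M> where S: "shifting_sequence \<Delta> fs n \<M> I\<^sub>\<Gamma>" and c: "lex_shift I = I \<longleftrightarrow> usli I"
 and i: "~ usli I --> inj \<Delta>" by blast
interpret shifting_sequence \<Delta> fs n \<M> I\<^sub>\<Gamma> by (rule S)
have sr: "inj (%i. sr_complex (\<Delta> i))" if "inj \<Delta>"
proof (rule injI)
 fix x y assume "sr_complex (\<Delta> x) = sr_complex (\<Delta> y)"
 hence "\<Delta> x = \<Delta> y" using sr_\<Delta> by metis
 thus "x = y" using that by (simp add: inj_eq)
qed
show ?thesis unfolding assms(6) lim_eq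
proof (intro conjI)
 show "ALL L. usli L & (1:L \<longleftrightarrow> 1:I) &
   (ALL j>=1. B_seq (betti L) j = B_seq (betti_fin n I\<^sub>\<Gamma>) j) --> L = M'" using unique_M[unfolded \<Delta>0] by blast
 show "~ usli I --> inj \<Delta> & inj (%i. sr_complex (\<Delta> i))" using i sr by blast
qed (use c sr_\<Delta> tendsto_ex1 usli_M B_M sr_complex_mideal[OF upM, where 'k = 'k] in simp_all)
qed

end
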